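(* Let $\mathcal V$ be an extensive, cartesian closed category with pullbacks, and let $G\colon\mathcal I\to\mathcal C$ be a $\mathcal V$-functor. Given a pair $(L,\lambda)$ of an object $L\in\mathcal C$ and a $\mathcal V$-natural transformation $\lambda\colon\Delta L\Rightarrow G$ in $\mathcal V\text{-}\mathrm{Cat}(\mathcal I,\mathcal C)$, the following are equivalent: (i) the pair $(L,\lambda)$ is a $\mathcal V$-limit of $G$; (ii) the pair $(L,\lambda)$ is an internal limit of $\mathrm{Int}\,G\colon\mathrm{Int}\,\mathcal I\to\mathrm{Int}\,\mathcal C$.
   Context: Extensive: $\mathcal V$ has all small coproducts and for every set $I$ and family $\{X_i\}_{i\in I}$ the functor $\bigsqcup_{i\in I}\colon\prod_{i\in I}\mathcal V_{/X_i}\to\mathcal V_{/\bigsqcup_i X_i}$ is an equivalence. $\ast$ is the terminal object, $\emptyset$ the initial object of $\mathcal V$, $\iota$ denotes coproduct inclusions. $\mathcal V$-categories are enriched over the cartesian structure and have a set of objects. $\mathcal C^{\mathcal I}$ is the $\mathcal V$-category of $\mathcal V$-functors $\mathcal I\to\mathcal C$ with hom-objects the ends $\int_{i}\mathcal C(Fi,F'i)$; $\Delta\colon\mathcal C\to\mathcal C^{\mathcal I}$ is the diagonal $\mathcal V$-functor. $(L,\lambda)$ is a (conical) $\mathcal V$-limit of $G$ if the $\mathcal V$-functor $\mathcal C^{\mathcal I}(\Delta(-),G)\colon\mathcal C^{\mathrm{op}}\to\mathcal V$ is $\mathcal V$-representable by $(L,\lambda)$, i.e. the $\mathcal V$-natural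 transformation $\mathcal C(-,L)\Rightarrow\mathcal C^{\mathcal I}(\Delta(-),G)$ corresponding to $\lambda\colon\ast\to\mathcal C^{\mathcal I}(\Delta L,G)$ by the enriched Yoneda lemma is an isomorphism. An internal category $\mathbb A$ to $\mathcal V$ consists of objects $\mathbb A_0,\mathbb A_1$ with maps $s,t,i,c$ satisfying the usual axioms; with internal functors these form $\mathrm{Cat}(\mathcal V)$, cartesian closed with internal hom $\llbracket-,-\rrbracket$. The terminal internal category is also written $\ast$; an element of $\mathbb A$ is an internal functor $\ast\to\mathbb A$. $\mathrm{Int}\,\mathcal C$ has $(\mathrm{Int}\,\mathcal C)_0=\bigsqcup_{A}\ast$, $(\mathrm{Int}\,\mathcal C)_1=\bigsqcup_{A,B}\mathcal C(A,B)$ with the evident structure maps; $\mathrm{Int}$ is a functor $\mathcal V\text{-}\mathrm{Cat}\to\mathrm{Cat}(\mathcal V)$. $\mathbb 2=\mathrm{Int}\,\mathbb 2$ for the $\mathcal V$-category with objects $0,1$, hom-objects $\mathbb 2(0,0)=\mathbb 2(0,1)=\mathbb 2(1,1)=\ast$, $\mathbb 2(1,0)=\emptyset$, with inclusion $\langle0,1\rangle\colon\ast\sqcup\ast\to\mathbb 2$. For $H\colon\mathbb A\to\mathbb B$ and an element $B$ of $\mathbb B$, the comma internal category $H\downarrow B$ is the pullback in $\mathrm{Cat}(\mathcal V)$ of $\langle0,1\rangle^*\colon\llbracket\mathbb 2,\mathbb B\rrbracket\to\mathbb B\times\mathbb B$ along $H\times B\colon\mathbb A\to\mathbb B\times\mathbb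 B$. The slice is $\mathbb A_{/T}=\mathrm{id}_{\mathbb A}\downarrow T$; $T$ is an internal terminal object of $\mathbb A$ if the projection $\mathbb A_{/T}\to\mathbb A$ is an isomorphism. For an internal functor $K\colon\mathbb I\to\mathbb A$, the internal category of cones $\Delta\downarrow K$ is the comma internal category for the diagonal $\Delta\colon\mathbb A\to\llbracket\mathbb I,\mathbb A\rrbracket$ and the element $K\colon\ast\to\llbracket\mathbb I,\mathbb A\rrbracket$; an internal limit of $K$ is an internal terminal object in $\Delta\downarrow K$. For $K=\mathrm{Int}\,G$, $(L,\lambda)$ is regarded as the element of $\Delta\downarrow\mathrm{Int}\,G$ given by $\iota_L\colon\ast\to\mathrm{Int}\,\mathcal C$ and the internal natural transformation $\Delta L\Rightarrow\mathrm{Int}\,G$ whose underlying map $\bigsqcup_{i\in\mathcal I}\ast\to(\mathrm{Int}\,\mathcal C)_1$ is induced by the components $\lambda_i\colon\ast\to\mathcal C(L,Gi)$. *)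

theory Defs
  imports "HOL-Library.FuncSet"
begin

section \<open>Categories\<close>

record ('o, 'm) cat =
  Obj :: "'o set"
  Arr :: "'m set"
  Dom :: "'m \<Rightarrow> 'o"
  Cod :: "'m \<Rightarrow> 'o"
  Ident :: "'o \<Rightarrow> 'm"
  Comp :: "'m \<Rightarrow> 'm \<Rightarrow> 'm" (infixr "\<cdot>\<index>" 70)

definition Hom :: "('o, 'm) cat \<Rightarrow> 'o \<Rightarrow> 'o \<Rightarrow> 'm set" where
  "Hom V X Y = {f \<in> Arr V. Dom V f = X \<and> Cod V f = Y}"

definition category :: "('o, 'm) cat \<Rightarrow> bool" where
  "category V \<longleftrightarrow>
     (\<forall>f\<in>Arr V. Dom V f \<in> Obj V \<and> Cod V f \<in> Obj V) \<and>
     (\<forall>X\<in>Obj V. Ident V X \<in> Hom V X X) \<and>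
     (\<forall>X Y Z. \<forall>f\<in>Hom V X Y. \<forall>g\<in>Hom V Y Z. g \<cdot>\<^bsub>V\<^esub> f \<in> Hom V X Z) \<and>
     (\<forall>X Y. \<forall>f\<in>Hom V X Y. Ident V Y \<cdot>\<^bsub>V\<^esub> f = f \<and> f \<cdot>\<^bsub>V\<^esub> Ident V X = f) \<and>
     (\<forall>W X Y Z. \<forall>f\<in>Hom V W X. \<forall>g\<in>Hom V X Y. \<forall>h\<in>Hom V Y Z.
        (h \<cdot>\<^bsub>V\<^esub> g) \<cdot>\<^bsub>V\<^esub> f = h \<cdot>\<^bsub>V\<^esub> (g \<cdot>\<^bsub>V\<^esub> f))"

definition iso :: "('o, 'm) cat \<Rightarrow> 'm \<Rightarrow> bool" where
  "iso V f \<longleftrightarrow> f \<in> Arr V \<and>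
     (\<exists>g\<in>Hom V (Cod V f) (Dom V f).
        g \<cdot>\<^bsub>V\<^esub> f = Ident V (Dom V f) \<and> f \<cdot>\<^bsub>V\<^esub> g = Ident V (Cod V f))"

record ('o, 'm, 'p, 'n) func =
  FOb :: "'o \<Rightarrow> 'p"
  FAr :: "'m \<Rightarrow> 'n"

definition is_functor :: "('o, 'm) cat \<Rightarrow> ('p, 'n) cat \<Rightarrow> ('o, 'm, 'p, 'n) func \<Rightarrow> bool" where
  "is_functor C D F \<longleftrightarrow>
     (\<forall>X\<in>Obj C. FOb F X \<in> Obj D) \<and>
     (\<forall>X\<in>Obj C. \<forall>Y\<in>Obj C. \<forall>f\<in>Hom C X Y. FAr F f \<in> Hom D (FOb F X) (FOb F Y)) \<and>
     (\<forall>X\<in>Obj C. FAr F (Ident C X) = Ident D (FOb F X)) \<and>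
     (\<forall>X Y Z. \<forall>f\<in>Hom C X Y. \<forall>g\<in>Hom C Y Z. FAr F (g \<cdot>\<^bsub>C\<^esub> f) = FAr F g \<cdot>\<^bsub>D\<^esub> FAr F f)"

definition id_func :: "('o, 'm, 'o, 'm) func" where
  "id_func = \<lparr>FOb = (\<lambda>X. X), FAr = (\<lambda>f. f)\<rparr>"

definition comp_func ::
  "('p, 'n, 'q, 'l) func \<Rightarrow> ('o, 'm, 'p, 'n) func \<Rightarrow> ('o, 'm, 'q, 'l) func" where
  "comp_func G F = \<lparr>FOb = (\<lambda>X. FOb G (FOb F X)), FAr = (\<lambda>f. FAr G (FAr F f))\<rparr>"

definition is_nat_iso :: "('o, 'm) cat \<Rightarrow> ('p, 'n) cat \<Rightarrow>
    ('o, 'm, 'p, 'n) func \<Rightarrow> ('o, 'm, 'p, 'n) func \<Rightarrow> ('o \<Rightarrow> 'n) \<Rightarrow> bool" where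
  "is_nat_iso C D F G \<tau> \<longleftrightarrow>
     (\<forall>X\<in>Obj C. \<tau> X \<in> Hom D (FOb F X) (FOb G X) \<and> iso D (\<tau> X)) \<and>
     (\<forall>X Y. \<forall>f\<in>Hom C X Y. \<tau> Y \<cdot>\<^bsub>D\<^esub> FAr F f = FAr G f \<cdot>\<^bsub>D\<^esub> \<tau> X)"

definition is_equivalence ::
  "('o, 'm) cat \<Rightarrow> ('p, 'n) cat \<Rightarrow> ('o, 'm, 'p, 'n) func \<Rightarrow> bool" where
  "is_equivalence C D F \<longleftrightarrow> is_functor C D F \<and>
     (\<exists>G \<sigma> \<tau>. is_functor D C G \<and>
        is_nat_iso C C id_func (comp_func G F) \<sigma> \<and> is_nat_iso D D (comp_func F G) id_func \<tau>)"

text \<open>A morphism of the slice from \<open>f\<close> to \<open>g\<close> is a triple \<open>(f, h, g)\<close> with \<open>g h = f\<close>.\<close>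

definition slice :: "('o, 'm) cat \<Rightarrow> 'o \<Rightarrow> ('m, 'm \<times> 'm \<times> 'm) cat" where
  "slice V X = \<lparr>
     Obj = {f \<in> Arr V. Cod V f = X},
     Arr = {(f, h, g). f \<in> Arr V \<and> g \<in> Arr V \<and> Cod V f = X \<and> Cod V g = X \<and>
                       h \<in> Hom V (Dom V f) (Dom V g) \<and> g \<cdot>\<^bsub>V\<^esub> h = f},
     Dom = (\<lambda>(f, h, g). f),
     Cod = (\<lambda>(f, h, g). g),
     Ident = (\<lambda>f. (f, Ident V (Dom V f), f)),
     Comp = (\<lambda>(_, k, l) (f, h, _). (f, k \<cdot>\<^bsub>V\<^esub> h, l))\<rparr>"

definition prod_cat :: "'i set \<Rightarrow> ('i \<Rightarrow> ('o, 'm) cat) \<Rightarrow> ('i \<Rightarrow> 'o, 'i \<Rightarrow> 'm) cat" where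
  "prod_cat I C = \<lparr>
     Obj = (\<Pi>\<^sub>E i\<in>I. Obj (C i)),
     Arr = (\<Pi>\<^sub>E i\<in>I. Arr (C i)),
     Dom = (\<lambda>f. \<lambda>i\<in>I. Dom (C i) (f i)),
     Cod = (\<lambda>f. \<lambda>i\<in>I. Cod (C i) (f i)),
     Ident = (\<lambda>X. \<lambda>i\<in>I. Ident (C i) (X i)),
     Comp = (\<lambda>g f. \<lambda>i\<in>I. g i \<cdot>\<^bsub>C i\<^esub> f i)\<rparr>"


section \<open>Limits, colimits and exponentials\<close>

text \<open>
  Universal objects are specified by their universal property, and one of them is selected by
  \<open>SOME\<close>; the induced morphisms are then given by \<open>THE\<close>.
\<close>

definition is_terminal :: "('o, 'm) cat \<Rightarrow> 'o \<Rightarrow> bool" where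
  "is_terminal V T \<longleftrightarrow> T \<in> Obj V \<and> (\<forall>X\<in>Obj V. \<exists>!f. f \<in> Hom V X T)"

definition terminal :: "('o, 'm) cat \<Rightarrow> 'o" ("\<one>\<index>") where
  "terminal V = (SOME T. is_terminal V T)"

definition bang :: "('o, 'm) cat \<Rightarrow> 'o \<Rightarrow> 'm" where
  "bang V X = (THE f. f \<in> Hom V X (terminal V))"

definition is_initial :: "('o, 'm) cat \<Rightarrow> 'o \<Rightarrow> bool" where
  "is_initial V Z \<longleftrightarrow> Z \<in> Obj V \<and> (\<forall>X\<in>Obj V. \<exists>!f. f \<in> Hom V Z X)"

definition initial :: "('o, 'm) cat \<Rightarrow> 'o" where
  "initial V = (SOME Z. is_initial V Z)"

definition is_product :: "('o, 'm) cat \<Rightarrow> 'o \<Rightarrow> 'o \<Rightarrow> 'o \<times> 'm \<times> 'm \<Rightarrow> bool" where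
  "is_product V X Y = (\<lambda>(P, p, q). P \<in> Obj V \<and> p \<in> Hom V P X \<and> q \<in> Hom V P Y \<and>
     (\<forall>Z\<in>Obj V. \<forall>f\<in>Hom V Z X. \<forall>g\<in>Hom V Z Y.
        \<exists>!h. h \<in> Hom V Z P \<and> p \<cdot>\<^bsub>V\<^esub> h = f \<and> q \<cdot>\<^bsub>V\<^esub> h = g))"

definition prod_choice :: "('o, 'm) cat \<Rightarrow> 'o \<Rightarrow> 'o \<Rightarrow> 'o \<times> 'm \<times> 'm" where
  "prod_choice V X Y = (SOME P. is_product V X Y P)"

definition prd :: "('o, 'm) cat \<Rightarrow> 'o \<Rightarrow> 'o \<Rightarrow> 'o" where
  "prd V X Y = fst (prod_choice V X Y)"

definition pr1 :: "('o, 'm) cat \<Rightarrow> 'o \<Rightarrow> 'o \<Rightarrow> 'm" where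
  "pr1 V X Y = fst (snd (prod_choice V X Y))"

definition pr2 :: "('o, 'm) cat \<Rightarrow> 'o \<Rightarrow> 'o \<Rightarrow> 'm" where
  "pr2 V X Y = snd (snd (prod_choice V X Y))"

definition pair :: "('o, 'm) cat \<Rightarrow> 'm \<Rightarrow> 'm \<Rightarrow> 'm" where
  "pair V f g = (THE h. h \<in> Hom V (Dom V f) (prd V (Cod V f) (Cod V g)) \<and>
     pr1 V (Cod V f) (Cod V g) \<cdot>\<^bsub>V\<^esub> h = f \<and> pr2 V (Cod V f) (Cod V g) \<cdot>\<^bsub>V\<^esub> h = g)"

definition prod_map :: "('o, 'm) cat \<Rightarrow> 'm \<Rightarrow> 'm \<Rightarrow> 'm" where
  "prod_map V f g = pair V (f \<cdot>\<^bsub>V\<^esub> pr1 V (Dom V f) (Dom V g)) (g \<cdot>\<^bsub>V\<^esub> pr2 V (Dom V f) (Dom V g))"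

definition is_pullback :: "('o, 'm) cat \<Rightarrow> 'm \<Rightarrow> 'm \<Rightarrow> 'o \<times> 'm \<times> 'm \<Rightarrow> bool" where
  "is_pullback V f g = (\<lambda>(P, p, q). P \<in> Obj V \<and>
     p \<in> Hom V P (Dom V f) \<and> q \<in> Hom V P (Dom V g) \<and> f \<cdot>\<^bsub>V\<^esub> p = g \<cdot>\<^bsub>V\<^esub> q \<and>
     (\<forall>Z\<in>Obj V. \<forall>a\<in>Hom V Z (Dom V f). \<forall>b\<in>Hom V Z (Dom V g). f \<cdot>\<^bsub>V\<^esub> a = g \<cdot>\<^bsub>V\<^esub> b \<longrightarrow>
        (\<exists>!h. h \<in> Hom V Z P \<and> p \<cdot>\<^bsub>V\<^esub> h = a \<and> q \<cdot>\<^bsub>V\<^esub> h = b)))"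

definition pb_choice :: "('o, 'm) cat \<Rightarrow> 'm \<Rightarrow> 'm \<Rightarrow> 'o \<times> 'm \<times> 'm" where
  "pb_choice V f g = (SOME P. is_pullback V f g P)"

definition pb :: "('o, 'm) cat \<Rightarrow> 'm \<Rightarrow> 'm \<Rightarrow> 'o" where
  "pb V f g = fst (pb_choice V f g)"

definition pb1 :: "('o, 'm) cat \<Rightarrow> 'm \<Rightarrow> 'm \<Rightarrow> 'm" where
  "pb1 V f g = fst (snd (pb_choice V f g))"

definition pb2 :: "('o, 'm) cat \<Rightarrow> 'm \<Rightarrow> 'm \<Rightarrow> 'm" where
  "pb2 V f g = snd (snd (pb_choice V f g))"

definition pb_pair :: "('o, 'm) cat \<Rightarrow> 'm \<Rightarrow> 'm \<Rightarrow> 'm \<Rightarrow> 'm \<Rightarrow> 'm" where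
  "pb_pair V f g a b = (THE h. h \<in> Hom V (Dom V a) (pb V f g) \<and>
     pb1 V f g \<cdot>\<^bsub>V\<^esub> h = a \<and> pb2 V f g \<cdot>\<^bsub>V\<^esub> h = b)"

definition has_pullbacks :: "('o, 'm) cat \<Rightarrow> bool" where
  "has_pullbacks V \<longleftrightarrow>
     (\<forall>f\<in>Arr V. \<forall>g\<in>Arr V. Cod V f = Cod V g \<longrightarrow> (\<exists>P. is_pullback V f g P))"

definition is_exponential :: "('o, 'm) cat \<Rightarrow> 'o \<Rightarrow> 'o \<Rightarrow> 'o \<times> 'm \<Rightarrow> bool" where
  "is_exponential V X Y = (\<lambda>(E, e). E \<in> Obj V \<and> e \<in> Hom V (prd V E X) Y \<and>
     (\<forall>Z\<in>Obj V. \<forall>f\<in>Hom V (prd V Z X) Y.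
        \<exists>!h. h \<in> Hom V Z E \<and> e \<cdot>\<^bsub>V\<^esub> prod_map V h (Ident V X) = f))"

definition exp_choice :: "('o, 'm) cat \<Rightarrow> 'o \<Rightarrow> 'o \<Rightarrow> 'o \<times> 'm" where
  "exp_choice V X Y = (SOME E. is_exponential V X Y E)"

definition expo :: "('o, 'm) cat \<Rightarrow> 'o \<Rightarrow> 'o \<Rightarrow> 'o" where
  "expo V X Y = fst (exp_choice V X Y)"

definition evl :: "('o, 'm) cat \<Rightarrow> 'o \<Rightarrow> 'o \<Rightarrow> 'm" where
  "evl V X Y = snd (exp_choice V X Y)"

text \<open>The transpose \<open>Z \<rightarrow> expo V X Y\<close> of \<open>f : Z \<times> X \<rightarrow> Y\<close>.\<close>

definition transp :: "('o, 'm) cat \<Rightarrow> 'o \<Rightarrow> 'o \<Rightarrow> 'o \<Rightarrow> 'm \<Rightarrow> 'm" where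
  "transp V Z X Y f = (THE h. h \<in> Hom V Z (expo V X Y) \<and>
     evl V X Y \<cdot>\<^bsub>V\<^esub> prod_map V h (Ident V X) = f)"

text \<open>The global element \<open>\<one> \<rightarrow> expo V X Y\<close> corresponding to \<open>f : X \<rightarrow> Y\<close>.\<close>

definition name_of :: "('o, 'm) cat \<Rightarrow> 'm \<Rightarrow> 'm" where
  "name_of V f = transp V \<one>\<^bsub>V\<^esub> (Dom V f) (Cod V f) (f \<cdot>\<^bsub>V\<^esub> pr2 V \<one>\<^bsub>V\<^esub> (Dom V f))"

definition cartesian_closed :: "('o, 'm) cat \<Rightarrow> bool" where
  "cartesian_closed V \<longleftrightarrow> (\<exists>T. is_terminal V T) \<and>
     (\<forall>X\<in>Obj V. \<forall>Y\<in>Obj V. \<exists>P. is_product V X Y P) \<and>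
     (\<forall>X\<in>Obj V. \<forall>Y\<in>Obj V. \<exists>E. is_exponential V X Y E)"

definition is_coproduct ::
  "('o, 'm) cat \<Rightarrow> 'i set \<Rightarrow> ('i \<Rightarrow> 'o) \<Rightarrow> 'o \<times> ('i \<Rightarrow> 'm) \<Rightarrow> bool" where
  "is_coproduct V I X = (\<lambda>(C, \<iota>). C \<in> Obj V \<and> (\<forall>i\<in>I. \<iota> i \<in> Hom V (X i) C) \<and>
     (\<forall>Y\<in>Obj V. \<forall>f. (\<forall>i\<in>I. f i \<in> Hom V (X i) Y) \<longrightarrow>
        (\<exists>!h. h \<in> Hom V C Y \<and> (\<forall>i\<in>I. h \<cdot>\<^bsub>V\<^esub> \<iota> i = f i))))"

definition coprod_choice ::
  "('o, 'm) cat \<Rightarrow> 'i set \<Rightarrow> ('i \<Rightarrow> 'o) \<Rightarrow> 'o \<times> ('i \<Rightarrow> 'm)" where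
  "coprod_choice V I X = (SOME C. is_coproduct V I X C)"

definition coprod :: "('o, 'm) cat \<Rightarrow> 'i set \<Rightarrow> ('i \<Rightarrow> 'o) \<Rightarrow> 'o" where
  "coprod V I X = fst (coprod_choice V I X)"

definition incl :: "('o, 'm) cat \<Rightarrow> 'i set \<Rightarrow> ('i \<Rightarrow> 'o) \<Rightarrow> 'i \<Rightarrow> 'm" where
  "incl V I X = snd (coprod_choice V I X)"

definition cotuple ::
  "('o, 'm) cat \<Rightarrow> 'i set \<Rightarrow> ('i \<Rightarrow> 'o) \<Rightarrow> 'o \<Rightarrow> ('i \<Rightarrow> 'm) \<Rightarrow> 'm" where
  "cotuple V I X Y f = (THE h. h \<in> Hom V (coprod V I X) Y \<and>
     (\<forall>i\<in>I. h \<cdot>\<^bsub>V\<^esub> incl V I X i = f i))"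


section \<open>Extensive categories\<close>

text \<open>
  Smallness is relative to a type \<open>'u\<close>: a set, of elements of any type, is small if it injects
  into \<open>'u\<close>. Up to reindexing, a small family is thus a family indexed by a subset of \<open>'u\<close>.
\<close>

definition small :: "'u itself \<Rightarrow> 'a set \<Rightarrow> bool" where
  "small U S \<longleftrightarrow> (\<exists>f :: 'a \<Rightarrow> 'u. inj_on f S)"

definition has_small_coproducts :: "('o, 'm) cat \<Rightarrow> 'u itself \<Rightarrow> bool" where
  "has_small_coproducts V U \<longleftrightarrow>
     (\<forall>(I :: 'u set) X. (\<forall>i\<in>I. X i \<in> Obj V) \<longrightarrow> (\<exists>C. is_coproduct V I X C))"

text \<open>The functor sending \<open>(f\<^sub>i : Y\<^sub>i \<rightarrow> X\<^sub>i)\<^sub>i\<close> to the induced morphism between the coproducts.\<close>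

definition coprod_functor :: "('o, 'm) cat \<Rightarrow> 'i set \<Rightarrow> ('i \<Rightarrow> 'o) \<Rightarrow>
    ('i \<Rightarrow> 'm, 'i \<Rightarrow> 'm \<times> 'm \<times> 'm, 'm, 'm \<times> 'm \<times> 'm) func" where
  "coprod_functor V I X =
    (let ob = (\<lambda>f. cotuple V I (\<lambda>i. Dom V (f i)) (coprod V I X) (\<lambda>i. incl V I X i \<cdot>\<^bsub>V\<^esub> f i));
         S = prod_cat I (\<lambda>i. slice V (X i))
     in \<lparr>FOb = ob,
         FAr = (\<lambda>t. let f = Dom S t; g = Cod S t; h = (\<lambda>i. fst (snd (t i)));
                        Y = (\<lambda>i. Dom V (f i)); Z = (\<lambda>i. Dom V (g i))
                    in (ob f, cotuple V I Y (coprod V I Z) (\<lambda>i. incl V I Z i \<cdot>\<^bsub>V\<^esub> h i), ob g))\<rparr>)"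

definition extensive :: "('o, 'm) cat \<Rightarrow> 'u itself \<Rightarrow> bool" where
  "extensive V U \<longleftrightarrow> has_small_coproducts V U \<and>
     (\<forall>(I :: 'u set) X. (\<forall>i\<in>I. X i \<in> Obj V) \<longrightarrow>
        is_equivalence (prod_cat I (\<lambda>i. slice V (X i))) (slice V (coprod V I X))
          (coprod_functor V I X))"


section \<open>Enriched categories\<close>

text \<open>\<open>VComp C A B D\<close> is the composition \<open>C(B,D) \<times> C(A,B) \<rightarrow> C(A,D)\<close>.\<close>

record ('x, 'o, 'm) vcat =
  VObj :: "'x set"
  VHom :: "'x \<Rightarrow> 'x \<Rightarrow> 'o"
  VId :: "'x \<Rightarrow> 'm"
  VComp :: "'x \<Rightarrow> 'x \<Rightarrow> 'x \<Rightarrow> 'm"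

text \<open>
  Composition of generalized elements \<open>g : X \<rightarrow> C(B,D)\<close> and \<open>f : X \<rightarrow> C(A,B)\<close>.
\<close>

definition vcmp :: "('o, 'm) cat \<Rightarrow> ('x, 'o, 'm) vcat \<Rightarrow> 'x \<Rightarrow> 'x \<Rightarrow> 'x \<Rightarrow> 'm \<Rightarrow> 'm \<Rightarrow> 'm" where
  "vcmp V C A B D g f = VComp C A B D \<cdot>\<^bsub>V\<^esub> pair V g f"

text \<open>The generalized element \<open>X \<rightarrow> \<one> \<rightarrow> Y\<close> that is constant at the global element \<open>a\<close>.\<close>

definition const_at :: "('o, 'm) cat \<Rightarrow> 'o \<Rightarrow> 'm \<Rightarrow> 'm" where
  "const_at V X a = a \<cdot>\<^bsub>V\<^esub> bang V X"

definition vcategory :: "('o, 'm) cat \<Rightarrow> ('x, 'o, 'm) vcat \<Rightarrow> bool" where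
  "vcategory V C \<longleftrightarrow>
     (\<forall>A\<in>VObj C. \<forall>B\<in>VObj C. VHom C A B \<in> Obj V) \<and>
     (\<forall>A\<in>VObj C. VId C A \<in> Hom V \<one>\<^bsub>V\<^esub> (VHom C A A)) \<and>
     (\<forall>A\<in>VObj C. \<forall>B\<in>VObj C. \<forall>D\<in>VObj C.
        VComp C A B D \<in> Hom V (prd V (VHom C B D) (VHom C A B)) (VHom C A D)) \<and>
     (\<forall>A\<in>VObj C. \<forall>B\<in>VObj C. let X = VHom C A B in
        vcmp V C A B B (const_at V X (VId C B)) (Ident V X) = Ident V X \<and>
        vcmp V C A A B (Ident V X) (const_at V X (VId C A)) = Ident V X) \<and>
     (\<forall>A\<in>VObj C. \<forall>B\<in>VObj C. \<forall>D\<in>VObj C. \<forall>E\<in>VObj C.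
        let X = VHom C A B; Y = VHom C B D; Z = VHom C D E;
            h = pr1 V Z Y \<cdot>\<^bsub>V\<^esub> pr1 V (prd V Z Y) X;
            g = pr2 V Z Y \<cdot>\<^bsub>V\<^esub> pr1 V (prd V Z Y) X;
            f = pr2 V (prd V Z Y) X
        in vcmp V C A B E (vcmp V C B D E h g) f = vcmp V C A D E h (vcmp V C A B D g f))"

record ('x, 'y, 'm) vfun =
  VFOb :: "'x \<Rightarrow> 'y"
  VFHom :: "'x \<Rightarrow> 'x \<Rightarrow> 'm"

text \<open>
  A \<open>\<V>\<close>-functor takes the value \<open>undefined\<close> away from the objects of its domain, so that
  equality of \<open>\<V>\<close>-functors is equality of records; \<open>mk_vfun\<close> enforces this.
\<close>

definition mk_vfun ::
  "('x, 'o, 'm) vcat \<Rightarrow> ('x \<Rightarrow> 'y) \<Rightarrow> ('x \<Rightarrow> 'x \<Rightarrow> 'm) \<Rightarrow> ('x, 'y, 'm) vfun" where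
  "mk_vfun C ob hm = \<lparr>VFOb = restrict ob (VObj C),
     VFHom = (\<lambda>A B. if A \<in> VObj C \<and> B \<in> VObj C then hm A B else undefined)\<rparr>"

definition vfunctor :: "('o, 'm) cat \<Rightarrow> ('x, 'o, 'm) vcat \<Rightarrow> ('y, 'o, 'm) vcat \<Rightarrow>
    ('x, 'y, 'm) vfun \<Rightarrow> bool" where
  "vfunctor V C D F \<longleftrightarrow>
     F = mk_vfun C (VFOb F) (VFHom F) \<and>
     (\<forall>A\<in>VObj C. VFOb F A \<in> VObj D) \<and>
     (\<forall>A\<in>VObj C. \<forall>B\<in>VObj C.
        VFHom F A B \<in> Hom V (VHom C A B) (VHom D (VFOb F A) (VFOb F B))) \<and>
     (\<forall>A\<in>VObj C. VFHom F A A \<cdot>\<^bsub>V\<^esub> VId C A = VId D (VFOb F A)) \<and>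
     (\<forall>A\<in>VObj C. \<forall>B\<in>VObj C. \<forall>E\<in>VObj C. let X = VHom C B E; Y = VHom C A B in
        VFHom F A E \<cdot>\<^bsub>V\<^esub> VComp C A B E =
        vcmp V D (VFOb F A) (VFOb F B) (VFOb F E)
          (VFHom F B E \<cdot>\<^bsub>V\<^esub> pr1 V X Y) (VFHom F A B \<cdot>\<^bsub>V\<^esub> pr2 V X Y))"

definition vfun_comp ::
  "('x, 'o, 'm) vcat \<Rightarrow> ('o, 'm) cat \<Rightarrow> ('y, 'z, 'm) vfun \<Rightarrow> ('x, 'y, 'm) vfun \<Rightarrow> ('x, 'z, 'm) vfun"
  where
  "vfun_comp C V G F = mk_vfun C (\<lambda>A. VFOb G (VFOb F A))
     (\<lambda>A B. VFHom G (VFOb F A) (VFOb F B) \<cdot>\<^bsub>V\<^esub> VFHom F A B)"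

definition vnat :: "('o, 'm) cat \<Rightarrow> ('x, 'o, 'm) vcat \<Rightarrow> ('y, 'o, 'm) vcat \<Rightarrow>
    ('x, 'y, 'm) vfun \<Rightarrow> ('x, 'y, 'm) vfun \<Rightarrow> ('x \<Rightarrow> 'm) \<Rightarrow> bool" where
  "vnat V C D F G \<alpha> \<longleftrightarrow>
     (\<forall>A\<in>VObj C. \<alpha> A \<in> Hom V \<one>\<^bsub>V\<^esub> (VHom D (VFOb F A) (VFOb G A))) \<and>
     (\<forall>A\<in>VObj C. \<forall>B\<in>VObj C. let X = VHom C A B in
        vcmp V D (VFOb F A) (VFOb F B) (VFOb G B) (const_at V X (\<alpha> B)) (VFHom F A B) =
        vcmp V D (VFOb F A) (VFOb G A) (VFOb G B) (VFHom G A B) (const_at V X (\<alpha> A)))"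

definition vnat_iso :: "('o, 'm) cat \<Rightarrow> ('x, 'o, 'm) vcat \<Rightarrow> ('y, 'o, 'm) vcat \<Rightarrow>
    ('x, 'y, 'm) vfun \<Rightarrow> ('x, 'y, 'm) vfun \<Rightarrow> ('x \<Rightarrow> 'm) \<Rightarrow> bool" where
  "vnat_iso V C D F G \<alpha> \<longleftrightarrow> vnat V C D F G \<alpha> \<and>
     (\<exists>\<beta>. vnat V C D G F \<beta> \<and> (\<forall>A\<in>VObj C.
        vcmp V D (VFOb F A) (VFOb G A) (VFOb F A) (\<beta> A) (\<alpha> A) = VId D (VFOb F A) \<and>
        vcmp V D (VFOb G A) (VFOb F A) (VFOb G A) (\<alpha> A) (\<beta> A) = VId D (VFOb G A)))"

definition op_vcat :: "('o, 'm) cat \<Rightarrow> ('x, 'o, 'm) vcat \<Rightarrow> ('x, 'o, 'm) vcat" where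
  "op_vcat V C = \<lparr>VObj = VObj C, VHom = (\<lambda>A B. VHom C B A), VId = VId C,
     VComp = (\<lambda>A B D. let X = VHom C D B; Y = VHom C B A in
       vcmp V C D B A (pr2 V X Y) (pr1 V X Y))\<rparr>"

definition op_vfun :: "('x, 'y, 'm) vfun \<Rightarrow> ('x, 'y, 'm) vfun" where
  "op_vfun F = \<lparr>VFOb = VFOb F, VFHom = (\<lambda>A B. VFHom F B A)\<rparr>"

text \<open>\<open>\<V>\<close> enriched over itself; this is a \<open>\<V>\<close>-category whose set of objects need not be small.\<close>

definition self_vcat :: "('o, 'm) cat \<Rightarrow> ('o, 'o, 'm) vcat" where
  "self_vcat V = \<lparr>VObj = Obj V, VHom = expo V, VId = (\<lambda>X. name_of V (Ident V X)),
     VComp = (\<lambda>X Y Z. let E = expo V Y Z; E' = expo V X Y; P = prd V E E';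
         g = pr1 V E E' \<cdot>\<^bsub>V\<^esub> pr1 V P X; f = pr2 V E E' \<cdot>\<^bsub>V\<^esub> pr1 V P X; x = pr2 V P X
       in transp V P X Z (evl V Y Z \<cdot>\<^bsub>V\<^esub> pair V g (evl V X Y \<cdot>\<^bsub>V\<^esub> pair V f x)))\<rparr>"

text \<open>The contravariant hom \<open>\<V>\<close>-functor \<open>C(-,B) : C\<^sup>o\<^sup>p \<rightarrow> \<V>\<close>.\<close>

definition hom_vfun :: "('o, 'm) cat \<Rightarrow> ('x, 'o, 'm) vcat \<Rightarrow> 'x \<Rightarrow> ('x, 'o, 'm) vfun" where
  "hom_vfun V C B = mk_vfun (op_vcat V C) (\<lambda>A. VHom C A B)
     (\<lambda>A A'. let X = VHom C A' A; Y = VHom C A B in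
        transp V X Y (VHom C A' B) (vcmp V C A' A B (pr2 V X Y) (pr1 V X Y)))"

text \<open>
  The \<open>\<V>\<close>-natural transformation \<open>C(-,L) \<Rightarrow> F\<close> corresponding to \<open>x : \<one> \<rightarrow> F L\<close> under the
  enriched Yoneda lemma, for \<open>F : C\<^sup>o\<^sup>p \<rightarrow> \<V>\<close>. Its component at \<open>A\<close> is
  \<open>C(A,L) \<rightarrow> [F L, F A] \<rightarrow> F A\<close>, where the second morphism is evaluation at \<open>x\<close>.
\<close>

definition yoneda_vnat ::
  "('o, 'm) cat \<Rightarrow> ('x, 'o, 'm) vcat \<Rightarrow> ('x, 'o, 'm) vfun \<Rightarrow> 'x \<Rightarrow> 'm \<Rightarrow> 'x \<Rightarrow> 'm" where
  "yoneda_vnat V C F L x = (\<lambda>A. name_of V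
     (evl V (VFOb F L) (VFOb F A) \<cdot>\<^bsub>V\<^esub> pair V (VFHom F L A) (const_at V (VHom C A L) x)))"

definition represents ::
  "('o, 'm) cat \<Rightarrow> ('x, 'o, 'm) vcat \<Rightarrow> ('x, 'o, 'm) vfun \<Rightarrow> 'x \<Rightarrow> 'm \<Rightarrow> bool" where
  "represents V C F L x \<longleftrightarrow>
     vnat_iso V (op_vcat V C) (self_vcat V) (hom_vfun V C L) F (yoneda_vnat V C F L x)"


section \<open>The enriched functor category and enriched limits\<close>

text \<open>
  Extraordinary \<open>\<V>\<close>-naturality of a family \<open>w\<^sub>i : X \<rightarrow> C(F i, F' i)\<close>, in the form transposed across
  \<open>X \<times> I(i,j) \<rightarrow> C(F i, F' j)\<close>.
\<close>

definition is_wedge :: "('o, 'm) cat \<Rightarrow> ('x, 'o, 'm) vcat \<Rightarrow> ('y, 'o, 'm) vcat \<Rightarrow>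
    ('x, 'y, 'm) vfun \<Rightarrow> ('x, 'y, 'm) vfun \<Rightarrow> 'o \<Rightarrow> ('x \<Rightarrow> 'm) \<Rightarrow> bool" where
  "is_wedge V I C F F' X w \<longleftrightarrow> X \<in> Obj V \<and>
     (\<forall>i\<in>VObj I. w i \<in> Hom V X (VHom C (VFOb F i) (VFOb F' i))) \<and>
     (\<forall>i\<in>VObj I. \<forall>j\<in>VObj I. let U = VHom I i j in
        vcmp V C (VFOb F i) (VFOb F' i) (VFOb F' j)
          (VFHom F' i j \<cdot>\<^bsub>V\<^esub> pr2 V X U) (w i \<cdot>\<^bsub>V\<^esub> pr1 V X U) =
        vcmp V C (VFOb F i) (VFOb F j) (VFOb F' j)
          (w j \<cdot>\<^bsub>V\<^esub> pr1 V X U) (VFHom F i j \<cdot>\<^bsub>V\<^esub> pr2 V X U))"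

definition is_end :: "('o, 'm) cat \<Rightarrow> ('x, 'o, 'm) vcat \<Rightarrow> ('y, 'o, 'm) vcat \<Rightarrow>
    ('x, 'y, 'm) vfun \<Rightarrow> ('x, 'y, 'm) vfun \<Rightarrow> 'o \<times> ('x \<Rightarrow> 'm) \<Rightarrow> bool" where
  "is_end V I C F F' = (\<lambda>(E, \<pi>). is_wedge V I C F F' E \<pi> \<and>
     (\<forall>X w. is_wedge V I C F F' X w \<longrightarrow>
        (\<exists>!h. h \<in> Hom V X E \<and> (\<forall>i\<in>VObj I. \<pi> i \<cdot>\<^bsub>V\<^esub> h = w i))))"

definition end_choice :: "('o, 'm) cat \<Rightarrow> ('x, 'o, 'm) vcat \<Rightarrow> ('y, 'o, 'm) vcat \<Rightarrow>
    ('x, 'y, 'm) vfun \<Rightarrow> ('x, 'y, 'm) vfun \<Rightarrow> 'o \<times> ('x \<Rightarrow> 'm)" where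
  "end_choice V I C F F' = (SOME E. is_end V I C F F' E)"

definition end_ob :: "('o, 'm) cat \<Rightarrow> ('x, 'o, 'm) vcat \<Rightarrow> ('y, 'o, 'm) vcat \<Rightarrow>
    ('x, 'y, 'm) vfun \<Rightarrow> ('x, 'y, 'm) vfun \<Rightarrow> 'o" where
  "end_ob V I C F F' = fst (end_choice V I C F F')"

definition end_pr :: "('o, 'm) cat \<Rightarrow> ('x, 'o, 'm) vcat \<Rightarrow> ('y, 'o, 'm) vcat \<Rightarrow>
    ('x, 'y, 'm) vfun \<Rightarrow> ('x, 'y, 'm) vfun \<Rightarrow> 'x \<Rightarrow> 'm" where
  "end_pr V I C F F' = snd (end_choice V I C F F')"

definition end_tuple :: "('o, 'm) cat \<Rightarrow> ('x, 'o, 'm) vcat \<Rightarrow> ('y, 'o, 'm) vcat \<Rightarrow>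
    ('x, 'y, 'm) vfun \<Rightarrow> ('x, 'y, 'm) vfun \<Rightarrow> 'o \<Rightarrow> ('x \<Rightarrow> 'm) \<Rightarrow> 'm" where
  "end_tuple V I C F F' X w = (THE h. h \<in> Hom V X (end_ob V I C F F') \<and>
     (\<forall>i\<in>VObj I. end_pr V I C F F' i \<cdot>\<^bsub>V\<^esub> h = w i))"

definition fun_vcat :: "('o, 'm) cat \<Rightarrow> ('x, 'o, 'm) vcat \<Rightarrow> ('y, 'o, 'm) vcat \<Rightarrow>
    (('x, 'y, 'm) vfun, 'o, 'm) vcat" where
  "fun_vcat V I C = \<lparr>VObj = {F. vfunctor V I C F}, VHom = end_ob V I C,
     VId = (\<lambda>F. end_tuple V I C F F \<one>\<^bsub>V\<^esub> (\<lambda>i. VId C (VFOb F i))),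
     VComp = (\<lambda>F G H. let X = end_ob V I C G H; Y = end_ob V I C F G in
       end_tuple V I C F H (prd V X Y)
         (\<lambda>i. vcmp V C (VFOb F i) (VFOb G i) (VFOb H i)
                (end_pr V I C G H i \<cdot>\<^bsub>V\<^esub> pr1 V X Y) (end_pr V I C F G i \<cdot>\<^bsub>V\<^esub> pr2 V X Y)))\<rparr>"

definition const_vfun :: "('o, 'm) cat \<Rightarrow> ('x, 'o, 'm) vcat \<Rightarrow> ('y, 'o, 'm) vcat \<Rightarrow> 'y \<Rightarrow>
    ('x, 'y, 'm) vfun" where
  "const_vfun V I C A = mk_vfun I (\<lambda>i. A) (\<lambda>i j. const_at V (VHom I i j) (VId C A))"

definition diag_vfun :: "('o, 'm) cat \<Rightarrow> ('x, 'o, 'm) vcat \<Rightarrow> ('y, 'o, 'm) vcat \<Rightarrow>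
    ('y, ('x, 'y, 'm) vfun, 'm) vfun" where
  "diag_vfun V I C = mk_vfun C (const_vfun V I C)
     (\<lambda>A B. end_tuple V I C (const_vfun V I C A) (const_vfun V I C B) (VHom C A B)
        (\<lambda>i. Ident V (VHom C A B)))"

text \<open>The \<open>\<V>\<close>-functor \<open>C\<^sup>I(\<Delta>(-),G) : C\<^sup>o\<^sup>p \<rightarrow> \<V>\<close>.\<close>

definition cone_vfun :: "('o, 'm) cat \<Rightarrow> ('x, 'o, 'm) vcat \<Rightarrow> ('y, 'o, 'm) vcat \<Rightarrow>
    ('x, 'y, 'm) vfun \<Rightarrow> ('y, 'o, 'm) vfun" where
  "cone_vfun V I C G =
     vfun_comp (op_vcat V C) V (hom_vfun V (fun_vcat V I C) G) (op_vfun (diag_vfun V I C))"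

definition is_vlimit :: "('o, 'm) cat \<Rightarrow> ('x, 'o, 'm) vcat \<Rightarrow> ('y, 'o, 'm) vcat \<Rightarrow>
    ('x, 'y, 'm) vfun \<Rightarrow> 'y \<Rightarrow> ('x \<Rightarrow> 'm) \<Rightarrow> bool" where
  "is_vlimit V I C G L l \<longleftrightarrow>
     represents V C (cone_vfun V I C G) L (end_tuple V I C (const_vfun V I C L) G \<one>\<^bsub>V\<^esub> l)"


section \<open>Internal categories\<close>

text \<open>
  Composition \<open>icmp : A\<^sub>1 \<times>\<^bsub>A\<^sub>0\<^esub> A\<^sub>1 \<rightarrow> A\<^sub>1\<close> is defined on the pullback of \<open>itgt\<close> along \<open>isrc\<close>, i.e. on
  composable pairs in diagrammatic order.
\<close>

record ('o, 'm) icat =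
  IOb :: 'o
  IAr :: 'o
  isrc :: 'm
  itgt :: 'm
  iid :: 'm
  icmp :: 'm

text \<open>Diagrammatic composition of generalized arrows \<open>f, g : X \<rightarrow> A\<^sub>1\<close>.\<close>

definition igcmp :: "('o, 'm) cat \<Rightarrow> ('o, 'm) icat \<Rightarrow> 'm \<Rightarrow> 'm \<Rightarrow> 'm" where
  "igcmp V A f g = icmp A \<cdot>\<^bsub>V\<^esub> pb_pair V (itgt A) (isrc A) f g"

definition internal_category :: "('o, 'm) cat \<Rightarrow> ('o, 'm) icat \<Rightarrow> bool" where
  "internal_category V A \<longleftrightarrow>
     (let s = isrc A; t = itgt A; i = iid A; c = icmp A;
          p = pb1 V t s; q = pb2 V t s;
          u = pb1 V (t \<cdot>\<^bsub>V\<^esub> q) s; h = pb2 V (t \<cdot>\<^bsub>V\<^esub> q) s; f = p \<cdot>\<^bsub>V\<^esub> u; g = q \<cdot>\<^bsub>V\<^esub> u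
      in IOb A \<in> Obj V \<and> IAr A \<in> Obj V \<and>
         s \<in> Hom V (IAr A) (IOb A) \<and> t \<in> Hom V (IAr A) (IOb A) \<and>
         i \<in> Hom V (IOb A) (IAr A) \<and> c \<in> Hom V (pb V t s) (IAr A) \<and>
         s \<cdot>\<^bsub>V\<^esub> i = Ident V (IOb A) \<and> t \<cdot>\<^bsub>V\<^esub> i = Ident V (IOb A) \<and>
         s \<cdot>\<^bsub>V\<^esub> c = s \<cdot>\<^bsub>V\<^esub> p \<and> t \<cdot>\<^bsub>V\<^esub> c = t \<cdot>\<^bsub>V\<^esub> q \<and>
         igcmp V A (i \<cdot>\<^bsub>V\<^esub> s) (Ident V (IAr A)) = Ident V (IAr A) \<and>
         igcmp V A (Ident V (IAr A)) (i \<cdot>\<^bsub>V\<^esub> t) = Ident V (IAr A) \<and>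
         igcmp V A (igcmp V A f g) h = igcmp V A f (igcmp V A g h))"

record ('o, 'm) ifun =
  IDom :: "('o, 'm) icat"
  ICod :: "('o, 'm) icat"
  IF0 :: 'm
  IF1 :: 'm

definition internal_functor :: "('o, 'm) cat \<Rightarrow> ('o, 'm) ifun \<Rightarrow> bool" where
  "internal_functor V F \<longleftrightarrow>
     (let A = IDom F; B = ICod F; p = pb1 V (itgt A) (isrc A); q = pb2 V (itgt A) (isrc A)
      in internal_category V A \<and> internal_category V B \<and>
         IF0 F \<in> Hom V (IOb A) (IOb B) \<and> IF1 F \<in> Hom V (IAr A) (IAr B) \<and>
         isrc B \<cdot>\<^bsub>V\<^esub> IF1 F = IF0 F \<cdot>\<^bsub>V\<^esub> isrc A \<and>
         itgt B \<cdot>\<^bsub>V\<^esub> IF1 F = IF0 F \<cdot>\<^bsub>V\<^esub> itgt A \<and>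
         IF1 F \<cdot>\<^bsub>V\<^esub> iid A = iid B \<cdot>\<^bsub>V\<^esub> IF0 F \<and>
         IF1 F \<cdot>\<^bsub>V\<^esub> icmp A = igcmp V B (IF1 F \<cdot>\<^bsub>V\<^esub> p) (IF1 F \<cdot>\<^bsub>V\<^esub> q))"

definition Cat :: "('o, 'm) cat \<Rightarrow> (('o, 'm) icat, ('o, 'm) ifun) cat" where
  "Cat V = \<lparr>
     Obj = {A. internal_category V A},
     Arr = {F. internal_functor V F},
     Dom = IDom,
     Cod = ICod,
     Ident = (\<lambda>A. \<lparr>IDom = A, ICod = A, IF0 = Ident V (IOb A), IF1 = Ident V (IAr A)\<rparr>),
     Comp = (\<lambda>G F. \<lparr>IDom = IDom F, ICod = ICod G,
                     IF0 = IF0 G \<cdot>\<^bsub>V\<^esub> IF0 F, IF1 = IF1 G \<cdot>\<^bsub>V\<^esub> IF1 F\<rparr>)\<rparr>"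


section \<open>Internalization of enriched categories\<close>

definition Int_ob :: "('o, 'm) cat \<Rightarrow> ('x, 'o, 'm) vcat \<Rightarrow> 'o" where
  "Int_ob V C = coprod V (VObj C) (\<lambda>_. \<one>\<^bsub>V\<^esub>)"

definition Int_ar :: "('o, 'm) cat \<Rightarrow> ('x, 'o, 'm) vcat \<Rightarrow> 'o" where
  "Int_ar V C = coprod V (VObj C \<times> VObj C) (\<lambda>(A, B). VHom C A B)"

definition inc0 :: "('o, 'm) cat \<Rightarrow> ('x, 'o, 'm) vcat \<Rightarrow> 'x \<Rightarrow> 'm" where
  "inc0 V C A = incl V (VObj C) (\<lambda>_. \<one>\<^bsub>V\<^esub>) A"

definition inc1 :: "('o, 'm) cat \<Rightarrow> ('x, 'o, 'm) vcat \<Rightarrow> 'x \<Rightarrow> 'x \<Rightarrow> 'm" where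
  "inc1 V C A B = incl V (VObj C \<times> VObj C) (\<lambda>(A, B). VHom C A B) (A, B)"

definition Int_ob_cotuple :: "('o, 'm) cat \<Rightarrow> ('x, 'o, 'm) vcat \<Rightarrow> 'o \<Rightarrow> ('x \<Rightarrow> 'm) \<Rightarrow> 'm" where
  "Int_ob_cotuple V C Y f = cotuple V (VObj C) (\<lambda>_. \<one>\<^bsub>V\<^esub>) Y f"

definition Int_ar_cotuple ::
  "('o, 'm) cat \<Rightarrow> ('x, 'o, 'm) vcat \<Rightarrow> 'o \<Rightarrow> ('x \<Rightarrow> 'x \<Rightarrow> 'm) \<Rightarrow> 'm" where
  "Int_ar_cotuple V C Y f =
     cotuple V (VObj C \<times> VObj C) (\<lambda>(A, B). VHom C A B) Y (\<lambda>(A, B). f A B)"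

text \<open>
  By extensivity the object of composable pairs is the coproduct of the \<open>C(A,B) \<times> C(B,D)\<close>, so the
  composition is determined by its restrictions to these summands. \<open>VComp\<close> takes its arguments
  in the opposite order.
\<close>

definition Intl :: "('o, 'm) cat \<Rightarrow> ('x, 'o, 'm) vcat \<Rightarrow> ('o, 'm) icat" where
  "Intl V C =
    (let s = Int_ar_cotuple V C (Int_ob V C) (\<lambda>A B. const_at V (VHom C A B) (inc0 V C A));
         t = Int_ar_cotuple V C (Int_ob V C) (\<lambda>A B. const_at V (VHom C A B) (inc0 V C B))
     in \<lparr>IOb = Int_ob V C, IAr = Int_ar V C, isrc = s, itgt = t,
         iid = Int_ob_cotuple V C (Int_ar V C) (\<lambda>A. inc1 V C A A \<cdot>\<^bsub>V\<^esub> VId C A),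
         icmp = (THE c. c \<in> Hom V (pb V t s) (Int_ar V C) \<and>
           (\<forall>A\<in>VObj C. \<forall>B\<in>VObj C. \<forall>D\<in>VObj C. let X = VHom C A B; Y = VHom C B D in
              c \<cdot>\<^bsub>V\<^esub> pb_pair V t s (inc1 V C A B \<cdot>\<^bsub>V\<^esub> pr1 V X Y) (inc1 V C B D \<cdot>\<^bsub>V\<^esub> pr2 V X Y) =
              inc1 V C A D \<cdot>\<^bsub>V\<^esub> vcmp V C A B D (pr2 V X Y) (pr1 V X Y)))\<rparr>)"

definition Int_fun :: "('o, 'm) cat \<Rightarrow> ('x, 'o, 'm) vcat \<Rightarrow> ('y, 'o, 'm) vcat \<Rightarrow>
    ('x, 'y, 'm) vfun \<Rightarrow> ('o, 'm) ifun" where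
  "Int_fun V C D F = \<lparr>IDom = Intl V C, ICod = Intl V D,
     IF0 = Int_ob_cotuple V C (Int_ob V D) (\<lambda>A. inc0 V D (VFOb F A)),
     IF1 = Int_ar_cotuple V C (Int_ar V D)
             (\<lambda>A B. inc1 V D (VFOb F A) (VFOb F B) \<cdot>\<^bsub>V\<^esub> VFHom F A B)\<rparr>"

text \<open>The element \<open>\<iota>\<^sub>A : \<one> \<rightarrow> Intl C\<close> of \<open>Intl C\<close> given by an object \<open>A\<close> of \<open>C\<close>.\<close>

definition Int_elem :: "('o, 'm) cat \<Rightarrow> ('x, 'o, 'm) vcat \<Rightarrow> 'x \<Rightarrow> ('o, 'm) ifun" where
  "Int_elem V C A = (let T = \<one>\<^bsub>Cat V\<^esub> in
     \<lparr>IDom = T, ICod = Intl V C,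
      IF0 = const_at V (IOb T) (inc0 V C A),
      IF1 = const_at V (IAr T) (inc1 V C A A \<cdot>\<^bsub>V\<^esub> VId C A)\<rparr>)"

text \<open>
  The \<open>\<V>\<close>-category \<open>2\<close>, with \<open>False\<close> and \<open>True\<close> for the objects \<open>0\<close> and \<open>1\<close>. Each of its
  structure morphisms is the only morphism of its type, as the product of \<open>\<emptyset>\<close> with any object
  of a cartesian closed category is initial.
\<close>

definition two_hom :: "('o, 'm) cat \<Rightarrow> bool \<Rightarrow> bool \<Rightarrow> 'o" where
  "two_hom V a b = (if a \<and> \<not> b then initial V else \<one>\<^bsub>V\<^esub>)"

definition two_vcat :: "('o, 'm) cat \<Rightarrow> (bool, 'o, 'm) vcat" where
  "two_vcat V = \<lparr>VObj = UNIV, VHom = two_hom V,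
     VId = (\<lambda>a. THE f. f \<in> Hom V \<one>\<^bsub>V\<^esub> (two_hom V a a)),
     VComp = (\<lambda>a b c. THE f. f \<in> Hom V (prd V (two_hom V b c) (two_hom V a b)) (two_hom V a c))\<rparr>"

definition Two :: "('o, 'm) cat \<Rightarrow> ('o, 'm) icat" where
  "Two V = Intl V (two_vcat V)"


section \<open>Comma internal categories and internal limits\<close>

text \<open>
  The next three definitions apply to any cartesian closed category \<open>W\<close>; they are used for
  \<open>W = Cat V\<close>. \<open>pre_comp W F Y\<close> is \<open>[F,Y] : [X',Y] \<rightarrow> [X,Y]\<close> for \<open>F : X \<rightarrow> X'\<close>;
  \<open>ev_at W x Y\<close> is evaluation \<open>[X,Y] \<rightarrow> Y\<close> at the element \<open>x : \<one> \<rightarrow> X\<close>.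
\<close>

definition pre_comp :: "('o, 'm) cat \<Rightarrow> 'm \<Rightarrow> 'o \<Rightarrow> 'm" where
  "pre_comp W F Y = (let X = Dom W F; X' = Cod W F; E = expo W X' Y in
     transp W E X Y (evl W X' Y \<cdot>\<^bsub>W\<^esub> prod_map W (Ident W E) F))"

definition ev_at :: "('o, 'm) cat \<Rightarrow> 'm \<Rightarrow> 'o \<Rightarrow> 'm" where
  "ev_at W x Y = (let X = Cod W x; E = expo W X Y in
     evl W X Y \<cdot>\<^bsub>W\<^esub> pair W (Ident W E) (const_at W E x))"

definition diag :: "('o, 'm) cat \<Rightarrow> 'o \<Rightarrow> 'o \<Rightarrow> 'm" where
  "diag W X Y = transp W Y X Y (pr1 W Y X)"

definition ends_incl :: "('o, 'm) cat \<Rightarrow> ('o, 'm) ifun" where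
  "ends_incl V = cotuple (Cat V) (UNIV :: bool set) (\<lambda>_. \<one>\<^bsub>Cat V\<^esub>) (Two V)
     (Int_elem V (two_vcat V))"

text \<open>
  The internal functor \<open>\<langle>0,1\<rangle>\<^sup>* : [2,B] \<rightarrow> [\<one> + \<one>, B] \<cong> B \<times> B\<close>, with the isomorphism given by
  evaluation at the two coproduct inclusions.
\<close>

definition ends :: "('o, 'm) cat \<Rightarrow> ('o, 'm) icat \<Rightarrow> ('o, 'm) ifun" where
  "ends V B = (let W = Cat V; \<iota> = incl W (UNIV :: bool set) (\<lambda>_. \<one>\<^bsub>W\<^esub>) in
     pair W (ev_at W (\<iota> False) B) (ev_at W (\<iota> True) B) \<cdot>\<^bsub>W\<^esub> pre_comp W (ends_incl V) B)"

text \<open>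
  For \<open>H : A \<rightarrow> B\<close> and \<open>b : \<one> \<rightarrow> B\<close>, the internal functor \<open>H \<times> b : A \<cong> A \<times> \<one> \<rightarrow> B \<times> B\<close>.
\<close>

definition comma_base :: "('o, 'm) cat \<Rightarrow> ('o, 'm) ifun \<Rightarrow> ('o, 'm) ifun \<Rightarrow> ('o, 'm) ifun" where
  "comma_base V H b = pair (Cat V) H (const_at (Cat V) (IDom H) b)"

definition comma :: "('o, 'm) cat \<Rightarrow> ('o, 'm) ifun \<Rightarrow> ('o, 'm) ifun \<Rightarrow> ('o, 'm) icat" where
  "comma V H b = pb (Cat V) (comma_base V H b) (ends V (ICod H))"

definition comma_proj :: "('o, 'm) cat \<Rightarrow> ('o, 'm) ifun \<Rightarrow> ('o, 'm) ifun \<Rightarrow> ('o, 'm) ifun" where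
  "comma_proj V H b = pb1 (Cat V) (comma_base V H b) (ends V (ICod H))"

definition comma_arrow :: "('o, 'm) cat \<Rightarrow> ('o, 'm) ifun \<Rightarrow> ('o, 'm) ifun \<Rightarrow> ('o, 'm) ifun" where
  "comma_arrow V H b = pb2 (Cat V) (comma_base V H b) (ends V (ICod H))"

definition internal_terminal :: "('o, 'm) cat \<Rightarrow> ('o, 'm) icat \<Rightarrow> ('o, 'm) ifun \<Rightarrow> bool" where
  "internal_terminal V A T \<longleftrightarrow> T \<in> Hom (Cat V) \<one>\<^bsub>Cat V\<^esub> A \<and>
     iso (Cat V) (comma_proj V (Ident (Cat V) A) T)"

definition cone_diag :: "('o, 'm) cat \<Rightarrow> ('o, 'm) ifun \<Rightarrow> ('o, 'm) ifun" where
  "cone_diag V K = diag (Cat V) (IDom K) (ICod K)"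

definition cones :: "('o, 'm) cat \<Rightarrow> ('o, 'm) ifun \<Rightarrow> ('o, 'm) icat" where
  "cones V K = comma V (cone_diag V K) (name_of (Cat V) K)"

definition is_internal_limit :: "('o, 'm) cat \<Rightarrow> ('o, 'm) ifun \<Rightarrow> ('o, 'm) ifun \<Rightarrow> bool" where
  "is_internal_limit V K e \<longleftrightarrow> internal_terminal V (cones V K) e"

text \<open>
  An element \<open>N : \<one> \<rightarrow> [2,[I,A]]\<close> corresponds to an internal functor \<open>2 \<times> I \<rightarrow> A\<close>, that is, to an
  internal natural transformation between internal functors \<open>I \<rightarrow> A\<close>. Its underlying map
  \<open>I\<^sub>0 \<rightarrow> A\<^sub>1\<close> is the restriction of \<open>(2 \<times> I)\<^sub>1 \<rightarrow> A\<^sub>1\<close> along the pair of the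
  arrow \<open>0 \<rightarrow> 1\<close> of \<open>2\<close> and the identities of \<open>I\<close>.
\<close>

definition nat_uncurry ::
  "('o, 'm) cat \<Rightarrow> ('o, 'm) icat \<Rightarrow> ('o, 'm) icat \<Rightarrow> ('o, 'm) ifun \<Rightarrow> ('o, 'm) ifun" where
  "nat_uncurry V I A N = (let W = Cat V; T = Two V; E = expo W I A in
     evl W I A \<cdot>\<^bsub>W\<^esub>
       prod_map W (evl W T E \<cdot>\<^bsub>W\<^esub> pair W (const_at W T N) (Ident W T)) (Ident W I))"

definition nat_underlying ::
  "('o, 'm) cat \<Rightarrow> ('o, 'm) icat \<Rightarrow> ('o, 'm) icat \<Rightarrow> ('o, 'm) ifun \<Rightarrow> 'm" where
  "nat_underlying V I A N = (let W = Cat V; T = Two V in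
     IF1 (nat_uncurry V I A N) \<cdot>\<^bsub>V\<^esub>
       (THE m. m \<in> Hom V (IOb I) (IAr (prd W T I)) \<and>
          IF1 (pr1 W T I) \<cdot>\<^bsub>V\<^esub> m = const_at V (IOb I) (inc1 V (two_vcat V) False True) \<and>
          IF1 (pr2 W T I) \<cdot>\<^bsub>V\<^esub> m = iid I))"

text \<open>
  The element of \<open>\<Delta> \<down> Intl G\<close> given by \<open>(L, l)\<close>. An element of the pullback \<open>\<Delta> \<down> Intl G\<close> is
  determined by its projection to \<open>Intl C\<close> and an internal natural transformation with prescribed
  source and target, and the latter by its underlying map.
\<close>

definition cone_elem :: "('o, 'm) cat \<Rightarrow> ('x, 'o, 'm) vcat \<Rightarrow> ('y, 'o, 'm) vcat \<Rightarrow>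
    ('x, 'y, 'm) vfun \<Rightarrow> 'y \<Rightarrow> ('x \<Rightarrow> 'm) \<Rightarrow> ('o, 'm) ifun" where
  "cone_elem V I C G L l =
    (let W = Cat V; K = Int_fun V I C G; D = cone_diag V K; k = name_of W K in
     THE e. e \<in> Hom W \<one>\<^bsub>W\<^esub> (cones V K) \<and>
       comma_proj V D k \<cdot>\<^bsub>W\<^esub> e = Int_elem V C L \<and>
       nat_underlying V (Intl V I) (Intl V C) (comma_arrow V D k \<cdot>\<^bsub>W\<^esub> e) =
         Int_ob_cotuple V I (Int_ar V C) (\<lambda>i. inc1 V C L (VFOb G i) \<cdot>\<^bsub>V\<^esub> l i))"

end

theory Submission
  imports Defs
begin

text \<open>
  Both conditions say the same about generalized elements, namely: for every object \<open>A\<close> of \<open>C\<close>, every \<open>X\<close> and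
  every wedge of morphisms \<open>w\<^sub>i : X \<rightarrow> C(A, G i)\<close> there is exactly one \<open>h : X \<rightarrow> C(A, L)\<close> with \<open>l\<^sub>i h = w\<^sub>i\<close> for all \<open>i\<close>.

  On the enriched side (\<open>is_vlimit_iff\<close>) the end that is the value of the functor of cones at \<open>A\<close> classifies
  the wedges, and the transformation given by \<open>l\<close> sends \<open>h\<close> to the wedge of the \<open>l\<^sub>i h\<close>. A \<open>\<V>\<close>-natural
  transformation between functors with values in \<open>\<V>\<close> is invertible as soon as its components are
  (\<open>vnat_iso_self\<close>), and a morphism is invertible iff it is bijective on generalized elements.

  On the internal side everything is expressed by generalized elements too. Internal categories form a cartesian
  closed category in which the generalized objects and arrows of an exponential are the families of internal functors
  and of internal natural transformations (\<open>pexp_expo\<close>). Hence a generalized object of \<open>[2, B]\<close> is an arrow of \<open>B\<close>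
  and a generalized arrow is a commutative square (\<open>ar_surj\<close>, \<open>square_ex\<close>), which makes comma categories
  explicit. An internal terminal object is terminal among generalized objects at every stage
  (\<open>internal_terminal_iff\<close>), so an internal limit is a universal family of internal cones with vertex an arbitrary
  generalized object \<open>a : X \<rightarrow> \<Squnion>\<^sub>A \<one>\<close> (\<open>cones_terminal_iff\<close>).

  Extensivity compares the two sides. It decomposes \<open>X\<close> into pieces on which \<open>a\<close> is constant, and
  universality can be tested on the pieces since existence is glued and uniqueness is local
  (\<open>all_factors_iff\<close>). An arrow whose ends are constant at \<open>A\<close> and \<open>B\<close> lies in \<open>C(A, B)\<close> (\<open>hom_factor\<close>). For
  constant \<open>a\<close>, therefore, internal cones are wedges (\<open>wedge_iff_int_nat\<close>) and the mediating arrows are morphisms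
  into \<open>C(A, L)\<close>.
\<close>

section \<open>Categories, products and exponentials\<close>

lemma in_Hom [simp]: "f \<in> Hom V X Y \<longleftrightarrow> f \<in> Arr V \<and> Dom V f = X \<and> Cod V f = Y"
  by (auto simp: Hom_def)

locale cat =
  fixes V :: "('o, 'm) cat" (structure)
  assumes category: "category V"
begin

lemma Dom_Obj [simp]: "f \<in> Arr V \<Longrightarrow> Dom V f \<in> Obj V"
  and Cod_Obj [simp]: "f \<in> Arr V \<Longrightarrow> Cod V f \<in> Obj V"
  using category by (auto simp: category_def)

lemma Ident_simps [simp]:
  assumes "X \<in> Obj V"
  shows "Ident V X \<in> Arr V" "Dom V (Ident V X) = X" "Cod V (Ident V X) = X"
  using category assms by (auto simp: category_def)

lemma comp_simps [simp]:
  assumes "f \<in> Arr V" "g \<in> Arr V" "Dom V g = Cod V f"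
  shows "g \<cdot> f \<in> Arr V" "Dom V (g \<cdot> f) = Dom V f" "Cod V (g \<cdot> f) = Cod V g"
proof -
  have "\<forall>X Y Z. \<forall>f\<in>Hom V X Y. \<forall>g\<in>Hom V Y Z. g \<cdot> f \<in> Hom V X Z"
    using category unfolding category_def by (elim conjE)
  from this[rule_format, of f "Dom V f" "Cod V f" g "Cod V g"]
  show "g \<cdot> f \<in> Arr V" "Dom V (g \<cdot> f) = Dom V f" "Cod V (g \<cdot> f) = Cod V g"
    using assms by auto
qed

lemma Ident_left [simp]: "f \<in> Arr V \<Longrightarrow> Cod V f = Y \<Longrightarrow> Ident V Y \<cdot> f = f" (is "PROP ?ga")
  and Ident_right [simp]: "f \<in> Arr V \<Longrightarrow> Dom V f = X \<Longrightarrow> f \<cdot> Ident V X = f" (is "PROP ?gb")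
proof -
  have *: "\<forall>X Y. \<forall>f\<in>Hom V X Y. Ident V Y \<cdot> f = f \<and> f \<cdot> Ident V X = f"
    using category unfolding category_def by (elim conjE)
  show "PROP ?ga"
    using *[rule_format, of f "Dom V f" Y] by simp
  show "PROP ?gb"
    using *[rule_format, of f X "Cod V f"] by simp
qed

lemma assoc [simp]:
  assumes "f \<in> Arr V" "g \<in> Arr V" "h \<in> Arr V" "Dom V g = Cod V f" "Dom V h = Cod V g"
  shows "(h \<cdot> g) \<cdot> f = h \<cdot> (g \<cdot> f)"
proof -
  have "\<forall>W X Y Z. \<forall>f\<in>Hom V W X. \<forall>g\<in>Hom V X Y. \<forall>h\<in>Hom V Y Z. (h \<cdot> g) \<cdot> f = h \<cdot> (g \<cdot> f)"
    using category unfolding category_def by (elim conjE)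
  from this[rule_format, of f "Dom V f" "Cod V f" g "Cod V g" h "Cod V h"] show ?thesis
    using assms by simp
qed

text \<open>Composites are kept associated to the right; in this form an equation between two composites applies inside a longer one.\<close>

lemma reassoc:
  assumes "g \<cdot> f = k" "f \<in> Arr V" "g \<in> Arr V" "Dom V g = Cod V f" "x \<in> Arr V" "Cod V x = Dom V f"
  shows "g \<cdot> (f \<cdot> x) = k \<cdot> x"
  using assms assoc[of x f g] by simp

text \<open>The domain of a composite is that of its first factor, so both legs of a square start at one object.\<close>

lemma Dom_eqI:
  assumes "g \<cdot> f = k \<cdot> h" "f \<in> Arr V" "g \<in> Arr V" "Dom V g = Cod V f"
    "h \<in> Arr V" "k \<in> Arr V" "Dom V k = Cod V h"
  shows "Dom V f = Dom V h"
  using comp_simps(2)[of f g] comp_simps(2)[of h k] assms by simp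

lemma isoI:
  assumes "f \<in> Arr V" "g \<in> Arr V" "Dom V g = Cod V f" "Cod V g = Dom V f"
    and "g \<cdot> f = Ident V (Dom V f)" "f \<cdot> g = Ident V (Cod V f)"
  shows "iso V f"
  using assms by (auto simp: iso_def)

lemma isoE:
  assumes "iso V f"
  obtains g where "f \<in> Arr V" "g \<in> Arr V" "Dom V g = Cod V f" "Cod V g = Dom V f"
    "g \<cdot> f = Ident V (Dom V f)" "f \<cdot> g = Ident V (Cod V f)"
  using assms by (auto simp: iso_def)

lemma terminal_unique:
  assumes "is_terminal V T" "f \<in> Arr V" "g \<in> Arr V" "Dom V f = Dom V g" "Cod V f = T" "Cod V g = T"
  shows "f = g"
  using assms by (auto simp: is_terminal_def dest: Dom_Obj)

lemma initial_unique:
  assumes "is_initial V Z" "f \<in> Arr V" "g \<in> Arr V" "Dom V f = Z" "Dom V g = Z" "Cod V f = Cod V g"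
  shows "f = g"
  using assms by (auto simp: is_initial_def dest: Cod_Obj)

lemma iso_initial:
  assumes "is_initial V Z" "f \<in> Hom V Z Z'" "g \<in> Hom V Z' Z" "f \<cdot> g = Ident V Z'"
  shows "is_initial V Z'"
proof -
  have "\<exists>!h. h \<in> Hom V Z' X" if X: "X \<in> Obj V" for X
  proof -
    obtain k where k: "k \<in> Hom V Z X" using assms(1) X by (auto simp: is_initial_def)
    show ?thesis
    proof (intro ex1I)
      show "k \<cdot> g \<in> Hom V Z' X" using k assms by simp
    next
      fix h assume h: "h \<in> Hom V Z' X"
      have "h \<cdot> f = k" using initial_unique[OF assms(1)] h k assms by simp
      then show "h = k \<cdot> g" using h k assms assoc[of g f h] by auto
    qed
  qed
  then show ?thesis using assms by (auto simp: is_initial_def)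
qed

subsection \<open>Universal cones\<close>

text \<open>
  The first two components of a product or pullback cone determine the mediating morphism in the
  same way, so one operation serves every product or pullback cone, chosen or not.
\<close>

definition lift :: "'m \<Rightarrow> 'm \<Rightarrow> 'm \<Rightarrow> 'm \<Rightarrow> 'm" where
  "lift p q f g = (THE h. h \<in> Hom V (Dom V f) (Dom V p) \<and> p \<cdot> h = f \<and> q \<cdot> h = g)"

lemma is_productD:
  assumes "is_product V X Y (P, p, q)"
  shows "P \<in> Obj V" "p \<in> Arr V" "Dom V p = P" "Cod V p = X" "q \<in> Arr V" "Dom V q = P" "Cod V q = Y"
  using assms by (auto simp: is_product_def)

lemma product_lift:
  assumes "is_product V X Y (P, p, q)"
    and "f \<in> Arr V" "g \<in> Arr V" "Dom V f = Dom V g" "Cod V f = X" "Cod V g = Y"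
  shows "lift p q f g \<in> Arr V" "Dom V (lift p q f g) = Dom V f" "Cod V (lift p q f g) = P"
    "p \<cdot> lift p q f g = f" "q \<cdot> lift p q f g = g"
proof -
  have "\<exists>!h. h \<in> Hom V (Dom V f) (Dom V p) \<and> p \<cdot> h = f \<and> q \<cdot> h = g"
    using assms unfolding is_product_def by auto
  from theI'[OF this] show "lift p q f g \<in> Arr V" "Dom V (lift p q f g) = Dom V f"
    "Cod V (lift p q f g) = P" "p \<cdot> lift p q f g = f" "q \<cdot> lift p q f g = g"
    using is_productD[OF assms(1)] by (auto simp: lift_def)
qed

lemma product_ext:
  assumes "is_product V X Y (P, p, q)"
    and "h \<in> Arr V" "k \<in> Arr V" "Dom V h = Dom V k" "Cod V h = P" "Cod V k = P"
    and "p \<cdot> h = p \<cdot> k" "q \<cdot> h = q \<cdot> k"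
  shows "h = k"
proof -
  have "\<exists>!m. m \<in> Hom V (Dom V h) P \<and> p \<cdot> m = p \<cdot> h \<and> q \<cdot> m = q \<cdot> h"
    using assms unfolding is_product_def by auto
  then show ?thesis using assms by auto
qed

lemma is_pullbackD:
  assumes "is_pullback V f g (P, p, q)"
  shows "P \<in> Obj V" "p \<in> Arr V" "Dom V p = P" "Cod V p = Dom V f"
    "q \<in> Arr V" "Dom V q = P" "Cod V q = Dom V g" "f \<cdot> p = g \<cdot> q"
  using assms by (auto simp: is_pullback_def)

lemma pullback_lift:
  assumes "is_pullback V f g (P, p, q)"
    and "a \<in> Arr V" "b \<in> Arr V" "Dom V a = Dom V b" "Cod V a = Dom V f" "Cod V b = Dom V g"
    and "f \<cdot> a = g \<cdot> b"
  shows "lift p q a b \<in> Arr V" "Dom V (lift p q a b) = Dom V a" "Cod V (lift p q a b) = P"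
    "p \<cdot> lift p q a b = a" "q \<cdot> lift p q a b = b"
proof -
  have "\<exists>!h. h \<in> Hom V (Dom V a) (Dom V p) \<and> p \<cdot> h = a \<and> q \<cdot> h = b"
    using assms unfolding is_pullback_def by auto
  from theI'[OF this] show "lift p q a b \<in> Arr V" "Dom V (lift p q a b) = Dom V a"
    "Cod V (lift p q a b) = P" "p \<cdot> lift p q a b = a" "q \<cdot> lift p q a b = b"
    using is_pullbackD[OF assms(1)] by (auto simp: lift_def)
qed

lemma pullback_ext:
  assumes "is_pullback V f g (P, p, q)" "f \<in> Arr V" "g \<in> Arr V"
    and "h \<in> Arr V" "k \<in> Arr V" "Dom V h = Dom V k" "Cod V h = P" "Cod V k = P"
    and "p \<cdot> h = p \<cdot> k" "q \<cdot> h = q \<cdot> k"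
  shows "h = k"
proof -
  have "f \<cdot> (p \<cdot> h) = g \<cdot> (q \<cdot> h)"
    using is_pullbackD[OF assms(1)] assms reassoc[of f p "g \<cdot> q" h] by simp
  then have "\<exists>!m. m \<in> Hom V (Dom V h) P \<and> p \<cdot> m = p \<cdot> h \<and> q \<cdot> m = q \<cdot> h"
    using is_pullbackD[OF assms(1)] assms unfolding is_pullback_def by auto
  then show ?thesis using assms by auto
qed

lemma pullbackI:
  assumes "P \<in> Obj V" "p \<in> Hom V P (Dom V f)" "q \<in> Hom V P (Dom V g)" "f \<cdot> p = g \<cdot> q"
    and "\<And>a b. \<lbrakk>a \<in> Arr V; b \<in> Hom V (Dom V a) (Dom V g); Cod V a = Dom V f; f \<cdot> a = g \<cdot> b\<rbrakk> \<Longrightarrow>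
       \<exists>h. h \<in> Hom V (Dom V a) P \<and> p \<cdot> h = a \<and> q \<cdot> h = b"
    and "\<And>h k. \<lbrakk>h \<in> Arr V; k \<in> Arr V; Dom V h = Dom V k; Cod V h = P; Cod V k = P; p \<cdot> h = p \<cdot> k; q \<cdot> h = q \<cdot> k\<rbrakk> \<Longrightarrow> h = k"
  shows "is_pullback V f g (P, p, q)"
  unfolding is_pullback_def prod.case
proof (intro conjI ballI impI)
  fix Z a b assume "a \<in> Hom V Z (Dom V f)" "b \<in> Hom V Z (Dom V g)" "f \<cdot> a = g \<cdot> b"
  with assms(5)[of a b] obtain h where "h \<in> Hom V Z P \<and> p \<cdot> h = a \<and> q \<cdot> h = b" by auto
  then show "\<exists>!h. h \<in> Hom V Z P \<and> p \<cdot> h = a \<and> q \<cdot> h = b"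
    by (intro ex1I[of _ h]) (auto intro!: assms(6))
qed (use assms in auto)

lemma pullback_iso:
  assumes "is_pullback V f g (P, p, q)" "is_pullback V f g (P', p', q')" "f \<in> Arr V" "g \<in> Arr V"
  obtains j where "j \<in> Hom V P P'" "iso V j" "p' \<cdot> j = p" "q' \<cdot> j = q"
proof -
  note D = is_pullbackD[OF assms(1)] is_pullbackD[OF assms(2)]
  let ?j = "lift p' q' p q" and ?k = "lift p q p' q'"
  have j: "?j \<in> Arr V" "Dom V ?j = P" "Cod V ?j = P'" "p' \<cdot> ?j = p" "q' \<cdot> ?j = q"
    using pullback_lift[OF assms(2), of p q] D by auto
  have k: "?k \<in> Arr V" "Dom V ?k = P'" "Cod V ?k = P" "p \<cdot> ?k = p'" "q \<cdot> ?k = q'"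
    using pullback_lift[OF assms(1), of p' q'] D by auto
  have "?k \<cdot> ?j = Ident V P"
    by (rule pullback_ext[OF assms(1)]) (use D j k assms in \<open>auto simp: reassoc[of p ?k p'] reassoc[of q ?k q']\<close>)
  moreover have "?j \<cdot> ?k = Ident V P'"
    by (rule pullback_ext[OF assms(2)]) (use D j k assms in \<open>auto simp: reassoc[of p' ?j p] reassoc[of q' ?j q]\<close>)
  ultimately have "iso V ?j" using isoI[of ?j ?k] j k by auto
  with j show ?thesis by (intro that) auto
qed

lemma pullback_transport:
  assumes "is_pullback V f g (P, p, q)" "f \<in> Arr V" "g \<in> Arr V"
    and "iso V j" "j \<in> Hom V P' P" "p \<cdot> j = p'" "q \<cdot> j = q'"
  shows "is_pullback V f g (P', p', q')"
proof -
  note D = is_pullbackD[OF assms(1)]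
  obtain k where k: "k \<in> Arr V" "Dom V k = P" "Cod V k = P'" "k \<cdot> j = Ident V P'" "j \<cdot> k = Ident V P"
    using assms by (auto elim: isoE)
  show ?thesis
  proof (rule pullbackI)
    show "P' \<in> Obj V" "p' \<in> Hom V P' (Dom V f)" "q' \<in> Hom V P' (Dom V g)"
      using D assms by (auto dest: Dom_Obj)
    show "f \<cdot> p' = g \<cdot> q'" using D assms assoc[of j p f] assoc[of j q g] by auto
  next
    fix a b assume ab: "a \<in> Arr V" "b \<in> Hom V (Dom V a) (Dom V g)" "Cod V a = Dom V f" "f \<cdot> a = g \<cdot> b"
    let ?h = "lift p q a b"
    have h: "?h \<in> Arr V" "Dom V ?h = Dom V a" "Cod V ?h = P" "p \<cdot> ?h = a" "q \<cdot> ?h = b"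
      using pullback_lift[OF assms(1), of a b] ab by auto
    have pq: "p' \<cdot> k = p" "q' \<cdot> k = q" using assms D k by auto
    show "\<exists>h. h \<in> Hom V (Dom V a) P' \<and> p' \<cdot> h = a \<and> q' \<cdot> h = b"
      using h k assms D pq reassoc[of p' k p ?h] reassoc[of q' k q ?h]
      by (intro exI[of _ "k \<cdot> ?h"]) auto
  next
    fix h h' assume h: "h \<in> Arr V" "h' \<in> Arr V" "Dom V h = Dom V h'" "Cod V h = P'" "Cod V h' = P'"
      "p' \<cdot> h = p' \<cdot> h'" "q' \<cdot> h = q' \<cdot> h'"
    have "j \<cdot> h = j \<cdot> h'"
      by (rule pullback_ext[OF assms(1)])
        (use h D assms in \<open>auto simp: reassoc[OF assms(6)] reassoc[OF assms(7)]\<close>)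
    then have "k \<cdot> (j \<cdot> h) = k \<cdot> (j \<cdot> h')" by simp
    then show "h = h'" using h k assms by (auto simp: reassoc[OF k(4)])
  qed
qed

end

locale cartesian = cat +
  assumes ex_terminal: "\<exists>T. is_terminal V T"
    and ex_product: "X \<in> Obj V \<Longrightarrow> Y \<in> Obj V \<Longrightarrow> \<exists>P. is_product V X Y P"
begin

lemma is_terminal: "is_terminal V \<one>"
  unfolding terminal_def by (rule someI_ex[OF ex_terminal])

lemma terminal_Obj [simp]: "\<one> \<in> Obj V"
  using is_terminal by (auto simp: is_terminal_def)

lemma bang_simps [simp]:
  assumes "X \<in> Obj V"
  shows "bang V X \<in> Arr V" "Dom V (bang V X) = X" "Cod V (bang V X) = \<one>"
proof -
  have "\<exists>!f. f \<in> Hom V X \<one>" using is_terminal assms by (auto simp: is_terminal_def)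
  from theI'[OF this] show "bang V X \<in> Arr V" "Dom V (bang V X) = X" "Cod V (bang V X) = \<one>"
    by (auto simp: bang_def)
qed

lemma to_terminal: "\<lbrakk>f \<in> Arr V; g \<in> Arr V; Dom V f = Dom V g; Cod V f = \<one>; Cod V g = \<one>\<rbrakk> \<Longrightarrow> f = g"
  using terminal_unique[OF is_terminal] by blast

lemma eq_bang: "\<lbrakk>f \<in> Arr V; Cod V f = \<one>; Dom V f = X\<rbrakk> \<Longrightarrow> f = bang V X"
  by (rule to_terminal) auto

lemma bang_comp [simp]: "f \<in> Arr V \<Longrightarrow> Cod V f = X \<Longrightarrow> bang V X \<cdot> f = bang V (Dom V f)"
  by (rule eq_bang) auto

lemma bang_terminal [simp]: "bang V \<one> = Ident V \<one>"
  by (rule eq_bang[symmetric]) auto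

lemma product: 
  assumes "X \<in> Obj V" "Y \<in> Obj V"
  shows "is_product V X Y (prd V X Y, pr1 V X Y, pr2 V X Y)"
  using someI_ex[OF ex_product[OF assms]] by (simp add: prd_def pr1_def pr2_def prod_choice_def)

lemma prd_simps [simp]:
  assumes "X \<in> Obj V" "Y \<in> Obj V"
  shows "prd V X Y \<in> Obj V"
    "pr1 V X Y \<in> Arr V" "Dom V (pr1 V X Y) = prd V X Y" "Cod V (pr1 V X Y) = X"
    "pr2 V X Y \<in> Arr V" "Dom V (pr2 V X Y) = prd V X Y" "Cod V (pr2 V X Y) = Y"
  using is_productD[OF product[OF assms]] by auto

lemma pair_simps [simp]:
  assumes "f \<in> Arr V" "g \<in> Arr V" "Dom V f = Dom V g"
  shows "pair V f g \<in> Arr V" "Dom V (pair V f g) = Dom V f"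
    "Cod V (pair V f g) = prd V (Cod V f) (Cod V g)" (is ?ga)
    "Cod V f = X \<Longrightarrow> Cod V g = Y \<Longrightarrow> pr1 V X Y \<cdot> pair V f g = f" (is "PROP ?gb")
    "Cod V f = X \<Longrightarrow> Cod V g = Y \<Longrightarrow> pr2 V X Y \<cdot> pair V f g = g" (is "PROP ?gc")
proof -
  have *: "pair V f g = lift (pr1 V (Cod V f) (Cod V g)) (pr2 V (Cod V f) (Cod V g)) f g"
    using assms by (simp add: pair_def lift_def)
  show "pair V f g \<in> Arr V" "Dom V (pair V f g) = Dom V f"
    ?ga
    "PROP ?gb"
    "PROP ?gc"
    unfolding * using product_lift[OF product, of "Cod V f" "Cod V g" f g] assms by auto
qed

lemma prod_ext:
  assumes "h \<in> Arr V" "k \<in> Arr V" "Dom V h = Dom V k" "Cod V h = prd V X Y" "Cod V k = prd V X Y"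
    and "X \<in> Obj V" "Y \<in> Obj V" "pr1 V X Y \<cdot> h = pr1 V X Y \<cdot> k" "pr2 V X Y \<cdot> h = pr2 V X Y \<cdot> k"
  shows "h = k"
  using product_ext[OF product] assms by blast

lemma pair_comp [simp]:
  assumes "f \<in> Arr V" "g \<in> Arr V" "Dom V f = Dom V g" "u \<in> Arr V" "Cod V u = Dom V g"
  shows "pair V f g \<cdot> u = pair V (f \<cdot> u) (g \<cdot> u)"
  by (rule prod_ext[of _ _ "Cod V f" "Cod V g"]) (use assms in \<open>auto simp: reassoc[OF pair_simps(4)] reassoc[OF pair_simps(5)]\<close>)

lemma pair_eta [simp]:
  assumes "h \<in> Arr V" "Cod V h = prd V X Y" "X \<in> Obj V" "Y \<in> Obj V"
  shows "pair V (pr1 V X Y \<cdot> h) (pr2 V X Y \<cdot> h) = h"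
  by (rule prod_ext[of _ _ X Y]) (use assms in auto)

lemma pair_pr [simp]:
  "X \<in> Obj V \<Longrightarrow> Y \<in> Obj V \<Longrightarrow> pair V (pr1 V X Y) (pr2 V X Y) = Ident V (prd V X Y)"
  by (rule prod_ext[of _ _ X Y]) auto

end

locale ccc = cartesian +
  assumes ex_exponential: "X \<in> Obj V \<Longrightarrow> Y \<in> Obj V \<Longrightarrow> \<exists>E. is_exponential V X Y E"
begin

lemma exponential:
  assumes "X \<in> Obj V" "Y \<in> Obj V"
  shows "is_exponential V X Y (expo V X Y, evl V X Y)"
  using someI_ex[OF ex_exponential[OF assms]] by (simp add: expo_def evl_def exp_choice_def)

lemma expo_simps [simp]:
  assumes "X \<in> Obj V" "Y \<in> Obj V"
  shows "expo V X Y \<in> Obj V" "evl V X Y \<in> Arr V" "Dom V (evl V X Y) = prd V (expo V X Y) X"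
    "Cod V (evl V X Y) = Y"
  using exponential[OF assms] by (auto simp: is_exponential_def)

lemma transp:
  assumes "X \<in> Obj V" "Z \<in> Obj V" "f \<in> Arr V" "Dom V f = prd V Z X" "Cod V f = Y"
  shows "transp V Z X Y f \<in> Arr V \<and> Dom V (transp V Z X Y f) = Z \<and> Cod V (transp V Z X Y f) = expo V X Y \<and>
    evl V X Y \<cdot> prod_map V (transp V Z X Y f) (Ident V X) = f"
proof -
  have "Y \<in> Obj V" using assms by auto
  from exponential[OF assms(1) this]
  have "\<exists>!h. h \<in> Hom V Z (expo V X Y) \<and> evl V X Y \<cdot> prod_map V h (Ident V X) = f"
    unfolding is_exponential_def using assms by auto
  from theI'[OF this] show ?thesis by (auto simp: transp_def)
qed

lemma transp_simps [simp]:
  assumes "X \<in> Obj V" "Z \<in> Obj V" "f \<in> Arr V" "Dom V f = prd V Z X" "Cod V f = Y"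
  shows "transp V Z X Y f \<in> Arr V" "Dom V (transp V Z X Y f) = Z" "Cod V (transp V Z X Y f) = expo V X Y"
  using transp[OF assms] by auto

lemma evl_transp [simp]:
  assumes "X \<in> Obj V" "Z \<in> Obj V" "f \<in> Arr V" "Dom V f = prd V Z X" "Cod V f = Y"
    and "y \<in> Arr V" "Cod V y = X"
  shows "\<lbrakk>x \<in> Arr V; Dom V x = Dom V y; Cod V x = Z\<rbrakk> \<Longrightarrow> evl V X Y \<cdot> pair V (transp V Z X Y f \<cdot> x) y = f \<cdot> pair V x y" (is "PROP ?ga")
    "Dom V y = Z \<Longrightarrow> evl V X Y \<cdot> pair V (transp V Z X Y f) y = f \<cdot> pair V (Ident V Z) y" (is "PROP ?gb")
proof -
  have Y: "Y \<in> Obj V" using assms by auto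
  have main: "evl V X Y \<cdot> pair V (transp V Z X Y f \<cdot> x) y = f \<cdot> pair V x y"
    if "x \<in> Arr V" "Dom V x = Dom V y" "Cod V x = Z" for x
  proof -
    have "f \<cdot> pair V x y = (evl V X Y \<cdot> prod_map V (transp V Z X Y f) (Ident V X)) \<cdot> pair V x y"
      using transp[OF assms(1-5)] by simp
    also have "\<dots> = evl V X Y \<cdot> pair V (transp V Z X Y f \<cdot> x) y"
      using assms that Y by (auto simp: prod_map_def)
    finally show ?thesis by simp
  qed
  show "PROP ?ga"
    by (rule main)
  show "PROP ?gb"
    using main[of "Ident V Z"] assms by auto
qed

lemma expo_ext:
  assumes "h \<in> Arr V" "k \<in> Arr V" "Dom V h = Z" "Dom V k = Z" "Cod V h = expo V X Y" "Cod V k = expo V X Y"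
    and "X \<in> Obj V" "Y \<in> Obj V"
    and "evl V X Y \<cdot> pair V (h \<cdot> pr1 V Z X) (pr2 V Z X) = evl V X Y \<cdot> pair V (k \<cdot> pr1 V Z X) (pr2 V Z X)"
  shows "h = k"
proof -
  have Z: "Z \<in> Obj V" using assms by auto
  let ?f = "evl V X Y \<cdot> pair V (h \<cdot> pr1 V Z X) (pr2 V Z X)"
  have "\<exists>!m. m \<in> Hom V Z (expo V X Y) \<and> evl V X Y \<cdot> prod_map V m (Ident V X) = ?f"
    using exponential[of X Y] assms Z unfolding is_exponential_def by auto
  moreover have "evl V X Y \<cdot> prod_map V h (Ident V X) = ?f" "evl V X Y \<cdot> prod_map V k (Ident V X) = ?f"
    using assms Z by (auto simp: prod_map_def)
  ultimately show ?thesis using assms by auto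
qed

lemma name_of_simps [simp]:
  assumes "f \<in> Arr V"
  shows "name_of V f \<in> Arr V" "Dom V (name_of V f) = \<one>" "Cod V (name_of V f) = expo V (Dom V f) (Cod V f)"
  using assms by (auto simp: name_of_def)

lemma evl_name_of [simp]:
  assumes "f \<in> Arr V" "Dom V f = X" "Cod V f = Y" "y \<in> Arr V" "Cod V y = X" 
    and "x \<in> Arr V" "Dom V x = Dom V y" "Cod V x = \<one>"
  shows "evl V X Y \<cdot> pair V (name_of V f \<cdot> x) y = f \<cdot> y"
  using assms by (auto simp: name_of_def)

end

lemma ccc_if_cartesian_closed: "category V \<Longrightarrow> cartesian_closed V \<Longrightarrow> ccc V"
  by unfold_locales (auto simp: cartesian_closed_def)

locale pullback_cat = cat +
  assumes ex_pullback: "\<lbrakk>f \<in> Arr V; g \<in> Arr V; Cod V f = Cod V g\<rbrakk> \<Longrightarrow> \<exists>P. is_pullback V f g P"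
begin

lemma pullback:
  assumes "f \<in> Arr V" "g \<in> Arr V" "Cod V f = Cod V g"
  shows "is_pullback V f g (pb V f g, pb1 V f g, pb2 V f g)"
  using someI_ex[OF ex_pullback[OF assms]] by (simp add: pb_def pb1_def pb2_def pb_choice_def)

lemma pb_simps [simp]:
  assumes "f \<in> Arr V" "g \<in> Arr V" "Cod V f = Cod V g"
  shows "pb V f g \<in> Obj V" "pb1 V f g \<in> Arr V" "Dom V (pb1 V f g) = pb V f g" "Cod V (pb1 V f g) = Dom V f"
    "pb2 V f g \<in> Arr V" "Dom V (pb2 V f g) = pb V f g" "Cod V (pb2 V f g) = Dom V g" 
  using is_pullbackD[OF pullback[OF assms]] by auto

lemma pb_commutes:
  assumes "f \<in> Arr V" "g \<in> Arr V" "Cod V f = Cod V g"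
  shows "f \<cdot> pb1 V f g = g \<cdot> pb2 V f g"
  using is_pullbackD[OF pullback[OF assms]] by auto

lemma pb_pair_simps [simp]:
  assumes "f \<in> Arr V" "g \<in> Arr V" "Cod V f = Cod V g"
    and "a \<in> Arr V" "b \<in> Arr V" "Cod V a = Dom V f" "Cod V b = Dom V g"
    and "f \<cdot> a = g \<cdot> b"
  shows "pb_pair V f g a b \<in> Arr V" "Dom V (pb_pair V f g a b) = Dom V a" "Cod V (pb_pair V f g a b) = pb V f g"
    "pb1 V f g \<cdot> pb_pair V f g a b = a" "pb2 V f g \<cdot> pb_pair V f g a b = b"
proof -
  have d: "Dom V a = Dom V b" using assms by (intro Dom_eqI[OF assms(8)]) auto
  have *: "pb_pair V f g a b = lift (pb1 V f g) (pb2 V f g) a b"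
    using assms by (simp add: pb_pair_def lift_def)
  show "pb_pair V f g a b \<in> Arr V" "Dom V (pb_pair V f g a b) = Dom V a" "Cod V (pb_pair V f g a b) = pb V f g"
    "pb1 V f g \<cdot> pb_pair V f g a b = a" "pb2 V f g \<cdot> pb_pair V f g a b = b"
    unfolding * using pullback_lift[OF pullback, of f g a b] assms d by auto
qed

lemma pb_ext:
  assumes "h \<in> Arr V" "k \<in> Arr V" "Dom V h = Dom V k" "Cod V h = pb V f g" "Cod V k = pb V f g"
    and "f \<in> Arr V" "g \<in> Arr V" "Cod V f = Cod V g" "pb1 V f g \<cdot> h = pb1 V f g \<cdot> k" "pb2 V f g \<cdot> h = pb2 V f g \<cdot> k"
  shows "h = k"
  using pullback_ext[OF pullback[of f g], of h k] assms by auto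

lemma pb_pair_comp [simp]:
  assumes "f \<in> Arr V" "g \<in> Arr V" "Cod V f = Cod V g"
    and "a \<in> Arr V" "b \<in> Arr V" "Cod V a = Dom V f" "Cod V b = Dom V g"
    and "f \<cdot> a = g \<cdot> b" "u \<in> Arr V" "Cod V u = Dom V a"
  shows "pb_pair V f g a b \<cdot> u = pb_pair V f g (a \<cdot> u) (b \<cdot> u)"
proof -
  have d: "Dom V a = Dom V b" using assms by (intro Dom_eqI[OF assms(8)]) auto
  have e: "f \<cdot> (a \<cdot> u) = g \<cdot> (b \<cdot> u)" using assms d by (simp add: reassoc[OF assms(8)])
  note S = pb_pair_simps[OF assms(1-8)]
  have "pb1 V f g \<cdot> (pb_pair V f g a b \<cdot> u) = a \<cdot> u" "pb2 V f g \<cdot> (pb_pair V f g a b \<cdot> u) = b \<cdot> u"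
    using assms(1-7,9,10) d S by (simp_all add: reassoc[OF S(4)] reassoc[OF S(5)])
  with e assms(1-7,9,10) d S show ?thesis
    by - (rule pb_ext[of _ _ f g], simp_all)
qed

lemma pb_pair_eta [simp]:
  assumes "f \<in> Arr V" "g \<in> Arr V" "Cod V f = Cod V g"
  shows "pb_pair V f g (pb1 V f g) (pb2 V f g) = Ident V (pb V f g)"
  by (rule pb_ext[of _ _ f g]) (use assms in \<open>auto simp: pb_commutes\<close>)

end

lemma pullback_cat_if_has_pullbacks: "category V \<Longrightarrow> has_pullbacks V \<Longrightarrow> pullback_cat V"
  by unfold_locales (auto simp: has_pullbacks_def)

section \<open>Coproducts and extensivity\<close>

lemma Ex1_unique: "\<exists>!x. P x \<Longrightarrow> P a \<Longrightarrow> P b \<Longrightarrow> a = b"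
  by blast

context cat
begin

lemma is_coproductD:
  assumes "is_coproduct V J X (C, \<iota>)"
  shows "C \<in> Obj V" "i \<in> J \<Longrightarrow> \<iota> i \<in> Arr V" "i \<in> J \<Longrightarrow> Dom V (\<iota> i) = X i" "i \<in> J \<Longrightarrow> Cod V (\<iota> i) = C"
  using assms by (auto simp: is_coproduct_def)

lemma coproduct_ex1:
  assumes "is_coproduct V J X (C, \<iota>)" "Y \<in> Obj V" "\<And>i. i \<in> J \<Longrightarrow> f i \<in> Hom V (X i) Y"
  shows "\<exists>!h. h \<in> Hom V C Y \<and> (\<forall>i\<in>J. h \<cdot> \<iota> i = f i)"
proof -
  have "\<forall>Y\<in>Obj V. \<forall>f. (\<forall>i\<in>J. f i \<in> Hom V (X i) Y) \<longrightarrow> (\<exists>!h. h \<in> Hom V C Y \<and> (\<forall>i\<in>J. h \<cdot> \<iota> i = f i))"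
    using assms(1) by (simp add: is_coproduct_def)
  then show ?thesis using assms(2,3) by blast
qed

lemma coproduct_ext:
  assumes "is_coproduct V J X (C, \<iota>)"
    and "h \<in> Arr V" "k \<in> Arr V" "Dom V h = C" "Dom V k = C" "Cod V h = Cod V k"
    and "\<And>i. i \<in> J \<Longrightarrow> h \<cdot> \<iota> i = k \<cdot> \<iota> i"
  shows "h = k"
proof -
  have "\<exists>!m. m \<in> Hom V C (Cod V h) \<and> (\<forall>i\<in>J. m \<cdot> \<iota> i = h \<cdot> \<iota> i)"
    by (rule coproduct_ex1[OF assms(1)]) (use is_coproductD[OF assms(1)] assms(2-6) in simp_all)
  from Ex1_unique[OF this, of h k] show ?thesis using assms(2-6) assms(7)[symmetric] by simp
qed

lemma coproduct_ex:
  assumes "is_coproduct V J X (C, \<iota>)" "Y \<in> Obj V"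
    and "\<And>i. i \<in> J \<Longrightarrow> f i \<in> Hom V (X i) Y"
  obtains h where "h \<in> Arr V" "Dom V h = C" "Cod V h = Y" "\<And>i. i \<in> J \<Longrightarrow> h \<cdot> \<iota> i = f i"
proof -
  from coproduct_ex1[OF assms] obtain h where "h \<in> Hom V C Y \<and> (\<forall>i\<in>J. h \<cdot> \<iota> i = f i)" by blast
  then show ?thesis by (intro that[of h]) simp_all
qed

lemma coproductI:
  assumes "C \<in> Obj V" "\<And>i. i \<in> J \<Longrightarrow> \<iota> i \<in> Hom V (X i) C"
    and "\<And>Y f. Y \<in> Obj V \<Longrightarrow> (\<And>i. i \<in> J \<Longrightarrow> f i \<in> Hom V (X i) Y) \<Longrightarrow>
      \<exists>h. h \<in> Hom V C Y \<and> (\<forall>i\<in>J. h \<cdot> \<iota> i = f i)"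
    and "\<And>h k. h \<in> Arr V \<Longrightarrow> k \<in> Arr V \<Longrightarrow> Dom V h = C \<Longrightarrow> Dom V k = C \<Longrightarrow> Cod V h = Cod V k \<Longrightarrow>
      (\<And>i. i \<in> J \<Longrightarrow> h \<cdot> \<iota> i = k \<cdot> \<iota> i) \<Longrightarrow> h = k"
  shows "is_coproduct V J X (C, \<iota>)"
  unfolding is_coproduct_def prod.case
proof (intro conjI ballI allI impI)
  fix Y f assume "Y \<in> Obj V" "\<forall>i\<in>J. f i \<in> Hom V (X i) Y"
  with assms(3)[of Y f] obtain h where h: "h \<in> Hom V C Y" "\<forall>i\<in>J. h \<cdot> \<iota> i = f i" by blast
  then show "\<exists>!h. h \<in> Hom V C Y \<and> (\<forall>i\<in>J. h \<cdot> \<iota> i = f i)"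
  proof (intro ex1I[of _ h])
    fix k assume "k \<in> Hom V C Y \<and> (\<forall>i\<in>J. k \<cdot> \<iota> i = f i)"
    with h show "k = h" by - (rule assms(4), simp_all)
  qed simp
qed (use assms(1,2) in auto)

lemma coproduct_transport:
  assumes "is_coproduct V J X (C, \<iota>)" "iso V j" "Dom V j = C" "Cod V j = C'"
    and "\<And>i. i \<in> J \<Longrightarrow> \<iota>' i = j \<cdot> \<iota> i"
  shows "is_coproduct V J X (C', \<iota>')"
proof -
  note D = is_coproductD[OF assms(1)]
  obtain k where k: "j \<in> Arr V" "k \<in> Arr V" "Dom V k = C'" "Cod V k = C" "k \<cdot> j = Ident V C" "j \<cdot> k = Ident V C'"
    using assms by (auto elim: isoE)
  show ?thesis
  proof (rule coproductI)
    show "C' \<in> Obj V" using k assms by (auto dest: Cod_Obj)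
    show "\<iota>' i \<in> Hom V (X i) C'" if "i \<in> J" for i using D that assms k by auto
  next
    fix Y f assume Y: "Y \<in> Obj V" "\<And>i. i \<in> J \<Longrightarrow> f i \<in> Hom V (X i) Y"
    from coproduct_ex[OF assms(1) Y] obtain h where h: "h \<in> Arr V" "Dom V h = C" "Cod V h = Y" "\<And>i. i \<in> J \<Longrightarrow> h \<cdot> \<iota> i = f i"
      by blast
    show "\<exists>h. h \<in> Hom V C' Y \<and> (\<forall>i\<in>J. h \<cdot> \<iota>' i = f i)"
      using h k D assms(3-5) by (intro exI[of _ "h \<cdot> k"]) (auto simp: reassoc[OF k(5)])
  next
    fix h h' assume h: "h \<in> Arr V" "h' \<in> Arr V" "Dom V h = C'" "Dom V h' = C'" "Cod V h = Cod V h'"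
      "\<And>i. i \<in> J \<Longrightarrow> h \<cdot> \<iota>' i = h' \<cdot> \<iota>' i"
    have "h \<cdot> j = h' \<cdot> j"
    proof (rule coproduct_ext[OF assms(1)])
      fix i assume "i \<in> J"
      then show "(h \<cdot> j) \<cdot> \<iota> i = (h' \<cdot> j) \<cdot> \<iota> i" using h(1-5) h(6)[of i] D k assms(3-5) by simp
    qed (use h k assms in auto)
    then have "(h \<cdot> j) \<cdot> k = (h' \<cdot> j) \<cdot> k" by simp
    then show "h = h'" using h k assms(3,4) by simp
  qed
qed

lemma coproduct_iso:
  assumes "is_coproduct V J X (C, \<iota>)" "is_coproduct V J X (C', \<iota>')"
  obtains j where "iso V j" "j \<in> Hom V C C'" "\<And>i. i \<in> J \<Longrightarrow> j \<cdot> \<iota> i = \<iota>' i"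
proof -
  note D = is_coproductD[OF assms(1)] is_coproductD[OF assms(2)]
  obtain j where j: "j \<in> Arr V" "Dom V j = C" "Cod V j = C'" "\<And>i. i \<in> J \<Longrightarrow> j \<cdot> \<iota> i = \<iota>' i"
    by (rule coproduct_ex[OF assms(1), of C' \<iota>']) (use D in auto)
  obtain k where k: "k \<in> Arr V" "Dom V k = C'" "Cod V k = C" "\<And>i. i \<in> J \<Longrightarrow> k \<cdot> \<iota>' i = \<iota> i"
    by (rule coproduct_ex[OF assms(2), of C \<iota>]) (use D in auto)
  have "k \<cdot> j = Ident V C"
    by (rule coproduct_ext[OF assms(1)]) (use j k D in auto)
  moreover have "j \<cdot> k = Ident V C'"
    by (rule coproduct_ext[OF assms(2)]) (use j k D in auto)
  ultimately have "iso V j" using j k by (intro isoI[of j k]) auto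
  with j show ?thesis using that by auto
qed

lemma coproduct_reindex:
  assumes "is_coproduct V I X (C, \<iota>)" "bij_betw \<phi> J I"
  shows "is_coproduct V J (\<lambda>j. X (\<phi> j)) (C, \<lambda>j. \<iota> (\<phi> j))"
proof -
  note D = is_coproductD[OF assms(1)]
  have \<phi>: "\<phi> j \<in> I" if "j \<in> J" for j using assms(2) that by (auto simp: bij_betw_def)
  have \<psi>: "\<exists>j\<in>J. i = \<phi> j" if "i \<in> I" for i using assms(2) that by (auto simp: bij_betw_def)
  define \<psi> where "\<psi> = inv_into J \<phi>"
  have \<psi>\<phi>: "\<psi> (\<phi> j) = j" if "j \<in> J" for j
    using assms(2) that by (auto simp: \<psi>_def bij_betw_def)
  have \<phi>\<psi>: "\<phi> (\<psi> i) = i \<and> \<psi> i \<in> J" if "i \<in> I" for i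
    using \<psi>[OF that] \<psi>\<phi> by auto
  show ?thesis
  proof (rule coproductI)
    fix Y f assume Y: "Y \<in> Obj V" "\<And>j. j \<in> J \<Longrightarrow> f j \<in> Hom V (X (\<phi> j)) Y"
    have "\<And>i. i \<in> I \<Longrightarrow> f (\<psi> i) \<in> Hom V (X i) Y" using Y(2) \<phi>\<psi> by metis
    from coproduct_ex[OF assms(1) Y(1) this] obtain h where
      h: "h \<in> Arr V" "Dom V h = C" "Cod V h = Y" "\<And>i. i \<in> I \<Longrightarrow> h \<cdot> \<iota> i = f (\<psi> i)" by blast
    show "\<exists>h. h \<in> Hom V C Y \<and> (\<forall>j\<in>J. h \<cdot> \<iota> (\<phi> j) = f j)"
      using h(1-3) h(4)[OF \<phi>] \<psi>\<phi> by (intro exI[of _ h]) auto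
  next
    fix h k assume h: "h \<in> Arr V" "k \<in> Arr V" "Dom V h = C" "Dom V k = C" "Cod V h = Cod V k"
      "\<And>j. j \<in> J \<Longrightarrow> h \<cdot> \<iota> (\<phi> j) = k \<cdot> \<iota> (\<phi> j)"
    show "h = k" by (rule coproduct_ext[OF assms(1) h(1-5)]) (use h(6) \<psi> in blast)
  qed (use D \<phi> in auto)
qed

lemma coproduct_nested:
  assumes "is_coproduct V J X (C, \<iota>)" "\<And>j. j \<in> J \<Longrightarrow> is_coproduct V K (Y j) (X j, \<kappa> j)"
  shows "is_coproduct V (J \<times> K) (\<lambda>(j, k). Y j k) (C, \<lambda>(j, k). \<iota> j \<cdot> \<kappa> j k)"
proof -
  note D = is_coproductD[OF assms(1)] is_coproductD[OF assms(2)]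
  show ?thesis
  proof (rule coproductI)
    fix Z f assume Z: "Z \<in> Obj V" "\<And>i. i \<in> J \<times> K \<Longrightarrow> f i \<in> Hom V (case i of (j, k) \<Rightarrow> Y j k) Z"
    have "\<exists>g. g \<in> Hom V (X j) Z \<and> (\<forall>k\<in>K. g \<cdot> \<kappa> j k = f (j, k))" if j: "j \<in> J" for j
      by (rule coproduct_ex[OF assms(2)[OF j] Z(1), of "\<lambda>k. f (j, k)"])
        (use Z(2) j in \<open>auto simp: all_conj_distrib\<close>)
    then obtain g where g: "\<And>j. j \<in> J \<Longrightarrow> g j \<in> Hom V (X j) Z \<and> (\<forall>k\<in>K. g j \<cdot> \<kappa> j k = f (j, k))"
      by metis
    obtain h where h: "h \<in> Arr V" "Dom V h = C" "Cod V h = Z" "\<And>i. i \<in> J \<Longrightarrow> h \<cdot> \<iota> i = g i"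
      by (rule coproduct_ex[OF assms(1) Z(1), of g]) (use g in auto)
    show "\<exists>h. h \<in> Hom V C Z \<and> (\<forall>i\<in>J \<times> K. h \<cdot> (case i of (j, k) \<Rightarrow> \<iota> j \<cdot> \<kappa> j k) = f i)"
      using h g D by (intro exI[of _ h]) (auto simp: reassoc[OF h(4)])
  next
    fix h k assume h: "h \<in> Arr V" "k \<in> Arr V" "Dom V h = C" "Dom V k = C" "Cod V h = Cod V k"
      "\<And>i. i \<in> J \<times> K \<Longrightarrow> h \<cdot> (case i of (j, k) \<Rightarrow> \<iota> j \<cdot> \<kappa> j k) = k \<cdot> (case i of (j, k) \<Rightarrow> \<iota> j \<cdot> \<kappa> j k)"
    show "h = k"
    proof (rule coproduct_ext[OF assms(1) h(1-5)])
      fix j assume j: "j \<in> J"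
      show "h \<cdot> \<iota> j = k \<cdot> \<iota> j"
      proof (rule coproduct_ext[OF assms(2)[OF j]])
        fix l assume "l \<in> K"
        then show "(h \<cdot> \<iota> j) \<cdot> \<kappa> j l = (k \<cdot> \<iota> j) \<cdot> \<kappa> j l"
          using h(1-5) h(6)[of "(j, l)"] j D by simp
      qed (use h(1-5) j D in auto)
    qed
  qed (use D in auto)
qed

lemma coproduct_choice:
  assumes "\<exists>C. is_coproduct V J X C"
  shows "is_coproduct V J X (coprod V J X, incl V J X)"
  using someI_ex[OF assms] by (simp add: coprod_def incl_def coprod_choice_def)

lemma cotuple:
  assumes "is_coproduct V J X (coprod V J X, incl V J X)" "Y \<in> Obj V" "\<And>i. i \<in> J \<Longrightarrow> f i \<in> Hom V (X i) Y"
  shows "cotuple V J X Y f \<in> Arr V" "Dom V (cotuple V J X Y f) = coprod V J X" "Cod V (cotuple V J X Y f) = Y"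
    "i \<in> J \<Longrightarrow> cotuple V J X Y f \<cdot> incl V J X i = f i" (is "PROP ?ga")
proof -
  have "\<exists>!h. h \<in> Hom V (coprod V J X) Y \<and> (\<forall>i\<in>J. h \<cdot> incl V J X i = f i)"
    by (rule coproduct_ex1[OF assms])
  from theI'[OF this] show "cotuple V J X Y f \<in> Arr V" "Dom V (cotuple V J X Y f) = coprod V J X" "Cod V (cotuple V J X Y f) = Y"
    "PROP ?ga"
    by (auto simp: cotuple_def)
qed

lemma functor_Obj: "is_functor C D F \<Longrightarrow> X \<in> Obj C \<Longrightarrow> FOb F X \<in> Obj D"
  by (simp add: is_functor_def)

lemma functor_Hom:
  "\<lbrakk>is_functor C D F; f \<in> Hom C X Y; X \<in> Obj C; Y \<in> Obj C\<rbrakk> \<Longrightarrow> FAr F f \<in> Hom D (FOb F X) (FOb F Y)"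
  unfolding is_functor_def by blast

text \<open>The preimage is \<open>FAr G u\<close> conjugated by the unit \<open>\<sigma>\<close>; it is mapped to \<open>u\<close> because \<open>G\<close> is faithful.\<close>

lemma equivalence_full:
  fixes D :: "('p, 'n) cat" and F :: "('o, 'm, 'p, 'n) func"
  assumes "category D" "is_equivalence V D F" "X \<in> Obj V" "Y \<in> Obj V" "u \<in> Hom D (FOb F X) (FOb F Y)"
  obtains t where "t \<in> Hom V X Y" "FAr F t = u"
proof -
  interpret D: cat D using assms(1) by unfold_locales
  obtain G \<sigma> \<tau> where G: "is_functor D V G" and F: "is_functor V D F"
    and \<sigma>: "is_nat_iso V V id_func (comp_func G F) \<sigma>" and \<tau>: "is_nat_iso D D (comp_func F G) id_func \<tau>"
    using assms(2) by (auto simp: is_equivalence_def)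
  note FO = functor_Obj[OF F assms(3)] functor_Obj[OF F assms(4)]
  note GO = functor_Obj[OF G FO(1)] functor_Obj[OF G FO(2)]
  note FA = functor_Hom[OF F _ assms(3,4)] and GA = functor_Hom[OF G _ FO]
  note FGA = functor_Hom[OF F GA GO]
  \<comment> \<open>\<open>G\<close> is faithful because \<open>\<tau>\<close> is invertible.\<close>
  have faithful: "v = v'" if "v \<in> Hom D (FOb F X) (FOb F Y)" "v' \<in> Hom D (FOb F X) (FOb F Y)" "FAr G v = FAr G v'" for v v'
  proof -
    let ?A = "FOb F X"
    have t: "\<tau> ?A \<in> Hom D (FOb F (FOb G ?A)) ?A" "iso D (\<tau> ?A)"
      using \<tau> FO by (auto simp: is_nat_iso_def comp_func_def id_func_def)
    have nat: "\<tau> (FOb F Y) \<cdot>\<^bsub>D\<^esub> FAr F (FAr G w) = w \<cdot>\<^bsub>D\<^esub> \<tau> ?A" if "w \<in> Hom D ?A (FOb F Y)" for w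
      using \<tau> that unfolding is_nat_iso_def comp_func_def id_func_def by auto
    have "v \<cdot>\<^bsub>D\<^esub> \<tau> ?A = v' \<cdot>\<^bsub>D\<^esub> \<tau> ?A" using nat[OF that(1)] nat[OF that(2)] that(3) by simp
    moreover obtain k where k: "k \<in> Arr D" "Dom D k = ?A" "Cod D k = Dom D (\<tau> ?A)" "\<tau> ?A \<cdot>\<^bsub>D\<^esub> k = Ident D ?A"
      using t by (auto elim: D.isoE)
    ultimately have "(v \<cdot>\<^bsub>D\<^esub> \<tau> ?A) \<cdot>\<^bsub>D\<^esub> k = (v' \<cdot>\<^bsub>D\<^esub> \<tau> ?A) \<cdot>\<^bsub>D\<^esub> k" by simp
    then show ?thesis using k t that(1,2) by simp
  qed
  have sX: "\<sigma> X \<in> Hom V X (FOb G (FOb F X))" "iso V (\<sigma> X)" and sY: "\<sigma> Y \<in> Hom V Y (FOb G (FOb F Y))" "iso V (\<sigma> Y)"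
    using \<sigma> assms by (auto simp: is_nat_iso_def comp_func_def id_func_def)
  obtain k where k: "k \<in> Arr V" "Dom V k = Cod V (\<sigma> X)" "Cod V k = X" "\<sigma> X \<cdot> k = Ident V (Cod V (\<sigma> X))"
    using sX by (auto elim: isoE)
  obtain l where l: "l \<in> Arr V" "Dom V l = Cod V (\<sigma> Y)" "Cod V l = Y" "\<sigma> Y \<cdot> l = Ident V (Cod V (\<sigma> Y))"
    using sY by (auto elim: isoE)
  define t where "t = l \<cdot> (FAr G u \<cdot> \<sigma> X)"
  have t: "t \<in> Hom V X Y" using l sX sY GA[OF assms(5)] by (auto simp: t_def)
  have "\<sigma> Y \<cdot> t = FAr G (FAr F t) \<cdot> \<sigma> X"
    using \<sigma> t unfolding is_nat_iso_def comp_func_def id_func_def by auto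
  moreover have "\<sigma> Y \<cdot> t = FAr G u \<cdot> \<sigma> X"
    using l sX sY GA[OF assms(5)] by (auto simp: t_def reassoc[OF l(4)])
  ultimately have "(FAr G (FAr F t) \<cdot> \<sigma> X) \<cdot> k = (FAr G u \<cdot> \<sigma> X) \<cdot> k" by simp
  then have "FAr G (FAr F t) = FAr G u"
    using k sX GA[OF assms(5)] GA[OF FA[OF t]] by simp
  from faithful[OF FA[OF t] assms(5) this] t show ?thesis by (intro that)
qed

lemma slice_Hom:
  "t \<in> Hom (slice V X) f g \<longleftrightarrow>
     (\<exists>h. t = (f, h, g) \<and> f \<in> Arr V \<and> g \<in> Arr V \<and> Cod V f = X \<and> Cod V g = X \<and> h \<in> Arr V \<and>
       Dom V h = Dom V f \<and> Cod V h = Dom V g \<and> g \<cdot> h = f)"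
  by (cases t) (auto simp: slice_def)

lemma slice_Comp [simp]: "(g', k, l) \<cdot>\<^bsub>slice V X\<^esub> (f, h, g) = (f, k \<cdot> h, l)"
  by (simp add: slice_def)

lemma slice_category: "category (slice V X)"
  unfolding category_def
proof (intro conjI allI ballI)
  show "Dom (slice V X) t \<in> Obj (slice V X)" "Cod (slice V X) t \<in> Obj (slice V X)" if "t \<in> Arr (slice V X)" for t
    using that by (auto simp: slice_def)
  show "Ident (slice V X) f \<in> Hom (slice V X) f f" if "f \<in> Obj (slice V X)" for f
    using that by (auto simp: slice_def)
  show "u \<cdot>\<^bsub>slice V X\<^esub> t \<in> Hom (slice V X) f h" if tu: "t \<in> Hom (slice V X) f g" "u \<in> Hom (slice V X) g h" for t u f g h
  proof -
    obtain m where m: "t = (f, m, g) \<and> f \<in> Arr V \<and> g \<in> Arr V \<and> Cod V f = X \<and> Cod V g = X \<and> m \<in> Arr V \<and>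
       Dom V m = Dom V f \<and> Cod V m = Dom V g \<and> g \<cdot> m = f"
      using tu(1) unfolding slice_Hom ..
    obtain k where k: "u = (g, k, h) \<and> g \<in> Arr V \<and> h \<in> Arr V \<and> Cod V g = X \<and> Cod V h = X \<and> k \<in> Arr V \<and>
       Dom V k = Dom V g \<and> Cod V k = Dom V h \<and> h \<cdot> k = g"
      using tu(2) unfolding slice_Hom ..
    have "h \<cdot> (k \<cdot> m) = f" using m k by (simp add: reassoc[of h k g m])
    then show ?thesis using m k by (simp add: slice_Hom del: in_Hom)
  qed
  show "Ident (slice V X) g \<cdot>\<^bsub>slice V X\<^esub> t = t" "t \<cdot>\<^bsub>slice V X\<^esub> Ident (slice V X) f = t" if "t \<in> Hom (slice V X) f g" for t f g
    using that unfolding slice_Hom by (elim exE conjE; simp add: slice_def)+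
  show "(v \<cdot>\<^bsub>slice V X\<^esub> u) \<cdot>\<^bsub>slice V X\<^esub> t = v \<cdot>\<^bsub>slice V X\<^esub> (u \<cdot>\<^bsub>slice V X\<^esub> t)"
    if "t \<in> Hom (slice V X) e f" "u \<in> Hom (slice V X) f g" "v \<in> Hom (slice V X) g h" for t u v e f g h
    using that unfolding slice_Hom by (elim exE conjE) simp
qed

lemma prod_cat_Hom:
  "t \<in> Hom (prod_cat I S) F G \<longleftrightarrow> t \<in> extensional I \<and> F \<in> extensional I \<and> G \<in> extensional I \<and>
     (\<forall>i\<in>I. t i \<in> Arr (S i) \<and> Dom (S i) (t i) = F i \<and> Cod (S i) (t i) = G i)"
proof -
  have r: "restrict f I = F \<longleftrightarrow> F \<in> extensional I \<and> (\<forall>i\<in>I. f i = F i)" for f F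
    by (auto simp: extensional_def fun_eq_iff)
  show ?thesis by (auto simp: prod_cat_def PiE_iff r)
qed

lemma prod_cat_category:
  assumes "\<And>i. i \<in> I \<Longrightarrow> category (S i)"
  shows "category (prod_cat I S)"
proof -
  have c: "cat (S i)" if "i \<in> I" for i using assms that by unfold_locales
  note S = c[THEN cat.Dom_Obj] c[THEN cat.Cod_Obj] c[THEN cat.Ident_simps(1)] c[THEN cat.Ident_simps(2)]
    c[THEN cat.Ident_simps(3)] c[THEN cat.comp_simps(1)] c[THEN cat.comp_simps(2)] c[THEN cat.comp_simps(3)]
    c[THEN cat.Ident_left] c[THEN cat.Ident_right] c[THEN cat.assoc]
  have Comp: "u \<cdot>\<^bsub>prod_cat I S\<^esub> t = (\<lambda>i\<in>I. u i \<cdot>\<^bsub>S i\<^esub> t i)" for t u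
    by (simp add: prod_cat_def)
  have Ident: "Ident (prod_cat I S) F = (\<lambda>i\<in>I. Ident (S i) (F i))" for F
    by (simp add: prod_cat_def)
  show ?thesis
    unfolding category_def
  proof (intro conjI allI ballI)
    show "Dom (prod_cat I S) t \<in> Obj (prod_cat I S)" "Cod (prod_cat I S) t \<in> Obj (prod_cat I S)"
      if "t \<in> Arr (prod_cat I S)" for t
      using that S by (auto simp: prod_cat_def PiE_iff)
    show "Ident (prod_cat I S) F \<in> Hom (prod_cat I S) F F" if "F \<in> Obj (prod_cat I S)" for F
    proof -
      have "F \<in> extensional I" "\<forall>i\<in>I. F i \<in> Obj (S i)" using that by (auto simp: prod_cat_def PiE_iff)
      then show ?thesis unfolding prod_cat_Hom Ident using S by simp
    qed
    show "u \<cdot>\<^bsub>prod_cat I S\<^esub> t \<in> Hom (prod_cat I S) F H"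
      if "t \<in> Hom (prod_cat I S) F G" "u \<in> Hom (prod_cat I S) G H" for t u F G H
      using that S unfolding prod_cat_Hom Comp by simp
    show "Ident (prod_cat I S) G \<cdot>\<^bsub>prod_cat I S\<^esub> t = t" "t \<cdot>\<^bsub>prod_cat I S\<^esub> Ident (prod_cat I S) F = t"
      if "t \<in> Hom (prod_cat I S) F G" for t F G
      using that S unfolding prod_cat_Hom Comp Ident by (auto intro!: extensionalityI[of _ I])
    show "(v \<cdot>\<^bsub>prod_cat I S\<^esub> u) \<cdot>\<^bsub>prod_cat I S\<^esub> t = v \<cdot>\<^bsub>prod_cat I S\<^esub> (u \<cdot>\<^bsub>prod_cat I S\<^esub> t)"
      if "t \<in> Hom (prod_cat I S) E F" "u \<in> Hom (prod_cat I S) F G" "v \<in> Hom (prod_cat I S) G H" for t u v E F G H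
      using that S unfolding prod_cat_Hom Comp by (auto intro!: extensionalityI[of _ I])
  qed
qed

end

context ccc
begin

text \<open>Morphisms out of \<open>X \<times> C\<close> are transposed to morphisms from \<open>C\<close> into an exponential.\<close>

lemma coproduct_prd:
  assumes "is_coproduct V J Y (C, \<iota>)" "X \<in> Obj V" "\<And>j. j \<in> J \<Longrightarrow> Y j \<in> Obj V"
  shows "is_coproduct V J (\<lambda>j. prd V X (Y j)) (prd V X C, \<lambda>j. pair V (pr1 V X (Y j)) (\<iota> j \<cdot> pr2 V X (Y j)))"
proof -
  note D = is_coproductD[OF assms(1)]
  show ?thesis
  proof (rule coproductI)
    fix Z f assume Z: "Z \<in> Obj V" "\<And>j. j \<in> J \<Longrightarrow> f j \<in> Hom V (prd V X (Y j)) Z"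
    define g where "g j = transp V (Y j) X Z (f j \<cdot> pair V (pr2 V (Y j) X) (pr1 V (Y j) X))" for j
    obtain h where h: "h \<in> Arr V" "Dom V h = C" "Cod V h = expo V X Z" "\<And>i. i \<in> J \<Longrightarrow> h \<cdot> \<iota> i = g i"
      by (rule coproduct_ex[OF assms(1), of "expo V X Z" g]) (use Z assms in \<open>auto simp: g_def\<close>)
    have "(evl V X Z \<cdot> pair V (h \<cdot> pr2 V X C) (pr1 V X C)) \<cdot> pair V (pr1 V X (Y j)) (\<iota> j \<cdot> pr2 V X (Y j)) = f j"
      if "j \<in> J" for j
    proof -
      have "(evl V X Z \<cdot> pair V (h \<cdot> pr2 V X C) (pr1 V X C)) \<cdot> pair V (pr1 V X (Y j)) (\<iota> j \<cdot> pr2 V X (Y j)) =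
          evl V X Z \<cdot> pair V (g j \<cdot> pr2 V X (Y j)) (pr1 V X (Y j))"
        using that h Z D assms by (simp add: reassoc[OF h(4)])
      then show ?thesis using that Z assms by (simp add: g_def)
    qed
    then show "\<exists>h. h \<in> Hom V (prd V X C) Z \<and> (\<forall>i\<in>J. h \<cdot> pair V (pr1 V X (Y i)) (\<iota> i \<cdot> pr2 V X (Y i)) = f i)"
      using h Z D assms(2) by (intro exI[of _ "evl V X Z \<cdot> pair V (h \<cdot> pr2 V X C) (pr1 V X C)"]) auto
  next
    fix h k assume h: "h \<in> Arr V" "k \<in> Arr V" "Dom V h = prd V X C" "Dom V k = prd V X C" "Cod V h = Cod V k"
      "\<And>j. j \<in> J \<Longrightarrow> h \<cdot> pair V (pr1 V X (Y j)) (\<iota> j \<cdot> pr2 V X (Y j)) = k \<cdot> pair V (pr1 V X (Y j)) (\<iota> j \<cdot> pr2 V X (Y j))"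
    define tr where "tr m = transp V C X (Cod V k) (m \<cdot> pair V (pr2 V C X) (pr1 V C X))" for m
    have tr: "tr m \<in> Arr V" "Dom V (tr m) = C" "Cod V (tr m) = expo V X (Cod V k)"
      "evl V X (Cod V k) \<cdot> pair V (tr m \<cdot> pr2 V X C) (pr1 V X C) = m"
      "j \<in> J \<Longrightarrow> evl V X (Cod V k) \<cdot> pair V (tr m \<cdot> (\<iota> j \<cdot> pr1 V (Y j) X)) (pr2 V (Y j) X) =
         (m \<cdot> pair V (pr1 V X (Y j)) (\<iota> j \<cdot> pr2 V X (Y j))) \<cdot> pair V (pr2 V (Y j) X) (pr1 V (Y j) X)"
      if "m \<in> Arr V" "Dom V m = prd V X C" "Cod V m = Cod V k" for m j
      using that assms D h(1-5) by (auto simp: tr_def)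
    have "tr h = tr k"
    proof (rule coproduct_ext[OF assms(1)])
      fix j assume j: "j \<in> J"
      have "h \<cdot> pair V (pr2 V (Y j) X) (\<iota> j \<cdot> pr1 V (Y j) X) = k \<cdot> pair V (pr2 V (Y j) X) (\<iota> j \<cdot> pr1 V (Y j) X)"
        using arg_cong[OF h(6)[OF j], of "\<lambda>x. x \<cdot> pair V (pr2 V (Y j) X) (pr1 V (Y j) X)"] h(1-5) D assms j by simp
      then show "tr h \<cdot> \<iota> j = tr k \<cdot> \<iota> j"
        by - (rule expo_ext[of _ _ "Y j" X "Cod V k"], use j tr D assms h(1-5) in auto)
    qed (use tr h in auto)
    then show "h = k" using tr(4)[of h] tr(4)[of k] h(1-5) by metis
  qed (use D assms in auto)
qed

lemma initial_prd:
  assumes "is_initial V Z" "X \<in> Obj V"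
  shows "is_initial V (prd V Z X)"
proof -
  have Z: "Z \<in> Obj V" using assms by (auto simp: is_initial_def)
  have "\<exists>!h. h \<in> Hom V (prd V Z X) Y" if Y: "Y \<in> Obj V" for Y
  proof -
    have "\<exists>k. k \<in> Hom V Z (expo V X Y)" using assms Y unfolding is_initial_def by (meson expo_simps(1))
    then obtain k where k: "k \<in> Hom V Z (expo V X Y)" ..
    show ?thesis
    proof (rule ex1I)
      show "evl V X Y \<cdot> pair V (k \<cdot> pr1 V Z X) (pr2 V Z X) \<in> Hom V (prd V Z X) Y" using k assms Y Z by auto
    next
      fix h assume h: "h \<in> Hom V (prd V Z X) Y"
      have "transp V Z X Y h = k"
        by (rule initial_unique[OF assms(1)]) (use h k assms Z in auto)
      moreover have "evl V X Y \<cdot> pair V (transp V Z X Y h \<cdot> pr1 V Z X) (pr2 V Z X) = h"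
        using h assms Z by simp
      ultimately show "h = evl V X Y \<cdot> pair V (k \<cdot> pr1 V Z X) (pr2 V Z X)" by simp
    qed
  qed
  then show ?thesis using Z assms by (auto simp: is_initial_def)
qed

text \<open>Given \<open>f : X \<rightarrow> Z\<close>, the object \<open>X\<close> is a retract of \<open>Z \<times> X\<close>, which is initial by transposition.\<close>

lemma strict_initial:
  assumes "is_initial V Z" "f \<in> Arr V" "Cod V f = Z"
  shows "is_initial V (Dom V f)"
proof -
  let ?X = "Dom V f"
  have [simp]: "Z \<in> Obj V" using assms by (auto simp: is_initial_def)
  show ?thesis
    by (rule iso_initial[OF initial_prd[OF assms(1), of ?X], of "pr2 V Z ?X" ?X "pair V f (Ident V ?X)"])
      (use assms in auto)
qed

end

locale ccc_pb = ccc V + pullback_cat V for V :: "('o, 'm) cat" (structure)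

text \<open>
  The universe \<open>U\<close> has an infinite underlying type, so that \<open>J \<times> J\<close> is small if \<open>J\<close> is.
\<close>

locale extensive_ccc = ccc_pb V for V :: "('o, 'm) cat" (structure) +
  fixes U :: "'u itself"
  assumes infinite_universe: "infinite (UNIV :: 'u set)"
    and extensive: "extensive V U"
begin

lemma small_times:
  assumes "small U J" "small U K"
  shows "small U (J \<times> K)"
proof -
  obtain f :: "_ \<Rightarrow> 'u" and g :: "_ \<Rightarrow> 'u" where fg: "inj_on f J" "inj_on g K" using assms by (auto simp: small_def)
  have "\<exists>h. bij_betw h ((UNIV :: 'u set) \<times> (UNIV :: 'u set)) (UNIV :: 'u set)"
    unfolding card_of_ordIso by (rule card_of_Times_same_infinite[OF infinite_universe])
  then obtain h where h: "bij_betw h ((UNIV :: 'u set) \<times> (UNIV :: 'u set)) (UNIV :: 'u set)" ..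
  have "inj_on (\<lambda>(x, y). h (f x, g y)) (J \<times> K)"
  proof (rule inj_onI, clarify)
    fix a b c d assume *: "a \<in> J" "c \<in> J" "b \<in> K" "d \<in> K" "h (f a, g b) = h (f c, g d)"
    then have "(f a, g b) = (f c, g d)" using inj_onD[OF bij_betw_imp_inj_on[OF h]] by blast
    then show "a = c \<and> b = d" using fg * by (auto dest: inj_onD)
  qed
  then show ?thesis by (auto simp: small_def)
qed

lemma small_bool: "small U (UNIV :: bool set)"
proof -
  obtain a b :: 'u where "a \<noteq> b"
    using infinite_universe by (metis (full_types) UNIV_eq_I finite.emptyI finite.insertI insertI1)
  then have "inj_on (\<lambda>x. if x then a else b) UNIV" by (auto simp: inj_on_def)
  then show ?thesis by (auto simp: small_def)
qed

lemma ex_coproduct_universe: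
  fixes I :: "'u set"
  shows "(\<And>i. i \<in> I \<Longrightarrow> X i \<in> Obj V) \<Longrightarrow> is_coproduct V I X (coprod V I X, incl V I X)"
  using extensive by (intro coproduct_choice) (auto simp: extensive_def has_small_coproducts_def)

lemma small_bij:
  assumes "small U J"
  obtains I :: "'u set" and \<phi> \<psi> where "bij_betw \<phi> J I" "bij_betw \<psi> I J" "\<And>i. i \<in> I \<Longrightarrow> \<phi> (\<psi> i) = i" "\<And>j. j \<in> J \<Longrightarrow> \<psi> (\<phi> j) = j"
proof -
  obtain f :: "_ \<Rightarrow> 'u" where "inj_on f J" using assms by (auto simp: small_def)
  then show ?thesis
    by (intro that[of f "f ` J" "inv_into J f"])
      (auto simp: inj_on_imp_bij_betw f_inv_into_f intro!: bij_betw_inv_into)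
qed

lemma small_coproduct:
  assumes "small U J" "\<And>j. j \<in> J \<Longrightarrow> X j \<in> Obj V"
  shows "is_coproduct V J X (coprod V J X, incl V J X)"
proof (rule coproduct_choice)
  obtain I :: "'u set" and \<phi> \<psi> where b: "bij_betw \<phi> J I" "bij_betw \<psi> I J" "\<And>i. i \<in> I \<Longrightarrow> \<phi> (\<psi> i) = i" "\<And>j. j \<in> J \<Longrightarrow> \<psi> (\<phi> j) = j"
    by (rule small_bij[OF assms(1)]) blast
  have "is_coproduct V I (\<lambda>i. X (\<psi> i)) (coprod V I (\<lambda>i. X (\<psi> i)), incl V I (\<lambda>i. X (\<psi> i)))"
    using assms b by (intro ex_coproduct_universe) (auto simp: bij_betw_def)
  from coproduct_reindex[OF this b(1)]
  have "is_coproduct V J (\<lambda>j. X (\<psi> (\<phi> j))) (coprod V I (\<lambda>i. X (\<psi> i)), \<lambda>j. incl V I (\<lambda>i. X (\<psi> i)) (\<phi> j))" .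
  then have "is_coproduct V J X (coprod V I (\<lambda>i. X (\<psi> i)), \<lambda>j. incl V I (\<lambda>i. X (\<psi> i)) (\<phi> j))"
    using b(4) by (simp add: is_coproduct_def)
  then show "\<exists>C. is_coproduct V J X C" ..
qed

lemma ex_initial: "\<exists>Z. is_initial V Z"
proof -
  have c: "is_coproduct V ({} :: 'u set) (\<lambda>_. \<one>) (coprod V ({} :: 'u set) (\<lambda>_. \<one>), incl V {} (\<lambda>_. \<one>))"
    by (rule ex_coproduct_universe) simp
  then have "is_initial V (coprod V ({} :: 'u set) (\<lambda>_. \<one>))"
    unfolding is_coproduct_def is_initial_def by auto
  then show ?thesis ..
qed

lemma initial: "is_initial V (initial V)"
  unfolding initial_def by (rule someI_ex[OF ex_initial])

lemma initial_Obj [simp]: "initial V \<in> Obj V"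
  using initial by (auto simp: is_initial_def)

definition cobang :: "'o \<Rightarrow> 'm" where
  "cobang X = (THE f. f \<in> Hom V (initial V) X)"

lemma cobang [simp]:
  assumes "X \<in> Obj V"
  shows "cobang X \<in> Arr V" "Dom V (cobang X) = initial V" "Cod V (cobang X) = X"
proof -
  have "\<exists>!f. f \<in> Hom V (initial V) X" using initial assms by (auto simp: is_initial_def)
  from theI'[OF this] show "cobang X \<in> Arr V" "Dom V (cobang X) = initial V" "Cod V (cobang X) = X"
    by (auto simp: cobang_def)
qed

lemma from_initial: "\<lbrakk>f \<in> Arr V; g \<in> Arr V; Dom V f = initial V; Dom V g = initial V; Cod V f = Cod V g\<rbrakk> \<Longrightarrow> f = g"
  using initial_unique[OF initial] by blast

subsection \<open>Consequences of extensivity\<close>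

context
  fixes I :: "'u set" and X :: "'u \<Rightarrow> 'o"
  assumes X: "\<And>i. i \<in> I \<Longrightarrow> X i \<in> Obj V"
begin

private abbreviation "S \<equiv> prod_cat I (\<lambda>i. slice V (X i))"
private abbreviation "T \<equiv> slice V (coprod V I X)"
private abbreviation "ob f \<equiv> cotuple V I (\<lambda>i. Dom V (f i)) (coprod V I X) (\<lambda>i. incl V I X i \<cdot> f i)"

private lemma equiv: "is_equivalence S T (coprod_functor V I X)"
  using extensive X by (auto simp: extensive_def)

private lemma FOb_eq: "FOb (coprod_functor V I X) f = ob f"
  by (simp add: coprod_functor_def Let_def)

private lemma Obj_S: "f \<in> Obj S \<longleftrightarrow> f \<in> extensional I \<and> (\<forall>i\<in>I. f i \<in> Arr V \<and> Cod V (f i) = X i)"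
  by (auto simp: prod_cat_def slice_def PiE_iff)

private lemmas inclX = is_coproductD[OF ex_coproduct_universe[of I X, OF X]]

private lemma ob:
  assumes "f \<in> Obj S"
  shows "is_coproduct V I (\<lambda>i. Dom V (f i)) (coprod V I (\<lambda>i. Dom V (f i)), incl V I (\<lambda>i. Dom V (f i)))" (is ?ga)
    "ob f \<in> Arr V" "Dom V (ob f) = coprod V I (\<lambda>i. Dom V (f i))" (is ?gb) "Cod V (ob f) = coprod V I X"
    "i \<in> I \<Longrightarrow> ob f \<cdot> incl V I (\<lambda>i. Dom V (f i)) i = incl V I X i \<cdot> f i" (is "PROP ?gc")
proof -
  show c: ?ga
    using assms by (intro ex_coproduct_universe) (auto simp: Obj_S)
  show "ob f \<in> Arr V" ?gb "Cod V (ob f) = coprod V I X"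
    "PROP ?gc"
    using cotuple[OF c, of "coprod V I X" "\<lambda>i. incl V I X i \<cdot> f i"] inclX assms by (auto simp: Obj_S)
qed

text \<open>The equivalence is essentially surjective, so \<open>g\<close> is isomorphic over the coproduct to the image of a family.\<close>

lemma decompose_universe:
  assumes "g \<in> Arr V" "Cod V g = coprod V I X"
  shows "\<exists>Y e f. is_coproduct V I Y (Dom V g, e) \<and>
    (\<forall>i\<in>I. f i \<in> Hom V (Y i) (X i) \<and> g \<cdot> e i = incl V I X i \<cdot> f i)"
proof -
  obtain G \<tau> where G: "is_functor T S G" and \<tau>: "is_nat_iso T T (comp_func (coprod_functor V I X) G) id_func \<tau>"
    using equiv by (auto simp: is_equivalence_def)
  have g: "g \<in> Obj T" using assms by (simp add: slice_def)
  define f where "f = FOb G g"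
  have f: "f \<in> Obj S" using functor_Obj[OF G g] by (simp add: f_def)
  have t: "\<tau> g \<in> Hom T (ob f) g" "iso T (\<tau> g)"
    using \<tau> g by (auto simp: is_nat_iso_def comp_func_def id_func_def FOb_eq f_def simp del: in_Hom)
  obtain m where m: "\<tau> g = (ob f, m, g)" "m \<in> Arr V" "Dom V m = Dom V (ob f)" "Cod V m = Dom V g" "g \<cdot> m = ob f"
    using t(1) unfolding slice_Hom by auto
  obtain w where w: "w \<in> Hom T g (ob f)" "w \<cdot>\<^bsub>T\<^esub> \<tau> g = Ident T (ob f)" "\<tau> g \<cdot>\<^bsub>T\<^esub> w = Ident T g"
    using t unfolding iso_def by auto
  obtain k where k: "w = (g, k, ob f)" "k \<in> Arr V" "Dom V k = Dom V g" "Cod V k = Dom V (ob f)"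
    using w(1) unfolding slice_Hom by auto
  have "k \<cdot> m = Ident V (Dom V (ob f))" "m \<cdot> k = Ident V (Dom V g)"
    using w m k by (auto simp: slice_def)
  then have "iso V m" using m k by (intro isoI[of m k]) auto
  then have "is_coproduct V I (\<lambda>i. Dom V (f i)) (Dom V g, \<lambda>i. m \<cdot> incl V I (\<lambda>i. Dom V (f i)) i)"
    by (rule coproduct_transport[OF ob(1)[OF f]]) (use m ob[OF f] in auto)
  moreover have "g \<cdot> (m \<cdot> incl V I (\<lambda>i. Dom V (f i)) i) = incl V I X i \<cdot> f i" if "i \<in> I" for i
    using m ob[OF f] that assms is_coproductD[OF ob(1)[OF f]] by (simp add: reassoc[OF m(5)])
  ultimately show ?thesis using f
    by (intro exI[of _ "\<lambda>i. Dom V (f i)"] exI[of _ "\<lambda>i. m \<cdot> incl V I (\<lambda>i. Dom V (f i)) i"] exI[of _ f])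
      (auto simp: Obj_S)
qed

text \<open>
  Both maps are objects of the slice over the coproduct, as images of families that are initial
  except at \<open>j\<close>, respectively \<open>k\<close>. Fullness turns the identity of \<open>Z\<close> into a morphism of families.
\<close>

lemma overlap_universe:
  assumes j: "j \<in> I" "h \<in> Hom V Z (X j)" and k: "k \<in> I" "h' \<in> Hom V Z (X k)"
    and eq: "incl V I X j \<cdot> h = incl V I X k \<cdot> h'"
  shows "if j = k then h = h' else is_initial V Z"
proof -
  have Z [simp]: "Z \<in> Obj V" using j by auto
  define fam where "fam j h = (\<lambda>i\<in>I. if i = j then h else cobang (X i))" for j h
  have fam: "fam j h \<in> Obj S" if "j \<in> I" "h \<in> Hom V Z (X j)" for j h
    using that X by (auto simp: fam_def Obj_S)
  have fam_at: "fam j h i = (if i = j then h else cobang (X i))" if "i \<in> I" for i j h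
    using that by (simp add: fam_def)
  define Y where "Y j h = (\<lambda>i. Dom V (fam j h i))" for j h
  have Y: "Y j h i = (if i = j then Z else initial V)" if "i \<in> I" "j \<in> I" "h \<in> Hom V Z (X j)" for i j h
    using that X by (auto simp: Y_def fam_at)
  define B where "B j h = ob (fam j h)" for j h
  have O: "is_coproduct V I (Y j h) (coprod V I (Y j h), incl V I (Y j h))"
    "B j h \<in> Arr V" "Dom V (B j h) = coprod V I (Y j h)" "Cod V (B j h) = coprod V I X"
    "\<And>i. i \<in> I \<Longrightarrow> B j h \<cdot> incl V I (Y j h) i = incl V I X i \<cdot> fam j h i"
    if "j \<in> I" "h \<in> Hom V Z (X j)" for j h
    using ob[OF fam[OF that]] by (simp_all add: B_def Y_def)
  note OI = is_coproductD[OF O(1)]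
  have "\<exists>r. r \<in> Hom V (coprod V I (Y j h)) Z \<and> r \<cdot> incl V I (Y j h) j = Ident V Z \<and> incl V I (Y j h) j \<cdot> r = Ident V (coprod V I (Y j h))"
    if jh: "j \<in> I" "h \<in> Hom V Z (X j)" for j h
  proof -
    obtain r where r: "r \<in> Arr V" "Dom V r = coprod V I (Y j h)" "Cod V r = Z"
      "\<And>i. i \<in> I \<Longrightarrow> r \<cdot> incl V I (Y j h) i = (if i = j then Ident V Z else cobang Z)"
      by (rule coproduct_ex[OF O(1)[OF jh], of Z "\<lambda>i. if i = j then Ident V Z else cobang Z"])
        (use Y jh in auto)
    have "incl V I (Y j h) j \<cdot> r = Ident V (coprod V I (Y j h))"
    proof (rule coproduct_ext[OF O(1)[OF jh]])
      fix i assume i: "i \<in> I"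
      show "(incl V I (Y j h) j \<cdot> r) \<cdot> incl V I (Y j h) i = Ident V (coprod V I (Y j h)) \<cdot> incl V I (Y j h) i"
      proof (cases "i = j")
        case True
        then show ?thesis using r(1-3) r(4)[OF i] OI[OF jh] jh Y[OF i jh] i by simp
      next
        case False
        then show ?thesis using r(1-3) OI[OF jh] jh Y[OF i jh] Y[OF jh(1) jh] i by (intro from_initial) simp_all
      qed
    qed (use r OI[OF jh] jh Y[OF jh(1) jh] in auto)
    then show ?thesis using r(1-3) r(4)[OF jh(1)] by (intro exI[of _ r]) auto
  qed
  from this[OF j] this[OF k] obtain r r' where
    r: "r \<in> Arr V" "Dom V r = coprod V I (Y j h)" "Cod V r = Z" "r \<cdot> incl V I (Y j h) j = Ident V Z" and
    r': "r' \<in> Arr V" "Dom V r' = coprod V I (Y k h')" "Cod V r' = Z" "r' \<cdot> incl V I (Y k h') k = Ident V Z"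
    by auto
  define u where "u = incl V I (Y k h') k \<cdot> r"
  note Oj = O[OF j] and Ok = O[OF k] and Ij = OI[OF j] and Ik = OI[OF k]
  have u: "u \<in> Arr V" "Dom V u = coprod V I (Y j h)" "Cod V u = coprod V I (Y k h')"
    using r Ik(2-4)[OF k(1)] Y[OF k(1) k] by (auto simp: u_def)
  have Bu: "B k h' \<cdot> u = B j h"
  proof (rule coproduct_ext[OF Oj(1)])
    fix i assume i: "i \<in> I"
    show "(B k h' \<cdot> u) \<cdot> incl V I (Y j h) i = B j h \<cdot> incl V I (Y j h) i"
    proof (cases "i = j")
      case True
      have "(B k h' \<cdot> u) \<cdot> incl V I (Y j h) j = B k h' \<cdot> incl V I (Y k h') k"
        using u r Ok(2-4) Ij(2-4)[OF j(1)] Ik(2-4)[OF k(1)] Y[OF j(1) j] Y[OF k(1) k]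
        by (simp add: u_def)
      then show ?thesis using True Oj(5)[OF j(1)] Ok(5)[OF k(1)] eq j k by (simp add: fam_at)
    next
      case False
      then show ?thesis using u Oj(2-4) Ok(2-4) Ij(2-4)[OF i] Y[OF i j] by (intro from_initial) simp_all
    qed
  qed (use u Oj(2-4) Ok(2-4) in auto)
  have uT: "(B j h, u, B k h') \<in> Hom T (FOb (coprod_functor V I X) (fam j h)) (FOb (coprod_functor V I X) (fam k h'))"
    unfolding slice_Hom FOb_eq B_def[symmetric] using Bu u Oj(2-4) Ok(2-4) by auto
  have catS: "cat S" using prod_cat_category[of I "\<lambda>i. slice V (X i)"] slice_category by unfold_locales auto
  obtain t where t: "t \<in> Hom S (fam j h) (fam k h')" "FAr (coprod_functor V I X) t = (B j h, u, B k h')"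
    by (rule cat.equivalence_full[OF catS slice_category equiv fam[OF j] fam[OF k] uT])
  have tD: "t i \<in> Hom (slice V (X i)) (fam j h i) (fam k h' i)" if "i \<in> I" for i
    using t(1) that unfolding prod_cat_Hom by simp
  define m where "m i = fst (snd (t i))" for i
  have m: "m i \<in> Arr V" "Dom V (m i) = Y j h i" "Cod V (m i) = Y k h' i" "fam k h' i \<cdot> m i = fam j h i" if "i \<in> I" for i
    using tD[OF that] unfolding slice_Hom by (auto simp: m_def Y_def)
  have "cotuple V I (Y j h) (coprod V I (Y k h')) (\<lambda>i. incl V I (Y k h') i \<cdot> m i) = u"
  proof -
    have "Dom S t = fam j h" "Cod S t = fam k h'" using t(1) by auto
    then show ?thesis using t(2) by (simp add: coprod_functor_def Let_def m_def Y_def)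
  qed
  then have um: "u \<cdot> incl V I (Y j h) i = incl V I (Y k h') i \<cdot> m i" if "i \<in> I" for i
    using cotuple(4)[OF Oj(1), of "coprod V I (Y k h')" "\<lambda>i. incl V I (Y k h') i \<cdot> m i" i] that m Ik by auto
  show ?thesis
  proof (cases "j = k")
    case True
    have "r' \<cdot> (u \<cdot> incl V I (Y j h) j) = Ident V Z"
      using r r' Ij(2-4)[OF j(1)] Ik(2-4)[OF k(1)] Y[OF j(1) j] Y[OF k(1) k] by (simp add: u_def)
    moreover have "r' \<cdot> (u \<cdot> incl V I (Y j h) j) = m j"
      using um[OF j(1)] r' m[OF j(1)] True Ik(2-4)[OF k(1)] Y[OF k(1) k] by (simp add: reassoc[OF r'(4)])
    ultimately have "m j = Ident V Z" by simp
    then have "h' = h" using m(4)[OF j(1)] True j k by (simp add: fam_at)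
    then show ?thesis using True by simp
  next
    case False
    then have "is_initial V (Dom V (m j))"
      using m[OF j(1)] Y[OF j(1) k] initial by (intro strict_initial[OF initial]) auto
    then show ?thesis using m[OF j(1)] Y[OF j(1) j] False by simp
  qed
qed

end

text \<open>A small family is reindexed along an injection into the universe.\<close>

lemma decompose:
  assumes "small U J" "is_coproduct V J X (C, \<iota>)" "\<And>j. j \<in> J \<Longrightarrow> X j \<in> Obj V" "g \<in> Arr V" "Cod V g = C"
  shows "\<exists>Y e f. is_coproduct V J Y (Dom V g, e) \<and> (\<forall>j\<in>J. f j \<in> Hom V (Y j) (X j) \<and> g \<cdot> e j = \<iota> j \<cdot> f j)"
proof -
  obtain I :: "'u set" and \<phi> \<psi> where b: "bij_betw \<phi> J I" "bij_betw \<psi> I J" "\<And>i. i \<in> I \<Longrightarrow> \<phi> (\<psi> i) = i" "\<And>j. j \<in> J \<Longrightarrow> \<psi> (\<phi> j) = j"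
    by (rule small_bij[OF assms(1)]) blast
  have mem: "\<phi> j \<in> I" if "j \<in> J" for j using b that by (auto simp: bij_betw_def)
  have mem': "\<psi> i \<in> J" if "i \<in> I" for i using b that by (auto simp: bij_betw_def)
  define X' where "X' = (\<lambda>i. X (\<psi> i))"
  have X': "\<And>i. i \<in> I \<Longrightarrow> X' i \<in> Obj V" using assms(3) mem' by (auto simp: X'_def)
  have c: "is_coproduct V I X' (C, \<lambda>i. \<iota> (\<psi> i))" unfolding X'_def by (rule coproduct_reindex[OF assms(2) b(2)])
  obtain n where n: "iso V n" "n \<in> Hom V C (coprod V I X')" "\<And>i. i \<in> I \<Longrightarrow> n \<cdot> \<iota> (\<psi> i) = incl V I X' i"
    by (rule coproduct_iso[OF c ex_coproduct_universe[of I X', OF X']]) blast+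
  obtain n' where n': "n' \<in> Arr V" "Dom V n' = coprod V I X'" "Cod V n' = C" "n' \<cdot> n = Ident V C"
    using n by (auto elim: isoE)
  have n'i: "n' \<cdot> incl V I X' i = \<iota> (\<psi> i)" if "i \<in> I" for i
  proof -
    have "n' \<cdot> (n \<cdot> \<iota> (\<psi> i)) = \<iota> (\<psi> i)"
      using n(2) n' is_coproductD[OF c] that by (simp add: reassoc[OF n'(4)])
    then show ?thesis using n(3)[OF that] by simp
  qed
  have "\<exists>Y e f. is_coproduct V I Y (Dom V (n \<cdot> g), e) \<and>
    (\<forall>i\<in>I. f i \<in> Hom V (Y i) (X' i) \<and> (n \<cdot> g) \<cdot> e i = incl V I X' i \<cdot> f i)"
    by (rule decompose_universe[OF X']) (use n assms in auto)
  then obtain Y e f where Y: "is_coproduct V I Y (Dom V g, e)"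
    "\<And>i. i \<in> I \<Longrightarrow> f i \<in> Hom V (Y i) (X' i) \<and> (n \<cdot> g) \<cdot> e i = incl V I X' i \<cdot> f i"
    using n(2) assms(4,5) by auto
  have c1: "is_coproduct V J (\<lambda>j. Y (\<phi> j)) (Dom V g, \<lambda>j. e (\<phi> j))" by (rule coproduct_reindex[OF Y(1) b(1)])
  have c2: "f (\<phi> j) \<in> Hom V (Y (\<phi> j)) (X j)" if "j \<in> J" for j
    using Y(2)[OF mem[OF that]] b(4)[OF that] by (simp add: X'_def)
  have c3: "g \<cdot> e (\<phi> j) = \<iota> j \<cdot> f (\<phi> j)" if j: "j \<in> J" for j
  proof -
    have "n' \<cdot> ((n \<cdot> g) \<cdot> e (\<phi> j)) = g \<cdot> e (\<phi> j)"
      using n(2) n' assms(4,5) is_coproductD[OF Y(1)] mem[OF j] by (simp add: reassoc[OF n'(4)])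
    moreover have "n' \<cdot> (incl V I X' (\<phi> j) \<cdot> f (\<phi> j)) = \<iota> j \<cdot> f (\<phi> j)"
      using Y(2)[OF mem[OF j]] n'i[OF mem[OF j]] b(4)[OF j] n' is_coproductD[OF ex_coproduct_universe[of I X', OF X']] mem[OF j]
      by (simp add: reassoc[OF n'i[OF mem[OF j]]])
    ultimately show ?thesis using Y(2)[OF mem[OF j]] by simp
  qed
  show ?thesis
    by (intro exI[of _ "\<lambda>j. Y (\<phi> j)"] exI[of _ "\<lambda>j. e (\<phi> j)"] exI[of _ "\<lambda>j. f (\<phi> j)"] conjI ballI c1 c2 c3)
qed

text \<open>The inclusions into a small coproduct are disjoint monomorphisms.\<close>

lemma overlap:
  assumes "small U J" "is_coproduct V J X (C, \<iota>)" "\<And>j. j \<in> J \<Longrightarrow> X j \<in> Obj V"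
    and j: "j \<in> J" "h \<in> Hom V Z (X j)" and k: "k \<in> J" "h' \<in> Hom V Z (X k)" and eq: "\<iota> j \<cdot> h = \<iota> k \<cdot> h'"
  shows "if j = k then h = h' else is_initial V Z"
proof -
  obtain I :: "'u set" and \<phi> \<psi> where b: "bij_betw \<phi> J I" "bij_betw \<psi> I J" "\<And>i. i \<in> I \<Longrightarrow> \<phi> (\<psi> i) = i" "\<And>j. j \<in> J \<Longrightarrow> \<psi> (\<phi> j) = j"
    by (rule small_bij[OF assms(1)]) blast
  have mem: "\<phi> j \<in> I" if "j \<in> J" for j using b that by (auto simp: bij_betw_def)
  have mem': "\<psi> i \<in> J" if "i \<in> I" for i using b that by (auto simp: bij_betw_def)
  define X' where "X' = (\<lambda>i. X (\<psi> i))"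
  have X': "\<And>i. i \<in> I \<Longrightarrow> X' i \<in> Obj V" using assms(3) mem' by (auto simp: X'_def)
  have c: "is_coproduct V I X' (C, \<lambda>i. \<iota> (\<psi> i))" unfolding X'_def by (rule coproduct_reindex[OF assms(2) b(2)])
  obtain n where n: "iso V n" "n \<in> Hom V C (coprod V I X')" "\<And>i. i \<in> I \<Longrightarrow> n \<cdot> \<iota> (\<psi> i) = incl V I X' i"
    by (rule coproduct_iso[OF c ex_coproduct_universe[of I X', OF X']]) blast+
  have inc: "n \<cdot> (\<iota> j \<cdot> h) = incl V I X' (\<phi> j) \<cdot> h" if "j \<in> J" "h \<in> Hom V Z (X j)" for j h
  proof -
    have "n \<cdot> \<iota> j = incl V I X' (\<phi> j)" using n(3)[OF mem[OF that(1)]] b(4)[OF that(1)] by simp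
    from reassoc[OF this, of h] show ?thesis using n(2) is_coproductD[OF assms(2)] that by simp
  qed
  have "if \<phi> j = \<phi> k then h = h' else is_initial V Z"
    using overlap_universe[of I X', OF X' mem[OF j(1)] _ mem[OF k(1)], where h = h and Z = Z and h' = h'] inc[OF j] inc[OF k] eq j k b(4)
    by (simp add: X'_def)
  then show ?thesis using b(4)[OF j(1)] b(4)[OF k(1)] by (metis (full_types))
qed

text \<open>All pieces in the decomposition of \<open>g\<close> but one are initial, so that one is the whole domain.\<close>

lemma coproduct_factor:
  assumes "small U J" "is_coproduct V J X (C, \<iota>)" "\<And>j. j \<in> J \<Longrightarrow> X j \<in> Obj V"
    and g: "g \<in> Arr V" "Cod V g = C" and j: "j \<in> J"
    and disj: "\<And>i k x. \<lbrakk>i \<in> J; i \<noteq> j; k \<in> Arr V; Cod V k = Dom V g; x \<in> Hom V (Dom V k) (X i); g \<cdot> k = \<iota> i \<cdot> x\<rbrakk> \<Longrightarrow> is_initial V (Dom V k)"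
  obtains h where "h \<in> Arr V" "Dom V h = Dom V g" "Cod V h = X j" "\<iota> j \<cdot> h = g"
proof -
  note D = is_coproductD[OF assms(2)]
  obtain Y e f where Y: "is_coproduct V J Y (Dom V g, e)"
    "\<And>i. i \<in> J \<Longrightarrow> f i \<in> Hom V (Y i) (X i)" "\<And>i. i \<in> J \<Longrightarrow> g \<cdot> e i = \<iota> i \<cdot> f i"
    using decompose[OF assms(1-3) g] by blast
  note E = is_coproductD[OF Y(1)]
  have init: "is_initial V (Y i)" if i: "i \<in> J" "i \<noteq> j" for i
    using disj[OF i, of "e i" "f i"] Y(2,3)[OF i(1)] E(2-4)[OF i(1)] by simp
  have "\<exists>k. k \<in> Hom V (Y i) (X j)" if "i \<in> J" for i
    using Y(2)[OF that] init[OF that] assms(3)[OF j] unfolding is_initial_def by (cases "i = j") blast+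
  then obtain k where k: "\<And>i. i \<in> J \<Longrightarrow> k i \<in> Hom V (Y i) (X j)" by metis
  obtain h where h: "h \<in> Arr V" "Dom V h = Dom V g" "Cod V h = X j" "\<And>i. i \<in> J \<Longrightarrow> h \<cdot> e i = (if i = j then f j else k i)"
    by (rule coproduct_ex[OF Y(1) assms(3)[OF j], of "\<lambda>i. if i = j then f j else k i"]) (use Y(2)[OF j] k in auto)
  have "\<iota> j \<cdot> h = g"
  proof (rule coproduct_ext[OF Y(1)])
    fix i assume i: "i \<in> J"
    show "(\<iota> j \<cdot> h) \<cdot> e i = g \<cdot> e i"
    proof (cases "i = j")
      case True
      then show ?thesis using h(1-3) h(4)[OF i] Y(3)[OF i] D(2-4)[OF i] E(2-4)[OF i] by simp
    next
      case False
      show ?thesis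
        by (rule initial_unique[OF init[OF i False]]) (use h(1-3) D j E(2-4)[OF i] g in auto)
    qed
  qed (use h D j g in auto)
  with h(1-3) show ?thesis by (intro that)
qed

end

section \<open>The category of internal categories\<close>

context ccc_pb
begin

abbreviation W :: "(('o, 'm) icat, ('o, 'm) ifun) cat" where "W \<equiv> Cat V"
abbreviation compW (infixr "\<cdot>\<^sub>W" 70) where "G \<cdot>\<^sub>W F \<equiv> Comp W G F"
abbreviation oneW ("\<one>\<^sub>W") where "\<one>\<^sub>W \<equiv> terminal W"

lemma icat_unfold:
  assumes "A \<in> Obj W"
  defines "s \<equiv> isrc A" and "t \<equiv> itgt A" and "i \<equiv> iid A" and "c \<equiv> icmp A"
  shows "IOb A \<in> Obj V" "IAr A \<in> Obj V" "s \<in> Hom V (IAr A) (IOb A)" "t \<in> Hom V (IAr A) (IOb A)"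
    "i \<in> Hom V (IOb A) (IAr A)" "c \<in> Hom V (pb V t s) (IAr A)"
    "s \<cdot> i = Ident V (IOb A)" "t \<cdot> i = Ident V (IOb A)"
    "s \<cdot> c = s \<cdot> pb1 V t s" "t \<cdot> c = t \<cdot> pb2 V t s"
    "igcmp V A (i \<cdot> s) (Ident V (IAr A)) = Ident V (IAr A)" (is ?ga) "igcmp V A (Ident V (IAr A)) (i \<cdot> t) = Ident V (IAr A)" (is ?gb)
    "igcmp V A (igcmp V A (pb1 V t s \<cdot> pb1 V (t \<cdot> pb2 V t s) s) (pb2 V t s \<cdot> pb1 V (t \<cdot> pb2 V t s) s)) (pb2 V (t \<cdot> pb2 V t s) s) =
      igcmp V A (pb1 V t s \<cdot> pb1 V (t \<cdot> pb2 V t s) s) (igcmp V A (pb2 V t s \<cdot> pb1 V (t \<cdot> pb2 V t s) s) (pb2 V (t \<cdot> pb2 V t s) s))" (is ?gc)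
proof -
  have "internal_category V A" using assms(1) by (simp add: Cat_def)
  note * = this[unfolded internal_category_def Let_def, folded s_def t_def i_def c_def]
  show "IOb A \<in> Obj V" "IAr A \<in> Obj V" "s \<in> Hom V (IAr A) (IOb A)" "t \<in> Hom V (IAr A) (IOb A)"
    "i \<in> Hom V (IOb A) (IAr A)" "c \<in> Hom V (pb V t s) (IAr A)"
    "s \<cdot> i = Ident V (IOb A)" "t \<cdot> i = Ident V (IOb A)"
    "s \<cdot> c = s \<cdot> pb1 V t s" "t \<cdot> c = t \<cdot> pb2 V t s"
    ?ga ?gb
    ?gc
    by - (insert *, elim conjE, assumption)+
qed

lemma icat_simps [simp]:
  assumes "A \<in> Obj W"
  shows "IOb A \<in> Obj V" "IAr A \<in> Obj V"
    "isrc A \<in> Arr V" "Dom V (isrc A) = IAr A" "Cod V (isrc A) = IOb A"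
    "itgt A \<in> Arr V" "Dom V (itgt A) = IAr A" "Cod V (itgt A) = IOb A"
    "iid A \<in> Arr V" "Dom V (iid A) = IOb A" "Cod V (iid A) = IAr A"
    "icmp A \<in> Arr V" "Dom V (icmp A) = pb V (itgt A) (isrc A)" "Cod V (icmp A) = IAr A"
    "isrc A \<cdot> iid A = Ident V (IOb A)" "itgt A \<cdot> iid A = Ident V (IOb A)"
  using icat_unfold(1-8)[OF assms] by simp_all

lemma src_id [simp]:
  assumes "A \<in> Obj W" "a \<in> Arr V" "Cod V a = IOb A"
  shows "isrc A \<cdot> (iid A \<cdot> a) = a" "itgt A \<cdot> (iid A \<cdot> a) = a"
  using assms by (simp_all add: reassoc[OF icat_simps(15)] reassoc[OF icat_simps(16)])

lemma igcmp_typing: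
  assumes "isrc A \<in> Hom V (IAr A) (IOb A)" "itgt A \<in> Hom V (IAr A) (IOb A)" "icmp A \<in> Hom V (pb V (itgt A) (isrc A)) (IAr A)"
    and "f \<in> Arr V" "g \<in> Arr V" "Cod V f = IAr A" "Cod V g = IAr A" "itgt A \<cdot> f = isrc A \<cdot> g"
  shows "igcmp V A f g \<in> Arr V" "Dom V (igcmp V A f g) = Dom V f" "Cod V (igcmp V A f g) = IAr A"
    "u \<in> Arr V \<Longrightarrow> Cod V u = Dom V f \<Longrightarrow> igcmp V A f g \<cdot> u = igcmp V A (f \<cdot> u) (g \<cdot> u)"
  using assms by (simp_all add: igcmp_def)

lemma igcmp_pb:
  assumes "isrc A \<in> Hom V (IAr A) (IOb A)" "itgt A \<in> Hom V (IAr A) (IOb A)" "icmp A \<in> Hom V (pb V (itgt A) (isrc A)) (IAr A)"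
  shows "igcmp V A (pb1 V (itgt A) (isrc A)) (pb2 V (itgt A) (isrc A)) = icmp A"
  using assms by (simp add: igcmp_def)

lemmas icat_laws = icat_unfold(9-13)

lemma igcmp_simps [simp]:
  assumes "A \<in> Obj W" "f \<in> Arr V" "g \<in> Arr V" "Cod V f = IAr A" "Cod V g = IAr A" "itgt A \<cdot> f = isrc A \<cdot> g"
  shows "igcmp V A f g \<in> Arr V" "Dom V (igcmp V A f g) = Dom V f" "Cod V (igcmp V A f g) = IAr A"
    "isrc A \<cdot> igcmp V A f g = isrc A \<cdot> f" (is ?ga) "itgt A \<cdot> igcmp V A f g = itgt A \<cdot> g" (is ?gb)
    "u \<in> Arr V \<Longrightarrow> Cod V u = Dom V f \<Longrightarrow> igcmp V A f g \<cdot> u = igcmp V A (f \<cdot> u) (g \<cdot> u)" (is "PROP ?gc")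
proof -
  note T = igcmp_typing[of A f g]
  show "igcmp V A f g \<in> Arr V" "Dom V (igcmp V A f g) = Dom V f" "Cod V (igcmp V A f g) = IAr A"
    "PROP ?gc"
    using T assms by simp_all
  have "isrc A \<cdot> (icmp A \<cdot> pb_pair V (itgt A) (isrc A) f g) = isrc A \<cdot> f"
    using assms by (simp add: reassoc[OF icat_laws(1)])
  then show ?ga by (simp add: igcmp_def)
  have "itgt A \<cdot> (icmp A \<cdot> pb_pair V (itgt A) (isrc A) f g) = itgt A \<cdot> g"
    using assms by (simp add: reassoc[OF icat_laws(2)])
  then show ?gb by (simp add: igcmp_def)
qed

lemma igcmp_tgt_comp [simp]:
  assumes "A \<in> Obj W" "f \<in> Arr V" "g \<in> Arr V" "Cod V f = IAr A" "Cod V g = IAr A" "itgt A \<cdot> f = isrc A \<cdot> g"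
    "u \<in> Arr V" "Cod V u = Dom V f"
  shows "itgt A \<cdot> igcmp V A (f \<cdot> u) (g \<cdot> u) = itgt A \<cdot> (g \<cdot> u)" 
proof -
  have d: "Dom V f = Dom V g" using assms by (intro Dom_eqI[OF assms(6)]) auto
  have "itgt A \<cdot> (f \<cdot> u) = isrc A \<cdot> (g \<cdot> u)" using assms d by (simp add: reassoc[OF assms(6)])
  then show ?thesis using assms d by simp
qed

lemma igcmp_unit [simp]:
  assumes "A \<in> Obj W" "f \<in> Arr V" "Cod V f = IAr A"
  shows "isrc A \<cdot> f = a \<Longrightarrow> igcmp V A (iid A \<cdot> a) f = f" (is "PROP ?ga") "itgt A \<cdot> f = a \<Longrightarrow> igcmp V A f (iid A \<cdot> a) = f" (is "PROP ?gb")
proof -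
  have "igcmp V A (iid A \<cdot> isrc A) (Ident V (IAr A)) \<cdot> f = f" "igcmp V A (Ident V (IAr A)) (iid A \<cdot> itgt A) \<cdot> f = f"
    using assms icat_laws(3,4)[OF assms(1)] by simp_all
  then show "PROP ?ga" "PROP ?gb"
    using assms by auto
qed

lemma igcmp_assoc:
  assumes "A \<in> Obj W" "f \<in> Arr V" "g \<in> Arr V" "h \<in> Arr V" "Cod V f = IAr A" "Cod V g = IAr A" "Cod V h = IAr A"
    and fg: "itgt A \<cdot> f = isrc A \<cdot> g" and gh: "itgt A \<cdot> g = isrc A \<cdot> h"
  shows "igcmp V A (igcmp V A f g) h = igcmp V A f (igcmp V A g h)"
proof -
  let ?s = "isrc A" and ?t = "itgt A"
  let ?p = "pb1 V ?t ?s" and ?q = "pb2 V ?t ?s"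
  let ?u = "pb1 V (?t \<cdot> ?q) ?s" and ?h = "pb2 V (?t \<cdot> ?q) ?s"
  have law: "igcmp V A (igcmp V A (?p \<cdot> ?u) (?q \<cdot> ?u)) ?h = igcmp V A (?p \<cdot> ?u) (igcmp V A (?q \<cdot> ?u) ?h)"
    by (rule icat_laws(5)[OF assms(1)])
  have d: "Dom V f = Dom V g" using assms by (intro Dom_eqI[OF fg]) auto
  have c: "?t \<cdot> (?p \<cdot> x) = ?s \<cdot> (?q \<cdot> x)" if "x \<in> Arr V" "Cod V x = pb V ?t ?s" for x
    using reassoc[OF pb_commutes[of ?t ?s], of x] assms(1) that by simp
  have c': "?t \<cdot> (?q \<cdot> ?u) = ?s \<cdot> ?h" using pb_commutes[of "?t \<cdot> ?q" ?s] assms(1) by simp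
  define x where "x = pb_pair V (?t \<cdot> ?q) ?s (pb_pair V ?t ?s f g) h"
  have x: "x \<in> Arr V" "Dom V x = Dom V f" "Cod V x = pb V (?t \<cdot> ?q) ?s"
    and ux: "?u \<cdot> x = pb_pair V ?t ?s f g" and hx: "?h \<cdot> x = h"
    using assms d by (auto simp: x_def)
  have "igcmp V A (igcmp V A (?p \<cdot> ?u) (?q \<cdot> ?u)) ?h \<cdot> x = igcmp V A (igcmp V A f g) h"
    using assms c c' x ux hx by simp
  moreover have "igcmp V A (?p \<cdot> ?u) (igcmp V A (?q \<cdot> ?u) ?h) \<cdot> x = igcmp V A f (igcmp V A g h)"
    using assms c c' x ux hx by simp
  ultimately show ?thesis using law by simp
qed

text \<open>The axioms are stated for generalized arrows; at the pullback projections they become those of an internal category.\<close>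

lemma icatI:
  assumes "IOb A \<in> Obj V" "IAr A \<in> Obj V" "isrc A \<in> Hom V (IAr A) (IOb A)" "itgt A \<in> Hom V (IAr A) (IOb A)"
    "iid A \<in> Hom V (IOb A) (IAr A)" "icmp A \<in> Hom V (pb V (itgt A) (isrc A)) (IAr A)"
    "isrc A \<cdot> iid A = Ident V (IOb A)" "itgt A \<cdot> iid A = Ident V (IOb A)"
    and src: "\<And>f g. \<lbrakk>f \<in> Arr V; g \<in> Arr V; Cod V f = IAr A; Cod V g = IAr A; Dom V f = Dom V g; itgt A \<cdot> f = isrc A \<cdot> g\<rbrakk> \<Longrightarrow> isrc A \<cdot> igcmp V A f g = isrc A \<cdot> f"
    and tgt: "\<And>f g. \<lbrakk>f \<in> Arr V; g \<in> Arr V; Cod V f = IAr A; Cod V g = IAr A; Dom V f = Dom V g; itgt A \<cdot> f = isrc A \<cdot> g\<rbrakk> \<Longrightarrow> itgt A \<cdot> igcmp V A f g = itgt A \<cdot> g"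
    and unit1: "\<And>f. f \<in> Arr V \<Longrightarrow> Cod V f = IAr A \<Longrightarrow> igcmp V A (iid A \<cdot> (isrc A \<cdot> f)) f = f"
    and unit2: "\<And>f. f \<in> Arr V \<Longrightarrow> Cod V f = IAr A \<Longrightarrow> igcmp V A f (iid A \<cdot> (itgt A \<cdot> f)) = f"
    and asc: "\<And>f g h. \<lbrakk>f \<in> Arr V; g \<in> Arr V; h \<in> Arr V; Cod V f = IAr A; Cod V g = IAr A; Cod V h = IAr A; Dom V f = Dom V g; Dom V g = Dom V h; itgt A \<cdot> f = isrc A \<cdot> g; itgt A \<cdot> g = isrc A \<cdot> h\<rbrakk> \<Longrightarrow>
       igcmp V A (igcmp V A f g) h = igcmp V A f (igcmp V A g h)"
  shows "A \<in> Obj W"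
proof -
  let ?s = "isrc A" and ?t = "itgt A"
  let ?p = "pb1 V ?t ?s" and ?q = "pb2 V ?t ?s"
  let ?u = "pb1 V (?t \<cdot> ?q) ?s" and ?h = "pb2 V (?t \<cdot> ?q) ?s"
  note c = pb_commutes[of ?t ?s]
  have "?s \<cdot> icmp A = ?s \<cdot> ?p" "?t \<cdot> icmp A = ?t \<cdot> ?q"
    using src[of ?p ?q] tgt[of ?p ?q] c igcmp_pb[OF assms(3,4,6)] assms(1-6) by simp_all
  moreover have "igcmp V A (iid A \<cdot> ?s) (Ident V (IAr A)) = Ident V (IAr A)"
    "igcmp V A (Ident V (IAr A)) (iid A \<cdot> ?t) = Ident V (IAr A)"
    using unit1[of "Ident V (IAr A)"] unit2[of "Ident V (IAr A)"] assms(1-6) by simp_all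
  moreover have "igcmp V A (igcmp V A (?p \<cdot> ?u) (?q \<cdot> ?u)) ?h = igcmp V A (?p \<cdot> ?u) (igcmp V A (?q \<cdot> ?u) ?h)"
    using pb_commutes[of "?t \<cdot> ?q" ?s] reassoc[OF c, of ?u] assms(1-6)
    by - (rule asc, simp_all)
  ultimately have "internal_category V A" using assms(1-8)
    unfolding internal_category_def Let_def by - (intro conjI; assumption)
  then show ?thesis by (simp add: Cat_def)
qed

lemma ifun_unfold:
  assumes "F \<in> Arr W"
  shows "Dom W F \<in> Obj W" "Cod W F \<in> Obj W"
    "IF0 F \<in> Hom V (IOb (Dom W F)) (IOb (Cod W F))" (is ?ga) "IF1 F \<in> Hom V (IAr (Dom W F)) (IAr (Cod W F))" (is ?gb)
    "isrc (Cod W F) \<cdot> IF1 F = IF0 F \<cdot> isrc (Dom W F)" (is ?gc) "itgt (Cod W F) \<cdot> IF1 F = IF0 F \<cdot> itgt (Dom W F)" (is ?gd)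
    "IF1 F \<cdot> iid (Dom W F) = iid (Cod W F) \<cdot> IF0 F" (is ?ge)
    "IF1 F \<cdot> icmp (Dom W F) = igcmp V (Cod W F) (IF1 F \<cdot> pb1 V (itgt (Dom W F)) (isrc (Dom W F)))
       (IF1 F \<cdot> pb2 V (itgt (Dom W F)) (isrc (Dom W F)))" (is ?gf)
proof -
  have D: "Dom W F = IDom F" "Cod W F = ICod F" by (simp_all add: Cat_def)
  have "internal_functor V F" using assms by (simp add: Cat_def)
  note * = this[unfolded internal_functor_def Let_def]
  show "Dom W F \<in> Obj W" "Cod W F \<in> Obj W"
    using * by (simp_all add: Cat_def)
  show ?ga ?gb
    ?gc ?gd
    ?ge
    ?gf
    unfolding D by - (insert *, elim conjE, assumption)+
qed

lemmas ifun_Obj = ifun_unfold(1,2)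

lemma ifun_simps [simp]:
  assumes "F \<in> Arr W"
  shows "IF0 F \<in> Arr V" "Dom V (IF0 F) = IOb (Dom W F)" "Cod V (IF0 F) = IOb (Cod W F)"
    "IF1 F \<in> Arr V" "Dom V (IF1 F) = IAr (Dom W F)" "Cod V (IF1 F) = IAr (Cod W F)"
    "Cod W F = B \<Longrightarrow> isrc B \<cdot> IF1 F = IF0 F \<cdot> isrc (Dom W F)" "Cod W F = B \<Longrightarrow> itgt B \<cdot> IF1 F = IF0 F \<cdot> itgt (Dom W F)"
    "Dom W F = A \<Longrightarrow> IF1 F \<cdot> iid A = iid (Cod W F) \<cdot> IF0 F"
  using ifun_unfold(3-7)[OF assms] by auto

lemma ifun_comp_simps [simp]:
  assumes "F \<in> Arr W" "x \<in> Arr V"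
  shows "Cod W F = B \<Longrightarrow> Cod V x = IAr (Dom W F) \<Longrightarrow> isrc B \<cdot> (IF1 F \<cdot> x) = IF0 F \<cdot> (isrc (Dom W F) \<cdot> x)"
    "Cod W F = B \<Longrightarrow> Cod V x = IAr (Dom W F) \<Longrightarrow> itgt B \<cdot> (IF1 F \<cdot> x) = IF0 F \<cdot> (itgt (Dom W F) \<cdot> x)"
    "Dom W F = A \<Longrightarrow> Cod V x = IOb (Dom W F) \<Longrightarrow> IF1 F \<cdot> (iid A \<cdot> x) = iid (Cod W F) \<cdot> (IF0 F \<cdot> x)"
  using ifun_Obj[OF assms(1)] assms reassoc[of "isrc B" "IF1 F" "IF0 F \<cdot> isrc (Dom W F)" x]
    reassoc[of "itgt B" "IF1 F" "IF0 F \<cdot> itgt (Dom W F)" x]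
    reassoc[of "IF1 F" "iid A" "iid (Cod W F) \<cdot> IF0 F" x] by auto

lemma ifun_igcmp [simp]:
  assumes F: "F \<in> Arr W" "Dom W F = A" and "f \<in> Arr V" "g \<in> Arr V" "Cod V f = IAr A" "Cod V g = IAr A" "itgt A \<cdot> f = isrc A \<cdot> g"
  shows "IF1 F \<cdot> igcmp V A f g = igcmp V (Cod W F) (IF1 F \<cdot> f) (IF1 F \<cdot> g)"
proof -
  note O = ifun_Obj[OF F(1)]
  let ?p = "pb1 V (itgt A) (isrc A)" and ?q = "pb2 V (itgt A) (isrc A)"
  have d: "Dom V f = Dom V g" using assms O by (intro Dom_eqI[OF assms(7)]) auto
  have law: "IF1 F \<cdot> icmp A = igcmp V (Cod W F) (IF1 F \<cdot> ?p) (IF1 F \<cdot> ?q)"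
    using ifun_unfold(8)[OF F(1)] F(2) by simp
  have e: "IF0 F \<cdot> (itgt A \<cdot> ?p) = IF0 F \<cdot> (isrc A \<cdot> ?q)" using O F by (simp add: pb_commutes)
  have "IF1 F \<cdot> igcmp V A f g = (IF1 F \<cdot> icmp A) \<cdot> pb_pair V (itgt A) (isrc A) f g"
    using assms O by (simp add: igcmp_def)
  also have "\<dots> = igcmp V (Cod W F) (IF1 F \<cdot> f) (IF1 F \<cdot> g)"
    unfolding law using assms O d e by simp
  finally show ?thesis .
qed

lemma ifunI:
  assumes "A \<in> Obj W" "B \<in> Obj W" "F0 \<in> Hom V (IOb A) (IOb B)" "F1 \<in> Hom V (IAr A) (IAr B)"
    and "isrc B \<cdot> F1 = F0 \<cdot> isrc A" "itgt B \<cdot> F1 = F0 \<cdot> itgt A" "F1 \<cdot> iid A = iid B \<cdot> F0"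
    and "\<And>f g. \<lbrakk>f \<in> Arr V; g \<in> Arr V; Cod V f = IAr A; Cod V g = IAr A; Dom V f = Dom V g; itgt A \<cdot> f = isrc A \<cdot> g\<rbrakk> \<Longrightarrow>
       F1 \<cdot> igcmp V A f g = igcmp V B (F1 \<cdot> f) (F1 \<cdot> g)"
  shows "\<lparr>IDom = A, ICod = B, IF0 = F0, IF1 = F1\<rparr> \<in> Hom W A B"
proof -
  let ?p = "pb1 V (itgt A) (isrc A)" and ?q = "pb2 V (itgt A) (isrc A)"
  have "F1 \<cdot> igcmp V A ?p ?q = igcmp V B (F1 \<cdot> ?p) (F1 \<cdot> ?q)"
    by (rule assms(8)) (use assms(1) in \<open>simp_all add: pb_commutes\<close>)
  then have "F1 \<cdot> icmp A = igcmp V B (F1 \<cdot> ?p) (F1 \<cdot> ?q)"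
    using igcmp_pb[of A] assms(1) by simp
  moreover have "internal_category V A" "internal_category V B" using assms(1,2) by (simp_all add: Cat_def)
  ultimately show ?thesis using assms(3-7)
    unfolding in_Hom Cat_def internal_functor_def Let_def cat.simps ifun.simps mem_Collect_eq
    by - (elim conjE, intro conjI; (assumption | rule refl))
qed

lemma ifun_eqI:
  assumes "F \<in> Arr W" "G \<in> Arr W" "Dom W F = Dom W G" "Cod W F = Cod W G" "IF0 F = IF0 G" "IF1 F = IF1 G"
  shows "F = G"
  using assms by (cases F; cases G) (auto simp: Cat_def)

lemma IF_Comp [simp]: "IF0 (G \<cdot>\<^sub>W F) = IF0 G \<cdot> IF0 F" "IF1 (G \<cdot>\<^sub>W F) = IF1 G \<cdot> IF1 F"
  by (simp_all add: Cat_def)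

lemma IF_Ident [simp]: "IF0 (Ident W A) = Ident V (IOb A)" "IF1 (Ident W A) = Ident V (IAr A)"
  by (simp_all add: Cat_def)

lemma category_W: "category W"
proof -
  have D: "Dom W F = IDom F" "Cod W F = ICod F" for F by (simp_all add: Cat_def)
  have Comp: "G \<cdot>\<^sub>W F = \<lparr>IDom = Dom W F, ICod = Cod W G, IF0 = IF0 G \<cdot> IF0 F, IF1 = IF1 G \<cdot> IF1 F\<rparr>" for F G
    by (simp add: Cat_def)
  have comp: "G \<cdot>\<^sub>W F \<in> Hom W A C" if FG: "F \<in> Hom W A B" "G \<in> Hom W B C" for F G A B C
  proof -
    have [simp]: "A \<in> Obj W" "B \<in> Obj W" "C \<in> Obj W" using FG ifun_Obj[of F] ifun_Obj[of G] by auto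
    have "\<lparr>IDom = A, ICod = C, IF0 = IF0 G \<cdot> IF0 F, IF1 = IF1 G \<cdot> IF1 F\<rparr> \<in> Hom W A C"
      by (rule ifunI) (use FG in simp_all)
    then show ?thesis unfolding Comp using FG by simp
  qed
  show ?thesis
    unfolding category_def
  proof (intro conjI allI ballI)
    show "Dom W F \<in> Obj W" "Cod W F \<in> Obj W" if "F \<in> Arr W" for F using ifun_Obj[OF that] .
    show "Ident W A \<in> Hom W A A" if "A \<in> Obj W" for A
    proof -
      have "\<lparr>IDom = A, ICod = A, IF0 = Ident V (IOb A), IF1 = Ident V (IAr A)\<rparr> \<in> Hom W A A"
        by (rule ifunI) (use that in simp_all)
      then show ?thesis by (simp add: Cat_def)
    qed
    show "G \<cdot>\<^sub>W F \<in> Hom W A C" if "F \<in> Hom W A B" "G \<in> Hom W B C" for F G A B C by (rule comp[OF that])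
    show "Ident W B \<cdot>\<^sub>W F = F" "F \<cdot>\<^sub>W Ident W A = F" if "F \<in> Hom W A B" for F A B
      using that ifun_simps[of F] by (cases F; simp add: Comp; simp add: Cat_def)+
    show "(H \<cdot>\<^sub>W G) \<cdot>\<^sub>W F = H \<cdot>\<^sub>W (G \<cdot>\<^sub>W F)" if "F \<in> Hom W A B" "G \<in> Hom W B C" "H \<in> Hom W C D" for F G H A B C D
      unfolding Comp using that by (simp add: D)
  qed
qed

sublocale W: cat W
  by (unfold_locales) (rule category_W)

subsection \<open>Finite limits\<close>

text \<open>The pullbacks of the objects and of the arrows form an internal category, with composition in both components.\<close>

lemma canonical_pullback:
  assumes F: "F \<in> Arr W" and G: "G \<in> Arr W" and FG: "Cod W F = Cod W G"
  shows "\<exists>P p q. is_pullback W F G (P, p, q) \<and> is_pullback V (IF0 F) (IF0 G) (IOb P, IF0 p, IF0 q) \<and>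
    is_pullback V (IF1 F) (IF1 G) (IAr P, IF1 p, IF1 q)"
proof -
  define A B C where "A = Dom W F" and "B = Dom W G" and "C = Cod W G"
  have O [simp]: "A \<in> Obj W" "B \<in> Obj W" "C \<in> Obj W" using F G by (auto simp: A_def B_def C_def)
  have [simp]: "Dom W F = A" "Dom W G = B" "Cod W G = C" "Cod W F = C" using FG by (simp_all add: A_def B_def C_def)
  note [simp] = F G
  let ?F0 = "IF0 F" and ?G0 = "IF0 G" and ?F1 = "IF1 F" and ?G1 = "IF1 G"
  let ?a0 = "pb1 V ?F0 ?G0" and ?b0 = "pb2 V ?F0 ?G0" and ?a1 = "pb1 V ?F1 ?G1" and ?b1 = "pb2 V ?F1 ?G1"
  have c0: "?F0 \<cdot> ?a0 = ?G0 \<cdot> ?b0" and c1: "?F1 \<cdot> ?a1 = ?G1 \<cdot> ?b1" by (simp_all add: pb_commutes)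
  have c0': "?F0 \<cdot> (?a0 \<cdot> x) = ?G0 \<cdot> (?b0 \<cdot> x)" if "x \<in> Arr V" "Cod V x = pb V ?F0 ?G0" for x
    using reassoc[OF c0, of x] that by simp
  have c1': "?F1 \<cdot> (?a1 \<cdot> x) = ?G1 \<cdot> (?b1 \<cdot> x)" if "x \<in> Arr V" "Cod V x = pb V ?F1 ?G1" for x
    using reassoc[OF c1, of x] that by simp
  have cs: "?F0 \<cdot> (isrc A \<cdot> (?a1 \<cdot> x)) = ?G0 \<cdot> (isrc B \<cdot> (?b1 \<cdot> x))" if "x \<in> Arr V" "Cod V x = pb V ?F1 ?G1" for x
    using arg_cong[OF c1'[OF that], of "\<lambda>y. isrc C \<cdot> y"] that by simp
  have ct: "?F0 \<cdot> (itgt A \<cdot> (?a1 \<cdot> x)) = ?G0 \<cdot> (itgt B \<cdot> (?b1 \<cdot> x))" if "x \<in> Arr V" "Cod V x = pb V ?F1 ?G1" for x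
    using arg_cong[OF c1'[OF that], of "\<lambda>y. itgt C \<cdot> y"] that by simp
  have cs0: "?F0 \<cdot> (isrc A \<cdot> ?a1) = ?G0 \<cdot> (isrc B \<cdot> ?b1)" and ct0: "?F0 \<cdot> (itgt A \<cdot> ?a1) = ?G0 \<cdot> (itgt B \<cdot> ?b1)"
    using cs[of "Ident V (pb V ?F1 ?G1)"] ct[of "Ident V (pb V ?F1 ?G1)"] by simp_all
  define s where "s = pb_pair V ?F0 ?G0 (isrc A \<cdot> ?a1) (isrc B \<cdot> ?b1)"
  define t where "t = pb_pair V ?F0 ?G0 (itgt A \<cdot> ?a1) (itgt B \<cdot> ?b1)"
  have s: "s \<in> Arr V" "Dom V s = pb V ?F1 ?G1" "Cod V s = pb V ?F0 ?G0" "?a0 \<cdot> s = isrc A \<cdot> ?a1" "?b0 \<cdot> s = isrc B \<cdot> ?b1"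
    and t: "t \<in> Arr V" "Dom V t = pb V ?F1 ?G1" "Cod V t = pb V ?F0 ?G0" "?a0 \<cdot> t = itgt A \<cdot> ?a1" "?b0 \<cdot> t = itgt B \<cdot> ?b1"
    using cs0 ct0 by (simp_all add: s_def t_def)
  define m where "m f g = pb_pair V ?F1 ?G1 (igcmp V A (?a1 \<cdot> f) (?a1 \<cdot> g)) (igcmp V B (?b1 \<cdot> f) (?b1 \<cdot> g))" for f g
  define P where "P = \<lparr>IOb = pb V ?F0 ?G0, IAr = pb V ?F1 ?G1, isrc = s, itgt = t,
    iid = pb_pair V ?F1 ?G1 (iid A \<cdot> ?a0) (iid B \<cdot> ?b0), icmp = m (pb1 V t s) (pb2 V t s)\<rparr>"
  have sx: "?a0 \<cdot> (s \<cdot> x) = isrc A \<cdot> (?a1 \<cdot> x)" "?b0 \<cdot> (s \<cdot> x) = isrc B \<cdot> (?b1 \<cdot> x)"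
    "?a0 \<cdot> (t \<cdot> x) = itgt A \<cdot> (?a1 \<cdot> x)" "?b0 \<cdot> (t \<cdot> x) = itgt B \<cdot> (?b1 \<cdot> x)" if "x \<in> Arr V" "Cod V x = pb V ?F1 ?G1" for x
    using that reassoc[OF s(4), of x] reassoc[OF s(5), of x] reassoc[OF t(4), of x] reassoc[OF t(5), of x] s t by simp_all
  have co: "itgt A \<cdot> (?a1 \<cdot> f) = isrc A \<cdot> (?a1 \<cdot> g)" "itgt B \<cdot> (?b1 \<cdot> f) = isrc B \<cdot> (?b1 \<cdot> g)"
    if "f \<in> Arr V" "g \<in> Arr V" "Cod V f = pb V ?F1 ?G1" "Cod V g = pb V ?F1 ?G1" "t \<cdot> f = s \<cdot> g" for f g
    using arg_cong[OF that(5), of "\<lambda>x. ?a0 \<cdot> x"] arg_cong[OF that(5), of "\<lambda>x. ?b0 \<cdot> x"] that(1-4) by (simp_all add: sx)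
  have m: "m f g \<in> Arr V" "Dom V (m f g) = Dom V f" "Cod V (m f g) = pb V ?F1 ?G1"
    "?a1 \<cdot> m f g = igcmp V A (?a1 \<cdot> f) (?a1 \<cdot> g)" "?b1 \<cdot> m f g = igcmp V B (?b1 \<cdot> f) (?b1 \<cdot> g)"
    "u \<in> Arr V \<Longrightarrow> Cod V u = Dom V f \<Longrightarrow> m f g \<cdot> u = m (f \<cdot> u) (g \<cdot> u)"
    if fg: "f \<in> Arr V" "g \<in> Arr V" "Cod V f = pb V ?F1 ?G1" "Cod V g = pb V ?F1 ?G1" "t \<cdot> f = s \<cdot> g" for f g u
  proof -
    have d: "Dom V f = Dom V g" using fg s t by (intro Dom_eqI[OF fg(5)]) auto
    note c = co[OF fg]
    have "?F1 \<cdot> igcmp V A (?a1 \<cdot> f) (?a1 \<cdot> g) = ?G1 \<cdot> igcmp V B (?b1 \<cdot> f) (?b1 \<cdot> g)"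
      using fg c d by (simp add: c1')
    then show "m f g \<in> Arr V" "Dom V (m f g) = Dom V f" "Cod V (m f g) = pb V ?F1 ?G1"
      "?a1 \<cdot> m f g = igcmp V A (?a1 \<cdot> f) (?a1 \<cdot> g)" "?b1 \<cdot> m f g = igcmp V B (?b1 \<cdot> f) (?b1 \<cdot> g)"
      "u \<in> Arr V \<Longrightarrow> Cod V u = Dom V f \<Longrightarrow> m f g \<cdot> u = m (f \<cdot> u) (g \<cdot> u)"
      using fg(1-4) c d by (simp_all add: m_def)
  qed
  have Ps: "IOb P = pb V ?F0 ?G0" "IAr P = pb V ?F1 ?G1" "isrc P = s" "itgt P = t"
    "iid P = pb_pair V ?F1 ?G1 (iid A \<cdot> ?a0) (iid B \<cdot> ?b0)" by (simp_all add: P_def)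
  have i: "iid P \<in> Arr V" "Dom V (iid P) = pb V ?F0 ?G0" "Cod V (iid P) = pb V ?F1 ?G1" "?a1 \<cdot> iid P = iid A \<cdot> ?a0" "?b1 \<cdot> iid P = iid B \<cdot> ?b0"
    by (simp_all add: Ps c0)
  have ix: "?a1 \<cdot> (iid P \<cdot> x) = iid A \<cdot> (?a0 \<cdot> x)" "?b1 \<cdot> (iid P \<cdot> x) = iid B \<cdot> (?b0 \<cdot> x)" if "x \<in> Arr V" "Cod V x = pb V ?F0 ?G0" for x
    using that reassoc[OF i(4), of x] reassoc[OF i(5), of x] i by simp_all
  have gP: "igcmp V P f g = m f g"
    if "f \<in> Arr V" "g \<in> Arr V" "Cod V f = pb V ?F1 ?G1" "Cod V g = pb V ?F1 ?G1" "t \<cdot> f = s \<cdot> g" for f g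
    using that m[of "pb1 V t s" "pb2 V t s"] s t pb_commutes[of t s] by (simp add: P_def igcmp_def)
  have cP: "icmp P \<in> Hom V (pb V t s) (pb V ?F1 ?G1)"
    using m[of "pb1 V t s" "pb2 V t s"] s t pb_commutes[of t s] by (simp add: P_def)
  have e0: "x = y" if "x \<in> Arr V" "y \<in> Arr V" "Dom V x = Dom V y" "Cod V x = pb V ?F0 ?G0" "Cod V y = pb V ?F0 ?G0" "?a0 \<cdot> x = ?a0 \<cdot> y" "?b0 \<cdot> x = ?b0 \<cdot> y" for x y
    by (rule pb_ext[of _ _ ?F0 ?G0]) (use that in simp_all)
  have e1: "x = y" if "x \<in> Arr V" "y \<in> Arr V" "Dom V x = Dom V y" "Cod V x = pb V ?F1 ?G1" "Cod V y = pb V ?F1 ?G1" "?a1 \<cdot> x = ?a1 \<cdot> y" "?b1 \<cdot> x = ?b1 \<cdot> y" for x y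
    by (rule pb_ext[of _ _ ?F1 ?G1]) (use that in simp_all)
  have P [simp]: "P \<in> Obj W"
  proof (rule icatI)
    show "isrc P \<cdot> iid P = Ident V (IOb P)" "itgt P \<cdot> iid P = Ident V (IOb P)"
      unfolding Ps(1,3,4) by (rule e0; use i s t in \<open>simp add: sx i\<close>)+
  next
    fix f g assume fg: "f \<in> Arr V" "g \<in> Arr V" "Cod V f = IAr P" "Cod V g = IAr P" "Dom V f = Dom V g" "itgt P \<cdot> f = isrc P \<cdot> g"
    note fg' = fg[unfolded Ps(2-4)]
    show "isrc P \<cdot> igcmp V P f g = isrc P \<cdot> f" "itgt P \<cdot> igcmp V P f g = itgt P \<cdot> g"
      unfolding Ps(3,4) gP[OF fg'(1-4,6)]
      by (rule e0; use s t fg' m[OF fg'(1-4,6)] co[OF fg'(1-4,6)] in \<open>simp add: sx\<close>)+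
  next
    fix f assume f: "f \<in> Arr V" "Cod V f = IAr P"
    then have f': "f \<in> Arr V" "Cod V f = pb V ?F1 ?G1" by (simp_all add: Ps)
    have k: "t \<cdot> (iid P \<cdot> (s \<cdot> f)) = s \<cdot> f" "t \<cdot> f = s \<cdot> (iid P \<cdot> (t \<cdot> f))"
      by (rule e0; use i s t f' in \<open>simp add: sx ix\<close>)+
    have "igcmp V P (iid P \<cdot> (s \<cdot> f)) f = m (iid P \<cdot> (s \<cdot> f)) f" "igcmp V P f (iid P \<cdot> (t \<cdot> f)) = m f (iid P \<cdot> (t \<cdot> f))"
      using i s t f' k by (auto intro!: gP)
    moreover have "m (iid P \<cdot> (s \<cdot> f)) f = f" "m f (iid P \<cdot> (t \<cdot> f)) = f"
      using m(1-5)[of "iid P \<cdot> (s \<cdot> f)" f] m(1-5)[of f "iid P \<cdot> (t \<cdot> f)"] i s t f' k by - (rule e1; simp add: sx ix)+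
    ultimately show "igcmp V P (iid P \<cdot> (isrc P \<cdot> f)) f = f" "igcmp V P f (iid P \<cdot> (itgt P \<cdot> f)) = f"
      unfolding Ps(3,4) by simp_all
  next
    fix f g h assume fg: "f \<in> Arr V" "g \<in> Arr V" "h \<in> Arr V" "Cod V f = IAr P" "Cod V g = IAr P" "Cod V h = IAr P"
      "Dom V f = Dom V g" "Dom V g = Dom V h" "itgt P \<cdot> f = isrc P \<cdot> g" "itgt P \<cdot> g = isrc P \<cdot> h"
    note fg' = fg[unfolded Ps(2-4)]
    note m1 = m(1-5)[OF fg'(1,2,4,5,9)] and m2 = m(1-5)[OF fg'(2,3,5,6,10)]
    note o1 = co[OF fg'(1,2,4,5,9)] and o2 = co[OF fg'(2,3,5,6,10)]
    have k: "t \<cdot> m f g = s \<cdot> h" "t \<cdot> f = s \<cdot> m g h"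
      by (rule e0; use m1 m2 s t fg' o1 o2 in \<open>simp add: sx\<close>)+
    have "m (m f g) h = m f (m g h)"
      using m(1-5)[of "m f g" h] m(1-5)[of f "m g h"] m1 m2 s t fg' o1 o2 k
      by - (rule e1; simp add: igcmp_assoc)
    then show "igcmp V P (igcmp V P f g) h = igcmp V P f (igcmp V P g h)"
      using gP[of "m f g" h] gP[of f "m g h"] gP[OF fg'(1,2,4,5,9)] gP[OF fg'(2,3,5,6,10)] m1 m2 k fg' by simp
  qed (use s t i cP in \<open>simp_all add: Ps\<close>)
  define p where "p = \<lparr>IDom = P, ICod = A, IF0 = ?a0, IF1 = ?a1\<rparr>"
  define q where "q = \<lparr>IDom = P, ICod = B, IF0 = ?b0, IF1 = ?b1\<rparr>"
  have p: "p \<in> Hom W P A" unfolding p_def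
    by (rule ifunI) (use s t i in \<open>simp_all add: Ps gP m co\<close>)
  have q: "q \<in> Hom W P B" unfolding q_def
    by (rule ifunI) (use s t i in \<open>simp_all add: Ps gP m co\<close>)
  have [simp]: "IF0 p = ?a0" "IF1 p = ?a1" "IF0 q = ?b0" "IF1 q = ?b1" by (simp_all add: p_def q_def)
  have "is_pullback W F G (P, p, q)"
  proof (rule W.pullbackI)
    show "F \<cdot>\<^sub>W p = G \<cdot>\<^sub>W q" using p q by (intro ifun_eqI) (simp_all add: c0 c1)
  next
    fix a b assume ab: "a \<in> Arr W" "b \<in> Hom W (Dom W a) (Dom W G)" "Cod W a = Dom W F" "F \<cdot>\<^sub>W a = G \<cdot>\<^sub>W b"
    have e: "?F0 \<cdot> IF0 a = ?G0 \<cdot> IF0 b" "?F1 \<cdot> IF1 a = ?G1 \<cdot> IF1 b"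
      using arg_cong[OF ab(4), of IF0] arg_cong[OF ab(4), of IF1] by simp_all
    define Z where "Z = Dom W a"
    have Z [simp]: "Z \<in> Obj W" using ab by (simp add: Z_def)
    have ab' [simp]: "a \<in> Arr W" "b \<in> Arr W" "Dom W a = Z" "Dom W b = Z" "Cod W a = A" "Cod W b = B" using ab by (simp_all add: Z_def)
    define h0 where "h0 = pb_pair V ?F0 ?G0 (IF0 a) (IF0 b)"
    define h1 where "h1 = pb_pair V ?F1 ?G1 (IF1 a) (IF1 b)"
    have h: "h0 \<in> Arr V" "Dom V h0 = IOb Z" "Cod V h0 = pb V ?F0 ?G0" "?a0 \<cdot> h0 = IF0 a" "?b0 \<cdot> h0 = IF0 b"
      "h1 \<in> Arr V" "Dom V h1 = IAr Z" "Cod V h1 = pb V ?F1 ?G1" "?a1 \<cdot> h1 = IF1 a" "?b1 \<cdot> h1 = IF1 b"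
      using e by (simp_all add: h0_def h1_def)
    have hx: "?a0 \<cdot> (h0 \<cdot> x) = IF0 a \<cdot> x" "?b0 \<cdot> (h0 \<cdot> x) = IF0 b \<cdot> x" if "x \<in> Arr V" "Cod V x = IOb Z" for x
      using reassoc[OF h(4), of x] reassoc[OF h(5), of x] that h by simp_all
    have hx1: "?a1 \<cdot> (h1 \<cdot> x) = IF1 a \<cdot> x" "?b1 \<cdot> (h1 \<cdot> x) = IF1 b \<cdot> x" if "x \<in> Arr V" "Cod V x = IAr Z" for x
      using reassoc[OF h(9), of x] reassoc[OF h(10), of x] that h by simp_all
    have "\<lparr>IDom = Z, ICod = P, IF0 = h0, IF1 = h1\<rparr> \<in> Hom W Z P"
    proof (rule ifunI)
      show "isrc P \<cdot> h1 = h0 \<cdot> isrc Z" "itgt P \<cdot> h1 = h0 \<cdot> itgt Z"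
        unfolding Ps by (rule e0; use h s t in \<open>simp add: sx hx\<close>)+
      show "h1 \<cdot> iid Z = iid P \<cdot> h0"
        by (rule e1; use h i in \<open>simp add: ix hx1\<close>)
    next
      fix f g assume fg: "f \<in> Arr V" "g \<in> Arr V" "Cod V f = IAr Z" "Cod V g = IAr Z" "Dom V f = Dom V g" "itgt Z \<cdot> f = isrc Z \<cdot> g"
      have k: "t \<cdot> (h1 \<cdot> f) = s \<cdot> (h1 \<cdot> g)"
        by (rule e0; use h s t fg in \<open>simp add: sx hx1\<close>)
      have "h1 \<cdot> igcmp V Z f g = m (h1 \<cdot> f) (h1 \<cdot> g)"
        using m(1-5)[of "h1 \<cdot> f" "h1 \<cdot> g"] k h fg by - (rule e1; simp add: hx1)
      then show "h1 \<cdot> igcmp V Z f g = igcmp V P (h1 \<cdot> f) (h1 \<cdot> g)"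
        using gP[of "h1 \<cdot> f" "h1 \<cdot> g"] k h fg by simp
    qed (use h in \<open>simp_all add: Ps\<close>)
    then show "\<exists>h. h \<in> Hom W (Dom W a) P \<and> p \<cdot>\<^sub>W h = a \<and> q \<cdot>\<^sub>W h = b"
      using p q h by (intro exI[of _ "\<lparr>IDom = Z, ICod = P, IF0 = h0, IF1 = h1\<rparr>"] conjI ifun_eqI) simp_all
  next
    fix h k assume hk: "h \<in> Arr W" "k \<in> Arr W" "Dom W h = Dom W k" "Cod W h = P" "Cod W k = P"
      "p \<cdot>\<^sub>W h = p \<cdot>\<^sub>W k" "q \<cdot>\<^sub>W h = q \<cdot>\<^sub>W k"
    have "?a0 \<cdot> IF0 h = ?a0 \<cdot> IF0 k" "?b0 \<cdot> IF0 h = ?b0 \<cdot> IF0 k" "?a1 \<cdot> IF1 h = ?a1 \<cdot> IF1 k" "?b1 \<cdot> IF1 h = ?b1 \<cdot> IF1 k"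
      using arg_cong[OF hk(6), of IF0] arg_cong[OF hk(6), of IF1] arg_cong[OF hk(7), of IF0] arg_cong[OF hk(7), of IF1]
      by simp_all
    then have "IF0 h = IF0 k" "IF1 h = IF1 k"
      using hk(1-5) e0[of "IF0 h" "IF0 k"] e1[of "IF1 h" "IF1 k"] by (simp_all add: Ps)
    then show "h = k" using hk(1-5) by (intro ifun_eqI) simp_all
  qed (use p q in simp_all)
  moreover have "is_pullback V ?F0 ?G0 (IOb P, IF0 p, IF0 q)" "is_pullback V ?F1 ?G1 (IAr P, IF1 p, IF1 q)"
    using pullback[of ?F0 ?G0] pullback[of ?F1 ?G1] by (simp_all add: Ps)
  ultimately show ?thesis by blast
qed

sublocale W: pullback_cat W
proof unfold_locales
  show "\<exists>P. is_pullback W f g P" if "f \<in> Arr W" "g \<in> Arr W" "Cod W f = Cod W g" for f g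
    using canonical_pullback[OF that] by blast
qed

lemma iso_IF:
  assumes "iso W j"
  shows "iso V (IF0 j)" "iso V (IF1 j)"
proof -
  obtain k where k: "j \<in> Arr W" "k \<in> Arr W" "Dom W k = Cod W j" "Cod W k = Dom W j"
    "k \<cdot>\<^sub>W j = Ident W (Dom W j)" "j \<cdot>\<^sub>W k = Ident W (Cod W j)"
    using assms by (auto elim: W.isoE)
  have "IF0 k \<cdot> IF0 j = Ident V (IOb (Dom W j))" "IF0 j \<cdot> IF0 k = Ident V (IOb (Cod W j))"
    "IF1 k \<cdot> IF1 j = Ident V (IAr (Dom W j))" "IF1 j \<cdot> IF1 k = Ident V (IAr (Cod W j))"
    using arg_cong[OF k(5), of IF0] arg_cong[OF k(6), of IF0] arg_cong[OF k(5), of IF1] arg_cong[OF k(6), of IF1] by simp_all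
  then show "iso V (IF0 j)" "iso V (IF1 j)"
    using isoI[of "IF0 j" "IF0 k"] isoI[of "IF1 j" "IF1 k"] k by simp_all
qed

text \<open>Every pullback is isomorphic to the one formed on objects and on arrows.\<close>

lemma pullback_pointwise:
  assumes "is_pullback W F G (P, p, q)" "F \<in> Arr W" "G \<in> Arr W" "Cod W F = Cod W G"
  shows "is_pullback V (IF0 F) (IF0 G) (IOb P, IF0 p, IF0 q)" (is ?ga) "is_pullback V (IF1 F) (IF1 G) (IAr P, IF1 p, IF1 q)" (is ?gb)
proof -
  obtain P' p' q' where P': "is_pullback W F G (P', p', q')" "is_pullback V (IF0 F) (IF0 G) (IOb P', IF0 p', IF0 q')"
    "is_pullback V (IF1 F) (IF1 G) (IAr P', IF1 p', IF1 q')"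
    using canonical_pullback[OF assms(2-4)] by blast
  obtain j where j: "j \<in> Hom W P P'" "iso W j" "p' \<cdot>\<^sub>W j = p" "q' \<cdot>\<^sub>W j = q"
    using W.pullback_iso[OF assms(1) P'(1) assms(2,3)] by blast
  have ij: "iso V (IF0 j)" "iso V (IF1 j)" using iso_IF[OF j(2)] by simp_all
  show ?ga
    by (rule pullback_transport[OF P'(2) _ _ ij(1)]) (use assms j in auto)
  show ?gb
    by (rule pullback_transport[OF P'(3) _ _ ij(2)]) (use assms j in auto)
qed

subsection \<open>Discrete internal categories, the terminal one and its elements\<close>

definition disc :: "'o \<Rightarrow> ('o, 'm) icat" where
  "disc X = \<lparr>IOb = X, IAr = X, isrc = Ident V X, itgt = Ident V X, iid = Ident V X,
     icmp = pb1 V (Ident V X) (Ident V X)\<rparr>"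

lemma disc_sel [simp]:
  "IOb (disc X) = X" "IAr (disc X) = X" "isrc (disc X) = Ident V X" "itgt (disc X) = Ident V X" "iid (disc X) = Ident V X"
  by (simp_all add: disc_def)

lemma igcmp_disc: "\<lbrakk>X \<in> Obj V; f \<in> Arr V; Cod V f = X\<rbrakk> \<Longrightarrow> igcmp V (disc X) f f = f"
  by (simp add: igcmp_def) (simp add: disc_def)

lemma disc_Obj [simp]:
  assumes "X \<in> Obj V"
  shows "disc X \<in> Obj W"
proof (rule icatI)
  show "icmp (disc X) \<in> Hom V (pb V (itgt (disc X)) (isrc (disc X))) (IAr (disc X))"
    using assms by (simp add: disc_def)
qed (use assms igcmp_disc in auto)

text \<open>Internal functors out of a discrete internal category are morphisms into the object of objects.\<close>

lemma disc_functor: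
  assumes "X \<in> Obj V" "A \<in> Obj W" "a \<in> Hom V X (IOb A)"
  shows "\<lparr>IDom = disc X, ICod = A, IF0 = a, IF1 = iid A \<cdot> a\<rparr> \<in> Hom W (disc X) A"
  by (rule ifunI) (use assms igcmp_disc in auto)

lemma disc_functor_IF1:
  assumes "X \<in> Obj V" "F \<in> Arr W" "Dom W F = disc X"
  shows "IF1 F = iid (Cod W F) \<cdot> IF0 F"
  using ifun_simps(9)[OF assms(2,3)] assms ifun_simps(1-6)[OF assms(2)] by simp

lemma is_terminal_disc: "is_terminal W (disc \<one>)"
  unfolding is_terminal_def
proof (intro conjI ballI)
  fix A assume A: "A \<in> Obj W"
  have "\<lparr>IDom = A, ICod = disc \<one>, IF0 = bang V (IOb A), IF1 = bang V (IAr A)\<rparr> \<in> Hom W A (disc \<one>)"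
    by (rule ifunI) (use A igcmp_disc in auto)
  then show "\<exists>!F. F \<in> Hom W A (disc \<one>)"
  proof (rule ex1I)
    fix F assume F: "F \<in> Hom W A (disc \<one>)"
    have "IF0 F = bang V (IOb A)" "IF1 F = bang V (IAr A)" using F by (auto intro!: eq_bang)
    then show "F = \<lparr>IDom = A, ICod = disc \<one>, IF0 = bang V (IOb A), IF1 = bang V (IAr A)\<rparr>"
      using F by (cases F) (auto simp: Cat_def)
  qed
qed simp

lemma product_if_pullback:
  fixes D :: "('p, 'n) cat"
  assumes "is_terminal D T" "f \<in> Hom D X T" "g \<in> Hom D Y T" "is_pullback D f g (P, p, q)" "category D"
  shows "is_product D X Y (P, p, q)"
proof -
  interpret D: cat D using assms by unfold_locales
  have "f \<cdot>\<^bsub>D\<^esub> a = g \<cdot>\<^bsub>D\<^esub> b" if "a \<in> Hom D Z X" "b \<in> Hom D Z Y" for a b Z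
    by (rule D.terminal_unique[OF assms(1)]) (use that assms in auto)
  then show ?thesis using assms(2-4) unfolding is_product_def is_pullback_def by auto
qed

sublocale W: cartesian W
proof unfold_locales
  show "\<exists>T. is_terminal W T" using is_terminal_disc by blast
  show "\<exists>P. is_product W X Y P" if XY: "X \<in> Obj W" "Y \<in> Obj W" for X Y
  proof -
    obtain f g where fg: "f \<in> Hom W X (disc \<one>)" "g \<in> Hom W Y (disc \<one>)"
      using is_terminal_disc XY unfolding is_terminal_def by blast
    then obtain P p q where "is_pullback W f g (P, p, q)"
      using W.ex_pullback[of f g] by auto
    from product_if_pullback[OF is_terminal_disc fg this category_W] show ?thesis by blast
  qed
qed

lemma product_pointwise:
  assumes "A \<in> Obj W" "B \<in> Obj W" "is_product W A B (P, p, q)"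
  shows "is_product V (IOb A) (IOb B) (IOb P, IF0 p, IF0 q)" (is ?ga) "is_product V (IAr A) (IAr B) (IAr P, IF1 p, IF1 q)" (is ?gb)
proof -
  obtain f g where fg: "f \<in> Hom W A (disc \<one>)" "g \<in> Hom W B (disc \<one>)"
    using is_terminal_disc assms unfolding is_terminal_def by blast
  have c: "f \<cdot>\<^sub>W a = g \<cdot>\<^sub>W b" if "a \<in> Hom W Z A" "b \<in> Hom W Z B" for a b Z
    by (rule W.terminal_unique[OF is_terminal_disc]) (use that fg in auto)
  then have "is_pullback W f g (P, p, q)"
    using assms(3) fg unfolding is_product_def is_pullback_def by auto
  from pullback_pointwise[OF this] fg
  have "is_pullback V (IF0 f) (IF0 g) (IOb P, IF0 p, IF0 q)" "is_pullback V (IF1 f) (IF1 g) (IAr P, IF1 p, IF1 q)" by auto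
  then show ?ga ?gb
    using fg by (auto intro!: product_if_pullback[OF is_terminal _ _ _ category])
qed

lemma terminal_pointwise: "is_terminal V (IOb \<one>\<^sub>W)" "is_terminal V (IAr \<one>\<^sub>W)"
proof -
  obtain f g where f: "f \<in> Hom W \<one>\<^sub>W (disc \<one>)" and g: "g \<in> Hom W (disc \<one>) \<one>\<^sub>W"
    using is_terminal_disc W.is_terminal unfolding is_terminal_def by blast
  have "g \<cdot>\<^sub>W f = Ident W \<one>\<^sub>W" using f g by (intro W.to_terminal) auto
  from arg_cong[OF this, of IF0] arg_cong[OF this, of IF1]
  have gf: "IF0 g \<cdot> IF0 f = Ident V (IOb \<one>\<^sub>W)" "IF1 g \<cdot> IF1 f = Ident V (IAr \<one>\<^sub>W)" by simp_all
  have *: "is_terminal V T" if "h \<in> Hom V T \<one>" "k \<in> Hom V \<one> T" "k \<cdot> h = Ident V T" for T h k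
    unfolding is_terminal_def
  proof (intro conjI ballI)
    show "T \<in> Obj V" using that by auto
    fix X assume X: "X \<in> Obj V"
    show "\<exists>!f. f \<in> Hom V X T"
    proof (rule ex1I)
      show "k \<cdot> bang V X \<in> Hom V X T" using that X by simp
      fix f assume f: "f \<in> Hom V X T"
      have "h \<cdot> f = bang V X" using f that by (intro eq_bang) auto
      moreover have "k \<cdot> (h \<cdot> f) = f" using f that by (simp add: reassoc[OF that(3)])
      ultimately show "f = k \<cdot> bang V X" by simp
    qed
  qed
  show "is_terminal V (IOb \<one>\<^sub>W)" "is_terminal V (IAr \<one>\<^sub>W)"
    using *[OF _ _ gf(1)] *[OF _ _ gf(2)] f g by auto
qed

lemma ex1_terminal_point: "\<exists>!z. z \<in> Hom V \<one> (IOb \<one>\<^sub>W)"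
  using terminal_pointwise(1) by (auto simp: is_terminal_def)

text \<open>
  The global element underlying an element of an internal category. The object of objects of the terminal internal
  category is terminal, but need not be \<open>\<one>\<close> itself.
\<close>

definition pt :: "('o, 'm) ifun \<Rightarrow> 'm" where
  "pt b = IF0 b \<cdot> (THE z. z \<in> Hom V \<one> (IOb \<one>\<^sub>W))"

lemma pt [simp]:
  assumes "b \<in> Arr W" "Dom W b = \<one>\<^sub>W"
  shows "pt b \<in> Arr V" "Dom V (pt b) = \<one>" "Cod V (pt b) = IOb (Cod W b)"
  using theI'[OF ex1_terminal_point] assms by (auto simp: pt_def)

text \<open>The terminal internal category is discrete, so an element is constant at its point and the identity of the point.\<close>

lemma elem_eq:
  assumes "b \<in> Arr W" "Dom W b = \<one>\<^sub>W" "y \<in> Arr V"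
  shows "Cod V y = IOb \<one>\<^sub>W \<Longrightarrow> IF0 b \<cdot> y = pt b \<cdot> bang V (Dom V y)" (is "PROP ?ga")
    "Cod V y = IAr \<one>\<^sub>W \<Longrightarrow> IF1 b \<cdot> y = iid (Cod W b) \<cdot> (pt b \<cdot> bang V (Dom V y))"
proof -
  let ?z = "THE z. z \<in> Hom V \<one> (IOb \<one>\<^sub>W)"
  from theI'[OF ex1_terminal_point] have z: "?z \<in> Arr V" "Dom V ?z = \<one>" "Cod V ?z = IOb \<one>\<^sub>W" by auto
  have main: "IF0 b \<cdot> y = pt b \<cdot> bang V (Dom V y)" if "y \<in> Arr V" "Cod V y = IOb \<one>\<^sub>W" for y
  proof -
    have "y = ?z \<cdot> bang V (Dom V y)"
      by (rule terminal_unique[OF terminal_pointwise(1)]) (use z that in auto)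
    then have "IF0 b \<cdot> y = IF0 b \<cdot> (?z \<cdot> bang V (Dom V y))" by simp
    then show ?thesis using that z assms by (simp add: pt_def)
  qed
  show "PROP ?ga" using main assms by blast
  assume y: "Cod V y = IAr \<one>\<^sub>W"
  have "y = iid \<one>\<^sub>W \<cdot> (isrc \<one>\<^sub>W \<cdot> y)"
    by (rule terminal_unique[OF terminal_pointwise(2)]) (use y assms in auto)
  then have "IF1 b \<cdot> y = IF1 b \<cdot> (iid \<one>\<^sub>W \<cdot> (isrc \<one>\<^sub>W \<cdot> y))" by simp
  then show "IF1 b \<cdot> y = iid (Cod W b) \<cdot> (pt b \<cdot> bang V (Dom V y))"
    using y assms main[of "isrc \<one>\<^sub>W \<cdot> y"] by simp
qed

lemma elem_eqI:
  assumes "b \<in> Hom W \<one>\<^sub>W A" "c \<in> Hom W \<one>\<^sub>W A" "pt b = pt c"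
  shows "b = c"
proof (rule ifun_eqI)
  show "IF0 b = IF0 c" using elem_eq(1)[of b "Ident V (IOb \<one>\<^sub>W)"] elem_eq(1)[of c "Ident V (IOb \<one>\<^sub>W)"] assms by simp
  show "IF1 b = IF1 c" using elem_eq(2)[of b "Ident V (IAr \<one>\<^sub>W)"] elem_eq(2)[of c "Ident V (IAr \<one>\<^sub>W)"] assms by simp
qed (use assms in simp_all)

lemma pt_comp [simp]:
  assumes "b \<in> Arr W" "Dom W b = \<one>\<^sub>W" "F \<in> Arr W" "Dom W F = Cod W b"
  shows "pt (F \<cdot>\<^sub>W b) = IF0 F \<cdot> pt b"
  using theI'[OF ex1_terminal_point] assms by (simp add: pt_def)

text \<open>The inverse of \<open>pt\<close>.\<close>

definition el :: "('o, 'm) icat \<Rightarrow> 'm \<Rightarrow> ('o, 'm) ifun" where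
  "el A a = \<lparr>IDom = \<one>\<^sub>W, ICod = A, IF0 = a \<cdot> bang V (IOb \<one>\<^sub>W), IF1 = iid A \<cdot> (a \<cdot> bang V (IAr \<one>\<^sub>W))\<rparr>"

lemma el:
  assumes "A \<in> Obj W" "a \<in> Hom V \<one> (IOb A)"
  shows "el A a \<in> Hom W \<one>\<^sub>W A" "pt (el A a) = a"
proof -
  show e: "el A a \<in> Hom W \<one>\<^sub>W A" unfolding el_def
    by (rule ifunI) (use assms in simp_all)
  from theI'[OF ex1_terminal_point] show "pt (el A a) = a"
    using assms by (simp add: pt_def el_def)
qed

subsection \<open>Generalized elements of products of internal categories\<close>

text \<open>Pairing of generalized objects (\<open>ip0\<close>) and generalized arrows (\<open>ip1\<close>) of \<open>A\<close> and \<open>B\<close>, as such of the product.\<close>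

definition ip0 :: "('o, 'm) icat \<Rightarrow> ('o, 'm) icat \<Rightarrow> 'm \<Rightarrow> 'm \<Rightarrow> 'm" where
  "ip0 A B = lift (IF0 (pr1 W A B)) (IF0 (pr2 W A B))"

definition ip1 :: "('o, 'm) icat \<Rightarrow> ('o, 'm) icat \<Rightarrow> 'm \<Rightarrow> 'm \<Rightarrow> 'm" where
  "ip1 A B = lift (IF1 (pr1 W A B)) (IF1 (pr2 W A B))"

context
  fixes A B assumes AB [simp]: "A \<in> Obj W" "B \<in> Obj W"
begin

lemmas prd_pointwise = product_pointwise[OF AB W.product[OF AB]]

lemma ip0_ext:
  assumes "h \<in> Arr V" "k \<in> Arr V" "Dom V h = Dom V k" "Cod V h = IOb (prd W A B)" "Cod V k = IOb (prd W A B)"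
    "IF0 (pr1 W A B) \<cdot> h = IF0 (pr1 W A B) \<cdot> k" "IF0 (pr2 W A B) \<cdot> h = IF0 (pr2 W A B) \<cdot> k"
  shows "h = k"
  using product_ext[OF prd_pointwise(1)] assms by blast

lemma ip1_ext:
  assumes "h \<in> Arr V" "k \<in> Arr V" "Dom V h = Dom V k" "Cod V h = IAr (prd W A B)" "Cod V k = IAr (prd W A B)"
    "IF1 (pr1 W A B) \<cdot> h = IF1 (pr1 W A B) \<cdot> k" "IF1 (pr2 W A B) \<cdot> h = IF1 (pr2 W A B) \<cdot> k"
  shows "h = k"
  using product_ext[OF prd_pointwise(2)] assms by blast

lemma ip0_simps [simp]:
  assumes "f \<in> Arr V" "g \<in> Arr V" "Dom V f = Dom V g" "Cod V f = IOb A" "Cod V g = IOb B"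
  shows "ip0 A B f g \<in> Arr V" "Dom V (ip0 A B f g) = Dom V f" "Cod V (ip0 A B f g) = IOb (prd W A B)"
    "IF0 (pr1 W A B) \<cdot> ip0 A B f g = f" "IF0 (pr2 W A B) \<cdot> ip0 A B f g = g"
  using product_lift[OF prd_pointwise(1), of f g] assms by (simp_all add: ip0_def)

lemma ip1_simps [simp]:
  assumes "f \<in> Arr V" "g \<in> Arr V" "Dom V f = Dom V g" "Cod V f = IAr A" "Cod V g = IAr B"
  shows "ip1 A B f g \<in> Arr V" "Dom V (ip1 A B f g) = Dom V f" "Cod V (ip1 A B f g) = IAr (prd W A B)"
    "IF1 (pr1 W A B) \<cdot> ip1 A B f g = f" "IF1 (pr2 W A B) \<cdot> ip1 A B f g = g"
  using product_lift[OF prd_pointwise(2), of f g] assms by (simp_all add: ip1_def)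

lemma ip0_comp [simp]:
  assumes "f \<in> Arr V" "g \<in> Arr V" "Dom V f = Dom V g" "Cod V f = IOb A" "Cod V g = IOb B" "u \<in> Arr V" "Cod V u = Dom V g"
  shows "ip0 A B f g \<cdot> u = ip0 A B (f \<cdot> u) (g \<cdot> u)"
  using assms reassoc[OF ip0_simps(4), of f g u] reassoc[OF ip0_simps(5), of f g u] by - (rule ip0_ext; simp)

lemma ip1_comp [simp]:
  assumes "f \<in> Arr V" "g \<in> Arr V" "Dom V f = Dom V g" "Cod V f = IAr A" "Cod V g = IAr B" "u \<in> Arr V" "Cod V u = Dom V g"
  shows "ip1 A B f g \<cdot> u = ip1 A B (f \<cdot> u) (g \<cdot> u)"
  using assms reassoc[OF ip1_simps(4), of f g u] reassoc[OF ip1_simps(5), of f g u] by - (rule ip1_ext; simp)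

lemma ip_eta [simp]:
  "h \<in> Arr V \<Longrightarrow> Cod V h = IOb (prd W A B) \<Longrightarrow> ip0 A B (IF0 (pr1 W A B) \<cdot> h) (IF0 (pr2 W A B) \<cdot> h) = h"
  "h \<in> Arr V \<Longrightarrow> Cod V h = IAr (prd W A B) \<Longrightarrow> ip1 A B (IF1 (pr1 W A B) \<cdot> h) (IF1 (pr2 W A B) \<cdot> h) = h"
  "ip0 A B (IF0 (pr1 W A B)) (IF0 (pr2 W A B)) = Ident V (IOb (prd W A B))"
  "ip1 A B (IF1 (pr1 W A B)) (IF1 (pr2 W A B)) = Ident V (IAr (prd W A B))"
  by (rule ip0_ext ip1_ext; simp)+

lemma src_ip1 [simp]:
  assumes "f \<in> Arr V" "g \<in> Arr V" "Dom V f = Dom V g" "Cod V f = IAr A" "Cod V g = IAr B"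
  shows "isrc (prd W A B) \<cdot> ip1 A B f g = ip0 A B (isrc A \<cdot> f) (isrc B \<cdot> g)"
    "itgt (prd W A B) \<cdot> ip1 A B f g = ip0 A B (itgt A \<cdot> f) (itgt B \<cdot> g)"
  using assms ifun_comp_simps(1)[of "pr1 W A B" "ip1 A B f g"] ifun_comp_simps(1)[of "pr2 W A B" "ip1 A B f g"]
    ifun_comp_simps(2)[of "pr1 W A B" "ip1 A B f g"] ifun_comp_simps(2)[of "pr2 W A B" "ip1 A B f g"]
  by - (rule ip0_ext; simp del: ifun_comp_simps)+

lemma id_ip0 [simp]:
  assumes "f \<in> Arr V" "g \<in> Arr V" "Dom V f = Dom V g" "Cod V f = IOb A" "Cod V g = IOb B"
  shows "iid (prd W A B) \<cdot> ip0 A B f g = ip1 A B (iid A \<cdot> f) (iid B \<cdot> g)"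
  using assms by - (rule ip1_ext; simp)

lemma igcmp_ip1 [simp]:
  assumes "f \<in> Arr V" "g \<in> Arr V" "Dom V f = Dom V g" "Cod V f = IAr A" "Cod V g = IAr B"
    "f' \<in> Arr V" "g' \<in> Arr V" "Dom V f' = Dom V g'" "Cod V f' = IAr A" "Cod V g' = IAr B"
    "itgt A \<cdot> f = isrc A \<cdot> f'" "itgt B \<cdot> g = isrc B \<cdot> g'"
  shows "igcmp V (prd W A B) (ip1 A B f g) (ip1 A B f' g') = ip1 A B (igcmp V A f f') (igcmp V B g g')"
  using assms by - (rule ip1_ext; simp)

end

lemma IF_pair [simp]:
  assumes "F \<in> Arr W" "G \<in> Arr W" "Dom W F = Dom W G" "Cod W F = A" "Cod W G = B"
  shows "IF0 (pair W F G) = ip0 A B (IF0 F) (IF0 G)" "IF1 (pair W F G) = ip1 A B (IF1 F) (IF1 G)"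
proof -
  have O [simp]: "A \<in> Obj W" "B \<in> Obj W" using assms by auto
  have e: "pr1 W A B \<cdot>\<^sub>W pair W F G = F" "pr2 W A B \<cdot>\<^sub>W pair W F G = G" using assms by simp_all
  have "IF0 (pr1 W A B) \<cdot> IF0 (pair W F G) = IF0 F" "IF0 (pr2 W A B) \<cdot> IF0 (pair W F G) = IF0 G"
    "IF1 (pr1 W A B) \<cdot> IF1 (pair W F G) = IF1 F" "IF1 (pr2 W A B) \<cdot> IF1 (pair W F G) = IF1 G"
    using arg_cong[OF e(1), of IF0] arg_cong[OF e(2), of IF0] arg_cong[OF e(1), of IF1] arg_cong[OF e(2), of IF1] by simp_all
  then show "IF0 (pair W F G) = ip0 A B (IF0 F) (IF0 G)" "IF1 (pair W F G) = ip1 A B (IF1 F) (IF1 G)"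
    using assms by - (rule ip0_ext[OF O] ip1_ext[OF O]; simp)+
qed

end

section \<open>Exponentials of internal categories\<close>

context ccc_pb
begin

subsection \<open>Representable presheaves\<close>

text \<open>
  A presheaf on \<open>V\<close> is given by a predicate \<open>P X x\<close>, read as \<open>x\<close> being an element over \<open>X\<close>,
  and a restriction operation. Subpresheaves cut out by equations between morphisms are then
  conjunctions.
\<close>

definition presheaf :: "('o \<Rightarrow> 'a \<Rightarrow> bool) \<Rightarrow> ('m \<Rightarrow> 'a \<Rightarrow> 'a) \<Rightarrow> bool" where
  "presheaf P r \<longleftrightarrow> (\<forall>X x h. P X x \<longrightarrow> h \<in> Arr V \<longrightarrow> Cod V h = X \<longrightarrow> P (Dom V h) (r h x)) \<and>
     (\<forall>X x h k. P X x \<longrightarrow> h \<in> Arr V \<longrightarrow> Cod V h = X \<longrightarrow> k \<in> Arr V \<longrightarrow> Cod V k = Dom V h \<longrightarrow> r (h \<cdot> k) x = r k (r h x))"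

text \<open>The object \<open>R\<close> represents the presheaf, with universal element \<open>u\<close>.\<close>

definition represented :: "('o \<Rightarrow> 'a \<Rightarrow> bool) \<Rightarrow> ('m \<Rightarrow> 'a \<Rightarrow> 'a) \<Rightarrow> 'o \<Rightarrow> 'a \<Rightarrow> bool" where
  "represented P r R u \<longleftrightarrow> presheaf P r \<and> R \<in> Obj V \<and> P R u \<and>
     (\<forall>X x. P X x \<longrightarrow> (\<exists>h. h \<in> Hom V X R \<and> r h u = x)) \<and>
     (\<forall>h k. h \<in> Arr V \<longrightarrow> k \<in> Arr V \<longrightarrow> Dom V h = Dom V k \<longrightarrow> Cod V h = R \<longrightarrow> Cod V k = R \<longrightarrow> r h u = r k u \<longrightarrow> h = k)"

lemma presheafD:
  assumes "presheaf P r" "P X x" "h \<in> Arr V" "Cod V h = X"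
  shows "P (Dom V h) (r h x)" "k \<in> Arr V \<Longrightarrow> Cod V k = Dom V h \<Longrightarrow> r (h \<cdot> k) x = r k (r h x)"
  using assms unfolding presheaf_def by blast+

lemma representedD:
  assumes "represented P r R u"
  shows "presheaf P r" "R \<in> Obj V" "P R u" "P X x \<Longrightarrow> \<exists>h. h \<in> Hom V X R \<and> r h u = x"
    "\<lbrakk>h \<in> Arr V; k \<in> Arr V; Dom V h = Dom V k; Cod V h = R; Cod V k = R; r h u = r k u\<rbrakk> \<Longrightarrow> h = k"
  using assms unfolding represented_def by blast+

text \<open>Restriction of a family \<open>X \<times> K \<rightarrow> M\<close> along a morphism \<open>h\<close> into \<open>X\<close>.\<close>

definition res :: "'o \<Rightarrow> 'm \<Rightarrow> 'm \<Rightarrow> 'm" where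
  "res K h F = F \<cdot> pair V (h \<cdot> pr1 V (Dom V h) K) (pr2 V (Dom V h) K)"

lemma res_simps [simp]:
  assumes "K \<in> Obj V" "h \<in> Arr V" "F \<in> Arr V" "Dom V F = prd V (Cod V h) K"
  shows "res K h F \<in> Arr V" "Dom V (res K h F) = prd V (Dom V h) K" "Cod V (res K h F) = Cod V F"
    "\<lbrakk>x \<in> Arr V; y \<in> Arr V; Dom V x = Dom V y; Cod V x = Dom V h; Cod V y = K\<rbrakk> \<Longrightarrow> res K h F \<cdot> pair V x y = F \<cdot> pair V (h \<cdot> x) y"
  using assms by (simp_all add: res_def)

lemma res_Ident: "\<lbrakk>K \<in> Obj V; X \<in> Obj V; F \<in> Arr V; Dom V F = prd V X K\<rbrakk> \<Longrightarrow> res K (Ident V X) F = F"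
  by (simp add: res_def)

lemma res_comp:
  assumes "K \<in> Obj V" "h \<in> Arr V" "F \<in> Arr V" "Dom V F = prd V (Cod V h) K" "k \<in> Arr V" "Cod V k = Dom V h"
  shows "res K (h \<cdot> k) F = res K k (res K h F)"
  using assms by (simp add: res_def)

lemma comp_res:
  assumes "K \<in> Obj V" "h \<in> Arr V" "F \<in> Arr V" "Dom V F = prd V (Cod V h) K" "g \<in> Arr V" "Dom V g = Cod V F"
  shows "res K h (g \<cdot> F) = g \<cdot> res K h F"
  using assms by (simp add: res_def)

lemma represented_hom: "K \<in> Obj V \<Longrightarrow> M \<in> Obj V \<Longrightarrow> \<exists>R u. represented (\<lambda>X F. X \<in> Obj V \<and> F \<in> Hom V (prd V X K) M) (res K) R u"
proof (intro exI)
  assume KM: "K \<in> Obj V" "M \<in> Obj V"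
  have ru: "res K h (evl V K M) = evl V K M \<cdot> pair V (h \<cdot> pr1 V (Dom V h) K) (pr2 V (Dom V h) K)" for h
    by (simp add: res_def)
  show "represented (\<lambda>X F. X \<in> Obj V \<and> F \<in> Hom V (prd V X K) M) (res K) (expo V K M) (evl V K M)"
    unfolding represented_def
  proof (intro conjI allI impI)
    show "presheaf (\<lambda>X F. X \<in> Obj V \<and> F \<in> Hom V (prd V X K) M) (res K)"
      unfolding presheaf_def using KM by (auto simp: res_comp)
    show "\<exists>h. h \<in> Hom V X (expo V K M) \<and> res K h (evl V K M) = F" if "X \<in> Obj V \<and> F \<in> Hom V (prd V X K) M" for X F
      using KM that by (intro exI[of _ "transp V X K M F"]) (simp add: ru)
    show "h = k" if "h \<in> Arr V" "k \<in> Arr V" "Dom V h = Dom V k" "Cod V h = expo V K M" "Cod V k = expo V K M"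
      "res K h (evl V K M) = res K k (evl V K M)" for h k
      by (rule expo_ext[of h k "Dom V k" K M]) (use that KM in \<open>simp_all add: ru\<close>)
  qed (use KM in auto)
qed

lemma represented_yoneda: "R \<in> Obj V \<Longrightarrow> represented (\<lambda>X f. f \<in> Hom V X R) (\<lambda>h f. f \<cdot> h) R (Ident V R)"
  by (auto simp: represented_def presheaf_def)

lemma represented_prod:
  assumes "represented P r R u" "represented Q q S v"
  shows "represented (\<lambda>X z. P X (fst z) \<and> Q X (snd z)) (\<lambda>h z. (r h (fst z), q h (snd z)))
    (prd V R S) (r (pr1 V R S) u, q (pr2 V R S) v)"
proof -
  note D = representedD[OF assms(1)] and E = representedD[OF assms(2)]
  have p: "P (prd V R S) (r (pr1 V R S) u)" using presheafD(1)[OF D(1,3), of "pr1 V R S"] D(2) E(2) by simp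
  have q: "Q (prd V R S) (q (pr2 V R S) v)" using presheafD(1)[OF E(1,3), of "pr2 V R S"] D(2) E(2) by simp
  have pk: "r (pr1 V R S \<cdot> k) u = r k (r (pr1 V R S) u)" if "k \<in> Arr V" "Cod V k = prd V R S" for k
    using presheafD(2)[OF D(1,3), of "pr1 V R S" k] D(2) E(2) that by simp
  have qk: "q (pr2 V R S \<cdot> k) v = q k (q (pr2 V R S) v)" if "k \<in> Arr V" "Cod V k = prd V R S" for k
    using presheafD(2)[OF E(1,3), of "pr2 V R S" k] D(2) E(2) that by simp
  show ?thesis
    unfolding represented_def fst_conv snd_conv
  proof (intro conjI allI impI)
    show "presheaf (\<lambda>X z. P X (fst z) \<and> Q X (snd z)) (\<lambda>h z. (r h (fst z), q h (snd z)))"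
      using D(1) E(1) unfolding presheaf_def by auto
    show "prd V R S \<in> Obj V" using D(2) E(2) by simp
    show "\<exists>h. h \<in> Hom V X (prd V R S) \<and> (r h (r (pr1 V R S) u), q h (q (pr2 V R S) v)) = z"
      if z: "P X (fst z) \<and> Q X (snd z)" for X z
    proof -
      obtain h where h: "h \<in> Hom V X R" "r h u = fst z" using D(4)[of X "fst z"] z by blast
      obtain k where k: "k \<in> Hom V X S" "q k v = snd z" using E(4)[of X "snd z"] z by blast
      show ?thesis
        using h k D(2) E(2) pk[of "pair V h k"] qk[of "pair V h k"] by (intro exI[of _ "pair V h k"]) (simp add: prod_eq_iff)
    qed
    show "h = k" if "h \<in> Arr V" "k \<in> Arr V" "Dom V h = Dom V k" "Cod V h = prd V R S" "Cod V k = prd V R S"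
      "(r h (r (pr1 V R S) u), q h (q (pr2 V R S) v)) = (r k (r (pr1 V R S) u), q k (q (pr2 V R S) v))" for h k
    proof -
      have "r (pr1 V R S \<cdot> h) u = r (pr1 V R S \<cdot> k) u" "q (pr2 V R S \<cdot> h) v = q (pr2 V R S \<cdot> k) v"
        using that pk[of h] pk[of k] qk[of h] qk[of k] by simp_all
      then have "pr1 V R S \<cdot> h = pr1 V R S \<cdot> k" "pr2 V R S \<cdot> h = pr2 V R S \<cdot> k"
        using D(5)[of "pr1 V R S \<cdot> h" "pr1 V R S \<cdot> k"] E(5)[of "pr2 V R S \<cdot> h" "pr2 V R S \<cdot> k"] D(2) E(2) that(1-5) by simp_all
      then show ?thesis using that(1-5) D(2) E(2) by - (rule prod_ext[of h k R S])
    qed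
  qed (rule p q)+
qed

text \<open>
  The subpresheaf where two natural families of morphisms \<open>X \<times> K \<rightarrow> M\<close> agree is represented by the
  equalizer of the transposed families, formed as a pullback.
\<close>

lemma represented_equalizer:
  assumes rep: "\<exists>R u. represented P r R u" and KM: "K \<in> Obj V" "M \<in> Obj V"
    and \<alpha>: "\<And>X x. P X x \<Longrightarrow> \<alpha> X x \<in> Hom V (prd V X K) M" "\<And>X x h. \<lbrakk>P X x; h \<in> Arr V; Cod V h = X\<rbrakk> \<Longrightarrow> \<alpha> (Dom V h) (r h x) = res K h (\<alpha> X x)"
    and \<beta>: "\<And>X x. P X x \<Longrightarrow> \<beta> X x \<in> Hom V (prd V X K) M" "\<And>X x h. \<lbrakk>P X x; h \<in> Arr V; Cod V h = X\<rbrakk> \<Longrightarrow> \<beta> (Dom V h) (r h x) = res K h (\<beta> X x)"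
  shows "\<exists>R u. represented (\<lambda>X x. P X x \<and> \<alpha> X x = \<beta> X x) r R u"
proof -
  obtain R u where Ru: "represented P r R u" using rep by blast
  note D = representedD[OF Ru]
  note [simp] = D(2) KM
  have [simp]: "\<alpha> R u \<in> Arr V" "Dom V (\<alpha> R u) = prd V R K" "Cod V (\<alpha> R u) = M" "\<beta> R u \<in> Arr V" "Dom V (\<beta> R u) = prd V R K" "Cod V (\<beta> R u) = M"
    using \<alpha>(1)[OF D(3)] \<beta>(1)[OF D(3)] by auto
  define a where "a = transp V R K M (\<alpha> R u)"
  define b where "b = transp V R K M (\<beta> R u)"
  have ab [simp]: "a \<in> Arr V" "Dom V a = R" "Cod V a = expo V K M" "b \<in> Arr V" "Dom V b = R" "Cod V b = expo V K M"
    by (simp_all add: a_def b_def)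
  have key: "a \<cdot> h = b \<cdot> h \<longleftrightarrow> \<alpha> (Dom V h) (r h u) = \<beta> (Dom V h) (r h u)" if h: "h \<in> Arr V" "Cod V h = R" for h
  proof -
    have A: "\<alpha> (Dom V h) (r h u) = evl V K M \<cdot> pair V ((a \<cdot> h) \<cdot> pr1 V (Dom V h) K) (pr2 V (Dom V h) K)"
      using h by (simp add: \<alpha>(2)[OF D(3)] res_def a_def)
    have B: "\<beta> (Dom V h) (r h u) = evl V K M \<cdot> pair V ((b \<cdot> h) \<cdot> pr1 V (Dom V h) K) (pr2 V (Dom V h) K)"
      using h by (simp add: \<beta>(2)[OF D(3)] res_def b_def)
    show ?thesis
    proof
      assume "\<alpha> (Dom V h) (r h u) = \<beta> (Dom V h) (r h u)"
      then show "a \<cdot> h = b \<cdot> h"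
        unfolding A B using h by - (rule expo_ext[of _ _ "Dom V h" K M]; simp)
    qed (simp only: A B)
  qed
  define f where "f = pair V a (Ident V R)"
  define g where "g = pair V b (Ident V R)"
  have fg [simp]: "f \<in> Arr V" "g \<in> Arr V" "Dom V f = R" "Dom V g = R" "Cod V f = prd V (expo V K M) R" "Cod V g = prd V (expo V K M) R"
    by (simp_all add: f_def g_def)
  define e where "e = pb1 V f g"
  have e: "e \<in> Arr V" "Dom V e = pb V f g" "Cod V e = R" "pb2 V f g = e" "a \<cdot> e = b \<cdot> e"
  proof -
    have c: "f \<cdot> pb1 V f g = g \<cdot> pb2 V f g" by (simp add: pb_commutes)
    have "pr1 V (expo V K M) R \<cdot> f = a" "pr2 V (expo V K M) R \<cdot> f = Ident V R"
      "pr1 V (expo V K M) R \<cdot> g = b" "pr2 V (expo V K M) R \<cdot> g = Ident V R"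
      by (simp_all add: f_def g_def)
    note this[THEN reassoc]
    then have p: "pb1 V f g = pb2 V f g" and q: "a \<cdot> pb1 V f g = b \<cdot> pb2 V f g"
      using arg_cong[OF c, of "\<lambda>x. pr2 V (expo V K M) R \<cdot> x"] arg_cong[OF c, of "\<lambda>x. pr1 V (expo V K M) R \<cdot> x"]
      by simp_all
    show "e \<in> Arr V" "Dom V e = pb V f g" "Cod V e = R" "pb2 V f g = e" "a \<cdot> e = b \<cdot> e"
      using p q by (simp_all add: e_def)
  qed
  have r: "r (e \<cdot> k) u = r k (r e u)" if "k \<in> Arr V" "Cod V k = pb V f g" for k
    using presheafD(2)[OF D(1,3) e(1,3)] that e by simp
  have "represented (\<lambda>X x. P X x \<and> \<alpha> X x = \<beta> X x) r (pb V f g) (r e u)"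
    unfolding represented_def
  proof (intro conjI allI impI)
    show "presheaf (\<lambda>X x. P X x \<and> \<alpha> X x = \<beta> X x) r"
      unfolding presheaf_def
    proof (intro conjI allI impI)
      show "P (Dom V h) (r h x)" if "P X x \<and> \<alpha> X x = \<beta> X x" "h \<in> Arr V" "Cod V h = X" for X x h
        using presheafD[OF D(1)] that by blast
      show "\<alpha> (Dom V h) (r h x) = \<beta> (Dom V h) (r h x)" if "P X x \<and> \<alpha> X x = \<beta> X x" "h \<in> Arr V" "Cod V h = X" for X x h
        using \<alpha>(2) \<beta>(2) that by metis
      show "r (h \<cdot> k) x = r k (r h x)" if "P X x \<and> \<alpha> X x = \<beta> X x" "h \<in> Arr V" "Cod V h = X" "k \<in> Arr V" "Cod V k = Dom V h" for X x h k
        using presheafD[OF D(1)] that by blast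
    qed
    show "pb V f g \<in> Obj V" by simp
    show "P (pb V f g) (r e u)" using presheafD(1)[OF D(1,3) e(1,3)] e(2) by simp
    show "\<alpha> (pb V f g) (r e u) = \<beta> (pb V f g) (r e u)" using key[OF e(1,3)] e(2,5) by simp
    show "\<exists>h. h \<in> Hom V X (pb V f g) \<and> r h (r e u) = x" if "P X x \<and> \<alpha> X x = \<beta> X x" for X x
    proof -
      obtain h where h: "h \<in> Hom V X R" "r h u = x" using D(4) \<open>P X x \<and> \<alpha> X x = \<beta> X x\<close> by blast
      then have ah: "a \<cdot> h = b \<cdot> h" using key[of h] that by simp
      have fh: "f \<cdot> h = g \<cdot> h" using h ah by (simp add: f_def g_def)
      define k where "k = pb_pair V f g h h"
      have k: "k \<in> Arr V" "Dom V k = X" "Cod V k = pb V f g" "e \<cdot> k = h" using h fh by (simp_all add: k_def e_def)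
      then have "r k (r e u) = x" using r[of k] h(2) by simp
      then show ?thesis using k by auto
    qed
    show "h = k" if hk: "h \<in> Arr V" "k \<in> Arr V" "Dom V h = Dom V k" "Cod V h = pb V f g" "Cod V k = pb V f g" "r h (r e u) = r k (r e u)" for h k
    proof -
      have "e \<cdot> h = e \<cdot> k" using D(5)[of "e \<cdot> h" "e \<cdot> k"] r hk e by simp
      then show ?thesis using hk e by (intro pb_ext[of h k f g]) (simp_all add: e_def)
    qed
  qed
  then show ?thesis by blast
qed

lemma IF1_ip1_id [simp]:
  assumes "E \<in> Obj W" "A \<in> Obj W" "F \<in> Arr W" "Dom W F = prd W E A"
    and "x \<in> Arr V" "y \<in> Arr V" "Dom V x = Dom V y" "Cod V x = IOb E" "Cod V y = IOb A"
  shows "IF1 F \<cdot> ip1 E A (iid E \<cdot> x) (iid A \<cdot> y) = iid (Cod W F) \<cdot> (IF0 F \<cdot> ip0 E A x y)"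
  using assms by (simp add: id_ip0[symmetric] del: id_ip0)

subsection \<open>Families of internal functors and of natural transformations\<close>

text \<open>
  A family of internal functors \<open>A \<rightarrow> B\<close> indexed by \<open>X\<close>: the axioms of an internal functor, fibrewise. The conjunction is
  nested to the left because the representing object is built by one equalizer after the other.
\<close>

definition ffam :: "('o, 'm) icat \<Rightarrow> ('o, 'm) icat \<Rightarrow> 'o \<Rightarrow> 'm \<Rightarrow> 'm \<Rightarrow> bool" where
  "ffam A B X F0 F1 \<longleftrightarrow>
     (((((X \<in> Obj V \<and> F0 \<in> Hom V (prd V X (IOb A)) (IOb B)) \<and> (X \<in> Obj V \<and> F1 \<in> Hom V (prd V X (IAr A)) (IAr B))) \<and>
     isrc B \<cdot> F1 = F0 \<cdot> pair V (pr1 V X (IAr A)) (isrc A \<cdot> pr2 V X (IAr A))) \<and>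
     itgt B \<cdot> F1 = F0 \<cdot> pair V (pr1 V X (IAr A)) (itgt A \<cdot> pr2 V X (IAr A))) \<and>
     F1 \<cdot> pair V (pr1 V X (IOb A)) (iid A \<cdot> pr2 V X (IOb A)) = iid B \<cdot> F0) \<and>
     (let T = pb V (itgt A) (isrc A); p = pb1 V (itgt A) (isrc A); q = pb2 V (itgt A) (isrc A) in
       F1 \<cdot> pair V (pr1 V X T) (icmp A \<cdot> pr2 V X T) =
       igcmp V B (F1 \<cdot> pair V (pr1 V X T) (p \<cdot> pr2 V X T)) (F1 \<cdot> pair V (pr1 V X T) (q \<cdot> pr2 V X T)))"

text \<open>A family of internal natural transformations, between two families of internal functors, given by its components.\<close>

definition nfam :: "('o, 'm) icat \<Rightarrow> ('o, 'm) icat \<Rightarrow> 'o \<Rightarrow> 'm \<Rightarrow> 'm \<Rightarrow> 'm \<Rightarrow> 'm \<Rightarrow> 'm \<Rightarrow> bool" where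
  "nfam A B X F0 F1 G0 G1 \<alpha> \<longleftrightarrow> \<alpha> \<in> Hom V (prd V X (IOb A)) (IAr B) \<and> isrc B \<cdot> \<alpha> = F0 \<and> itgt B \<cdot> \<alpha> = G0 \<and>
     igcmp V B F1 (\<alpha> \<cdot> pair V (pr1 V X (IAr A)) (itgt A \<cdot> pr2 V X (IAr A))) =
     igcmp V B (\<alpha> \<cdot> pair V (pr1 V X (IAr A)) (isrc A \<cdot> pr2 V X (IAr A))) G1"

context
  fixes A B assumes AB [simp]: "A \<in> Obj W" "B \<in> Obj W"
begin

lemma ffamD:
  assumes "ffam A B X F0 F1"
  shows "X \<in> Obj V" "F0 \<in> Arr V" "Dom V F0 = prd V X (IOb A)" "Cod V F0 = IOb B"
    "F1 \<in> Arr V" "Dom V F1 = prd V X (IAr A)" "Cod V F1 = IAr B"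
  using assms unfolding ffam_def by simp_all

lemma ffam_elem:
  assumes F: "ffam A B X F0 F1" and x: "x \<in> Arr V" "f \<in> Arr V" "Dom V x = Dom V f" "Cod V x = X"
  shows "Cod V f = IAr A \<Longrightarrow> isrc B \<cdot> (F1 \<cdot> pair V x f) = F0 \<cdot> pair V x (isrc A \<cdot> f)"
    "Cod V f = IAr A \<Longrightarrow> itgt B \<cdot> (F1 \<cdot> pair V x f) = F0 \<cdot> pair V x (itgt A \<cdot> f)"
    "Cod V f = IOb A \<Longrightarrow> F1 \<cdot> pair V x (iid A \<cdot> f) = iid B \<cdot> (F0 \<cdot> pair V x f)"
    "\<lbrakk>Cod V f = IAr A; g \<in> Arr V; Cod V g = IAr A; itgt A \<cdot> f = isrc A \<cdot> g\<rbrakk> \<Longrightarrow>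
      F1 \<cdot> pair V x (igcmp V A f g) = igcmp V B (F1 \<cdot> pair V x f) (F1 \<cdot> pair V x g)"
proof -
  note [simp] = ffamD[OF F]
  let ?T = "pb V (itgt A) (isrc A)" and ?p = "pb1 V (itgt A) (isrc A)" and ?q = "pb2 V (itgt A) (isrc A)"
  have s: "isrc B \<cdot> F1 = F0 \<cdot> pair V (pr1 V X (IAr A)) (isrc A \<cdot> pr2 V X (IAr A))"
    and t: "itgt B \<cdot> F1 = F0 \<cdot> pair V (pr1 V X (IAr A)) (itgt A \<cdot> pr2 V X (IAr A))"
    and i: "F1 \<cdot> pair V (pr1 V X (IOb A)) (iid A \<cdot> pr2 V X (IOb A)) = iid B \<cdot> F0"
    and c: "F1 \<cdot> pair V (pr1 V X ?T) (icmp A \<cdot> pr2 V X ?T) =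
       igcmp V B (F1 \<cdot> pair V (pr1 V X ?T) (?p \<cdot> pr2 V X ?T)) (F1 \<cdot> pair V (pr1 V X ?T) (?q \<cdot> pr2 V X ?T))"
    using F unfolding ffam_def Let_def by blast+
  show S: "isrc B \<cdot> (F1 \<cdot> pair V x f) = F0 \<cdot> pair V x (isrc A \<cdot> f)" if "Cod V f = IAr A"
    using reassoc[OF s, of "pair V x f"] x that by simp
  show "itgt B \<cdot> (F1 \<cdot> pair V x f) = F0 \<cdot> pair V x (itgt A \<cdot> f)" if "Cod V f = IAr A"
    using reassoc[OF t, of "pair V x f"] x that by simp
  show "F1 \<cdot> pair V x (iid A \<cdot> f) = iid B \<cdot> (F0 \<cdot> pair V x f)" if "Cod V f = IOb A"
    using arg_cong[OF i, of "\<lambda>h. h \<cdot> pair V x f"] x that by simp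
  have s': "isrc B \<cdot> (F1 \<cdot> pair V x f) = F0 \<cdot> pair V x (isrc A \<cdot> f)" if "x \<in> Arr V" "f \<in> Arr V" "Dom V x = Dom V f" "Cod V x = X" "Cod V f = IAr A" for x f
    using reassoc[OF s, of "pair V x f"] that by simp
  have t': "itgt B \<cdot> (F1 \<cdot> pair V x f) = F0 \<cdot> pair V x (itgt A \<cdot> f)" if "x \<in> Arr V" "f \<in> Arr V" "Dom V x = Dom V f" "Cod V x = X" "Cod V f = IAr A" for x f
    using reassoc[OF t, of "pair V x f"] that by simp
  show "F1 \<cdot> pair V x (igcmp V A f g) = igcmp V B (F1 \<cdot> pair V x f) (F1 \<cdot> pair V x g)"
    if f: "Cod V f = IAr A" "g \<in> Arr V" "Cod V g = IAr A" "itgt A \<cdot> f = isrc A \<cdot> g"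
  proof -
    have d: "Dom V f = Dom V g" using f x by (intro Dom_eqI[OF f(4)]) auto
    have pq: "itgt A \<cdot> (?p \<cdot> pr2 V X ?T) = isrc A \<cdot> (?q \<cdot> pr2 V X ?T)"
      using reassoc[OF pb_commutes[of "itgt A" "isrc A"], of "pr2 V X ?T"] by simp
    have z: "pb_pair V (itgt A) (isrc A) f g \<in> Arr V" "Dom V (pb_pair V (itgt A) (isrc A) f g) = Dom V f" using f x d by simp_all
    from arg_cong[OF c, of "\<lambda>h. h \<cdot> pair V x (pb_pair V (itgt A) (isrc A) f g)"]
    show ?thesis using f x d z s' t' pq by (simp add: igcmp_def[of V A])
  qed
qed

lemma ffamI:
  assumes T: "X \<in> Obj V" "F0 \<in> Hom V (prd V X (IOb A)) (IOb B)" "F1 \<in> Hom V (prd V X (IAr A)) (IAr B)"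
    and st: "\<And>x f. \<lbrakk>x \<in> Arr V; f \<in> Arr V; Dom V x = Dom V f; Cod V x = X; Cod V f = IAr A\<rbrakk> \<Longrightarrow>
      isrc B \<cdot> (F1 \<cdot> pair V x f) = F0 \<cdot> pair V x (isrc A \<cdot> f) \<and> itgt B \<cdot> (F1 \<cdot> pair V x f) = F0 \<cdot> pair V x (itgt A \<cdot> f)"
    and i: "\<And>x f. \<lbrakk>x \<in> Arr V; f \<in> Arr V; Dom V x = Dom V f; Cod V x = X; Cod V f = IOb A\<rbrakk> \<Longrightarrow>
      F1 \<cdot> pair V x (iid A \<cdot> f) = iid B \<cdot> (F0 \<cdot> pair V x f)"
    and c: "\<And>x f g. \<lbrakk>x \<in> Arr V; f \<in> Arr V; g \<in> Arr V; Dom V x = Dom V f; Dom V f = Dom V g; Cod V x = X; Cod V f = IAr A; Cod V g = IAr A; itgt A \<cdot> f = isrc A \<cdot> g\<rbrakk> \<Longrightarrow> F1 \<cdot> pair V x (igcmp V A f g) = igcmp V B (F1 \<cdot> pair V x f) (F1 \<cdot> pair V x g)"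
  shows "ffam A B X F0 F1"
proof -
  note [simp] = T(1)
  have [simp]: "F0 \<in> Arr V" "Dom V F0 = prd V X (IOb A)" "Cod V F0 = IOb B" "F1 \<in> Arr V" "Dom V F1 = prd V X (IAr A)" "Cod V F1 = IAr B"
    using T by simp_all
  let ?T = "pb V (itgt A) (isrc A)" and ?p = "pb1 V (itgt A) (isrc A)" and ?q = "pb2 V (itgt A) (isrc A)"
  have pq: "itgt A \<cdot> (?p \<cdot> pr2 V X ?T) = isrc A \<cdot> (?q \<cdot> pr2 V X ?T)"
    using reassoc[OF pb_commutes[of "itgt A" "isrc A"], of "pr2 V X ?T"] by simp
  have "igcmp V A (?p \<cdot> pr2 V X ?T) (?q \<cdot> pr2 V X ?T) = igcmp V A ?p ?q \<cdot> pr2 V X ?T"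
    by (simp add: pb_commutes)
  also have "\<dots> = icmp A \<cdot> pr2 V X ?T" by (subst igcmp_pb) simp_all
  finally have e: "igcmp V A (?p \<cdot> pr2 V X ?T) (?q \<cdot> pr2 V X ?T) = icmp A \<cdot> pr2 V X ?T" .
  show ?thesis
    unfolding ffam_def Let_def
    using st[of "pr1 V X (IAr A)" "pr2 V X (IAr A)"] i[of "pr1 V X (IOb A)" "pr2 V X (IOb A)"]
      c[of "pr1 V X ?T" "?p \<cdot> pr2 V X ?T" "?q \<cdot> pr2 V X ?T"] pq e by simp
qed

lemma nfamD:
  assumes "nfam A B X F0 F1 G0 G1 \<alpha>"
  shows "\<alpha> \<in> Arr V" "Dom V \<alpha> = prd V X (IOb A)" "Cod V \<alpha> = IAr B" "isrc B \<cdot> \<alpha> = F0" "itgt B \<cdot> \<alpha> = G0"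
  using assms unfolding nfam_def by simp_all

lemma nfam_elem:
  assumes F: "ffam A B X F0 F1" and G: "ffam A B X G0 G1" and \<alpha>: "nfam A B X F0 F1 G0 G1 \<alpha>"
    and x: "x \<in> Arr V" "f \<in> Arr V" "Dom V x = Dom V f" "Cod V x = X"
  shows "Cod V f = IOb A \<Longrightarrow> isrc B \<cdot> (\<alpha> \<cdot> pair V x f) = F0 \<cdot> pair V x f"
    "Cod V f = IOb A \<Longrightarrow> itgt B \<cdot> (\<alpha> \<cdot> pair V x f) = G0 \<cdot> pair V x f"
    "Cod V f = IAr A \<Longrightarrow> igcmp V B (F1 \<cdot> pair V x f) (\<alpha> \<cdot> pair V x (itgt A \<cdot> f)) = igcmp V B (\<alpha> \<cdot> pair V x (isrc A \<cdot> f)) (G1 \<cdot> pair V x f)"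
proof -
  note [simp] = ffamD[OF F] ffamD[OF G] nfamD(1-3)[OF \<alpha>]
  have s: "isrc B \<cdot> (\<alpha> \<cdot> pair V x f) = F0 \<cdot> pair V x f" if "x \<in> Arr V" "f \<in> Arr V" "Dom V x = Dom V f" "Cod V x = X" "Cod V f = IOb A" for x f
    using reassoc[OF nfamD(4)[OF \<alpha>], of "pair V x f"] that by simp
  have t: "itgt B \<cdot> (\<alpha> \<cdot> pair V x f) = G0 \<cdot> pair V x f" if "x \<in> Arr V" "f \<in> Arr V" "Dom V x = Dom V f" "Cod V x = X" "Cod V f = IOb A" for x f
    using reassoc[OF nfamD(5)[OF \<alpha>], of "pair V x f"] that by simp
  show "isrc B \<cdot> (\<alpha> \<cdot> pair V x f) = F0 \<cdot> pair V x f" "itgt B \<cdot> (\<alpha> \<cdot> pair V x f) = G0 \<cdot> pair V x f" if "Cod V f = IOb A"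
    using s t x that by simp_all
  let ?x = "pr1 V X (IAr A)" and ?f = "pr2 V X (IAr A)"
  have e: "igcmp V B F1 (\<alpha> \<cdot> pair V ?x (itgt A \<cdot> ?f)) = igcmp V B (\<alpha> \<cdot> pair V ?x (isrc A \<cdot> ?f)) G1"
    using \<alpha> unfolding nfam_def by blast
  have F1: "isrc B \<cdot> F1 = F0 \<cdot> pair V ?x (isrc A \<cdot> ?f)" "itgt B \<cdot> F1 = F0 \<cdot> pair V ?x (itgt A \<cdot> ?f)"
    using ffam_elem(1,2)[OF F, of ?x ?f] by simp_all
  have G1: "isrc B \<cdot> G1 = G0 \<cdot> pair V ?x (isrc A \<cdot> ?f)" "itgt B \<cdot> G1 = G0 \<cdot> pair V ?x (itgt A \<cdot> ?f)"
    using ffam_elem(1,2)[OF G, of ?x ?f] by simp_all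
  show "igcmp V B (F1 \<cdot> pair V x f) (\<alpha> \<cdot> pair V x (itgt A \<cdot> f)) = igcmp V B (\<alpha> \<cdot> pair V x (isrc A \<cdot> f)) (G1 \<cdot> pair V x f)" if "Cod V f = IAr A"
    using arg_cong[OF e, of "\<lambda>h. h \<cdot> pair V x f"] x that s t F1 G1 by simp
qed

lemma nfamI:
  assumes F: "ffam A B X F0 F1" and G: "ffam A B X G0 G1"
    and \<alpha>: "\<alpha> \<in> Hom V (prd V X (IOb A)) (IAr B)" "isrc B \<cdot> \<alpha> = F0" "itgt B \<cdot> \<alpha> = G0"
    and nat: "\<And>x f. \<lbrakk>x \<in> Arr V; f \<in> Arr V; Dom V x = Dom V f; Cod V x = X; Cod V f = IAr A\<rbrakk> \<Longrightarrow>
      igcmp V B (F1 \<cdot> pair V x f) (\<alpha> \<cdot> pair V x (itgt A \<cdot> f)) = igcmp V B (\<alpha> \<cdot> pair V x (isrc A \<cdot> f)) (G1 \<cdot> pair V x f)"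
  shows "nfam A B X F0 F1 G0 G1 \<alpha>"
  unfolding nfam_def using \<alpha> nat[of "pr1 V X (IAr A)" "pr2 V X (IAr A)"] ffamD[OF F] ffamD[OF G] by simp

lemma ffam_res:
  assumes F: "ffam A B X F0 F1" and h: "h \<in> Arr V" "Cod V h = X"
  shows "ffam A B (Dom V h) (res (IOb A) h F0) (res (IAr A) h F1)"
  by (rule ffamI) (use ffamD[OF F] h in \<open>simp_all add: ffam_elem[OF F]\<close>)

lemma nfam_res:
  assumes F: "ffam A B X F0 F1" and G: "ffam A B X G0 G1" and \<alpha>: "nfam A B X F0 F1 G0 G1 \<alpha>" and h: "h \<in> Arr V" "Cod V h = X"
  shows "nfam A B (Dom V h) (res (IOb A) h F0) (res (IAr A) h F1) (res (IOb A) h G0) (res (IAr A) h G1) (res (IOb A) h \<alpha>)"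
  by (rule nfamI[OF ffam_res[OF F h] ffam_res[OF G h]])
    (use ffamD[OF F] ffamD[OF G] nfamD[OF \<alpha>] h in \<open>simp_all add: nfam_elem[OF F G \<alpha>] comp_res[symmetric]\<close>)

lemma nfam_id:
  assumes F: "ffam A B X F0 F1"
  shows "nfam A B X F0 F1 F0 F1 (iid B \<cdot> F0)"
  by (rule nfamI[OF F F]) (use ffamD[OF F] in \<open>simp_all add: ffam_elem[OF F]\<close>)

lemma nfam_comp:
  assumes F: "ffam A B X F0 F1" and G: "ffam A B X G0 G1" and H: "ffam A B X H0 H1"
    and \<alpha>: "nfam A B X F0 F1 G0 G1 \<alpha>" and \<beta>: "nfam A B X G0 G1 H0 H1 \<beta>"
  shows "nfam A B X F0 F1 H0 H1 (igcmp V B \<alpha> \<beta>)"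
proof (rule nfamI[OF F H])
  note [simp] = ffamD[OF F] ffamD[OF G] ffamD[OF H] nfamD[OF \<alpha>] nfamD[OF \<beta>]
  fix x f assume x: "x \<in> Arr V" "f \<in> Arr V" "Dom V x = Dom V f" "Cod V x = X" "Cod V f = IAr A"
  note x [simp]
  note E = ffam_elem[OF F] ffam_elem[OF G] ffam_elem[OF H] nfam_elem(1,2)[OF F G \<alpha>] nfam_elem(1,2)[OF G H \<beta>]
  have "igcmp V B (F1 \<cdot> pair V x f) (igcmp V B (\<alpha> \<cdot> pair V x (itgt A \<cdot> f)) (\<beta> \<cdot> pair V x (itgt A \<cdot> f))) =
      igcmp V B (igcmp V B (F1 \<cdot> pair V x f) (\<alpha> \<cdot> pair V x (itgt A \<cdot> f))) (\<beta> \<cdot> pair V x (itgt A \<cdot> f))"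
    by (simp add: igcmp_assoc E)
  also have "\<dots> = igcmp V B (igcmp V B (\<alpha> \<cdot> pair V x (isrc A \<cdot> f)) (G1 \<cdot> pair V x f)) (\<beta> \<cdot> pair V x (itgt A \<cdot> f))"
    by (simp add: nfam_elem(3)[OF F G \<alpha>])
  also have "\<dots> = igcmp V B (\<alpha> \<cdot> pair V x (isrc A \<cdot> f)) (igcmp V B (G1 \<cdot> pair V x f) (\<beta> \<cdot> pair V x (itgt A \<cdot> f)))"
    by (simp add: igcmp_assoc E)
  also have "\<dots> = igcmp V B (\<alpha> \<cdot> pair V x (isrc A \<cdot> f)) (igcmp V B (\<beta> \<cdot> pair V x (isrc A \<cdot> f)) (H1 \<cdot> pair V x f))"
    by (simp add: nfam_elem(3)[OF G H \<beta>])
  also have "\<dots> = igcmp V B (igcmp V B (\<alpha> \<cdot> pair V x (isrc A \<cdot> f)) (\<beta> \<cdot> pair V x (isrc A \<cdot> f))) (H1 \<cdot> pair V x f)"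
    by (simp add: igcmp_assoc E)
  finally show "igcmp V B (F1 \<cdot> pair V x f) (igcmp V B \<alpha> \<beta> \<cdot> pair V x (itgt A \<cdot> f)) =
      igcmp V B (igcmp V B \<alpha> \<beta> \<cdot> pair V x (isrc A \<cdot> f)) (H1 \<cdot> pair V x f)"
    by simp
qed (use ffamD[OF F] ffamD[OF G] ffamD[OF H] nfamD[OF \<alpha>] nfamD[OF \<beta>] in simp_all)

lemma ffam_represented:
  "\<exists>R u. represented (\<lambda>X F. ffam A B X (fst F) (snd F)) (\<lambda>h F. (res (IOb A) h (fst F), res (IAr A) h (snd F))) R u"
proof -
  let ?r = "\<lambda>h (F :: 'm \<times> 'm). (res (IOb A) h (fst F), res (IAr A) h (snd F))"
  let ?T = "pb V (itgt A) (isrc A)" and ?p = "pb1 V (itgt A) (isrc A)" and ?q = "pb2 V (itgt A) (isrc A)"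
  let ?P0 = "\<lambda>X F. (X \<in> Obj V \<and> fst F \<in> Hom V (prd V X (IOb A)) (IOb B)) \<and> (X \<in> Obj V \<and> snd F \<in> Hom V (prd V X (IAr A)) (IAr B))"
  let ?P1 = "\<lambda>X F. ?P0 X F \<and> isrc B \<cdot> snd F = fst F \<cdot> pair V (pr1 V X (IAr A)) (isrc A \<cdot> pr2 V X (IAr A))"
  let ?P2 = "\<lambda>X F. ?P1 X F \<and> itgt B \<cdot> snd F = fst F \<cdot> pair V (pr1 V X (IAr A)) (itgt A \<cdot> pr2 V X (IAr A))"
  let ?P3 = "\<lambda>X F. ?P2 X F \<and> snd F \<cdot> pair V (pr1 V X (IOb A)) (iid A \<cdot> pr2 V X (IOb A)) = iid B \<cdot> fst F"
  let ?P4 = "\<lambda>X F. ?P3 X F \<and> snd F \<cdot> pair V (pr1 V X ?T) (icmp A \<cdot> pr2 V X ?T) =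
       igcmp V B (snd F \<cdot> pair V (pr1 V X ?T) (?p \<cdot> pr2 V X ?T)) (snd F \<cdot> pair V (pr1 V X ?T) (?q \<cdot> pr2 V X ?T))"
  have pq: "itgt A \<cdot> (?p \<cdot> y) = isrc A \<cdot> (?q \<cdot> y)" if "y \<in> Arr V" "Cod V y = ?T" for y
    using reassoc[OF pb_commutes[of "itgt A" "isrc A"], of y] that by simp
  obtain R0 u0 where r0: "represented (\<lambda>X F0. X \<in> Obj V \<and> F0 \<in> Hom V (prd V X (IOb A)) (IOb B)) (res (IOb A)) R0 u0"
    using represented_hom[of "IOb A" "IOb B"] by auto
  obtain R1 u1 where r1: "represented (\<lambda>X F1. X \<in> Obj V \<and> F1 \<in> Hom V (prd V X (IAr A)) (IAr B)) (res (IAr A)) R1 u1"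
    using represented_hom[of "IAr A" "IAr B"] by auto
  from represented_prod[OF r0 r1] have "\<exists>R u. represented ?P0 ?r R u" by (intro exI)
  then have "\<exists>R u. represented ?P1 ?r R u"
    by (rule represented_equalizer[where K = "IAr A" and M = "IOb B"]) (auto simp: comp_res res_def)
  then have "\<exists>R u. represented ?P2 ?r R u"
    by (rule represented_equalizer[where K = "IAr A" and M = "IOb B"]) (auto simp: comp_res res_def)
  then have "\<exists>R u. represented ?P3 ?r R u"
    by (rule represented_equalizer[where K = "IOb A" and M = "IAr B"]) (auto simp: comp_res res_def)
  then have "\<exists>R u. represented ?P4 ?r R u"
  proof (rule represented_equalizer[where K = ?T and M = "IAr B"])
    fix X :: 'o and F :: "'m \<times> 'm" assume F: "?P3 X F"
    then have [simp]: "X \<in> Obj V" "snd F \<in> Arr V" "Dom V (snd F) = prd V X (IAr A)" "Cod V (snd F) = IAr B"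
      "fst F \<in> Arr V" "Dom V (fst F) = prd V X (IOb A)" "Cod V (fst F) = IOb B" by simp_all
    from F have s: "isrc B \<cdot> snd F = fst F \<cdot> pair V (pr1 V X (IAr A)) (isrc A \<cdot> pr2 V X (IAr A))"
      and t: "itgt B \<cdot> snd F = fst F \<cdot> pair V (pr1 V X (IAr A)) (itgt A \<cdot> pr2 V X (IAr A))" by blast+
    have st: "isrc B \<cdot> (snd F \<cdot> pair V x f) = fst F \<cdot> pair V x (isrc A \<cdot> f)"
      "itgt B \<cdot> (snd F \<cdot> pair V x f) = fst F \<cdot> pair V x (itgt A \<cdot> f)"
      if "x \<in> Arr V" "f \<in> Arr V" "Dom V x = Dom V f" "Cod V x = X" "Cod V f = IAr A" for x f
      using reassoc[OF s, of "pair V x f"] reassoc[OF t, of "pair V x f"] that by simp_all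
    show "igcmp V B (snd F \<cdot> pair V (pr1 V X ?T) (?p \<cdot> pr2 V X ?T)) (snd F \<cdot> pair V (pr1 V X ?T) (?q \<cdot> pr2 V X ?T))
      \<in> Hom V (prd V X ?T) (IAr B)"
      by (simp add: st pq)
    show "igcmp V B (snd (?r h F) \<cdot> pair V (pr1 V (Dom V h) ?T) (?p \<cdot> pr2 V (Dom V h) ?T)) (snd (?r h F) \<cdot> pair V (pr1 V (Dom V h) ?T) (?q \<cdot> pr2 V (Dom V h) ?T)) =
      res ?T h (igcmp V B (snd F \<cdot> pair V (pr1 V X ?T) (?p \<cdot> pr2 V X ?T)) (snd F \<cdot> pair V (pr1 V X ?T) (?q \<cdot> pr2 V X ?T)))"
      if "h \<in> Arr V" "Cod V h = X" for h
      using that by (simp add: res_def st pq)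
  qed (auto simp: res_def)
  moreover have "(\<lambda>X F. ffam A B X (fst F) (snd F)) = ?P4"
    unfolding ffam_def Let_def by (rule refl)
  ultimately show ?thesis by simp
qed

text \<open>An element consists of the two families of functors, as morphisms into \<open>R\<close>, and the transformation between them.\<close>

lemma nfam_represented:
  assumes rep: "represented (\<lambda>X F. ffam A B X (fst F) (snd F)) (\<lambda>h F. (res (IOb A) h (fst F), res (IAr A) h (snd F))) R u"
  shows "\<exists>S v. represented (\<lambda>X z. ((fst (fst z) \<in> Hom V X R \<and> snd (fst z) \<in> Hom V X R) \<and>
      nfam A B X (res (IOb A) (fst (fst z)) (fst u)) (res (IAr A) (fst (fst z)) (snd u))
        (res (IOb A) (snd (fst z)) (fst u)) (res (IAr A) (snd (fst z)) (snd u)) (snd z)))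
    (\<lambda>h z. ((fst (fst z) \<cdot> h, snd (fst z) \<cdot> h), res (IOb A) h (snd z))) S v"
proof -
  note R = representedD[OF rep]
  note [simp] = R(2)
  let ?r = "\<lambda>h (z :: ('m \<times> 'm) \<times> 'm). ((fst (fst z) \<cdot> h, snd (fst z) \<cdot> h), res (IOb A) h (snd z))"
  let ?U0 = "\<lambda>f. res (IOb A) f (fst u)" and ?U1 = "\<lambda>f. res (IAr A) f (snd u)"
  let ?P0 = "\<lambda>X z. (fst (fst z) \<in> Hom V X R \<and> snd (fst z) \<in> Hom V X R) \<and> (X \<in> Obj V \<and> snd z \<in> Hom V (prd V X (IOb A)) (IAr B))"
  let ?P1 = "\<lambda>X z. ?P0 X z \<and> isrc B \<cdot> snd z = ?U0 (fst (fst z))"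
  let ?P2 = "\<lambda>X z. ?P1 X z \<and> itgt B \<cdot> snd z = ?U0 (snd (fst z))"
  let ?P3 = "\<lambda>X z. ?P2 X z \<and> igcmp V B (?U1 (fst (fst z))) (snd z \<cdot> pair V (pr1 V X (IAr A)) (itgt A \<cdot> pr2 V X (IAr A))) =
     igcmp V B (snd z \<cdot> pair V (pr1 V X (IAr A)) (isrc A \<cdot> pr2 V X (IAr A))) (?U1 (snd (fst z)))"
  note U = ffam_elem[OF R(3)]
  note [simp] = ffamD[OF R(3)]
  obtain T w where "represented (\<lambda>X F0. X \<in> Obj V \<and> F0 \<in> Hom V (prd V X (IOb A)) (IAr B)) (res (IOb A)) T w"
    using represented_hom[of "IOb A" "IAr B"] by auto
  then have "\<exists>R u. represented ?P0 ?r R u"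
    using represented_prod[OF represented_prod[OF represented_yoneda[OF R(2)] represented_yoneda[OF R(2)]], of "\<lambda>X F0. X \<in> Obj V \<and> F0 \<in> Hom V (prd V X (IOb A)) (IAr B)" "res (IOb A)" T w]
    unfolding fst_conv snd_conv by blast
  then have "\<exists>R u. represented ?P1 ?r R u"
    by (rule represented_equalizer[where K = "IOb A" and M = "IOb B"]) (auto simp: comp_res res_comp)
  then have "\<exists>R u. represented ?P2 ?r R u"
    by (rule represented_equalizer[where K = "IOb A" and M = "IOb B"]) (auto simp: comp_res res_comp)
  then have "\<exists>R u. represented ?P3 ?r R u"
  proof (rule represented_equalizer[where K = "IAr A" and M = "IAr B"])
    fix X :: 'o and z :: "('m \<times> 'm) \<times> 'm" assume z: "?P2 X z"
    obtain f g \<alpha> where zz: "z = ((f, g), \<alpha>)" by (metis prod.collapse)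
    from z have [simp]: "f \<in> Arr V" "g \<in> Arr V" "Dom V f = X" "Dom V g = X" "Cod V f = R" "Cod V g = R" "X \<in> Obj V"
      "\<alpha> \<in> Arr V" "Dom V \<alpha> = prd V X (IOb A)" "Cod V \<alpha> = IAr B" by (simp_all add: zz)
    from z have s: "isrc B \<cdot> \<alpha> = ?U0 f" and t: "itgt B \<cdot> \<alpha> = ?U0 g" by (simp_all add: zz)
    have st: "isrc B \<cdot> (\<alpha> \<cdot> pair V x y) = fst u \<cdot> pair V (f \<cdot> x) y" "itgt B \<cdot> (\<alpha> \<cdot> pair V x y) = fst u \<cdot> pair V (g \<cdot> x) y"
      if "x \<in> Arr V" "y \<in> Arr V" "Dom V x = Dom V y" "Cod V x = X" "Cod V y = IOb A" for x y
      using reassoc[OF s, of "pair V x y"] reassoc[OF t, of "pair V x y"] that by simp_all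
    let ?x = "pr1 V X (IAr A)" and ?y = "pr2 V X (IAr A)"
    show "igcmp V B (?U1 (fst (fst z))) (snd z \<cdot> pair V ?x (itgt A \<cdot> ?y)) \<in> Hom V (prd V X (IAr A)) (IAr B)"
      "igcmp V B (snd z \<cdot> pair V ?x (isrc A \<cdot> ?y)) (?U1 (snd (fst z))) \<in> Hom V (prd V X (IAr A)) (IAr B)"
      by (simp_all add: zz res_def st U)
    fix h assume [simp]: "h \<in> Arr V" "Cod V h = X"
    let ?x' = "pr1 V (Dom V h) (IAr A)" and ?y' = "pr2 V (Dom V h) (IAr A)"
    show "igcmp V B (?U1 (fst (fst (?r h z)))) (snd (?r h z) \<cdot> pair V ?x' (itgt A \<cdot> ?y')) =
        res (IAr A) h (igcmp V B (?U1 (fst (fst z))) (snd z \<cdot> pair V ?x (itgt A \<cdot> ?y)))"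
      "igcmp V B (snd (?r h z) \<cdot> pair V ?x' (isrc A \<cdot> ?y')) (?U1 (snd (fst (?r h z)))) =
        res (IAr A) h (igcmp V B (snd z \<cdot> pair V ?x (isrc A \<cdot> ?y)) (?U1 (snd (fst z))))"
      by (simp_all add: zz res_def st U)
  qed simp_all
  moreover have "(\<lambda>X z. (fst (fst z) \<in> Hom V X R \<and> snd (fst z) \<in> Hom V X R) \<and>
      nfam A B X (?U0 (fst (fst z))) (?U1 (fst (fst z))) (?U0 (snd (fst z))) (?U1 (snd (fst z))) (snd z)) = ?P3"
    unfolding nfam_def by (intro ext) (use R(2) in \<open>auto dest: Dom_Obj\<close>)
  ultimately show ?thesis by simp
qed

subsection \<open>Pointwise exponentials\<close>

text \<open>
  For \<open>ev : E \<times> A \<rightarrow> B\<close>, a generalized object \<open>N\<close> of \<open>E\<close> induces a family \<open>(evo N, eva N)\<close> of internal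
  functors \<open>A \<rightarrow> B\<close>, and a generalized arrow \<open>M\<close> of \<open>E\<close> a family \<open>evt M\<close> of natural transformations.
\<close>

definition evo :: "('o, 'm) icat \<Rightarrow> ('o, 'm) ifun \<Rightarrow> 'm \<Rightarrow> 'm" where
  "evo E ev N = IF0 ev \<cdot> ip0 E A (N \<cdot> pr1 V (Dom V N) (IOb A)) (pr2 V (Dom V N) (IOb A))"

definition eva :: "('o, 'm) icat \<Rightarrow> ('o, 'm) ifun \<Rightarrow> 'm \<Rightarrow> 'm" where
  "eva E ev N = IF1 ev \<cdot> ip1 E A (iid E \<cdot> (N \<cdot> pr1 V (Dom V N) (IAr A))) (pr2 V (Dom V N) (IAr A))"

definition evt :: "('o, 'm) icat \<Rightarrow> ('o, 'm) ifun \<Rightarrow> 'm \<Rightarrow> 'm" where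
  "evt E ev M = IF1 ev \<cdot> ip1 E A (M \<cdot> pr1 V (Dom V M) (IOb A)) (iid A \<cdot> pr2 V (Dom V M) (IOb A))"

text \<open>The exponential in terms of generalized objects and arrows.\<close>

definition pexp :: "('o, 'm) icat \<Rightarrow> ('o, 'm) ifun \<Rightarrow> bool" where
  "pexp E ev \<longleftrightarrow> E \<in> Obj W \<and> ev \<in> Hom W (prd W E A) B \<and>
     (\<forall>X F0 F1. ffam A B X F0 F1 \<longrightarrow> (\<exists>N. N \<in> Hom V X (IOb E) \<and> evo E ev N = F0 \<and> eva E ev N = F1)) \<and>
     (\<forall>N N'. N \<in> Arr V \<longrightarrow> N' \<in> Arr V \<longrightarrow> Dom V N = Dom V N' \<longrightarrow> Cod V N = IOb E \<longrightarrow> Cod V N' = IOb E \<longrightarrow>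
       evo E ev N = evo E ev N' \<longrightarrow> eva E ev N = eva E ev N' \<longrightarrow> N = N') \<and>
     (\<forall>N N' \<alpha>. N \<in> Arr V \<longrightarrow> N' \<in> Arr V \<longrightarrow> Dom V N = Dom V N' \<longrightarrow> Cod V N = IOb E \<longrightarrow> Cod V N' = IOb E \<longrightarrow>
       nfam A B (Dom V N) (evo E ev N) (eva E ev N) (evo E ev N') (eva E ev N') \<alpha> \<longrightarrow>
       (\<exists>M. M \<in> Hom V (Dom V N) (IAr E) \<and> isrc E \<cdot> M = N \<and> itgt E \<cdot> M = N' \<and> evt E ev M = \<alpha>)) \<and>
     (\<forall>M M'. M \<in> Arr V \<longrightarrow> M' \<in> Arr V \<longrightarrow> Dom V M = Dom V M' \<longrightarrow> Cod V M = IAr E \<longrightarrow> Cod V M' = IAr E \<longrightarrow>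
       isrc E \<cdot> M = isrc E \<cdot> M' \<longrightarrow> itgt E \<cdot> M = itgt E \<cdot> M' \<longrightarrow> evt E ev M = evt E ev M' \<longrightarrow> M = M')"

lemma pexpD:
  assumes "pexp E ev"
  shows "E \<in> Obj W" "ev \<in> Arr W" "Dom W ev = prd W E A" "Cod W ev = B"
    "ffam A B X F0 F1 \<Longrightarrow> \<exists>N. N \<in> Hom V X (IOb E) \<and> evo E ev N = F0 \<and> eva E ev N = F1"
    "\<lbrakk>N \<in> Arr V; N' \<in> Arr V; Dom V N = Dom V N'; Cod V N = IOb E; Cod V N' = IOb E; evo E ev N = evo E ev N'; eva E ev N = eva E ev N'\<rbrakk> \<Longrightarrow> N = N'"
    "\<lbrakk>N \<in> Arr V; N' \<in> Arr V; Dom V N = Dom V N'; Cod V N = IOb E; Cod V N' = IOb E; nfam A B (Dom V N) (evo E ev N) (eva E ev N) (evo E ev N') (eva E ev N') \<alpha>\<rbrakk> \<Longrightarrow>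
       \<exists>M. M \<in> Hom V (Dom V N) (IAr E) \<and> isrc E \<cdot> M = N \<and> itgt E \<cdot> M = N' \<and> evt E ev M = \<alpha>"
    "\<lbrakk>M \<in> Arr V; M' \<in> Arr V; Dom V M = Dom V M'; Cod V M = IAr E; Cod V M' = IAr E; isrc E \<cdot> M = isrc E \<cdot> M'; itgt E \<cdot> M = itgt E \<cdot> M'; evt E ev M = evt E ev M'\<rbrakk> \<Longrightarrow> M = M'"
  using assms unfolding pexp_def by (simp, simp, simp, simp, blast, blast, blast, blast)

context
  fixes E ev assumes E [simp]: "E \<in> Obj W" and ev [simp]: "ev \<in> Arr W" "Dom W ev = prd W E A" "Cod W ev = B"
begin

lemma ev_simps [simp]:
  assumes "x \<in> Arr V" "y \<in> Arr V" "Dom V x = Dom V y"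
  shows "\<lbrakk>N \<in> Arr V; Cod V N = IOb E; Cod V x = Dom V N; Cod V y = IOb A\<rbrakk> \<Longrightarrow>
      evo E ev N \<cdot> pair V x y = IF0 ev \<cdot> ip0 E A (N \<cdot> x) y"
    "\<lbrakk>N \<in> Arr V; Cod V N = IOb E; Cod V x = Dom V N; Cod V y = IAr A\<rbrakk> \<Longrightarrow>
      eva E ev N \<cdot> pair V x y = IF1 ev \<cdot> ip1 E A (iid E \<cdot> (N \<cdot> x)) y"
    "\<lbrakk>N \<in> Arr V; Cod V N = IAr E; Cod V x = Dom V N; Cod V y = IOb A\<rbrakk> \<Longrightarrow>
      evt E ev N \<cdot> pair V x y = IF1 ev \<cdot> ip1 E A (N \<cdot> x) (iid A \<cdot> y)"
  using assms by (simp_all add: evo_def eva_def evt_def)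

lemma ev_typing [simp]:
  "N \<in> Arr V \<Longrightarrow> Cod V N = IOb E \<Longrightarrow> evo E ev N \<in> Arr V"
  "N \<in> Arr V \<Longrightarrow> Cod V N = IOb E \<Longrightarrow> Dom V (evo E ev N) = prd V (Dom V N) (IOb A)"
  "N \<in> Arr V \<Longrightarrow> Cod V N = IOb E \<Longrightarrow> Cod V (evo E ev N) = IOb B"
  "N \<in> Arr V \<Longrightarrow> Cod V N = IOb E \<Longrightarrow> eva E ev N \<in> Arr V"
  "N \<in> Arr V \<Longrightarrow> Cod V N = IOb E \<Longrightarrow> Dom V (eva E ev N) = prd V (Dom V N) (IAr A)"
  "N \<in> Arr V \<Longrightarrow> Cod V N = IOb E \<Longrightarrow> Cod V (eva E ev N) = IAr B"
  "N \<in> Arr V \<Longrightarrow> Cod V N = IAr E \<Longrightarrow> evt E ev N \<in> Arr V"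
  "N \<in> Arr V \<Longrightarrow> Cod V N = IAr E \<Longrightarrow> Dom V (evt E ev N) = prd V (Dom V N) (IOb A)"
  "N \<in> Arr V \<Longrightarrow> Cod V N = IAr E \<Longrightarrow> Cod V (evt E ev N) = IAr B"
  by (simp_all add: evo_def eva_def evt_def)

lemma ffam_ev: "N \<in> Arr V \<Longrightarrow> Cod V N = IOb E \<Longrightarrow> ffam A B (Dom V N) (evo E ev N) (eva E ev N)"
proof (rule ffamI)
  fix x f g assume N: "N \<in> Arr V" "Cod V N = IOb E" and
    x: "x \<in> Arr V" "f \<in> Arr V" "g \<in> Arr V" "Dom V x = Dom V f" "Dom V f = Dom V g" "Cod V x = Dom V N" "Cod V f = IAr A" "Cod V g = IAr A"
      "itgt A \<cdot> f = isrc A \<cdot> g"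
  have e: "igcmp V E (iid E \<cdot> (N \<cdot> x)) (iid E \<cdot> (N \<cdot> x)) = iid E \<cdot> (N \<cdot> x)" using N x by simp
  have "ip1 E A (iid E \<cdot> (N \<cdot> x)) (igcmp V A f g) = igcmp V (prd W E A) (ip1 E A (iid E \<cdot> (N \<cdot> x)) f) (ip1 E A (iid E \<cdot> (N \<cdot> x)) g)"
    using N x e by simp
  then show "eva E ev N \<cdot> pair V x (igcmp V A f g) = igcmp V B (eva E ev N \<cdot> pair V x f) (eva E ev N \<cdot> pair V x g)"
    using N x by (simp del: igcmp_ip1)
qed simp_all

lemma nfam_ev:
  assumes "M \<in> Arr V" "Cod V M = IAr E"
  shows "nfam A B (Dom V M) (evo E ev (isrc E \<cdot> M)) (eva E ev (isrc E \<cdot> M)) (evo E ev (itgt E \<cdot> M)) (eva E ev (itgt E \<cdot> M)) (evt E ev M)"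
proof (rule nfamI)
  show "ffam A B (Dom V M) (evo E ev (isrc E \<cdot> M)) (eva E ev (isrc E \<cdot> M))" "ffam A B (Dom V M) (evo E ev (itgt E \<cdot> M)) (eva E ev (itgt E \<cdot> M))"
    using ffam_ev[of "isrc E \<cdot> M"] ffam_ev[of "itgt E \<cdot> M"] assms by simp_all
  show "isrc B \<cdot> evt E ev M = evo E ev (isrc E \<cdot> M)" "itgt B \<cdot> evt E ev M = evo E ev (itgt E \<cdot> M)"
    using assms by (simp_all add: evo_def evt_def)
  fix x f assume x: "x \<in> Arr V" "f \<in> Arr V" "Dom V x = Dom V f" "Cod V x = Dom V M" "Cod V f = IAr A"
  have "igcmp V (prd W E A) (ip1 E A (iid E \<cdot> (isrc E \<cdot> (M \<cdot> x))) f) (ip1 E A (M \<cdot> x) (iid A \<cdot> (itgt A \<cdot> f))) = ip1 E A (M \<cdot> x) f"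
    "igcmp V (prd W E A) (ip1 E A (M \<cdot> x) (iid A \<cdot> (isrc A \<cdot> f))) (ip1 E A (iid E \<cdot> (itgt E \<cdot> (M \<cdot> x))) f) = ip1 E A (M \<cdot> x) f"
    using x assms by simp_all
  from this[THEN arg_cong[of _ _ "\<lambda>h. IF1 ev \<cdot> h"]]
  have "IF1 ev \<cdot> igcmp V (prd W E A) (ip1 E A (iid E \<cdot> (isrc E \<cdot> (M \<cdot> x))) f) (ip1 E A (M \<cdot> x) (iid A \<cdot> (itgt A \<cdot> f))) =
    IF1 ev \<cdot> igcmp V (prd W E A) (ip1 E A (M \<cdot> x) (iid A \<cdot> (isrc A \<cdot> f))) (ip1 E A (iid E \<cdot> (itgt E \<cdot> (M \<cdot> x))) f)" by simp
  then show "igcmp V B (eva E ev (isrc E \<cdot> M) \<cdot> pair V x f) (evt E ev M \<cdot> pair V x (itgt A \<cdot> f)) =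
      igcmp V B (evt E ev M \<cdot> pair V x (isrc A \<cdot> f)) (eva E ev (itgt E \<cdot> M) \<cdot> pair V x f)"
    using x assms by (simp del: igcmp_ip1)
qed (use assms in simp_all)

text \<open>An arrow of the product factors as \<open>(M, f) = (id, f) ; (M, id)\<close>, so its value is given by \<open>eva\<close> and \<open>evt\<close>.\<close>

lemma ev_arrow:
  assumes "M \<in> Arr V" "Cod V M = IAr E" "f \<in> Arr V" "Cod V f = IAr A" "Dom V M = Dom V f"
  shows "IF1 ev \<cdot> ip1 E A M f = igcmp V B (IF1 ev \<cdot> ip1 E A (iid E \<cdot> (isrc E \<cdot> M)) f) (IF1 ev \<cdot> ip1 E A M (iid A \<cdot> (itgt A \<cdot> f)))"
proof -
  have "igcmp V (prd W E A) (ip1 E A (iid E \<cdot> (isrc E \<cdot> M)) f) (ip1 E A M (iid A \<cdot> (itgt A \<cdot> f))) = ip1 E A M f"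
    using assms by simp
  from arg_cong[OF this, of "\<lambda>h. IF1 ev \<cdot> h"] show ?thesis using assms by (simp del: igcmp_ip1)
qed

lemma evt_id: "N \<in> Arr V \<Longrightarrow> Cod V N = IOb E \<Longrightarrow> evt E ev (iid E \<cdot> N) = iid B \<cdot> evo E ev N"
  by (simp add: evt_def evo_def id_ip0[symmetric] del: id_ip0)

lemma evt_igcmp:
  assumes "M \<in> Arr V" "M' \<in> Arr V" "Cod V M = IAr E" "Cod V M' = IAr E" "itgt E \<cdot> M = isrc E \<cdot> M'" "Dom V M = Dom V M'"
  shows "evt E ev (igcmp V E M M') = igcmp V B (evt E ev M) (evt E ev M')"
proof -
  let ?x = "pr1 V (Dom V M) (IOb A)" and ?a = "pr2 V (Dom V M) (IOb A)"
  have "itgt E \<cdot> (M \<cdot> ?x) = isrc E \<cdot> (M' \<cdot> ?x)" using assms by (simp add: reassoc[OF assms(5)])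
  moreover have "ip1 E A (igcmp V E (M \<cdot> ?x) (M' \<cdot> ?x)) (iid A \<cdot> ?a) =
      igcmp V (prd W E A) (ip1 E A (M \<cdot> ?x) (iid A \<cdot> ?a)) (ip1 E A (M' \<cdot> ?x) (iid A \<cdot> ?a))"
    using assms calculation by simp
  ultimately show ?thesis using assms by (simp add: evt_def del: igcmp_ip1)
qed

end

text \<open>A pointwise exponential is an exponential, because an internal functor amounts to its action on generalized elements.\<close>

lemma pexp_exponential:
  assumes "pexp E ev"
  shows "is_exponential W A B (E, ev)"
proof -
  note P = pexpD[OF assms]
  note [simp] = P(1-4)
  note T = ev_typing[OF P(1-4)] and S = ev_simps[OF P(1-4)]
  have pm: "prod_map W h (Ident W A) = pair W (h \<cdot>\<^sub>W pr1 W Z A) (pr2 W Z A)" if "h \<in> Arr W" "Dom W h = Z" for h Z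
    using that by (auto simp: prod_map_def)
  have "\<exists>!h. h \<in> Hom W Z E \<and> ev \<cdot>\<^sub>W prod_map W h (Ident W A) = H"
    if Z: "Z \<in> Obj W" and H: "H \<in> Hom W (prd W Z A) B" for Z H
  proof -
    note Z [simp]
    have [simp]: "H \<in> Arr W" "Dom W H = prd W Z A" "Cod W H = B" using H by simp_all
    note TH = ev_typing[OF Z, of H, simplified] and SH = ev_simps[OF Z, of H, simplified]
    have ex: "\<exists>N. N \<in> Hom V (Dom V z) (IOb E) \<and> evo E ev N = evo Z H z \<and> eva E ev N = eva Z H z"
      if "z \<in> Arr V" "Cod V z = IOb Z" for z
      using P(5) ffam_ev[OF Z, of H z] that by simp
    obtain K0 where K0 [simp]: "K0 \<in> Arr V" "Dom V K0 = IOb Z" "Cod V K0 = IOb E"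
      and evK0: "evo E ev K0 = evo Z H (Ident V (IOb Z))" "eva E ev K0 = eva Z H (Ident V (IOb Z))"
      using ex[of "Ident V (IOb Z)"] by auto
    have K0z: "evo E ev (K0 \<cdot> z) = evo Z H z \<and> eva E ev (K0 \<cdot> z) = eva Z H z" if z: "z \<in> Arr V" "Cod V z = IOb Z" for z
    proof -
      have "evo E ev (K0 \<cdot> z) = evo E ev K0 \<cdot> pair V (z \<cdot> pr1 V (Dom V z) (IOb A)) (pr2 V (Dom V z) (IOb A))"
        "eva E ev (K0 \<cdot> z) = eva E ev K0 \<cdot> pair V (z \<cdot> pr1 V (Dom V z) (IAr A)) (pr2 V (Dom V z) (IAr A))"
        using z by (simp_all add: S) (simp_all add: evo_def eva_def)
      then show ?thesis unfolding evK0 using z by (simp add: SH) (simp add: evo_def eva_def)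
    qed
    have "nfam A B (IAr Z) (evo E ev (K0 \<cdot> isrc Z)) (eva E ev (K0 \<cdot> isrc Z)) (evo E ev (K0 \<cdot> itgt Z)) (eva E ev (K0 \<cdot> itgt Z)) (evt Z H (Ident V (IAr Z)))"
      using nfam_ev[OF Z, of H "Ident V (IAr Z)"] K0z by simp
    with P(7)[of "K0 \<cdot> isrc Z" "K0 \<cdot> itgt Z"] obtain K1 where
      K1 [simp]: "K1 \<in> Arr V" "Dom V K1 = IAr Z" "Cod V K1 = IAr E" and stK1: "isrc E \<cdot> K1 = K0 \<cdot> isrc Z" "itgt E \<cdot> K1 = K0 \<cdot> itgt Z"
      and evK1: "evt E ev K1 = evt Z H (Ident V (IAr Z))" by auto
    have stz [simp]: "isrc E \<cdot> (K1 \<cdot> z) = K0 \<cdot> (isrc Z \<cdot> z)" "itgt E \<cdot> (K1 \<cdot> z) = K0 \<cdot> (itgt Z \<cdot> z)" if "z \<in> Arr V" "Cod V z = IAr Z" for z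
      using reassoc[OF stK1(1), of z] reassoc[OF stK1(2), of z] that by simp_all
    have K1z: "evt E ev (K1 \<cdot> z) = evt Z H z" if z: "z \<in> Arr V" "Cod V z = IAr Z" for z
    proof -
      have "evt E ev (K1 \<cdot> z) = evt E ev K1 \<cdot> pair V (z \<cdot> pr1 V (Dom V z) (IOb A)) (pr2 V (Dom V z) (IOb A))"
        using z by (simp add: S) (simp add: evt_def)
      then show ?thesis unfolding evK1 using z by (simp add: SH) (simp add: evt_def)
    qed
    define K where "K = \<lparr>IDom = Z, ICod = E, IF0 = K0, IF1 = K1\<rparr>"
    have K: "K \<in> Hom W Z E"
      unfolding K_def
    proof (rule ifunI)
      show "K1 \<cdot> iid Z = iid E \<cdot> K0"
        by (rule P(8)) (use K1z[of "iid Z"] K0z[of "Ident V (IOb Z)"] in \<open>simp_all add: evt_id[OF P(1-4)] evt_id[OF Z, of H "Ident V (IOb Z)", simplified]\<close>)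
    next
      fix f g assume fg: "f \<in> Arr V" "g \<in> Arr V" "Cod V f = IAr Z" "Cod V g = IAr Z" "Dom V f = Dom V g" "itgt Z \<cdot> f = isrc Z \<cdot> g"
      have "evt E ev (igcmp V E (K1 \<cdot> f) (K1 \<cdot> g)) = evt Z H (igcmp V Z f g)"
        using evt_igcmp[OF P(1-4), of "K1 \<cdot> f" "K1 \<cdot> g"] evt_igcmp[OF Z, of H f g] K1z fg by simp
      then show "K1 \<cdot> igcmp V Z f g = igcmp V E (K1 \<cdot> f) (K1 \<cdot> g)"
        using K1z[of "igcmp V Z f g"] fg by - (rule P(8); simp)
    qed (simp_all add: stK1)
    have KF [simp]: "IF0 K = K0" "IF1 K = K1" by (simp_all add: K_def)
    have comp: "(ev \<cdot>\<^sub>W prod_map W L (Ident W A) = H) \<longleftrightarrow>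
        (IF0 ev \<cdot> ip0 E A (IF0 L \<cdot> IF0 (pr1 W Z A)) (IF0 (pr2 W Z A)) = IF0 H \<and>
         IF1 ev \<cdot> ip1 E A (IF1 L \<cdot> IF1 (pr1 W Z A)) (IF1 (pr2 W Z A)) = IF1 H)" if L: "L \<in> Hom W Z E" for L
    proof -
      have "IF0 (ev \<cdot>\<^sub>W prod_map W L (Ident W A)) = IF0 ev \<cdot> ip0 E A (IF0 L \<cdot> IF0 (pr1 W Z A)) (IF0 (pr2 W Z A))"
        "IF1 (ev \<cdot>\<^sub>W prod_map W L (Ident W A)) = IF1 ev \<cdot> ip1 E A (IF1 L \<cdot> IF1 (pr1 W Z A)) (IF1 (pr2 W Z A))"
        "ev \<cdot>\<^sub>W prod_map W L (Ident W A) \<in> Hom W (prd W Z A) B"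
        using L by (simp_all add: pm)
      then show ?thesis by (auto intro!: ifun_eqI)
    qed
    have "ev \<cdot>\<^sub>W prod_map W K (Ident W A) = H"
      unfolding comp[OF K] KF
    proof
      let ?z = "IF0 (pr1 W Z A)" and ?a = "IF0 (pr2 W Z A)"
      have "evo E ev K0 \<cdot> pair V ?z ?a = evo Z H (Ident V (IOb Z)) \<cdot> pair V ?z ?a" by (simp only: evK0)
      then show "IF0 ev \<cdot> ip0 E A (K0 \<cdot> ?z) ?a = IF0 H" by (simp add: S SH)
      let ?z = "IF1 (pr1 W Z A)" and ?a = "IF1 (pr2 W Z A)"
      have "eva E ev K0 \<cdot> pair V (isrc Z \<cdot> ?z) ?a = eva Z H (Ident V (IOb Z)) \<cdot> pair V (isrc Z \<cdot> ?z) ?a"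
        "evt E ev K1 \<cdot> pair V ?z (itgt A \<cdot> ?a) = evt Z H (Ident V (IAr Z)) \<cdot> pair V ?z (itgt A \<cdot> ?a)"
        by (simp_all only: evK0 evK1)
      then have "IF1 ev \<cdot> ip1 E A (iid E \<cdot> (K0 \<cdot> (isrc Z \<cdot> ?z))) ?a = IF1 H \<cdot> ip1 Z A (iid Z \<cdot> (isrc Z \<cdot> ?z)) ?a"
        "IF1 ev \<cdot> ip1 E A (K1 \<cdot> ?z) (iid A \<cdot> (itgt A \<cdot> ?a)) = IF1 H \<cdot> ip1 Z A ?z (iid A \<cdot> (itgt A \<cdot> ?a))"
        by (simp_all add: S SH del: id_ip0 ifun_simps(7,8) ifun_comp_simps(1,2))
      then show "IF1 ev \<cdot> ip1 E A (K1 \<cdot> ?z) ?a = IF1 H"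
        using ev_arrow[OF P(1-4), of "K1 \<cdot> ?z" ?a] ev_arrow[OF Z, of H ?z ?a]
        by (simp del: ifun_simps(7,8) ifun_comp_simps(1,2))
    qed
    moreover have "L = L'" if L: "L \<in> Hom W Z E \<and> ev \<cdot>\<^sub>W prod_map W L (Ident W A) = H"
      and L': "L' \<in> Hom W Z E \<and> ev \<cdot>\<^sub>W prod_map W L' (Ident W A) = H" for L L'
    proof -
      have LL: "evo E ev (IF0 L) = evo Z H (Ident V (IOb Z)) \<and> eva E ev (IF0 L) = eva Z H (Ident V (IOb Z)) \<and> evt E ev (IF1 L) = evt Z H (Ident V (IAr Z))"
        if "L \<in> Hom W Z E \<and> ev \<cdot>\<^sub>W prod_map W L (Ident W A) = H" for L
      proof -
        have L: "L \<in> Hom W Z E" using that by (rule conjunct1)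
        have h: "IF0 H = IF0 ev \<cdot> ip0 E A (IF0 L \<cdot> IF0 (pr1 W Z A)) (IF0 (pr2 W Z A))"
          "IF1 H = IF1 ev \<cdot> ip1 E A (IF1 L \<cdot> IF1 (pr1 W Z A)) (IF1 (pr2 W Z A))"
          using comp[OF L, THEN iffD1, OF that[THEN conjunct2]] by simp_all
        show ?thesis unfolding evo_def[of Z] eva_def[of Z] evt_def[of Z] h using L by (simp add: evo_def eva_def evt_def)
      qed
      have "IF0 L = IF0 L'" using LL[OF L] LL[OF L'] L L' by - (rule P(6); simp)
      moreover have "IF1 L = IF1 L'" using LL[OF L] LL[OF L'] L L' calculation by - (rule P(8); simp)
      ultimately show ?thesis using L L' by (intro ifun_eqI) simp_all
    qed
    ultimately show ?thesis using K by blast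
  qed
  then show ?thesis unfolding is_exponential_def by auto
qed

lemma res_igcmp:
  assumes "h \<in> Arr V" "f \<in> Arr V" "g \<in> Arr V" "Dom V f = prd V (Cod V h) (IOb A)" "Dom V g = prd V (Cod V h) (IOb A)"
    "Cod V f = IAr B" "Cod V g = IAr B" "itgt B \<cdot> f = isrc B \<cdot> g"
  shows "res (IOb A) h (igcmp V B f g) = igcmp V B (res (IOb A) h f) (res (IOb A) h g)"
  using assms by (simp add: res_def)

text \<open>
  The objects of the exponential represent families of internal functors, its arrows represent
  families of natural transformations.
\<close>

lemma ex_pexp: "\<exists>E ev. pexp E ev"
proof -
  obtain R u where rep: "represented (\<lambda>X F. ffam A B X (fst F) (snd F)) (\<lambda>h F. (res (IOb A) h (fst F), res (IAr A) h (snd F))) R u"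
    using ffam_represented by blast
  note R = representedD[OF rep]
  define U0 U1 where "U0 = fst u" and "U1 = snd u"
  have U: "ffam A B R U0 U1" using R(3) by (simp add: U0_def U1_def)
  note [simp] = R(2) ffamD[OF U]
  obtain S v where rep2: "represented (\<lambda>X z. ((fst (fst z) \<in> Hom V X R \<and> snd (fst z) \<in> Hom V X R) \<and>
      nfam A B X (res (IOb A) (fst (fst z)) U0) (res (IAr A) (fst (fst z)) U1)
        (res (IOb A) (snd (fst z)) U0) (res (IAr A) (snd (fst z)) U1) (snd z)))
    (\<lambda>h z. ((fst (fst z) \<cdot> h, snd (fst z) \<cdot> h), res (IOb A) h (snd z))) S v"
    using nfam_represented[OF rep] unfolding U0_def U1_def by blast
  note S = representedD[OF rep2]
  define d c y where "d = fst (fst v)" and "c = snd (fst v)" and "y = snd v"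
  have dc [simp]: "S \<in> Obj V" "d \<in> Arr V" "Dom V d = S" "Cod V d = R" "c \<in> Arr V" "Dom V c = S" "Cod V c = R"
    and y: "nfam A B S (res (IOb A) d U0) (res (IAr A) d U1) (res (IOb A) c U0) (res (IAr A) c U1) y"
    using S(2,3) by (simp_all add: d_def c_def y_def)
  note [simp] = nfamD(1-3)[OF y]
  have obj_ex: "\<exists>h. h \<in> Hom V X R \<and> res (IOb A) h U0 = F0 \<and> res (IAr A) h U1 = F1" if "ffam A B X F0 F1" for X F0 F1
    using R(4)[where X = X and x = "(F0, F1)"] that by (simp add: U0_def U1_def)
  have obj_eq: "h = k" if "h \<in> Arr V" "k \<in> Arr V" "Dom V h = Dom V k" "Cod V h = R" "Cod V k = R"
    "res (IOb A) h U0 = res (IOb A) k U0" "res (IAr A) h U1 = res (IAr A) k U1" for h k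
    using R(5)[where h = h and k = k] that by (simp add: U0_def U1_def)
  have arr_ex: "\<exists>h. h \<in> Hom V X S \<and> d \<cdot> h = f \<and> c \<cdot> h = g \<and> res (IOb A) h y = \<alpha>"
    if "f \<in> Hom V X R" "g \<in> Hom V X R" "nfam A B X (res (IOb A) f U0) (res (IAr A) f U1) (res (IOb A) g U0) (res (IAr A) g U1) \<alpha>" for X f g \<alpha>
    using S(4)[where X = X and x = "((f, g), \<alpha>)"] that by (simp add: d_def c_def y_def)
  have arr_eq: "h = k" if "h \<in> Arr V" "k \<in> Arr V" "Dom V h = Dom V k" "Cod V h = S" "Cod V k = S"
    "d \<cdot> h = d \<cdot> k" "c \<cdot> h = c \<cdot> k" "res (IOb A) h y = res (IOb A) k y" for h k
    using S(5)[where h = h and k = k] that by (simp add: d_def c_def y_def)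
  note Ue = ffam_elem[OF U]
  have Ud: "ffam A B S (res (IOb A) d U0) (res (IAr A) d U1)" and Uc: "ffam A B S (res (IOb A) c U0) (res (IAr A) c U1)"
    using ffam_res[OF U, of d] ffam_res[OF U, of c] by simp_all
  have ye: "isrc B \<cdot> (y \<cdot> pair V M a) = U0 \<cdot> pair V (d \<cdot> M) a" "itgt B \<cdot> (y \<cdot> pair V M a) = U0 \<cdot> pair V (c \<cdot> M) a"
    if "M \<in> Arr V" "a \<in> Arr V" "Dom V M = Dom V a" "Cod V M = S" "Cod V a = IOb A" for M a
    using nfam_elem(1,2)[OF Ud Uc y that(1-4)] that by simp_all
  have ynat: "igcmp V B (U1 \<cdot> pair V (d \<cdot> M) f) (y \<cdot> pair V M (itgt A \<cdot> f)) = igcmp V B (y \<cdot> pair V M (isrc A \<cdot> f)) (U1 \<cdot> pair V (c \<cdot> M) f)"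
    if "M \<in> Arr V" "f \<in> Arr V" "Dom V M = Dom V f" "Cod V M = S" "Cod V f = IAr A" for M f
    using nfam_elem(3)[OF Ud Uc y that(1-4)] that by simp
  have nM: "nfam A B (Dom V M) (res (IOb A) (d \<cdot> M) U0) (res (IAr A) (d \<cdot> M) U1) (res (IOb A) (c \<cdot> M) U0) (res (IAr A) (c \<cdot> M) U1) (res (IOb A) M y)"
    if "M \<in> Arr V" "Cod V M = S" for M
    using nfam_res[OF Ud Uc y that] that by (simp add: res_comp[symmetric])
  have sM: "isrc B \<cdot> res (IOb A) M y = res (IOb A) (d \<cdot> M) U0" "itgt B \<cdot> res (IOb A) M y = res (IOb A) (c \<cdot> M) U0"
    if "M \<in> Arr V" "Cod V M = S" for M
    using nfamD(4,5)[OF nM[OF that]] .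
  have UN: "ffam A B (Dom V N) (res (IOb A) N U0) (res (IAr A) N U1)" if "N \<in> Arr V" "Cod V N = R" for N
    using ffam_res[OF U that] .
  obtain i where i [simp]: "i \<in> Arr V" "Dom V i = R" "Cod V i = S" and di: "d \<cdot> i = Ident V R" and ci: "c \<cdot> i = Ident V R"
    and yi: "res (IOb A) i y = iid B \<cdot> U0"
  proof -
    have "nfam A B R (res (IOb A) (Ident V R) U0) (res (IAr A) (Ident V R) U1) (res (IOb A) (Ident V R) U0) (res (IAr A) (Ident V R) U1) (iid B \<cdot> U0)"
      using nfam_id[OF U] by (simp add: res_Ident)
    from arr_ex[OF _ _ this] that show ?thesis by auto
  qed
  have dix [simp]: "d \<cdot> (i \<cdot> x) = x" "c \<cdot> (i \<cdot> x) = x" if "x \<in> Arr V" "Cod V x = R" for x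
    using reassoc[OF di, of x] reassoc[OF ci, of x] that by simp_all
  have yix: "y \<cdot> pair V (i \<cdot> x) a = iid B \<cdot> (U0 \<cdot> pair V x a)" if "x \<in> Arr V" "Cod V x = R" "a \<in> Arr V" "Cod V a = IOb A" "Dom V x = Dom V a" for x a
    using arg_cong[OF yi, of "\<lambda>h. h \<cdot> pair V x a"] that by simp
  \<comment> \<open>Composition in the exponential is vertical composition of the represented transformations.\<close>
  define cmp where "cmp f g = (THE h. h \<in> Hom V (Dom V f) S \<and> d \<cdot> h = d \<cdot> f \<and> c \<cdot> h = c \<cdot> g \<and>
    res (IOb A) h y = igcmp V B (res (IOb A) f y) (res (IOb A) g y))" for f g
  have cmp: "cmp f g \<in> Arr V" "Dom V (cmp f g) = Dom V f" "Cod V (cmp f g) = S" "d \<cdot> cmp f g = d \<cdot> f" "c \<cdot> cmp f g = c \<cdot> g"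
    "res (IOb A) (cmp f g) y = igcmp V B (res (IOb A) f y) (res (IOb A) g y)"
    if "f \<in> Arr V" "g \<in> Arr V" "Cod V f = S" "Cod V g = S" "c \<cdot> f = d \<cdot> g" for f g
  proof -
    have D: "Dom V f = Dom V g" using that by (intro Dom_eqI[OF that(5)]) auto
    note nf = nM[OF that(1,3)] and ng = nM[OF that(2,4)]
    have "nfam A B (Dom V f) (res (IOb A) (d \<cdot> f) U0) (res (IAr A) (d \<cdot> f) U1) (res (IOb A) (c \<cdot> g) U0) (res (IAr A) (c \<cdot> g) U1)
      (igcmp V B (res (IOb A) f y) (res (IOb A) g y))"
      by (rule nfam_comp[OF _ _ _ nf ng[folded D that(5)]])
        (use UN[of "d \<cdot> f"] UN[of "c \<cdot> f"] UN[of "c \<cdot> g"] that D in simp_all)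
    from arr_ex[OF _ _ this] that D obtain h where h: "h \<in> Hom V (Dom V f) S \<and> d \<cdot> h = d \<cdot> f \<and> c \<cdot> h = c \<cdot> g \<and>
      res (IOb A) h y = igcmp V B (res (IOb A) f y) (res (IOb A) g y)" by auto
    have "cmp f g = h"
      unfolding cmp_def by (rule the_equality, rule h, rule arr_eq) (use h in simp_all)
    with h show "cmp f g \<in> Arr V" "Dom V (cmp f g) = Dom V f" "Cod V (cmp f g) = S" "d \<cdot> cmp f g = d \<cdot> f" "c \<cdot> cmp f g = c \<cdot> g"
      "res (IOb A) (cmp f g) y = igcmp V B (res (IOb A) f y) (res (IOb A) g y)" by simp_all
  qed
  have cx: "c \<cdot> (f \<cdot> x) = d \<cdot> (g \<cdot> x)" if "f \<in> Arr V" "g \<in> Arr V" "Cod V f = S" "Cod V g = S" "c \<cdot> f = d \<cdot> g" "Dom V f = Dom V g" "x \<in> Arr V" "Cod V x = Dom V f" for f g x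
    using that by (simp add: reassoc[OF that(5)])
  have cmp_x: "cmp f g \<cdot> x = cmp (f \<cdot> x) (g \<cdot> x)"
    if fg: "f \<in> Arr V" "g \<in> Arr V" "Cod V f = S" "Cod V g = S" "c \<cdot> f = d \<cdot> g" and x: "x \<in> Arr V" "Cod V x = Dom V f" for f g x
  proof -
    have D: "Dom V f = Dom V g" using fg by (intro Dom_eqI[OF fg(5)]) auto
    note e = cx[OF fg D x]
    note C = cmp[OF fg] and C' = cmp[of "f \<cdot> x" "g \<cdot> x", simplified, unfolded e]
    show ?thesis
    proof (rule arr_eq)
      show "d \<cdot> (cmp f g \<cdot> x) = d \<cdot> cmp (f \<cdot> x) (g \<cdot> x)" "c \<cdot> (cmp f g \<cdot> x) = c \<cdot> cmp (f \<cdot> x) (g \<cdot> x)"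
        using reassoc[OF C(4), of x] reassoc[OF C(5), of x] C(1-3) C'(4,5) fg(1-4) x D by simp_all
      show "res (IOb A) (cmp f g \<cdot> x) y = res (IOb A) (cmp (f \<cdot> x) (g \<cdot> x)) y"
        using C C' fg x D by (simp add: res_comp res_igcmp sM)
    qed (use C(1-3) C'(1-3) fg(1-4) x D in simp_all)
  qed
  define E where "E = \<lparr>IOb = R, IAr = S, isrc = d, itgt = c, iid = i, icmp = cmp (pb1 V c d) (pb2 V c d)\<rparr>"
  have Es [simp]: "IOb E = R" "IAr E = S" "isrc E = d" "itgt E = c" "iid E = i" by (simp_all add: E_def)
  have pc: "c \<cdot> pb1 V c d = d \<cdot> pb2 V c d" by (simp add: pb_commutes)
  note cp = cmp[OF _ _ _ _ pc, simplified]
  have gE: "igcmp V E f g = cmp f g" if "f \<in> Arr V" "g \<in> Arr V" "Cod V f = S" "Cod V g = S" "c \<cdot> f = d \<cdot> g" for f g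
    using that cmp_x[OF _ _ _ _ pc, of "pb_pair V c d f g"] by (simp add: igcmp_def) (simp add: E_def)
  have E: "E \<in> Obj W"
  proof (rule icatI)
    show "icmp E \<in> Hom V (pb V (itgt E) (isrc E)) (IAr E)" using cp by (simp add: E_def)
  next
    fix f g assume "f \<in> Arr V" "g \<in> Arr V" "Cod V f = IAr E" "Cod V g = IAr E" "Dom V f = Dom V g" "itgt E \<cdot> f = isrc E \<cdot> g"
    then show "isrc E \<cdot> igcmp V E f g = isrc E \<cdot> f" "itgt E \<cdot> igcmp V E f g = itgt E \<cdot> g"
      using gE[of f g] cmp[of f g] by simp_all
  next
    fix f assume f: "f \<in> Arr V" "Cod V f = IAr E"
    have yi': "res (IOb A) (i \<cdot> x) y = iid B \<cdot> res (IOb A) x U0" if "x \<in> Arr V" "Cod V x = R" for x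
      using that yi by (simp add: res_comp comp_res)
    have "cmp (i \<cdot> (d \<cdot> f)) f = f" "cmp f (i \<cdot> (c \<cdot> f)) = f"
      using cmp[of "i \<cdot> (d \<cdot> f)" f] cmp[of f "i \<cdot> (c \<cdot> f)"] f sM[of f] by - (rule arr_eq; simp add: yi')+
    then show "igcmp V E (iid E \<cdot> (isrc E \<cdot> f)) f = f" "igcmp V E f (iid E \<cdot> (itgt E \<cdot> f)) = f"
      using gE[of "i \<cdot> (d \<cdot> f)" f] gE[of f "i \<cdot> (c \<cdot> f)"] f by simp_all
  next
    fix f g h assume fg: "f \<in> Arr V" "g \<in> Arr V" "h \<in> Arr V" "Cod V f = IAr E" "Cod V g = IAr E" "Cod V h = IAr E"
      "Dom V f = Dom V g" "Dom V g = Dom V h" "itgt E \<cdot> f = isrc E \<cdot> g" "itgt E \<cdot> g = isrc E \<cdot> h"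
    note fg' = fg[unfolded Es]
    note m1 = cmp[OF fg'(1,2,4,5,9)] and m2 = cmp[OF fg'(2,3,5,6,10)]
    have "cmp (cmp f g) h = cmp f (cmp g h)"
      using cmp[of "cmp f g" h] cmp[of f "cmp g h"] m1 m2 fg' sM by - (rule arr_eq; simp add: igcmp_assoc)
    then show "igcmp V E (igcmp V E f g) h = igcmp V E f (igcmp V E g h)"
      using gE[of "cmp f g" h] gE[of f "cmp g h"] gE[OF fg'(1,2,4,5,9)] gE[OF fg'(2,3,5,6,10)] m1 m2 fg' by simp
  qed (simp_all add: di ci)
  note [simp] = E
  let ?e = "IF0 (pr1 W E A)" and ?a = "IF0 (pr2 W E A)" and ?M = "IF1 (pr1 W E A)" and ?f = "IF1 (pr2 W E A)"
  have sts: "d \<cdot> (?M \<cdot> x) = ?e \<cdot> (isrc (prd W E A) \<cdot> x)" "c \<cdot> (?M \<cdot> x) = ?e \<cdot> (itgt (prd W E A) \<cdot> x)"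
    if "x \<in> Arr V" "Cod V x = IAr (prd W E A)" for x
    using that ifun_comp_simps(1,2)[of "pr1 W E A" x E] by simp_all
  have sts0: "d \<cdot> ?M = ?e \<cdot> isrc (prd W E A)" "c \<cdot> ?M = ?e \<cdot> itgt (prd W E A)"
    using ifun_simps(7,8)[of "pr1 W E A" E] by simp_all
  have Mt [simp]: "?e \<in> Arr V" "Dom V ?e = IOb (prd W E A)" "Cod V ?e = R" "?M \<in> Arr V" "Dom V ?M = IAr (prd W E A)" "Cod V ?M = S"
    using ifun_simps(1-6)[of "pr1 W E A"] by simp_all
  define e0 where "e0 = U0 \<cdot> pair V ?e ?a"
  \<comment> \<open>The value at an arrow \<open>(M, f)\<close> is the diagonal of the naturality square of \<open>M\<close> at \<open>f\<close>.\<close>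
  define e1 where "e1 = igcmp V B (U1 \<cdot> pair V (d \<cdot> ?M) ?f) (y \<cdot> pair V ?M (itgt A \<cdot> ?f))"
  define ev where "ev = \<lparr>IDom = prd W E A, ICod = B, IF0 = e0, IF1 = e1\<rparr>"
  have e1x: "e1 \<cdot> x = igcmp V B (U1 \<cdot> pair V (d \<cdot> (?M \<cdot> x)) (?f \<cdot> x)) (y \<cdot> pair V (?M \<cdot> x) (itgt A \<cdot> (?f \<cdot> x)))"
    if "x \<in> Arr V" "Cod V x = IAr (prd W E A)" for x
    unfolding e1_def using that by (simp add: Ue ye sts sts0 del: ifun_comp_simps(1,2) ifun_simps(7,8))
  have et [simp]: "e0 \<in> Arr V" "Dom V e0 = IOb (prd W E A)" "Cod V e0 = IOb B" "e1 \<in> Arr V" "Dom V e1 = IAr (prd W E A)" "Cod V e1 = IAr B"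
    by (simp_all add: e0_def e1_def Ue ye sts0)
  have ev: "ev \<in> Hom W (prd W E A) B"
    unfolding ev_def
  proof (rule ifunI)
    show "isrc B \<cdot> e1 = e0 \<cdot> isrc (prd W E A)" "itgt B \<cdot> e1 = e0 \<cdot> itgt (prd W E A)"
      by (simp_all add: e0_def e1_def Ue ye sts0)
    have "?M \<cdot> iid (prd W E A) = i \<cdot> ?e" using ifun_simps(9)[of "pr1 W E A"] by simp
    then show "e1 \<cdot> iid (prd W E A) = iid B \<cdot> e0"
      by (simp add: e1x Ue yix e0_def)
  next
    fix x z assume xz: "x \<in> Arr V" "z \<in> Arr V" "Cod V x = IAr (prd W E A)" "Cod V z = IAr (prd W E A)" "Dom V x = Dom V z"
      "itgt (prd W E A) \<cdot> x = isrc (prd W E A) \<cdot> z"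
    define M f N g where "M = ?M \<cdot> x" and "f = ?f \<cdot> x" and "N = ?M \<cdot> z" and "g = ?f \<cdot> z"
    have cN: "c \<cdot> M = d \<cdot> N" and tg: "itgt A \<cdot> f = isrc A \<cdot> g"
      using sts[of x] sts[of z] xz by (simp_all add: M_def N_def f_def g_def)
    have [simp]: "M \<in> Arr V" "N \<in> Arr V" "f \<in> Arr V" "g \<in> Arr V" "Dom V M = Dom V z" "Dom V N = Dom V z" "Dom V f = Dom V z" "Dom V g = Dom V z"
      "Cod V M = S" "Cod V N = S" "Cod V f = IAr A" "Cod V g = IAr A"
      using xz by (simp_all add: M_def N_def f_def g_def)
    have Mz: "?M \<cdot> igcmp V (prd W E A) x z = cmp M N" "?f \<cdot> igcmp V (prd W E A) x z = igcmp V A f g"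
      using xz gE[of M N] cN by (simp_all add: M_def N_def f_def g_def)
    have C: "cmp M N \<in> Arr V" "Dom V (cmp M N) = Dom V z" "Cod V (cmp M N) = S" "d \<cdot> cmp M N = d \<cdot> M" "c \<cdot> cmp M N = c \<cdot> N"
      using cmp[of M N] cN by simp_all
    have yC: "y \<cdot> pair V (cmp M N) a = igcmp V B (y \<cdot> pair V M a) (y \<cdot> pair V N a)" if "a \<in> Arr V" "Dom V a = Dom V z" "Cod V a = IOb A" for a
    proof -
      let ?P = "pair V (Ident V (Dom V z)) a"
      have z: "Dom V z \<in> Obj V" using xz by simp
      have 1: "res (IOb A) (cmp M N) y \<cdot> ?P = y \<cdot> pair V (cmp M N) a" using that C z by simp
      have 2: "res (IOb A) M y \<cdot> ?P = y \<cdot> pair V M a" "res (IOb A) N y \<cdot> ?P = y \<cdot> pair V N a" using that z by simp_all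
      have "itgt B \<cdot> res (IOb A) M y = isrc B \<cdot> res (IOb A) N y" using sM(2)[of M] sM(1)[of N] cN by simp
      then have 3: "igcmp V B (res (IOb A) M y) (res (IOb A) N y) \<cdot> ?P = igcmp V B (res (IOb A) M y \<cdot> ?P) (res (IOb A) N y \<cdot> ?P)"
        using that z by (intro igcmp_simps(6)) simp_all
      have "res (IOb A) (cmp M N) y = igcmp V B (res (IOb A) M y) (res (IOb A) N y)" using cmp(6)[of M N] cN by simp
      with 1 2 3 show ?thesis by simp
    qed
    have "e1 \<cdot> igcmp V (prd W E A) x z =
        igcmp V B (igcmp V B (U1 \<cdot> pair V (d \<cdot> M) f) (U1 \<cdot> pair V (d \<cdot> M) g)) (igcmp V B (y \<cdot> pair V M (itgt A \<cdot> g)) (y \<cdot> pair V N (itgt A \<cdot> g)))"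
      using xz Mz C tg by (simp add: e1x yC Ue)
    also have "\<dots> = igcmp V B (U1 \<cdot> pair V (d \<cdot> M) f) (igcmp V B (igcmp V B (U1 \<cdot> pair V (d \<cdot> M) g) (y \<cdot> pair V M (itgt A \<cdot> g))) (y \<cdot> pair V N (itgt A \<cdot> g)))"
      using tg cN by (simp add: igcmp_assoc Ue ye)
    also have "\<dots> = igcmp V B (U1 \<cdot> pair V (d \<cdot> M) f) (igcmp V B (igcmp V B (y \<cdot> pair V M (isrc A \<cdot> g)) (U1 \<cdot> pair V (c \<cdot> M) g)) (y \<cdot> pair V N (itgt A \<cdot> g)))"
      using ynat[of M g] by simp
    also have "\<dots> = igcmp V B (igcmp V B (U1 \<cdot> pair V (d \<cdot> M) f) (y \<cdot> pair V M (itgt A \<cdot> f))) (igcmp V B (U1 \<cdot> pair V (d \<cdot> N) g) (y \<cdot> pair V N (itgt A \<cdot> g)))"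
      using tg cN by (simp add: igcmp_assoc Ue ye)
    finally show "e1 \<cdot> igcmp V (prd W E A) x z = igcmp V B (e1 \<cdot> x) (e1 \<cdot> z)"
      using xz by (simp add: e1x M_def N_def f_def g_def)
  qed simp_all
  have evs: "ev \<in> Arr W" "Dom W ev = prd W E A" "Cod W ev = B" "IF0 ev = e0" "IF1 ev = e1" using ev by (simp_all add: ev_def)
  have evo: "evo E ev N = res (IOb A) N U0" if "N \<in> Arr V" "Cod V N = R" for N
    using that evs ip0_simps(4)[OF E AB(1)] by (simp add: evo_def e0_def res_def)
  have eva: "eva E ev N = res (IAr A) N U1" if "N \<in> Arr V" "Cod V N = R" for N
    using that evs by (simp add: eva_def e1x res_def yix Ue)
  have evt: "evt E ev M = res (IOb A) M y" if "M \<in> Arr V" "Cod V M = S" for M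
    using that evs by (simp add: evt_def e1x res_def ye Ue)
  have "pexp E ev"
    unfolding pexp_def
  proof (intro conjI allI impI)
    show "E \<in> Obj W" "ev \<in> Hom W (prd W E A) B" using ev by simp_all
    show "\<exists>N. N \<in> Hom V X (IOb E) \<and> evo E ev N = F0 \<and> eva E ev N = F1" if "ffam A B X F0 F1" for X F0 F1
      using obj_ex[OF that] evo eva by auto
    show "N = N'" if "N \<in> Arr V" "N' \<in> Arr V" "Dom V N = Dom V N'" "Cod V N = IOb E" "Cod V N' = IOb E"
      "evo E ev N = evo E ev N'" "eva E ev N = eva E ev N'" for N N'
      using that by - (rule obj_eq, simp_all add: evo eva)
    show "\<exists>M. M \<in> Hom V (Dom V N) (IAr E) \<and> isrc E \<cdot> M = N \<and> itgt E \<cdot> M = N' \<and> evt E ev M = \<alpha>"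
      if "N \<in> Arr V" "N' \<in> Arr V" "Dom V N = Dom V N'" "Cod V N = IOb E" "Cod V N' = IOb E"
       "nfam A B (Dom V N) (evo E ev N) (eva E ev N) (evo E ev N') (eva E ev N') \<alpha>" for N N' \<alpha>
      using arr_ex[of N "Dom V N" N' \<alpha>] that evt by (auto simp: evo eva)
    show "M = M'" if "M \<in> Arr V" "M' \<in> Arr V" "Dom V M = Dom V M'" "Cod V M = IAr E" "Cod V M' = IAr E"
      "isrc E \<cdot> M = isrc E \<cdot> M'" "itgt E \<cdot> M = itgt E \<cdot> M'" "evt E ev M = evt E ev M'" for M M'
      using that by - (rule arr_eq, simp_all add: evt)
  qed
  then show ?thesis by blast
qed

end

sublocale W: ccc W
  by unfold_locales (use ex_pexp pexp_exponential in blast)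

lemma (in cartesian) exponential_iso:
  assumes E: "is_exponential V X Y (E, e)" and E': "is_exponential V X Y (E', e')" and [simp]: "X \<in> Obj V"
  obtains j where "iso V j" "j \<in> Hom V E E'" "e' \<cdot> prod_map V j (Ident V X) = e"
proof -
  have ex: "\<exists>!h. h \<in> Hom V Z E \<and> e \<cdot> prod_map V h (Ident V X) = f" if "Z \<in> Obj V" "f \<in> Hom V (prd V Z X) Y" for Z f
    using E that unfolding is_exponential_def by blast
  have ex': "\<exists>!h. h \<in> Hom V Z E' \<and> e' \<cdot> prod_map V h (Ident V X) = f" if "Z \<in> Obj V" "f \<in> Hom V (prd V Z X) Y" for Z f
    using E' that unfolding is_exponential_def by blast
  have [simp]: "E \<in> Obj V" "e \<in> Arr V" "Dom V e = prd V E X" "Cod V e = Y" "E' \<in> Obj V" "e' \<in> Arr V" "Dom V e' = prd V E' X" "Cod V e' = Y"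
    using E E' unfolding is_exponential_def by simp_all
  have "\<exists>j. j \<in> Hom V E E' \<and> e' \<cdot> prod_map V j (Ident V X) = e" using ex1_implies_ex[OF ex'[of E e]] by simp
  then obtain j where j: "j \<in> Hom V E E'" "e' \<cdot> prod_map V j (Ident V X) = e" by blast
  have "\<exists>k. k \<in> Hom V E' E \<and> e \<cdot> prod_map V k (Ident V X) = e'" using ex1_implies_ex[OF ex[of E' e']] by simp
  then obtain k where k: "k \<in> Hom V E' E" "e \<cdot> prod_map V k (Ident V X) = e'" by blast
  have pm: "prod_map V (g \<cdot> f) (Ident V X) = prod_map V g (Ident V X) \<cdot> prod_map V f (Ident V X)"
    if "f \<in> Arr V" "g \<in> Arr V" "Dom V g = Cod V f" for f g
    using that by (simp add: prod_map_def)
  have pI: "prod_map V (Ident V Z) (Ident V X) = Ident V (prd V Z X)" if "Z \<in> Obj V" for Z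
    using that by (simp add: prod_map_def)
  have pt: "prod_map V f (Ident V X) \<in> Hom V (prd V (Dom V f) X) (prd V (Cod V f) X)" if "f \<in> Arr V" for f
    using that by (simp add: prod_map_def)
  have "e \<cdot> prod_map V (k \<cdot> j) (Ident V X) = e"
    using j k pm[of j k] pt[of j] pt[of k] by (simp add: reassoc[OF k(2)])
  then have "k \<cdot> j = Ident V E"
    using Ex1_unique[OF ex[of E e], of "k \<cdot> j" "Ident V E"] j k by (simp add: pI)
  moreover have "e' \<cdot> prod_map V (j \<cdot> k) (Ident V X) = e'"
    using j k pm[of k j] pt[of j] pt[of k] by (simp add: reassoc[OF j(2)])
  then have "j \<cdot> k = Ident V E'"
    using Ex1_unique[OF ex'[of E' e'], of "j \<cdot> k" "Ident V E'"] j k by (simp add: pI)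
  ultimately have "iso V j" using j k by (intro isoI[of j k]) auto
  then show ?thesis using j that by blast
qed

text \<open>The isomorphism is bijective on generalized objects and arrows.\<close>

lemma pexp_transport:
  assumes A: "A \<in> Obj W" and B: "B \<in> Obj W" and P: "pexp A B E ev" and J: "iso W J" "J \<in> Hom W E' E" and ev': "ev \<cdot>\<^sub>W prod_map W J (Ident W A) = ev'"
  shows "pexp A B E' ev'"
proof -
  note PD = pexpD[OF A B P]
  have [simp]: "J \<in> Arr W" "Dom W J = E'" "Cod W J = E" "E' \<in> Obj W" using J(2) by auto
  note [simp] = A B PD(1-4)
  obtain K where K [simp]: "K \<in> Arr W" "Dom W K = E" "Cod W K = E'" and KJ: "K \<cdot>\<^sub>W J = Ident W E'" and JK: "J \<cdot>\<^sub>W K = Ident W E"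
    using W.isoE[OF J(1)] by auto
  have inv: "IF0 K \<cdot> IF0 J = Ident V (IOb E')" "IF1 K \<cdot> IF1 J = Ident V (IAr E')" "IF0 J \<cdot> IF0 K = Ident V (IOb E)" "IF1 J \<cdot> IF1 K = Ident V (IAr E)"
    using arg_cong[OF KJ, of IF0] arg_cong[OF KJ, of IF1] arg_cong[OF JK, of IF0] arg_cong[OF JK, of IF1] by simp_all
  have invx: "IF0 J \<cdot> (IF0 K \<cdot> x) = x" if "x \<in> Arr V" "Cod V x = IOb E" for x
    using reassoc[OF inv(3), of x] that by simp
  have invx1: "IF1 J \<cdot> (IF1 K \<cdot> x) = x" if "x \<in> Arr V" "Cod V x = IAr E" for x
    using reassoc[OF inv(4), of x] that by simp
  have inj0: "x = y" if "IF0 J \<cdot> x = IF0 J \<cdot> y" "x \<in> Arr V" "y \<in> Arr V" "Cod V x = IOb E'" "Cod V y = IOb E'" for x y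
    using arg_cong[OF that(1), of "\<lambda>z. IF0 K \<cdot> z"] that(2-) reassoc[OF inv(1), of x] reassoc[OF inv(1), of y] by simp
  have inj1: "x = y" if "IF1 J \<cdot> x = IF1 J \<cdot> y" "x \<in> Arr V" "y \<in> Arr V" "Cod V x = IAr E'" "Cod V y = IAr E'" for x y
    using arg_cong[OF that(1), of "\<lambda>z. IF1 K \<cdot> z"] that(2-) reassoc[OF inv(2), of x] reassoc[OF inv(2), of y] by simp
  have evs: "ev' \<in> Hom W (prd W E' A) B" "IF0 ev' = IF0 ev \<cdot> ip0 E A (IF0 J \<cdot> IF0 (pr1 W E' A)) (IF0 (pr2 W E' A))"
    "IF1 ev' = IF1 ev \<cdot> ip1 E A (IF1 J \<cdot> IF1 (pr1 W E' A)) (IF1 (pr2 W E' A))"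
    unfolding ev'[symmetric] by (simp_all add: prod_map_def)
  have evo: "evo A E' ev' N = evo A E ev (IF0 J \<cdot> N)" "eva A E' ev' N = eva A E ev (IF0 J \<cdot> N)" if "N \<in> Arr V" "Cod V N = IOb E'" for N
    using that by (simp_all add: evo_def[OF A B] eva_def[OF A B] evs)
  have evt: "evt A E' ev' M = evt A E ev (IF1 J \<cdot> M)" if "M \<in> Arr V" "Cod V M = IAr E'" for M
    using that by (simp add: evt_def[OF A B] evs)
  show ?thesis
    unfolding pexp_def[OF A B]
  proof (intro conjI allI impI)
    show "E' \<in> Obj W" "ev' \<in> Hom W (prd W E' A) B" using evs(1) by simp_all
    show "\<exists>N. N \<in> Hom V X (IOb E') \<and> evo A E' ev' N = F0 \<and> eva A E' ev' N = F1" if F: "ffam A B X F0 F1" for X F0 F1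
    proof -
      obtain N where "N \<in> Hom V X (IOb E) \<and> evo A E ev N = F0 \<and> eva A E ev N = F1" using PD(5)[OF F] by blast
      then show ?thesis by (intro exI[of _ "IF0 K \<cdot> N"]) (simp add: evo invx)
    qed
    show "N = N'" if "N \<in> Arr V" "N' \<in> Arr V" "Dom V N = Dom V N'" "Cod V N = IOb E'" "Cod V N' = IOb E'"
      "evo A E' ev' N = evo A E' ev' N'" "eva A E' ev' N = eva A E' ev' N'" for N N'
      using PD(6)[of "IF0 J \<cdot> N" "IF0 J \<cdot> N'"] that by - (rule inj0; simp add: evo)
    show "\<exists>M. M \<in> Hom V (Dom V N) (IAr E') \<and> isrc E' \<cdot> M = N \<and> itgt E' \<cdot> M = N' \<and> evt A E' ev' M = \<alpha>"
      if N: "N \<in> Arr V" "N' \<in> Arr V" "Dom V N = Dom V N'" "Cod V N = IOb E'" "Cod V N' = IOb E'"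
       "nfam A B (Dom V N) (evo A E' ev' N) (eva A E' ev' N) (evo A E' ev' N') (eva A E' ev' N') \<alpha>" for N N' \<alpha>
    proof -
      obtain M where M: "M \<in> Hom V (Dom V N) (IAr E)" "isrc E \<cdot> M = IF0 J \<cdot> N" "itgt E \<cdot> M = IF0 J \<cdot> N'" "evt A E ev M = \<alpha>"
        using PD(7)[of "IF0 J \<cdot> N" "IF0 J \<cdot> N'" \<alpha>] N by (auto simp: evo)
      have "isrc E' \<cdot> (IF1 K \<cdot> M) = N" "itgt E' \<cdot> (IF1 K \<cdot> M) = N'"
        using M N reassoc[OF inv(1), of N] reassoc[OF inv(1), of N'] by simp_all
      then show ?thesis using M by (intro exI[of _ "IF1 K \<cdot> M"]) (simp add: evt invx1)
    qed
    show "M = M'" if "M \<in> Arr V" "M' \<in> Arr V" "Dom V M = Dom V M'" "Cod V M = IAr E'" "Cod V M' = IAr E'"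
      "isrc E' \<cdot> M = isrc E' \<cdot> M'" "itgt E' \<cdot> M = itgt E' \<cdot> M'" "evt A E' ev' M = evt A E' ev' M'" for M M'
      using PD(8)[of "IF1 J \<cdot> M" "IF1 J \<cdot> M'"] that by - (rule inj1; simp add: evt)
  qed
qed

text \<open>The chosen exponential is isomorphic to the constructed one.\<close>

lemma pexp_expo:
  assumes "A \<in> Obj W" "B \<in> Obj W"
  shows "pexp A B (expo W A B) (evl W A B)"
proof -
  obtain E ev where P: "pexp A B E ev" using ex_pexp[OF assms] by blast
  obtain j where "iso W j" "j \<in> Hom W (expo W A B) E" "ev \<cdot>\<^sub>W prod_map W j (Ident W A) = evl W A B"
    using W.exponential_iso[OF W.exponential[OF assms] pexp_exponential[OF assms P] assms(1)] by blast
  from pexp_transport[OF assms P this] show ?thesis .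
qed

end

section \<open>Internalization of small enriched categories\<close>

context extensive_ccc
begin

definition small_vcat :: "('x, 'o, 'm) vcat \<Rightarrow> bool" where
  "small_vcat C \<longleftrightarrow> vcategory V C \<and> small U (VObj C)"

context
  fixes C :: "('x, 'o, 'm) vcat"
  assumes C: "small_vcat C"
begin

lemma VHom_Obj [simp]: "A \<in> VObj C \<Longrightarrow> B \<in> VObj C \<Longrightarrow> VHom C A B \<in> Obj V"
  using C unfolding small_vcat_def vcategory_def by blast

lemma VId_simps [simp]:
  assumes "A \<in> VObj C"
  shows "VId C A \<in> Arr V" "Dom V (VId C A) = \<one>" "Cod V (VId C A) = VHom C A A"
proof -
  have "VId C A \<in> Hom V \<one> (VHom C A A)" using C assms unfolding small_vcat_def vcategory_def by blast
  then show "VId C A \<in> Arr V" "Dom V (VId C A) = \<one>" "Cod V (VId C A) = VHom C A A" by simp_all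
qed

lemma VComp_simps [simp]:
  assumes "A \<in> VObj C" "B \<in> VObj C" "D \<in> VObj C"
  shows "VComp C A B D \<in> Arr V" "Dom V (VComp C A B D) = prd V (VHom C B D) (VHom C A B)" (is ?ga) "Cod V (VComp C A B D) = VHom C A D"
proof -
  have "VComp C A B D \<in> Hom V (prd V (VHom C B D) (VHom C A B)) (VHom C A D)"
    using C assms unfolding small_vcat_def vcategory_def by blast
  then show "VComp C A B D \<in> Arr V" ?ga "Cod V (VComp C A B D) = VHom C A D"
    by simp_all
qed

lemma vcmp_simps [simp]:
  assumes "A \<in> VObj C" "B \<in> VObj C" "D \<in> VObj C" "g \<in> Arr V" "f \<in> Arr V" "Dom V g = Dom V f" "Cod V g = VHom C B D" "Cod V f = VHom C A B"
  shows "vcmp V C A B D g f \<in> Arr V" "Dom V (vcmp V C A B D g f) = Dom V f" "Cod V (vcmp V C A B D g f) = VHom C A D"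
    "u \<in> Arr V \<Longrightarrow> Cod V u = Dom V f \<Longrightarrow> vcmp V C A B D g f \<cdot> u = vcmp V C A B D (g \<cdot> u) (f \<cdot> u)"
  using assms by (simp_all add: vcmp_def)

lemma vcmp_unit [simp]:
  assumes "A \<in> VObj C" "B \<in> VObj C" "f \<in> Arr V" "Cod V f = VHom C A B" "Dom V f = X"
  shows "vcmp V C A B B (VId C B \<cdot> bang V X) f = f" (is ?ga) "vcmp V C A A B f (VId C A \<cdot> bang V X) = f" (is ?gb)
proof -
  let ?X = "VHom C A B"
  have "vcmp V C A B B (const_at V ?X (VId C B)) (Ident V ?X) = Ident V ?X"
    "vcmp V C A A B (Ident V ?X) (const_at V ?X (VId C A)) = Ident V ?X"
    using C assms(1,2) unfolding small_vcat_def vcategory_def Let_def by blast+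
  then have "vcmp V C A B B (const_at V ?X (VId C B)) (Ident V ?X) \<cdot> f = f"
    "vcmp V C A A B (Ident V ?X) (const_at V ?X (VId C A)) \<cdot> f = f"
    using assms by simp_all
  then show ?ga ?gb
    using assms by (simp_all add: const_at_def)
qed

lemma vcmp_assoc:
  assumes "A \<in> VObj C" "B \<in> VObj C" "D \<in> VObj C" "E \<in> VObj C" "f \<in> Arr V" "g \<in> Arr V" "h \<in> Arr V"
    "Cod V f = VHom C A B" "Cod V g = VHom C B D" "Cod V h = VHom C D E" "Dom V f = Dom V g" "Dom V g = Dom V h"
  shows "vcmp V C A B E (vcmp V C B D E h g) f = vcmp V C A D E h (vcmp V C A B D g f)"
proof -
  let ?X = "VHom C A B" and ?Y = "VHom C B D" and ?Z = "VHom C D E"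
  let ?h = "pr1 V ?Z ?Y \<cdot> pr1 V (prd V ?Z ?Y) ?X" and ?g = "pr2 V ?Z ?Y \<cdot> pr1 V (prd V ?Z ?Y) ?X" and ?f = "pr2 V (prd V ?Z ?Y) ?X"
  have "vcmp V C A B E (vcmp V C B D E ?h ?g) ?f = vcmp V C A D E ?h (vcmp V C A B D ?g ?f)"
    using C assms(1-4) unfolding small_vcat_def vcategory_def Let_def by blast
  from arg_cong[OF this, of "\<lambda>x. x \<cdot> pair V (pair V h g) f"] show ?thesis using assms by simp
qed

lemma Int_ob_coproduct: "is_coproduct V (VObj C) (\<lambda>_. \<one>) (Int_ob V C, inc0 V C)"
proof -
  have "is_coproduct V (VObj C) (\<lambda>_. \<one>) (coprod V (VObj C) (\<lambda>_. \<one>), incl V (VObj C) (\<lambda>_. \<one>))"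
    using C by (intro small_coproduct) (auto simp: small_vcat_def)
  moreover have "inc0 V C = incl V (VObj C) (\<lambda>_. \<one>)" by (simp add: inc0_def fun_eq_iff)
  ultimately show ?thesis by (simp add: Int_ob_def)
qed

lemma Int_ar_coproduct: "is_coproduct V (VObj C \<times> VObj C) (\<lambda>(A, B). VHom C A B) (Int_ar V C, \<lambda>(A, B). inc1 V C A B)"
proof -
  have "is_coproduct V (VObj C \<times> VObj C) (\<lambda>(A, B). VHom C A B) (coprod V (VObj C \<times> VObj C) (\<lambda>(A, B). VHom C A B),
      incl V (VObj C \<times> VObj C) (\<lambda>(A, B). VHom C A B))"
    using C by (intro small_coproduct small_times) (auto simp: small_vcat_def)
  moreover have "(\<lambda>(A, B). inc1 V C A B) = incl V (VObj C \<times> VObj C) (\<lambda>(A, B). VHom C A B)" by (simp add: inc1_def fun_eq_iff)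
  ultimately show ?thesis by (simp add: Int_ar_def)
qed

lemma inc_simps [simp]:
  "Int_ob V C \<in> Obj V" "Int_ar V C \<in> Obj V"
  "A \<in> VObj C \<Longrightarrow> inc0 V C A \<in> Arr V" "A \<in> VObj C \<Longrightarrow> Dom V (inc0 V C A) = \<one>" "A \<in> VObj C \<Longrightarrow> Cod V (inc0 V C A) = Int_ob V C"
  "A \<in> VObj C \<Longrightarrow> B \<in> VObj C \<Longrightarrow> inc1 V C A B \<in> Arr V" "A \<in> VObj C \<Longrightarrow> B \<in> VObj C \<Longrightarrow> Dom V (inc1 V C A B) = VHom C A B"
  "A \<in> VObj C \<Longrightarrow> B \<in> VObj C \<Longrightarrow> Cod V (inc1 V C A B) = Int_ar V C"
  using is_coproductD[OF Int_ob_coproduct] is_coproductD(1)[OF Int_ar_coproduct] is_coproductD(2-4)[OF Int_ar_coproduct, where i = "(A, B)"] by auto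

lemma Int_ob_cotuple:
  assumes "Y \<in> Obj V" "\<And>A. A \<in> VObj C \<Longrightarrow> f A \<in> Hom V \<one> Y"
  shows "Int_ob_cotuple V C Y f \<in> Arr V" "Dom V (Int_ob_cotuple V C Y f) = Int_ob V C" "Cod V (Int_ob_cotuple V C Y f) = Y"
    "A \<in> VObj C \<Longrightarrow> Int_ob_cotuple V C Y f \<cdot> inc0 V C A = f A"
  using cotuple[OF Int_ob_coproduct[unfolded Int_ob_def inc0_def], of Y f] assms
  by (simp_all add: Int_ob_cotuple_def Int_ob_def inc0_def)

lemma Int_ar_cotuple:
  assumes "Y \<in> Obj V" "\<And>A B. A \<in> VObj C \<Longrightarrow> B \<in> VObj C \<Longrightarrow> f A B \<in> Hom V (VHom C A B) Y"
  shows "Int_ar_cotuple V C Y f \<in> Arr V" "Dom V (Int_ar_cotuple V C Y f) = Int_ar V C" "Cod V (Int_ar_cotuple V C Y f) = Y"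
    "A \<in> VObj C \<Longrightarrow> B \<in> VObj C \<Longrightarrow> Int_ar_cotuple V C Y f \<cdot> inc1 V C A B = f A B" (is "PROP ?ga")
proof -
  have *: "is_coproduct V (VObj C \<times> VObj C) (\<lambda>(A, B). VHom C A B) (coprod V (VObj C \<times> VObj C) (\<lambda>(A, B). VHom C A B),
      incl V (VObj C \<times> VObj C) (\<lambda>(A, B). VHom C A B))"
    using C by (intro small_coproduct small_times) (auto simp: small_vcat_def)
  have f: "(case i of (A, B) \<Rightarrow> f A B) \<in> Hom V (case i of (A, B) \<Rightarrow> VHom C A B) Y" if "i \<in> VObj C \<times> VObj C" for i
    using assms(2)[of "fst i" "snd i"] that by (cases i) auto
  note c = cotuple[OF *, of Y "\<lambda>(A, B). f A B", OF assms(1) f]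
  show "Int_ar_cotuple V C Y f \<in> Arr V" "Dom V (Int_ar_cotuple V C Y f) = Int_ar V C" "Cod V (Int_ar_cotuple V C Y f) = Y"
    "PROP ?ga"
    using c(1-3) c(4)[of "(A, B)"] by (simp_all add: Int_ar_cotuple_def Int_ar_def inc1_def)
qed

subsection \<open>Working locally on a decomposition\<close>

text \<open>
  A generalized object of \<open>Intl V C\<close> is locally constant, a generalized arrow locally lies in one hom-object,
  and two objects of \<open>C\<close> are locally different only over an initial object.
\<close>

lemma obj_decompose:
  assumes "a \<in> Arr V" "Cod V a = Int_ob V C"
  shows "\<exists>Y e. is_coproduct V (VObj C) Y (Dom V a, e) \<and> (\<forall>A\<in>VObj C. a \<cdot> e A = inc0 V C A \<cdot> bang V (Y A))"
proof -
  have "\<exists>Y e f. is_coproduct V (VObj C) Y (Dom V a, e) \<and> (\<forall>A\<in>VObj C. f A \<in> Hom V (Y A) \<one> \<and> a \<cdot> e A = inc0 V C A \<cdot> f A)"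
    using C assms by (intro decompose[OF _ Int_ob_coproduct]) (auto simp: small_vcat_def)
  then obtain Y e f where Y: "is_coproduct V (VObj C) Y (Dom V a, e)" "\<forall>A\<in>VObj C. f A \<in> Hom V (Y A) \<one> \<and> a \<cdot> e A = inc0 V C A \<cdot> f A"
    by blast
  then have "f A = bang V (Y A)" if "A \<in> VObj C" for A using that by (intro eq_bang) auto
  with Y show ?thesis by (intro exI[of _ Y] exI[of _ e]) auto
qed

lemma obj_local_eq:
  assumes "a \<in> Arr V" "Cod V a = Int_ob V C" "u \<in> Arr V" "v \<in> Arr V" "Dom V u = Dom V a" "Dom V v = Dom V a" "Cod V u = Cod V v"
    and "\<And>A e. \<lbrakk>A \<in> VObj C; e \<in> Arr V; Cod V e = Dom V a; a \<cdot> e = inc0 V C A \<cdot> bang V (Dom V e)\<rbrakk> \<Longrightarrow> u \<cdot> e = v \<cdot> e"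
  shows "u = v"
proof -
  obtain Y e where Y: "is_coproduct V (VObj C) Y (Dom V a, e)" "\<forall>A\<in>VObj C. a \<cdot> e A = inc0 V C A \<cdot> bang V (Y A)"
    using obj_decompose[OF assms(1,2)] by blast
  show ?thesis
    by (rule coproduct_ext[OF Y(1)]) (use assms Y(2) is_coproductD[OF Y(1)] in auto)
qed

lemma arr_decompose:
  assumes "f \<in> Arr V" "Cod V f = Int_ar V C"
  shows "\<exists>Y e f'. is_coproduct V (VObj C \<times> VObj C) Y (Dom V f, e) \<and>
    (\<forall>A\<in>VObj C. \<forall>B\<in>VObj C. f' (A, B) \<in> Hom V (Y (A, B)) (VHom C A B) \<and> f \<cdot> e (A, B) = inc1 V C A B \<cdot> f' (A, B))"
proof -
  have "\<exists>Y e f'. is_coproduct V (VObj C \<times> VObj C) Y (Dom V f, e) \<and>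
    (\<forall>j\<in>VObj C \<times> VObj C. f' j \<in> Hom V (Y j) (case j of (A, B) \<Rightarrow> VHom C A B) \<and> f \<cdot> e j = (case j of (A, B) \<Rightarrow> inc1 V C A B) \<cdot> f' j)"
    using C assms by (intro decompose[OF _ Int_ar_coproduct] small_times) (auto simp: small_vcat_def)
  then show ?thesis by auto
qed

lemma arr_local_eq:
  assumes "f \<in> Arr V" "Cod V f = Int_ar V C" "u \<in> Arr V" "v \<in> Arr V" "Dom V u = Dom V f" "Dom V v = Dom V f" "Cod V u = Cod V v"
    and "\<And>A B e f'. \<lbrakk>A \<in> VObj C; B \<in> VObj C; e \<in> Arr V; Cod V e = Dom V f; f' \<in> Hom V (Dom V e) (VHom C A B); f \<cdot> e = inc1 V C A B \<cdot> f'\<rbrakk> \<Longrightarrow> u \<cdot> e = v \<cdot> e"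
  shows "u = v"
proof -
  obtain Y e f' where Y: "is_coproduct V (VObj C \<times> VObj C) Y (Dom V f, e)"
    "\<forall>A\<in>VObj C. \<forall>B\<in>VObj C. f' (A, B) \<in> Hom V (Y (A, B)) (VHom C A B) \<and> f \<cdot> e (A, B) = inc1 V C A B \<cdot> f' (A, B)"
    using arr_decompose[OF assms(1,2)] by blast
  show ?thesis
  proof (rule coproduct_ext[OF Y(1)])
    fix i assume i: "i \<in> VObj C \<times> VObj C"
    then obtain A B where AB: "i = (A, B)" "A \<in> VObj C" "B \<in> VObj C" by blast
    then show "u \<cdot> e i = v \<cdot> e i"
      using assms(8)[of A B "e (A, B)" "f' (A, B)"] Y(2) is_coproductD[OF Y(1)] i by auto
  qed (use assms in auto)
qed

lemma inc0_disjoint: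
  assumes "A \<in> VObj C" "B \<in> VObj C" "X \<in> Obj V" "inc0 V C A \<cdot> bang V X = inc0 V C B \<cdot> bang V X"
  shows "A = B \<or> is_initial V X"
  using overlap[OF _ Int_ob_coproduct, of A "bang V X" X B "bang V X"] C assms by (auto simp: small_vcat_def split: if_splits)

lemma inc1_overlap:
  assumes "A \<in> VObj C" "B \<in> VObj C" "A' \<in> VObj C" "B' \<in> VObj C" "f \<in> Hom V X (VHom C A B)" "g \<in> Hom V X (VHom C A' B')"
    and "inc1 V C A B \<cdot> f = inc1 V C A' B' \<cdot> g"
  shows "(A = A' \<and> B = B' \<and> f = g) \<or> is_initial V X"
proof -
  have "if (A, B) = (A', B') then f = g else is_initial V X"
  proof (rule overlap[OF _ Int_ar_coproduct, where j = "(A, B)" and k = "(A', B')"])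
    show "small U (VObj C \<times> VObj C)" using C by (intro small_times) (auto simp: small_vcat_def)
  qed (use assms in auto)
  then show ?thesis by (cases "(A, B) = (A', B')") auto
qed

lemma inc1_mono:
  assumes "A \<in> VObj C" "B \<in> VObj C" "f \<in> Arr V" "g \<in> Arr V" "Dom V f = Dom V g" "Cod V f = VHom C A B" "Cod V g = VHom C A B"
    and "inc1 V C A B \<cdot> f = inc1 V C A B \<cdot> g"
  shows "f = g"
proof -
  have "(A = A \<and> B = B \<and> f = g) \<or> is_initial V (Dom V f)"
    by (rule inc1_overlap[OF assms(1,2,1,2) _ _ assms(8)]) (use assms(3-7) in simp_all)
  then show ?thesis using initial_unique[OF _ assms(3,4) refl assms(5)[symmetric]] assms(6,7) by metis
qed

subsection \<open>The internal category\<close>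

lemma Intl_sel [simp]: "IOb (Intl V C) = Int_ob V C" "IAr (Intl V C) = Int_ar V C"
  by (simp_all add: Intl_def Let_def)

lemma Intl_st [simp]:
  shows "isrc (Intl V C) \<in> Arr V" "Dom V (isrc (Intl V C)) = Int_ar V C" "Cod V (isrc (Intl V C)) = Int_ob V C"
    "itgt (Intl V C) \<in> Arr V" "Dom V (itgt (Intl V C)) = Int_ar V C" "Cod V (itgt (Intl V C)) = Int_ob V C"
    "A \<in> VObj C \<Longrightarrow> B \<in> VObj C \<Longrightarrow> isrc (Intl V C) \<cdot> inc1 V C A B = inc0 V C A \<cdot> bang V (VHom C A B)" (is "PROP ?ga")
    "A \<in> VObj C \<Longrightarrow> B \<in> VObj C \<Longrightarrow> itgt (Intl V C) \<cdot> inc1 V C A B = inc0 V C B \<cdot> bang V (VHom C A B)" (is "PROP ?gb")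
proof -
  have s: "isrc (Intl V C) = Int_ar_cotuple V C (Int_ob V C) (\<lambda>A B. const_at V (VHom C A B) (inc0 V C A))"
    and t: "itgt (Intl V C) = Int_ar_cotuple V C (Int_ob V C) (\<lambda>A B. const_at V (VHom C A B) (inc0 V C B))"
    by (simp_all add: Intl_def Let_def)
  have cs: "const_at V (VHom C A B) (inc0 V C A) \<in> Hom V (VHom C A B) (Int_ob V C)" "const_at V (VHom C A B) (inc0 V C B) \<in> Hom V (VHom C A B) (Int_ob V C)"
    if "A \<in> VObj C" "B \<in> VObj C" for A B using that by (simp_all add: const_at_def)
  note S = Int_ar_cotuple[OF inc_simps(1), of "\<lambda>A B. const_at V (VHom C A B) (inc0 V C A)", OF cs(1), folded s]
  note T = Int_ar_cotuple[OF inc_simps(1), of "\<lambda>A B. const_at V (VHom C A B) (inc0 V C B)", OF cs(2), folded t]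
  show "isrc (Intl V C) \<in> Arr V" "Dom V (isrc (Intl V C)) = Int_ar V C" "Cod V (isrc (Intl V C)) = Int_ob V C"
    "itgt (Intl V C) \<in> Arr V" "Dom V (itgt (Intl V C)) = Int_ar V C" "Cod V (itgt (Intl V C)) = Int_ob V C"
    using S(1-3) T(1-3) by blast+
  show "PROP ?ga"
    "PROP ?gb"
    using S(4)[of A B] T(4)[of A B] by (simp_all add: const_at_def)
qed

lemma Intl_st_comp [simp]:
  assumes "A \<in> VObj C" "B \<in> VObj C" "f \<in> Arr V" "Cod V f = VHom C A B"
  shows "isrc (Intl V C) \<cdot> (inc1 V C A B \<cdot> f) = inc0 V C A \<cdot> bang V (Dom V f)"
    "itgt (Intl V C) \<cdot> (inc1 V C A B \<cdot> f) = inc0 V C B \<cdot> bang V (Dom V f)"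
  using assms reassoc[OF Intl_st(7), of A B f] reassoc[OF Intl_st(8), of A B f] by simp_all

lemma Intl_id [simp]:
  shows "iid (Intl V C) \<in> Arr V" "Dom V (iid (Intl V C)) = Int_ob V C" "Cod V (iid (Intl V C)) = Int_ar V C"
    "A \<in> VObj C \<Longrightarrow> iid (Intl V C) \<cdot> inc0 V C A = inc1 V C A A \<cdot> VId C A" (is "PROP ?ga")
    "\<lbrakk>A \<in> VObj C; x \<in> Arr V; Cod V x = \<one>\<rbrakk> \<Longrightarrow> iid (Intl V C) \<cdot> (inc0 V C A \<cdot> x) = inc1 V C A A \<cdot> (VId C A \<cdot> x)" (is "PROP ?gb")
proof -
  have i: "iid (Intl V C) = Int_ob_cotuple V C (Int_ar V C) (\<lambda>A. inc1 V C A A \<cdot> VId C A)"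
    by (simp add: Intl_def Let_def)
  have m: "inc1 V C A A \<cdot> VId C A \<in> Hom V \<one> (Int_ar V C)" if "A \<in> VObj C" for A using that by simp
  note S = Int_ob_cotuple[OF inc_simps(2), of "\<lambda>A. inc1 V C A A \<cdot> VId C A", OF m, folded i]
  show "iid (Intl V C) \<in> Arr V" "Dom V (iid (Intl V C)) = Int_ob V C" "Cod V (iid (Intl V C)) = Int_ar V C"
    "PROP ?ga"
    using S by blast+
  show "PROP ?gb"
    using reassoc[OF S(4), of A x] S(1-3) by simp
qed

text \<open>Composability forces the middle objects of two locally given arrows to agree.\<close>

lemma pair_local_eq:
  assumes f: "f \<in> Arr V" "Cod V f = Int_ar V C" and g: "g \<in> Arr V" "Cod V g = Int_ar V C" and fg: "itgt (Intl V C) \<cdot> f = isrc (Intl V C) \<cdot> g"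
    and uv: "u \<in> Arr V" "v \<in> Arr V" "Dom V u = Dom V f" "Dom V v = Dom V f" "Cod V u = Cod V v"
    and loc: "\<And>A B D e f' g'. \<lbrakk>A \<in> VObj C; B \<in> VObj C; D \<in> VObj C; e \<in> Arr V; Cod V e = Dom V f; f' \<in> Hom V (Dom V e) (VHom C A B); g' \<in> Hom V (Dom V e) (VHom C B D); f \<cdot> e = inc1 V C A B \<cdot> f'; g \<cdot> e = inc1 V C B D \<cdot> g'\<rbrakk> \<Longrightarrow> u \<cdot> e = v \<cdot> e"
  shows "u = v"
proof (rule arr_local_eq[OF f uv])
  have d: "Dom V f = Dom V g" using f g by (intro Dom_eqI[OF fg]) auto
  fix A B e f' assume AB: "A \<in> VObj C" "B \<in> VObj C" and e: "e \<in> Arr V" "Cod V e = Dom V f" and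
    f': "f' \<in> Hom V (Dom V e) (VHom C A B)" "f \<cdot> e = inc1 V C A B \<cdot> f'"
  have ge: "g \<cdot> e \<in> Arr V" "Cod V (g \<cdot> e) = Int_ar V C" "Dom V (g \<cdot> e) = Dom V e" using g e d by simp_all
  show "u \<cdot> e = v \<cdot> e"
  proof (rule arr_local_eq[OF ge(1,2)])
    fix B' D k g' assume BD: "B' \<in> VObj C" "D \<in> VObj C" and k: "k \<in> Arr V" "Cod V k = Dom V (g \<cdot> e)" and
      g': "g' \<in> Hom V (Dom V k) (VHom C B' D)" "(g \<cdot> e) \<cdot> k = inc1 V C B' D \<cdot> g'"
    have k': "Cod V k = Dom V e" using k ge by simp
    have fk: "f \<cdot> (e \<cdot> k) = inc1 V C A B \<cdot> (f' \<cdot> k)" and gk: "g \<cdot> (e \<cdot> k) = inc1 V C B' D \<cdot> g'"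
      using reassoc[OF f'(2), of k] f e k k' f' AB g g' d by simp_all
    have "itgt (Intl V C) \<cdot> (f \<cdot> (e \<cdot> k)) = isrc (Intl V C) \<cdot> (g \<cdot> (e \<cdot> k))"
      using reassoc[OF fg, of "e \<cdot> k"] f g e k k' d by simp
    then have "inc0 V C B \<cdot> bang V (Dom V k) = inc0 V C B' \<cdot> bang V (Dom V k)"
      unfolding fk gk using AB BD f' g' k k' by simp
    then consider "B = B'" | "is_initial V (Dom V k)" using inc0_disjoint[of B B' "Dom V k"] AB BD k by auto
    then have "u \<cdot> (e \<cdot> k) = v \<cdot> (e \<cdot> k)"
    proof cases
      case 1
      show ?thesis by (rule loc[of A B D "e \<cdot> k" "f' \<cdot> k" g']) (use 1 AB BD e k k' f' g' fk gk in simp_all)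
    next
      case 2
      then show ?thesis by (rule initial_unique) (use uv e k k' in simp_all)
    qed
    then show "(u \<cdot> e) \<cdot> k = (v \<cdot> e) \<cdot> k" using uv e k k' by simp
  qed (use uv e ge in simp_all)
qed

text \<open>
  The object of composable pairs decomposes into pieces on which each of the two arrows lies in a hom-object. A piece is
  initial unless the middle objects agree, and then the composition of \<open>C\<close> defines the morphism. The equation is
  checked by decomposing the given pair along these pieces.
\<close>

lemma Intl_comp_ex:
  defines "P \<equiv> pb V (itgt (Intl V C)) (isrc (Intl V C))"
  shows "\<exists>c. c \<in> Hom V P (Int_ar V C) \<and> (\<forall>A\<in>VObj C. \<forall>B\<in>VObj C. \<forall>D\<in>VObj C. \<forall>X f g. f \<in> Hom V X (VHom C A B) \<longrightarrow> g \<in> Hom V X (VHom C B D) \<longrightarrow>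
    c \<cdot> pb_pair V (itgt (Intl V C)) (isrc (Intl V C)) (inc1 V C A B \<cdot> f) (inc1 V C B D \<cdot> g) = inc1 V C A D \<cdot> vcmp V C A B D g f)"
proof -
  let ?s = "isrc (Intl V C)" and ?t = "itgt (Intl V C)" and ?J = "VObj C \<times> VObj C"
  let ?p = "pb1 V ?t ?s" and ?q = "pb2 V ?t ?s"
  have [simp]: "P \<in> Obj V" by (simp add: P_def)
  have pq: "?p \<in> Arr V" "Dom V ?p = P" "Cod V ?p = Int_ar V C" "?q \<in> Arr V" "Dom V ?q = P" "Cod V ?q = Int_ar V C" "?t \<cdot> ?p = ?s \<cdot> ?q"
    by (simp_all add: P_def pb_commutes)
  obtain Y e f where Y: "is_coproduct V ?J Y (P, e)"
    and f: "\<forall>A\<in>VObj C. \<forall>B\<in>VObj C. f (A, B) \<in> Hom V (Y (A, B)) (VHom C A B) \<and> ?p \<cdot> e (A, B) = inc1 V C A B \<cdot> f (A, B)"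
    using arr_decompose[OF pq(1,3)] pq(2) by auto
  note eD = is_coproductD(2-4)[OF Y]
  have "\<exists>Z k g. is_coproduct V ?J Z (Y j, k) \<and>
    (\<forall>B\<in>VObj C. \<forall>D\<in>VObj C. g (B, D) \<in> Hom V (Z (B, D)) (VHom C B D) \<and> (?q \<cdot> e j) \<cdot> k (B, D) = inc1 V C B D \<cdot> g (B, D))" if "j \<in> ?J" for j
    using arr_decompose[of "?q \<cdot> e j"] pq eD[of j] that by simp
  then obtain Z k g where Z: "\<And>j. j \<in> ?J \<Longrightarrow> is_coproduct V ?J (Z j) (Y j, k j)"
    and g: "\<And>j B D. \<lbrakk>j \<in> ?J; B \<in> VObj C; D \<in> VObj C\<rbrakk> \<Longrightarrow>
      g j (B, D) \<in> Hom V (Z j (B, D)) (VHom C B D) \<and> (?q \<cdot> e j) \<cdot> k j (B, D) = inc1 V C B D \<cdot> g j (B, D)"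
    by metis
  note kD = is_coproductD(2-4)[OF Z]
  have ZO: "Z i j \<in> Obj V" if "i \<in> ?J" "j \<in> ?J" for i j
    using kD(1,2)[of i j] that Dom_Obj[of "k i j"] by simp
  have nest: "is_coproduct V (?J \<times> ?J) (\<lambda>(i, j). Z i j) (P, \<lambda>(i, j). e i \<cdot> k i j)"
    by (rule coproduct_nested[OF Y Z])
  have ini: "B = B' \<or> is_initial V (Z (A, B) (B', D))" if o: "A \<in> VObj C" "B \<in> VObj C" "B' \<in> VObj C" "D \<in> VObj C" for A B B' D
  proof -
    let ?e = "e (A, B)" and ?k = "k (A, B) (B', D)"
    have ek: "?e \<in> Arr V" "Dom V ?e = Y (A, B)" "Cod V ?e = P" "?k \<in> Arr V" "Dom V ?k = Z (A, B) (B', D)" "Cod V ?k = Y (A, B)"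
      using eD[of "(A, B)"] kD[of "(A, B)" "(B', D)"] o by auto
    have "?p \<cdot> ?e = inc1 V C A B \<cdot> f (A, B)" and fh: "f (A, B) \<in> Hom V (Y (A, B)) (VHom C A B)" using f o by auto
    from reassoc[OF this(1), of ?k] have 1: "?p \<cdot> (?e \<cdot> ?k) = inc1 V C A B \<cdot> (f (A, B) \<cdot> ?k)" using pq o ek fh by simp
    have 2: "?q \<cdot> (?e \<cdot> ?k) = inc1 V C B' D \<cdot> g (A, B) (B', D)" and gh: "g (A, B) (B', D) \<in> Hom V (Z (A, B) (B', D)) (VHom C B' D)"
      using g[of "(A, B)" B' D] pq o ek by simp_all
    have "?t \<cdot> (?p \<cdot> (?e \<cdot> ?k)) = ?s \<cdot> (?q \<cdot> (?e \<cdot> ?k))"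
      using reassoc[OF pq(7), of "?e \<cdot> ?k"] pq(1-6) ek by simp
    then have "inc0 V C B \<cdot> bang V (Z (A, B) (B', D)) = inc0 V C B' \<cdot> bang V (Z (A, B) (B', D))"
      unfolding 1 2 using o fh gh ek by simp
    then show ?thesis using inc0_disjoint[of B B' "Z (A, B) (B', D)"] o gh by (auto dest: Dom_Obj)
  qed
  have "\<exists>h. h \<in> Hom V (Z (A, B) (B', D)) (Int_ar V C) \<and> (B = B' \<longrightarrow> h = inc1 V C A D \<cdot> vcmp V C A B D (g (A, B) (B', D)) (f (A, B) \<cdot> k (A, B) (B', D)))"
    if o: "A \<in> VObj C" "B \<in> VObj C" "B' \<in> VObj C" "D \<in> VObj C" for A B B' D
  proof (cases "B = B'")
    case True
    then show ?thesis using o f g[of "(A, B)" B' D] kD[of "(A, B)" "(B', D)"] by simp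
  next
    case False
    then have "is_initial V (Z (A, B) (B', D))" using ini[OF o] by simp
    then show ?thesis using False unfolding is_initial_def by (metis inc_simps(2))
  qed
  then have "\<exists>h. h \<in> Hom V (Z (fst i) (snd i)) (Int_ar V C) \<and> (snd (fst i) = fst (snd i) \<longrightarrow>
      h = inc1 V C (fst (fst i)) (snd (snd i)) \<cdot> vcmp V C (fst (fst i)) (snd (fst i)) (snd (snd i)) (g (fst i) (snd i)) (f (fst i) \<cdot> k (fst i) (snd i)))"
    if "i \<in> ?J \<times> ?J" for i
    using that by auto
  then obtain h where h: "\<And>i. i \<in> ?J \<times> ?J \<Longrightarrow> h i \<in> Hom V (Z (fst i) (snd i)) (Int_ar V C) \<and> (snd (fst i) = fst (snd i) \<longrightarrow>
      h i = inc1 V C (fst (fst i)) (snd (snd i)) \<cdot> vcmp V C (fst (fst i)) (snd (fst i)) (snd (snd i)) (g (fst i) (snd i)) (f (fst i) \<cdot> k (fst i) (snd i)))"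
    by metis
  obtain c where c: "c \<in> Arr V" "Dom V c = P" "Cod V c = Int_ar V C" "\<And>i. i \<in> ?J \<times> ?J \<Longrightarrow> c \<cdot> (case i of (i, j) \<Rightarrow> e i \<cdot> k i j) = h i"
    by (rule coproduct_ex[OF nest inc_simps(2), of h]) (use h in \<open>auto simp: split_beta\<close>)
  have spec: "c \<cdot> pb_pair V ?t ?s (inc1 V C A B \<cdot> x) (inc1 V C B D \<cdot> y) = inc1 V C A D \<cdot> vcmp V C A B D y x"
    if o: "A \<in> VObj C" "B \<in> VObj C" "D \<in> VObj C" and xy: "x \<in> Hom V X (VHom C A B)" "y \<in> Hom V X (VHom C B D)" for A B D X x y
  proof -
    define z where "z = pb_pair V ?t ?s (inc1 V C A B \<cdot> x) (inc1 V C B D \<cdot> y)"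
    have z: "z \<in> Arr V" "Dom V z = X" "Cod V z = P" "?p \<cdot> z = inc1 V C A B \<cdot> x" "?q \<cdot> z = inc1 V C B D \<cdot> y"
      using o xy by (simp_all add: z_def P_def)
    have "\<exists>T m l. is_coproduct V (?J \<times> ?J) T (Dom V z, m) \<and>
      (\<forall>i\<in>?J \<times> ?J. l i \<in> Hom V (T i) (case i of (i, j) \<Rightarrow> Z i j) \<and> z \<cdot> m i = (case i of (i, j) \<Rightarrow> e i \<cdot> k i j) \<cdot> l i)"
      using C z(1,3) ZO by (intro decompose[OF _ nest] small_times) (auto simp: small_vcat_def)
    then obtain T m l where T: "is_coproduct V (?J \<times> ?J) T (X, m)" and
      l': "\<forall>i\<in>?J \<times> ?J. l i \<in> Hom V (T i) (case i of (i, j) \<Rightarrow> Z i j) \<and> z \<cdot> m i = (case i of (i, j) \<Rightarrow> e i \<cdot> k i j) \<cdot> l i"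
      unfolding z(2) by blast
    have l: "l i \<in> Hom V (T i) (Z (fst i) (snd i)) \<and> z \<cdot> m i = (e (fst i) \<cdot> k (fst i) (snd i)) \<cdot> l i" if "i \<in> ?J \<times> ?J" for i
      using bspec[OF l' that] by (simp add: split_beta)
    note mD = is_coproductD(2-4)[OF T]
    have "c \<cdot> z = inc1 V C A D \<cdot> vcmp V C A B D y x"
    proof (rule coproduct_ext[OF T])
      fix i assume i: "i \<in> ?J \<times> ?J"
      then obtain A' B' B'' D' where i': "i = ((A', B'), (B'', D'))" and o': "A' \<in> VObj C" "B' \<in> VObj C" "B'' \<in> VObj C" "D' \<in> VObj C" by auto
      let ?e = "e (A', B')" and ?k = "k (A', B') (B'', D')" and ?l = "l i" and ?m = "m i"
      have ek: "?e \<in> Arr V" "Dom V ?e = Y (A', B')" "Cod V ?e = P" "?k \<in> Arr V" "Dom V ?k = Z (A', B') (B'', D')" "Cod V ?k = Y (A', B')"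
        using eD[of "(A', B')"] kD[of "(A', B')" "(B'', D')"] o' by auto
      have lm: "?l \<in> Arr V" "Dom V ?l = T i" "Cod V ?l = Z (A', B') (B'', D')" "?m \<in> Arr V" "Dom V ?m = T i" "Cod V ?m = X"
        and zm: "z \<cdot> ?m = ?e \<cdot> (?k \<cdot> ?l)"
        using l[OF i] mD[of i] i ek by (simp_all add: i')
      have fe: "?p \<cdot> ?e = inc1 V C A' B' \<cdot> f (A', B')" and fh: "f (A', B') \<in> Hom V (Y (A', B')) (VHom C A' B')" using f o' by auto
      have ge: "?q \<cdot> (?e \<cdot> ?k) = inc1 V C B'' D' \<cdot> g (A', B') (B'', D')" and gh: "g (A', B') (B'', D') \<in> Hom V (Z (A', B') (B'', D')) (VHom C B'' D')"
        using g[of "(A', B')" B'' D'] pq o' ek by simp_all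
      have "inc1 V C A B \<cdot> (x \<cdot> ?m) = ?p \<cdot> (z \<cdot> ?m)"
        using z xy o lm pq by (simp add: reassoc[OF z(4)])
      also have "\<dots> = inc1 V C A' B' \<cdot> (f (A', B') \<cdot> (?k \<cdot> ?l))"
        unfolding zm using reassoc[OF fe, of "?k \<cdot> ?l"] ek lm fh pq o' by simp
      finally have 1: "(A = A' \<and> B = B' \<and> x \<cdot> ?m = f (A', B') \<cdot> (?k \<cdot> ?l)) \<or> is_initial V (T i)"
        using o o' xy lm fh ek by (intro inc1_overlap) simp_all
      have "inc1 V C B D \<cdot> (y \<cdot> ?m) = ?q \<cdot> (z \<cdot> ?m)"
        using z xy o lm pq by (simp add: reassoc[OF z(5)])
      also have "\<dots> = inc1 V C B'' D' \<cdot> (g (A', B') (B'', D') \<cdot> ?l)"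
        unfolding zm using reassoc[OF ge, of ?l] ek lm gh pq o' by simp
      finally have 2: "(B = B'' \<and> D = D' \<and> y \<cdot> ?m = g (A', B') (B'', D') \<cdot> ?l) \<or> is_initial V (T i)"
        using o o' xy lm gh ek by (intro inc1_overlap) simp_all
      show "(c \<cdot> z) \<cdot> ?m = (inc1 V C A D \<cdot> vcmp V C A B D y x) \<cdot> ?m"
      proof (cases "is_initial V (T i)")
        case True
        then show ?thesis by (rule initial_unique) (use c z lm o xy in simp_all)
      next
        case False
        with 1 2 have eq: "A = A'" "B = B'" "B = B''" "D = D'" "x \<cdot> ?m = f (A', B') \<cdot> (?k \<cdot> ?l)" "y \<cdot> ?m = g (A', B') (B'', D') \<cdot> ?l" by auto
        have "c \<cdot> (?e \<cdot> ?k) = inc1 V C A D \<cdot> vcmp V C A B D (g (A', B') (B'', D')) (f (A', B') \<cdot> ?k)"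
          using c(4)[OF i] h[OF i] eq(1-4) by (simp add: i')
        from reassoc[OF this, of ?l]
        have "c \<cdot> (?e \<cdot> (?k \<cdot> ?l)) = inc1 V C A D \<cdot> vcmp V C A B D (g (A', B') (B'', D') \<cdot> ?l) (f (A', B') \<cdot> (?k \<cdot> ?l))"
          using c(1-3) ek lm o fh gh eq(1-4) by simp
        then have "c \<cdot> (z \<cdot> ?m) = inc1 V C A D \<cdot> vcmp V C A B D (y \<cdot> ?m) (x \<cdot> ?m)" by (simp only: zm eq(5,6))
        then show ?thesis using c(1-3) z(1-3) lm o xy by simp
      qed
    qed (use c z o xy in simp_all)
    then show ?thesis by (simp add: z_def)
  qed
  show ?thesis by (intro exI[of _ c] conjI ballI allI impI spec) (use c(1-3) in simp_all)
qed

text \<open>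
  The restrictions to the summands determine the composition because equality of morphisms out of the object of composable
  pairs is local.
\<close>

lemma Intl_icmp:
  "icmp (Intl V C) \<in> Hom V (pb V (itgt (Intl V C)) (isrc (Intl V C))) (Int_ar V C)"
  "\<lbrakk>A \<in> VObj C; B \<in> VObj C; D \<in> VObj C; f \<in> Arr V; g \<in> Arr V; Dom V f = Dom V g; Cod V f = VHom C A B; Cod V g = VHom C B D\<rbrakk> \<Longrightarrow>
     igcmp V (Intl V C) (inc1 V C A B \<cdot> f) (inc1 V C B D \<cdot> g) = inc1 V C A D \<cdot> vcmp V C A B D g f" (is "PROP ?ga")
proof -
  let ?s = "isrc (Intl V C)" and ?t = "itgt (Intl V C)"
  let ?P = "pb V ?t ?s" and ?p = "pb1 V ?t ?s" and ?q = "pb2 V ?t ?s"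
  let ?z = "\<lambda>A B D. pb_pair V ?t ?s (inc1 V C A B \<cdot> pr1 V (VHom C A B) (VHom C B D)) (inc1 V C B D \<cdot> pr2 V (VHom C A B) (VHom C B D))"
  let ?spec = "\<lambda>c. c \<in> Hom V ?P (Int_ar V C) \<and> (\<forall>A\<in>VObj C. \<forall>B\<in>VObj C. \<forall>D\<in>VObj C.
     c \<cdot> ?z A B D = inc1 V C A D \<cdot> vcmp V C A B D (pr2 V (VHom C A B) (VHom C B D)) (pr1 V (VHom C A B) (VHom C B D)))"
  obtain c where c: "c \<in> Hom V ?P (Int_ar V C)" and cc: "\<And>A B D X f g. \<lbrakk>A \<in> VObj C; B \<in> VObj C; D \<in> VObj C; f \<in> Hom V X (VHom C A B); g \<in> Hom V X (VHom C B D)\<rbrakk> \<Longrightarrow>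
      c \<cdot> pb_pair V ?t ?s (inc1 V C A B \<cdot> f) (inc1 V C B D \<cdot> g) = inc1 V C A D \<cdot> vcmp V C A B D g f"
    using Intl_comp_ex by metis
  have spec: "?spec c"
  proof (intro conjI ballI)
    fix A B D assume o: "A \<in> VObj C" "B \<in> VObj C" "D \<in> VObj C"
    show "c \<cdot> ?z A B D = inc1 V C A D \<cdot> vcmp V C A B D (pr2 V (VHom C A B) (VHom C B D)) (pr1 V (VHom C A B) (VHom C B D))"
      by (rule cc[OF o, of _ "prd V (VHom C A B) (VHom C B D)"]) (use o in simp_all)
  qed (rule c)
  have pq: "?p \<in> Arr V" "Dom V ?p = ?P" "Cod V ?p = Int_ar V C" "?q \<in> Arr V" "Dom V ?q = ?P" "Cod V ?q = Int_ar V C" "?t \<cdot> ?p = ?s \<cdot> ?q"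
    by (simp_all add: pb_commutes)
  have uniq: "c' = c" if c': "?spec c'" for c'
  proof (rule pair_local_eq[OF pq(1,3,4,6,7)])
    fix A B D e f' g' assume o: "A \<in> VObj C" "B \<in> VObj C" "D \<in> VObj C" and e: "e \<in> Arr V" "Cod V e = Dom V ?p"
      and f: "f' \<in> Hom V (Dom V e) (VHom C A B)" "?p \<cdot> e = inc1 V C A B \<cdot> f'" and g: "g' \<in> Hom V (Dom V e) (VHom C B D)" "?q \<cdot> e = inc1 V C B D \<cdot> g'"
    have z: "?z A B D \<in> Arr V" "Dom V (?z A B D) = prd V (VHom C A B) (VHom C B D)" "Cod V (?z A B D) = ?P"
      "?p \<cdot> ?z A B D = inc1 V C A B \<cdot> pr1 V (VHom C A B) (VHom C B D)" "?q \<cdot> ?z A B D = inc1 V C B D \<cdot> pr2 V (VHom C A B) (VHom C B D)"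
      using o by simp_all
    have "e = ?z A B D \<cdot> pair V f' g'"
      by (rule pb_ext[of _ _ ?t ?s]) (use o e f g pq z(1-3) reassoc[OF z(4), of "pair V f' g'"] reassoc[OF z(5), of "pair V f' g'"] in simp_all)
    moreover have "(c' \<cdot> ?z A B D) \<cdot> pair V f' g' = (c \<cdot> ?z A B D) \<cdot> pair V f' g'"
      using c' spec o by metis
    moreover have "(c' \<cdot> ?z A B D) \<cdot> pair V f' g' = c' \<cdot> (?z A B D \<cdot> pair V f' g')" "(c \<cdot> ?z A B D) \<cdot> pair V f' g' = c \<cdot> (?z A B D \<cdot> pair V f' g')"
      by (rule assoc; use c' c z(1-3) f(1) g(1) o in simp)+
    ultimately show "c' \<cdot> e = c \<cdot> e" by simp
  qed (use that c in simp_all)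
  have "icmp (Intl V C) = (THE c. ?spec c)"
    by (simp add: Intl_def Let_def)
  also have "\<dots> = c" by (rule the_equality) (rule spec, rule uniq)
  finally have ic: "icmp (Intl V C) = c" .
  show "icmp (Intl V C) \<in> Hom V ?P (Int_ar V C)" using c ic by simp
  show "PROP ?ga"
    using cc[of A B D f "Dom V f" g] by (simp add: igcmp_def ic)
qed

lemma Intl_igcmp [simp]:
  "\<lbrakk>A \<in> VObj C; B \<in> VObj C; D \<in> VObj C; f \<in> Arr V; g \<in> Arr V; Dom V f = Dom V g; Cod V f = VHom C A B; Cod V g = VHom C B D\<rbrakk> \<Longrightarrow>
     igcmp V (Intl V C) (inc1 V C A B \<cdot> f) (inc1 V C B D \<cdot> g) = inc1 V C A D \<cdot> vcmp V C A B D g f"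
  by (rule Intl_icmp(2))

text \<open>The axioms are local, and on hom-objects they are those of \<open>C\<close>.\<close>

lemma Intl_Obj [simp]: "Intl V C \<in> Obj W"
proof -
  let ?K = "Intl V C"
  let ?s = "isrc ?K" and ?t = "itgt ?K" and ?i = "iid ?K"
  note T = igcmp_typing[of ?K, simplified, OF Intl_icmp(1)[simplified]]
  have ix: "?s \<cdot> ?i = Ident V (Int_ob V C)" "?t \<cdot> ?i = Ident V (Int_ob V C)"
    by (rule coproduct_ext[OF Int_ob_coproduct]; simp)+
  show ?thesis
  proof (rule icatI)
    fix f g assume fg: "f \<in> Arr V" "g \<in> Arr V" "Cod V f = IAr ?K" "Cod V g = IAr ?K" "Dom V f = Dom V g" "?t \<cdot> f = ?s \<cdot> g"
    note fg' = fg[simplified]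
    note T' = T[OF fg'(1,2,3,4,6)]
    have m: "igcmp V ?K f g \<cdot> e = igcmp V ?K (f \<cdot> e) (g \<cdot> e)" if "e \<in> Arr V" "Cod V e = Dom V f" for e using T'(4)[of e] that by simp
    show "?s \<cdot> igcmp V ?K f g = ?s \<cdot> f" "?t \<cdot> igcmp V ?K f g = ?t \<cdot> g"
      by (rule pair_local_eq[OF fg'(1,3,2,4,6)]; use fg'(1-5) T'(1-3) m in simp)+
  next
    fix f assume f: "f \<in> Arr V" "Cod V f = IAr ?K"
    note f' = f[simplified]
    have c: "?t \<cdot> (?i \<cdot> (?s \<cdot> f)) = ?s \<cdot> f" "?s \<cdot> (?i \<cdot> (?t \<cdot> f)) = ?t \<cdot> f"
      using reassoc[OF ix(2), of "?s \<cdot> f"] reassoc[OF ix(1), of "?t \<cdot> f"] f' by simp_all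
    note T1 = T[of "?i \<cdot> (?s \<cdot> f)" f] and T2 = T[of f "?i \<cdot> (?t \<cdot> f)"]
    show "igcmp V ?K (?i \<cdot> (?s \<cdot> f)) f = f" "igcmp V ?K f (?i \<cdot> (?t \<cdot> f)) = f"
      by (rule arr_local_eq[OF f']; use f' c T1 T2 in simp)+
  next
    fix f g h assume fg: "f \<in> Arr V" "g \<in> Arr V" "h \<in> Arr V" "Cod V f = IAr ?K" "Cod V g = IAr ?K" "Cod V h = IAr ?K"
      "Dom V f = Dom V g" "Dom V g = Dom V h" "?t \<cdot> f = ?s \<cdot> g" "?t \<cdot> g = ?s \<cdot> h"
    note fg' = fg[simplified]
    note T1 = T[OF fg'(1,2,4,5,9)] and T2 = T[OF fg'(2,3,5,6,10)]
    have st: "?t \<cdot> igcmp V ?K f g = ?t \<cdot> g"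
      by (rule pair_local_eq[OF fg'(1,4,2,5,9)]; use fg'(1-8) T1 in simp)
    have st2: "?s \<cdot> igcmp V ?K g h = ?s \<cdot> g"
      by (rule pair_local_eq[OF fg'(2,5,3,6,10)]; use fg'(1-8) T2 in simp)
    have k1: "?t \<cdot> igcmp V ?K f g = ?s \<cdot> h" and k2: "?t \<cdot> f = ?s \<cdot> igcmp V ?K g h" using st st2 fg' by simp_all
    note T3 = T[OF T1(1) fg'(3) T1(3) fg'(6) k1] and T4 = T[OF fg'(1) T2(1) fg'(4) T2(3) k2]
    show "igcmp V ?K (igcmp V ?K f g) h = igcmp V ?K f (igcmp V ?K g h)"
    proof (rule pair_local_eq[OF fg'(1,4,2,5,9)])
      fix A B D e f1 g1 assume o: "A \<in> VObj C" "B \<in> VObj C" "D \<in> VObj C" and e: "e \<in> Arr V" "Cod V e = Dom V f"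
        and f1: "f1 \<in> Hom V (Dom V e) (VHom C A B)" "f \<cdot> e = inc1 V C A B \<cdot> f1" and g1: "g1 \<in> Hom V (Dom V e) (VHom C B D)" "g \<cdot> e = inc1 V C B D \<cdot> g1"
      have he: "h \<cdot> e \<in> Arr V" "Cod V (h \<cdot> e) = Int_ar V C" "Dom V (h \<cdot> e) = Dom V e" using e fg' by simp_all
      have ge: "g \<cdot> e \<in> Arr V" "Cod V (g \<cdot> e) = Int_ar V C" "Dom V (g \<cdot> e) = Dom V e" using e fg' by simp_all
      have te: "?t \<cdot> (g \<cdot> e) = ?s \<cdot> (h \<cdot> e)" using reassoc[OF fg'(10), of e] fg'(1-8) e by simp
      show "igcmp V ?K (igcmp V ?K f g) h \<cdot> e = igcmp V ?K f (igcmp V ?K g h) \<cdot> e"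
      proof (rule arr_local_eq[OF he(1,2)])
        fix D' E k h1 assume o': "D' \<in> VObj C" "E \<in> VObj C" and k: "k \<in> Arr V" "Cod V k = Dom V (h \<cdot> e)"
          and h1: "h1 \<in> Hom V (Dom V k) (VHom C D' E)" "(h \<cdot> e) \<cdot> k = inc1 V C D' E \<cdot> h1"
        have k': "Cod V k = Dom V e" using k he by simp
        have fk: "f \<cdot> (e \<cdot> k) = inc1 V C A B \<cdot> (f1 \<cdot> k)" and gk: "g \<cdot> (e \<cdot> k) = inc1 V C B D \<cdot> (g1 \<cdot> k)" and hk: "h \<cdot> (e \<cdot> k) = inc1 V C D' E \<cdot> h1"
          using reassoc[OF f1(2), of k] reassoc[OF g1(2), of k] h1 fg'(1-8) e k k' o f1(1) g1(1) by simp_all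
        have "?t \<cdot> (g \<cdot> (e \<cdot> k)) = ?s \<cdot> (h \<cdot> (e \<cdot> k))" using reassoc[OF fg'(10), of "e \<cdot> k"] fg'(1-8) e k k' by simp
        then have "inc0 V C D \<cdot> bang V (Dom V k) = inc0 V C D' \<cdot> bang V (Dom V k)"
          unfolding gk hk using o o' g1 h1 k k' by simp
        then consider "D = D'" | "is_initial V (Dom V k)" using inc0_disjoint[of D D' "Dom V k"] o o' k by auto
        then have "igcmp V ?K (igcmp V ?K f g) h \<cdot> (e \<cdot> k) = igcmp V ?K f (igcmp V ?K g h) \<cdot> (e \<cdot> k)"
        proof cases
          case 1
          then show ?thesis
            using T1(1-3) T1(4)[of "e \<cdot> k"] T2(1-3) T2(4)[of "e \<cdot> k"] T3(4)[of "e \<cdot> k"] T4(4)[of "e \<cdot> k"] fk gk hk fg'(1-8) e(1,2) k k' o o' f1(1) g1(1) h1(1)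
            by (simp add: vcmp_assoc)
        next
          case 2
          then show ?thesis by (rule initial_unique) (use T1 T2 T3(1-3) T4(1-3) fg'(1-8) e k k' in simp_all)
        qed
        then show "(igcmp V ?K (igcmp V ?K f g) h \<cdot> e) \<cdot> k = (igcmp V ?K f (igcmp V ?K g h) \<cdot> e) \<cdot> k"
          using T1 T2 T3(1-3) T4(1-3) fg'(1-8) e k k' by simp
      qed (use T1(1-3) T2(1-3) T3(1-3) T4(1-3) fg'(1-8) e he in simp_all)
    qed (use T1(1-3) T2(1-3) T3(1-3) T4(1-3) fg'(1-8) in simp_all)
  qed (use ix Intl_icmp(1) in simp_all)
qed

text \<open>A piece on which \<open>f\<close> lies in another hom-object is initial, since its ends are constant at different objects.\<close>

lemma hom_factor:
  assumes f: "f \<in> Arr V" "Cod V f = Int_ar V C" and AB: "A \<in> VObj C" "B \<in> VObj C"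
    and st: "isrc (Intl V C) \<cdot> f = inc0 V C A \<cdot> bang V (Dom V f)" "itgt (Intl V C) \<cdot> f = inc0 V C B \<cdot> bang V (Dom V f)"
  obtains f' where "f' \<in> Arr V" "Dom V f' = Dom V f" "Cod V f' = VHom C A B" "f = inc1 V C A B \<cdot> f'"
proof -
  have "\<exists>h. h \<in> Arr V \<and> Dom V h = Dom V f \<and> Cod V h = (case (A, B) of (A, B) \<Rightarrow> VHom C A B) \<and> (case (A, B) of (A, B) \<Rightarrow> inc1 V C A B) \<cdot> h = f"
  proof (rule coproduct_factor[OF _ Int_ar_coproduct _ f, of "(A, B)"])
    show "small U (VObj C \<times> VObj C)" using C by (intro small_times) (auto simp: small_vcat_def)
    fix i k x assume i: "i \<in> VObj C \<times> VObj C" "i \<noteq> (A, B)" and k: "k \<in> Arr V" "Cod V k = Dom V f"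
      and x: "x \<in> Hom V (Dom V k) (case i of (A, B) \<Rightarrow> VHom C A B)" "f \<cdot> k = (case i of (A, B) \<Rightarrow> inc1 V C A B) \<cdot> x"
    obtain A' B' where i': "i = (A', B')" "A' \<in> VObj C" "B' \<in> VObj C" using i by auto
    have e: "f \<cdot> k = inc1 V C A' B' \<cdot> x" "x \<in> Hom V (Dom V k) (VHom C A' B')" using x i' by simp_all
    have "inc0 V C A \<cdot> bang V (Dom V k) = isrc (Intl V C) \<cdot> (f \<cdot> k)" "inc0 V C B \<cdot> bang V (Dom V k) = itgt (Intl V C) \<cdot> (f \<cdot> k)"
      using reassoc[OF st(1), of k] reassoc[OF st(2), of k] f k AB by simp_all
    then have "inc0 V C A \<cdot> bang V (Dom V k) = inc0 V C A' \<cdot> bang V (Dom V k)" "inc0 V C B \<cdot> bang V (Dom V k) = inc0 V C B' \<cdot> bang V (Dom V k)"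
      unfolding e(1) using i' e(2) by simp_all
    then have "(A = A' \<or> is_initial V (Dom V k)) \<and> (B = B' \<or> is_initial V (Dom V k))"
      using inc0_disjoint[of A A' "Dom V k"] inc0_disjoint[of B B' "Dom V k"] AB i' k by simp
    then show "is_initial V (Dom V k)" using i' i by auto
  qed (use AB in auto)
  then show ?thesis using that by auto
qed

lemma Int_elem:
  assumes "A \<in> VObj C"
  shows "Int_elem V C A = el (Intl V C) (inc0 V C A)" "Int_elem V C A \<in> Hom W \<one>\<^sub>W (Intl V C)" (is ?ga) "pt (Int_elem V C A) = inc0 V C A"
proof -
  have [simp]: "IAr \<one>\<^sub>W \<in> Obj V" using icat_simps(2)[OF W.terminal_Obj] .
  show e: "Int_elem V C A = el (Intl V C) (inc0 V C A)"
    using assms by (simp add: Int_elem_def el_def Let_def const_at_def)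
  show ?ga "pt (Int_elem V C A) = inc0 V C A"
    unfolding e using el[of "Intl V C" "inc0 V C A"] assms by simp_all
qed

end

lemma Int_fun:
  assumes I: "small_vcat I" and C: "small_vcat C" and G: "vfunctor V I C G"
  shows "Int_fun V I C G \<in> Hom W (Intl V I) (Intl V C)" (is ?ga)
    "i \<in> VObj I \<Longrightarrow> IF0 (Int_fun V I C G) \<cdot> inc0 V I i = inc0 V C (VFOb G i)" (is "PROP ?gb")
    "i \<in> VObj I \<Longrightarrow> j \<in> VObj I \<Longrightarrow> IF1 (Int_fun V I C G) \<cdot> inc1 V I i j = inc1 V C (VFOb G i) (VFOb G j) \<cdot> VFHom G i j" (is "PROP ?gc")
proof -
  note [simp] = VHom_Obj[OF I] VHom_Obj[OF C] VId_simps[OF I] VId_simps[OF C] inc_simps[OF I] inc_simps[OF C] Intl_sel[OF I] Intl_sel[OF C]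
    Intl_st[OF I] Intl_st[OF C] Intl_st_comp[OF I] Intl_st_comp[OF C] Intl_id[OF I] Intl_id[OF C] Intl_igcmp[OF I] Intl_igcmp[OF C]
    vcmp_simps[OF I] vcmp_simps[OF C] Intl_Obj[OF I] Intl_Obj[OF C]
  have Go [simp]: "VFOb G i \<in> VObj C" if "i \<in> VObj I" for i using G that unfolding vfunctor_def by blast
  have Gh: "VFHom G i j \<in> Hom V (VHom I i j) (VHom C (VFOb G i) (VFOb G j))" if "i \<in> VObj I" "j \<in> VObj I" for i j
    using G that unfolding vfunctor_def by blast
  then have [simp]: "VFHom G i j \<in> Arr V" "Dom V (VFHom G i j) = VHom I i j" "Cod V (VFHom G i j) = VHom C (VFOb G i) (VFOb G j)"
    if "i \<in> VObj I" "j \<in> VObj I" for i j using that by auto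
  have Gi: "VFHom G i i \<cdot> VId I i = VId C (VFOb G i)" if "i \<in> VObj I" for i
    using G that unfolding vfunctor_def by blast
  have Gc: "VFHom G i k \<cdot> vcmp V I i j k g f = vcmp V C (VFOb G i) (VFOb G j) (VFOb G k) (VFHom G j k \<cdot> g) (VFHom G i j \<cdot> f)"
    if o: "i \<in> VObj I" "j \<in> VObj I" "k \<in> VObj I" and fg: "f \<in> Arr V" "g \<in> Arr V" "Dom V f = Dom V g" "Cod V f = VHom I i j" "Cod V g = VHom I j k" for i j k f g
  proof -
    let ?X = "VHom I j k" and ?Y = "VHom I i j"
    have "VFHom G i k \<cdot> VComp I i j k = vcmp V C (VFOb G i) (VFOb G j) (VFOb G k) (VFHom G j k \<cdot> pr1 V ?X ?Y) (VFHom G i j \<cdot> pr2 V ?X ?Y)"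
      using G o unfolding vfunctor_def Let_def by blast
    from arg_cong[OF this, of "\<lambda>x. x \<cdot> pair V g f"] show ?thesis
      using o fg VComp_simps[OF I] by (simp add: vcmp_def[of V I])
  qed
  define F0 where "F0 = Int_ob_cotuple V I (Int_ob V C) (\<lambda>A. inc0 V C (VFOb G A))"
  define F1 where "F1 = Int_ar_cotuple V I (Int_ar V C) (\<lambda>A B. inc1 V C (VFOb G A) (VFOb G B) \<cdot> VFHom G A B)"
  have F0 [simp]: "F0 \<in> Arr V" "Dom V F0 = Int_ob V I" "Cod V F0 = Int_ob V C" "A \<in> VObj I \<Longrightarrow> F0 \<cdot> inc0 V I A = inc0 V C (VFOb G A)" for A
    using Int_ob_cotuple[OF I, of "Int_ob V C" "\<lambda>A. inc0 V C (VFOb G A)"] by (simp_all add: F0_def)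
  have F1 [simp]: "F1 \<in> Arr V" "Dom V F1 = Int_ar V I" "Cod V F1 = Int_ar V C"
    "A \<in> VObj I \<Longrightarrow> B \<in> VObj I \<Longrightarrow> F1 \<cdot> inc1 V I A B = inc1 V C (VFOb G A) (VFOb G B) \<cdot> VFHom G A B" for A B
    using Int_ar_cotuple[OF I, of "Int_ar V C" "\<lambda>A B. inc1 V C (VFOb G A) (VFOb G B) \<cdot> VFHom G A B"] by (simp_all add: F1_def)
  have F0x [simp]: "F0 \<cdot> (inc0 V I A \<cdot> x) = inc0 V C (VFOb G A) \<cdot> x" if "A \<in> VObj I" "x \<in> Arr V" "Cod V x = \<one>" for A x
    using reassoc[OF F0(4), of A x] that by simp
  have F1x [simp]: "F1 \<cdot> (inc1 V I A B \<cdot> x) = inc1 V C (VFOb G A) (VFOb G B) \<cdot> (VFHom G A B \<cdot> x)"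
    if "A \<in> VObj I" "B \<in> VObj I" "x \<in> Arr V" "Cod V x = VHom I A B" for A B x
    using reassoc[OF F1(4), of A B x] that by simp
  have eq: "Int_fun V I C G = \<lparr>IDom = Intl V I, ICod = Intl V C, IF0 = F0, IF1 = F1\<rparr>"
    by (simp add: Int_fun_def F0_def F1_def)
  show ?ga
    unfolding eq
  proof (rule ifunI)
    show "isrc (Intl V C) \<cdot> F1 = F0 \<cdot> isrc (Intl V I)" "itgt (Intl V C) \<cdot> F1 = F0 \<cdot> itgt (Intl V I)"
      by (rule coproduct_ext[OF Int_ar_coproduct[OF I]]; force)+
    show "F1 \<cdot> iid (Intl V I) = iid (Intl V C) \<cdot> F0"
      by (rule coproduct_ext[OF Int_ob_coproduct[OF I]]) (simp_all add: Gi)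
  next
    fix f g assume fg: "f \<in> Arr V" "g \<in> Arr V" "Cod V f = IAr (Intl V I)" "Cod V g = IAr (Intl V I)" "Dom V f = Dom V g"
      "itgt (Intl V I) \<cdot> f = isrc (Intl V I) \<cdot> g"
    note fg' = fg[simplified]
    have st: "isrc (Intl V C) \<cdot> (F1 \<cdot> f) = F0 \<cdot> (isrc (Intl V I) \<cdot> f)" "itgt (Intl V C) \<cdot> (F1 \<cdot> f) = F0 \<cdot> (itgt (Intl V I) \<cdot> f)"
      if "f \<in> Arr V" "Cod V f = Int_ar V I" for f
      by (rule arr_local_eq[OF I that]; use that in simp)+
    have t: "itgt (Intl V C) \<cdot> (F1 \<cdot> f) = isrc (Intl V C) \<cdot> (F1 \<cdot> g)" using st fg' by simp
    show "F1 \<cdot> igcmp V (Intl V I) f g = igcmp V (Intl V C) (F1 \<cdot> f) (F1 \<cdot> g)"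
      by (rule pair_local_eq[OF I fg'(1,3,2,4,6)]) (use fg' t in \<open>simp_all add: Gc\<close>)
  qed simp_all
  show "PROP ?gb"
    "PROP ?gc"
    by (simp_all add: eq)
qed

end

context extensive_ccc
begin

declare Intl_id(4,5) [simp del]

lemma initial_comp_eq:
  assumes "is_initial V (Dom V e)" "e \<in> Arr V" "u \<in> Arr V" "v \<in> Arr V" "Dom V u = Cod V e" "Dom V v = Cod V e" "Cod V u = Cod V v"
  shows "u \<cdot> e = v \<cdot> e"
  by (rule initial_unique[OF assms(1)]) (use assms in simp_all)

subsection \<open>Morphisms out of products with an internalization\<close>

context
  fixes C :: "('x, 'o, 'm) vcat" and X :: 'o
  assumes C [simp]: "small_vcat C" and X [simp]: "X \<in> Obj V"
begin

text \<open>Since \<open>X \<times> -\<close> preserves coproducts, morphisms out of these products are compared and defined on the summands.\<close>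

lemma prd_Int_ob_ext:
  assumes uv: "u \<in> Arr V" "v \<in> Arr V" "Dom V u = prd V X (Int_ob V C)" "Dom V v = prd V X (Int_ob V C)" "Cod V u = Cod V v"
    and loc: "\<And>A y. \<lbrakk>A \<in> VObj C; y \<in> Arr V; Cod V y = X\<rbrakk> \<Longrightarrow>
      u \<cdot> pair V y (inc0 V C A \<cdot> bang V (Dom V y)) = v \<cdot> pair V y (inc0 V C A \<cdot> bang V (Dom V y))"
  shows "u = v"
proof (rule obj_local_eq[OF C, of "pr2 V X (Int_ob V C)"])
  fix A e assume A: "A \<in> VObj C" and e: "e \<in> Arr V" "Cod V e = Dom V (pr2 V X (Int_ob V C))"
    "pr2 V X (Int_ob V C) \<cdot> e = inc0 V C A \<cdot> bang V (Dom V e)"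
  then have "e = pair V (pr1 V X (Int_ob V C) \<cdot> e) (inc0 V C A \<cdot> bang V (Dom V e))"
    using pair_eta[of e X "Int_ob V C"] by simp
  moreover have "u \<cdot> pair V (pr1 V X (Int_ob V C) \<cdot> e) (inc0 V C A \<cdot> bang V (Dom V e)) =
      v \<cdot> pair V (pr1 V X (Int_ob V C) \<cdot> e) (inc0 V C A \<cdot> bang V (Dom V e))"
    using loc[OF A, of "pr1 V X (Int_ob V C) \<cdot> e"] e by simp
  ultimately show "u \<cdot> e = v \<cdot> e" by simp
qed (use uv in simp_all)

lemma prd_Int_ob_ex:
  assumes "Z \<in> Obj V" "\<And>A. A \<in> VObj C \<Longrightarrow> f A \<in> Hom V X Z"
  shows "\<exists>u. u \<in> Hom V (prd V X (Int_ob V C)) Z \<and>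
    (\<forall>A\<in>VObj C. \<forall>y. y \<in> Arr V \<longrightarrow> Cod V y = X \<longrightarrow> u \<cdot> pair V y (inc0 V C A \<cdot> bang V (Dom V y)) = f A \<cdot> y)"
proof -
  have c: "is_coproduct V (VObj C) (\<lambda>A. prd V X \<one>) (prd V X (Int_ob V C), \<lambda>A. pair V (pr1 V X \<one>) (inc0 V C A \<cdot> pr2 V X \<one>))"
    by (rule coproduct_prd[OF Int_ob_coproduct[OF C]]) simp_all
  obtain u where u: "u \<in> Arr V" "Dom V u = prd V X (Int_ob V C)" "Cod V u = Z"
    "\<And>A. A \<in> VObj C \<Longrightarrow> u \<cdot> pair V (pr1 V X \<one>) (inc0 V C A \<cdot> pr2 V X \<one>) = f A \<cdot> pr1 V X \<one>"
    by (rule coproduct_ex[OF c assms(1), of "\<lambda>A. f A \<cdot> pr1 V X \<one>"]) (use assms(2) in auto)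
  have "u \<cdot> pair V y (inc0 V C A \<cdot> bang V (Dom V y)) = f A \<cdot> y" if "A \<in> VObj C" "y \<in> Arr V" "Cod V y = X" for A y
    using arg_cong[OF u(4)[OF that(1)], of "\<lambda>h. h \<cdot> pair V y (bang V (Dom V y))"] u(1-3) that assms(2)[OF that(1)] by simp
  then show ?thesis using u(1-3) by (intro exI[of _ u]) simp
qed

lemma prd_Int_ar_ext:
  assumes uv: "u \<in> Arr V" "v \<in> Arr V" "Dom V u = prd V X (Int_ar V C)" "Dom V v = prd V X (Int_ar V C)" "Cod V u = Cod V v"
    and loc: "\<And>A B y f. \<lbrakk>A \<in> VObj C; B \<in> VObj C; y \<in> Arr V; Cod V y = X; f \<in> Arr V; Dom V f = Dom V y; Cod V f = VHom C A B\<rbrakk> \<Longrightarrow>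
      u \<cdot> pair V y (inc1 V C A B \<cdot> f) = v \<cdot> pair V y (inc1 V C A B \<cdot> f)"
  shows "u = v"
proof (rule arr_local_eq[OF C, of "pr2 V X (Int_ar V C)"])
  fix A B e f assume AB: "A \<in> VObj C" "B \<in> VObj C" and e: "e \<in> Arr V" "Cod V e = Dom V (pr2 V X (Int_ar V C))"
    and f: "f \<in> Hom V (Dom V e) (VHom C A B)" "pr2 V X (Int_ar V C) \<cdot> e = inc1 V C A B \<cdot> f"
  then have "e = pair V (pr1 V X (Int_ar V C) \<cdot> e) (inc1 V C A B \<cdot> f)"
    using pair_eta[of e X "Int_ar V C"] by simp
  moreover have "u \<cdot> pair V (pr1 V X (Int_ar V C) \<cdot> e) (inc1 V C A B \<cdot> f) = v \<cdot> pair V (pr1 V X (Int_ar V C) \<cdot> e) (inc1 V C A B \<cdot> f)"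
    using loc[OF AB, of "pr1 V X (Int_ar V C) \<cdot> e" f] e f by simp
  ultimately show "u \<cdot> e = v \<cdot> e" by simp
qed (use uv in simp_all)

lemma prd_Int_ar_ex:
  assumes "Z \<in> Obj V" "\<And>A B. A \<in> VObj C \<Longrightarrow> B \<in> VObj C \<Longrightarrow> f A B \<in> Hom V (prd V X (VHom C A B)) Z"
  shows "\<exists>u. u \<in> Hom V (prd V X (Int_ar V C)) Z \<and>
    (\<forall>A\<in>VObj C. \<forall>B\<in>VObj C. \<forall>y g. y \<in> Arr V \<longrightarrow> Cod V y = X \<longrightarrow> g \<in> Hom V (Dom V y) (VHom C A B) \<longrightarrow>
       u \<cdot> pair V y (inc1 V C A B \<cdot> g) = f A B \<cdot> pair V y g)"
proof -
  let ?J = "VObj C \<times> VObj C"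
  have c: "is_coproduct V ?J (\<lambda>j. prd V X (case j of (A, B) \<Rightarrow> VHom C A B)) (prd V X (Int_ar V C),
      \<lambda>j. pair V (pr1 V X (case j of (A, B) \<Rightarrow> VHom C A B)) ((case j of (A, B) \<Rightarrow> inc1 V C A B) \<cdot> pr2 V X (case j of (A, B) \<Rightarrow> VHom C A B)))"
    by (rule coproduct_prd[OF Int_ar_coproduct[OF C]]) auto
  obtain u where u: "u \<in> Arr V" "Dom V u = prd V X (Int_ar V C)" "Cod V u = Z" and
    uj: "\<And>j. j \<in> ?J \<Longrightarrow> u \<cdot> pair V (pr1 V X (case j of (A, B) \<Rightarrow> VHom C A B)) ((case j of (A, B) \<Rightarrow> inc1 V C A B) \<cdot> pr2 V X (case j of (A, B) \<Rightarrow> VHom C A B))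
      = (case j of (A, B) \<Rightarrow> f A B)"
    by (rule coproduct_ex[OF c assms(1), of "\<lambda>(A, B). f A B"]) (use assms(2) in \<open>auto simp: split_beta\<close>)
  have "u \<cdot> pair V y (inc1 V C A B \<cdot> g) = f A B \<cdot> pair V y g"
    if "A \<in> VObj C" "B \<in> VObj C" "y \<in> Arr V" "Cod V y = X" "g \<in> Hom V (Dom V y) (VHom C A B)" for A B y g
    using arg_cong[OF uj[of "(A, B)"], of "\<lambda>h. h \<cdot> pair V y g"] u that assms(2)[OF that(1,2)] by simp
  then show ?thesis using u by (intro exI[of _ u]) simp
qed

end

section \<open>The internal arrow category\<close>

lemma two_hom_Obj [simp]: "two_hom V a b \<in> Obj V"
  by (simp add: two_hom_def)

text \<open>Each hom-object of \<open>2\<close> is initial or terminal, so there is at most one morphism into it.\<close>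

lemma to_two_hom:
  assumes "f \<in> Arr V" "g \<in> Arr V" "Dom V f = Dom V g" "Cod V f = two_hom V a b" "Cod V g = two_hom V a b"
  shows "f = g"
proof (cases "a \<and> \<not> b")
  case True
  then have "is_initial V (Dom V f)" using assms(1,4) by (intro strict_initial[OF initial]) (simp_all add: two_hom_def)
  then show ?thesis by (rule initial_unique) (use assms in simp_all)
next
  case False
  then show ?thesis using assms by (intro to_terminal) (auto simp: two_hom_def)
qed

abbreviation two where "two \<equiv> two_vcat V"

lemma two_sel [simp]: "VObj two = UNIV" "VHom two = two_hom V"
  by (simp_all add: two_vcat_def)

lemma two_VId: "VId two a \<in> Hom V \<one> (two_hom V a a)"
proof -
  have "\<exists>!f. f \<in> Hom V \<one> (two_hom V a a)"
    by (rule ex1I[of _ "Ident V \<one>"]) (auto simp: two_hom_def intro: to_terminal)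
  from theI'[OF this] show ?thesis by (simp add: two_vcat_def)
qed

lemma two_VComp: "VComp two a b c \<in> Hom V (prd V (two_hom V b c) (two_hom V a b)) (two_hom V a c)"
proof -
  let ?P = "prd V (two_hom V b c) (two_hom V a b)"
  have "\<exists>f. f \<in> Hom V ?P (two_hom V a c)"
  proof (cases "a \<and> \<not> c")
    case True
    show ?thesis
    proof (cases b)
      case True
      then show ?thesis using \<open>a \<and> \<not> c\<close> by (intro exI[of _ "pr1 V (two_hom V b c) (two_hom V a b)"]) (simp add: two_hom_def)
    next
      case False
      then show ?thesis using \<open>a \<and> \<not> c\<close> by (intro exI[of _ "pr2 V (two_hom V b c) (two_hom V a b)"]) (simp add: two_hom_def)
    qed
  next
    case False
    then show ?thesis by (intro exI[of _ "bang V ?P"]) (auto simp: two_hom_def)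
  qed
  then have "\<exists>!f. f \<in> Hom V ?P (two_hom V a c)" by (auto intro: to_two_hom)
  from theI'[OF this] show ?thesis by (simp add: two_vcat_def)
qed

lemma small_vcat_two [simp]: "small_vcat two"
proof -
  note [simp] = two_VId[simplified] two_VComp[simplified]
  have "vcategory V two"
    unfolding vcategory_def Let_def two_sel
  proof (intro conjI ballI)
    show "vcmp V two a b b (const_at V (two_hom V a b) (VId two b)) (Ident V (two_hom V a b)) = Ident V (two_hom V a b)" for a b
      by (rule to_two_hom[of _ _ a b]) (simp_all add: vcmp_def const_at_def)
    show "vcmp V two a a b (Ident V (two_hom V a b)) (const_at V (two_hom V a b) (VId two a)) = Ident V (two_hom V a b)" for a b
      by (rule to_two_hom[of _ _ a b]) (simp_all add: vcmp_def const_at_def)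
    fix a b d e
    let ?X = "two_hom V a b" and ?Y = "two_hom V b d" and ?Z = "two_hom V d e"
    let ?h = "pr1 V ?Z ?Y \<cdot> pr1 V (prd V ?Z ?Y) ?X" and ?g = "pr2 V ?Z ?Y \<cdot> pr1 V (prd V ?Z ?Y) ?X" and ?f = "pr2 V (prd V ?Z ?Y) ?X"
    show "vcmp V two a b e (vcmp V two b d e ?h ?g) ?f = vcmp V two a d e ?h (vcmp V two a b d ?g ?f)"
      by (rule to_two_hom[of _ _ a e]) (simp_all add: vcmp_def)
  qed simp_all
  then show ?thesis by (simp add: small_vcat_def small_bool)
qed

abbreviation "T2 \<equiv> Intl V two"

abbreviation "a01 \<equiv> inc1 V two False True"

lemma a01 [simp]: "Dom V a01 = \<one>" "isrc T2 \<cdot> a01 = inc0 V two False" "itgt T2 \<cdot> a01 = inc0 V two True"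
  "x \<in> Arr V \<Longrightarrow> Cod V x = \<one> \<Longrightarrow> isrc T2 \<cdot> (a01 \<cdot> x) = inc0 V two False \<cdot> x" (is "PROP ?ga")
  "x \<in> Arr V \<Longrightarrow> Cod V x = \<one> \<Longrightarrow> itgt T2 \<cdot> (a01 \<cdot> x) = inc0 V two True \<cdot> x" (is "PROP ?gb")
proof -
  have d: "two_hom V False True = \<one>" by (simp add: two_hom_def)
  show "Dom V a01 = \<one>" by (simp add: d)
  show "isrc T2 \<cdot> a01 = inc0 V two False" "itgt T2 \<cdot> a01 = inc0 V two True" by (simp_all add: d)
  show "PROP ?ga"
    "PROP ?gb"
    using eq_bang[of x "Dom V x"] by (simp_all add: d)
qed

text \<open>
  Up to decomposition, the generalized arrows of \<open>2\<close> are thus the identities and the arrow \<open>0 \<rightarrow> 1\<close>.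
\<close>

lemma two_arr:
  assumes "f \<in> Arr V" "Cod V f = two_hom V a b"
  shows "a = b \<Longrightarrow> inc1 V two a b \<cdot> f = iid T2 \<cdot> (inc0 V two a \<cdot> bang V (Dom V f))"
    "\<not> a \<Longrightarrow> b \<Longrightarrow> inc1 V two a b \<cdot> f = a01 \<cdot> bang V (Dom V f)"
    "a \<Longrightarrow> \<not> b \<Longrightarrow> is_initial V (Dom V f)"
proof -
  note [simp] = two_VId[simplified]
  assume "a = b"
  then have "f = VId two a \<cdot> bang V (Dom V f)" using assms by (intro to_two_hom[of _ _ a a]) simp_all
  then show "inc1 V two a b \<cdot> f = iid T2 \<cdot> (inc0 V two a \<cdot> bang V (Dom V f))"
    using assms \<open>a = b\<close> by (simp add: Intl_id(5))
next
  assume "\<not> a" b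
  then show "inc1 V two a b \<cdot> f = a01 \<cdot> bang V (Dom V f)" using eq_bang[of f "Dom V f"] assms by (simp add: two_hom_def)
next
  assume a "\<not> b"
  then show "is_initial V (Dom V f)" using strict_initial[OF initial, of f] assms by (simp add: two_hom_def)
qed

context
  fixes B assumes B [simp]: "B \<in> Obj W"
begin

private abbreviation "E \<equiv> expo W T2 B"
private abbreviation "ev \<equiv> evl W T2 B"
private lemmas P = pexpD[OF Intl_Obj[OF small_vcat_two] B pexp_expo[OF Intl_Obj[OF small_vcat_two] B]]
private lemmas S = ev_simps[OF Intl_Obj[OF small_vcat_two] B P(1-4)] and T = ev_typing[OF Intl_Obj[OF small_vcat_two] B P(1-4)]

text \<open>
  Evaluation of generalized objects of \<open>[2, B]\<close> at the arrow \<open>0 \<rightarrow> 1\<close> (\<open>ar\<close>) and at the two objects of \<open>2\<close> (\<open>end0\<close>), and of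
  generalized arrows at the objects (\<open>end1\<close>).
\<close>

definition ar :: "'m \<Rightarrow> 'm" where
  "ar N = IF1 ev \<cdot> ip1 E T2 (iid E \<cdot> N) (a01 \<cdot> bang V (Dom V N))"

definition end0 :: "bool \<Rightarrow> 'm \<Rightarrow> 'm" where
  "end0 b N = IF0 ev \<cdot> ip0 E T2 N (inc0 V two b \<cdot> bang V (Dom V N))"

definition end1 :: "bool \<Rightarrow> 'm \<Rightarrow> 'm" where
  "end1 b M = IF1 ev \<cdot> ip1 E T2 M (iid T2 \<cdot> (inc0 V two b \<cdot> bang V (Dom V M)))"

lemma ar_simps [simp]:
  assumes "N \<in> Arr V" "Cod V N = IOb E"
  shows "ar N \<in> Arr V" "Dom V (ar N) = Dom V N" "Cod V (ar N) = IAr B"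
    "isrc B \<cdot> ar N = end0 False N" "itgt B \<cdot> ar N = end0 True N"
    "end0 b N \<in> Arr V" "Dom V (end0 b N) = Dom V N" "Cod V (end0 b N) = IOb B"
    "x \<in> Arr V \<Longrightarrow> Cod V x = Dom V N \<Longrightarrow> ar N \<cdot> x = ar (N \<cdot> x)"
    "x \<in> Arr V \<Longrightarrow> Cod V x = Dom V N \<Longrightarrow> end0 b N \<cdot> x = end0 b (N \<cdot> x)"
  using assms by (simp_all add: ar_def end0_def)

lemma end1_simps [simp]:
  assumes "M \<in> Arr V" "Cod V M = IAr E"
  shows "end1 b M \<in> Arr V" "Dom V (end1 b M) = Dom V M" "Cod V (end1 b M) = IAr B"
    "isrc B \<cdot> end1 b M = end0 b (isrc E \<cdot> M)" "itgt B \<cdot> end1 b M = end0 b (itgt E \<cdot> M)"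
    "x \<in> Arr V \<Longrightarrow> Cod V x = Dom V M \<Longrightarrow> end1 b M \<cdot> x = end1 b (M \<cdot> x)"
  using assms by (simp_all add: end1_def end0_def)

lemma ev_two:
  assumes N: "N \<in> Arr V" "Cod V N = IOb E" and y: "y \<in> Arr V" "Cod V y = Dom V N"
  shows "IF0 ev \<cdot> ip0 E T2 (N \<cdot> y) (inc0 V two b \<cdot> bang V (Dom V y)) = end0 b N \<cdot> y"
    "IF1 ev \<cdot> ip1 E T2 (iid E \<cdot> (N \<cdot> y)) (a01 \<cdot> bang V (Dom V y)) = ar N \<cdot> y"
    "IF1 ev \<cdot> ip1 E T2 (iid E \<cdot> (N \<cdot> y)) (iid T2 \<cdot> (inc0 V two b \<cdot> bang V (Dom V y))) = iid B \<cdot> (end0 b N \<cdot> y)"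
  using assms by (simp_all add: end0_def ar_def)

lemma ar_inj:
  assumes N: "N \<in> Arr V" "N' \<in> Arr V" "Dom V N = Dom V N'" "Cod V N = IOb E" "Cod V N' = IOb E" and eq: "ar N = ar N'"
  shows "N = N'"
proof -
  have e0: "end0 b N = end0 b N'" for b
    using arg_cong[OF eq, of "\<lambda>h. isrc B \<cdot> h"] arg_cong[OF eq, of "\<lambda>h. itgt B \<cdot> h"] N by (cases b) simp_all
  have y0: "end0 b N \<cdot> y = end0 b N' \<cdot> y" "ar N \<cdot> y = ar N' \<cdot> y" for b y using e0 eq by simp_all
  show ?thesis
  proof (rule P(6)[OF N])
    show "evo T2 E ev N = evo T2 E ev N'"
      by (rule prd_Int_ob_ext[of two "Dom V N"])
        (use N y0(1) in \<open>simp_all add: S T ev_two del: ar_simps(10)\<close>)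
    show "eva T2 E ev N = eva T2 E ev N'"
    proof (rule prd_Int_ar_ext[of two "Dom V N"])
      fix a b y f assume y: "y \<in> Arr V" "Cod V y = Dom V N" and f: "f \<in> Arr V" "Dom V f = Dom V y" "Cod V f = VHom two a b"
      consider "a = b" | "\<not> a" b | a "\<not> b" by blast
      then show "eva T2 E ev N \<cdot> pair V y (inc1 V two a b \<cdot> f) = eva T2 E ev N' \<cdot> pair V y (inc1 V two a b \<cdot> f)"
      proof cases
        case 1
        then have "inc1 V two a b \<cdot> f = iid T2 \<cdot> (inc0 V two a \<cdot> bang V (Dom V y))" using two_arr(1)[of f a b] f by simp
        then show ?thesis using N y y0(1)
          by (simp add: S ev_two(3) del: ar_simps(10) IF1_ip1_id)
      next
        case 2
        then have "inc1 V two a b \<cdot> f = a01 \<cdot> bang V (Dom V y)" using two_arr(2)[of f a b] f by simp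
        then show ?thesis using N y y0(2) by (simp add: S ev_two(2) del: ar_simps(9))
      next
        case 3
        then have "is_initial V (Dom V y)" using two_arr(3)[of f a b] f by simp
        then show ?thesis by (rule initial_unique) (use N y f in \<open>simp_all add: T\<close>)
      qed
    qed (use N in \<open>simp_all add: T\<close>)
  qed
qed

text \<open>
  The functor out of \<open>2\<close> is defined on the summands. In a composable pair of \<open>2\<close> one arrow is an identity, so
  functoriality holds by the unit laws.
\<close>

lemma ar_surj:
  assumes x: "x \<in> Arr V" "Cod V x = IAr B"
  shows "\<exists>N. N \<in> Hom V (Dom V x) (IOb E) \<and> ar N = x"
proof -
  note [simp] = x
  let ?X = "Dom V x"
  define v0 where "v0 b = (if b then itgt B else isrc B) \<cdot> x" for b
  have v0 [simp]: "v0 b \<in> Arr V" "Dom V (v0 b) = ?X" "Cod V (v0 b) = IOb B" "isrc B \<cdot> x = v0 False" "itgt B \<cdot> x = v0 True" for b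
    by (simp_all add: v0_def)
  have vy [simp]: "isrc B \<cdot> (x \<cdot> y) = v0 False \<cdot> y" "itgt B \<cdot> (x \<cdot> y) = v0 True \<cdot> y" if "y \<in> Arr V" "Cod V y = ?X" for y
    using that reassoc[OF v0(4), of y] reassoc[OF v0(5), of y] by simp_all
  obtain F0 where F0 [simp]: "F0 \<in> Arr V" "Dom V F0 = prd V ?X (Int_ob V two)" "Cod V F0 = IOb B"
    and F0y: "\<And>b y. y \<in> Arr V \<Longrightarrow> Cod V y = ?X \<Longrightarrow> F0 \<cdot> pair V y (inc0 V two b \<cdot> bang V (Dom V y)) = v0 b \<cdot> y"
    using prd_Int_ob_ex[of two ?X "IOb B" v0] by auto
  define v1 where "v1 a b = (if a = b then iid B \<cdot> (v0 a \<cdot> pr1 V ?X (two_hom V a b)) else if b then x \<cdot> pr1 V ?X (two_hom V a b)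
    else cobang (IAr B) \<cdot> pr2 V ?X (two_hom V a b))" for a b
  have v1: "v1 a b \<in> Hom V (prd V ?X (two_hom V a b)) (IAr B)" for a b
    by (auto simp: v1_def two_hom_def)
  obtain F1 where F1 [simp]: "F1 \<in> Arr V" "Dom V F1 = prd V ?X (Int_ar V two)" "Cod V F1 = IAr B"
    and F1v: "\<And>a b y g. \<lbrakk>y \<in> Arr V; Cod V y = ?X; g \<in> Hom V (Dom V y) (two_hom V a b)\<rbrakk> \<Longrightarrow> F1 \<cdot> pair V y (inc1 V two a b \<cdot> g) = v1 a b \<cdot> pair V y g"
    using prd_Int_ar_ex[of two ?X "IAr B" v1] v1 by auto
  have F1y: "a = b \<Longrightarrow> F1 \<cdot> pair V y (inc1 V two a b \<cdot> g) = iid B \<cdot> (v0 a \<cdot> y)"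
    "\<not> a \<Longrightarrow> b \<Longrightarrow> F1 \<cdot> pair V y (inc1 V two a b \<cdot> g) = x \<cdot> y" if "y \<in> Arr V" "Cod V y = ?X" "g \<in> Hom V (Dom V y) (two_hom V a b)" for a b y g
    using F1v[OF that] that by (simp_all add: v1_def)
  have F1i: "F1 \<cdot> pair V y (iid T2 \<cdot> (inc0 V two b \<cdot> bang V (Dom V y))) = iid B \<cdot> (v0 b \<cdot> y)" if "y \<in> Arr V" "Cod V y = ?X" for b y
    using F1y(1)[OF that, of "VId two b \<cdot> bang V (Dom V y)" b b] that two_VId[of b] by (simp add: Intl_id(5))
  have st: "isrc B \<cdot> (F1 \<cdot> pair V y f) = F0 \<cdot> pair V y (isrc T2 \<cdot> f)" "itgt B \<cdot> (F1 \<cdot> pair V y f) = F0 \<cdot> pair V y (itgt T2 \<cdot> f)"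
    if y: "y \<in> Arr V" "f \<in> Arr V" "Dom V y = Dom V f" "Cod V y = ?X" "Cod V f = Int_ar V two" for y f
  proof -
    have loc: "isrc B \<cdot> (F1 \<cdot> pair V (y \<cdot> e) (inc1 V two a b \<cdot> g)) = F0 \<cdot> pair V (y \<cdot> e) (inc0 V two a \<cdot> bang V (Dom V e)) \<and>
        itgt B \<cdot> (F1 \<cdot> pair V (y \<cdot> e) (inc1 V two a b \<cdot> g)) = F0 \<cdot> pair V (y \<cdot> e) (inc0 V two b \<cdot> bang V (Dom V e))"
      if e: "e \<in> Arr V" "Cod V e = Dom V f" "g \<in> Hom V (Dom V e) (two_hom V a b)" for a b e g
    proof -
      consider "a = b" | "\<not> a" b | a "\<not> b" by blast
      then show ?thesis
      proof cases
        case 1 then show ?thesis using F1y(1)[of "y \<cdot> e" g a b] F0y[of "y \<cdot> e"] y e by simp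
      next
        case 2 then show ?thesis using F1y(2)[of "y \<cdot> e" g a b] F0y[of "y \<cdot> e"] y e by simp
      next
        case 3
        then have i: "is_initial V (Dom V e)" using two_arr(3)[of g a b] e by simp
        show ?thesis by (intro conjI; rule initial_unique[OF i]) (use y e in simp_all)
      qed
    qed
    show "isrc B \<cdot> (F1 \<cdot> pair V y f) = F0 \<cdot> pair V y (isrc T2 \<cdot> f)"
      by (rule arr_local_eq[OF small_vcat_two, of f]) (use y loc in simp_all)
    show "itgt B \<cdot> (F1 \<cdot> pair V y f) = F0 \<cdot> pair V y (itgt T2 \<cdot> f)"
      by (rule arr_local_eq[OF small_vcat_two, of f]) (use y loc in simp_all)
  qed
  have "ffam T2 B ?X F0 F1"
  proof (rule ffamI)
    fix y f assume "y \<in> Arr V" "f \<in> Arr V" "Dom V y = Dom V f" "Cod V y = ?X" "Cod V f = IAr T2"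
    then show "isrc B \<cdot> (F1 \<cdot> pair V y f) = F0 \<cdot> pair V y (isrc T2 \<cdot> f) \<and> itgt B \<cdot> (F1 \<cdot> pair V y f) = F0 \<cdot> pair V y (itgt T2 \<cdot> f)"
      using st[of y f] by simp
  next
    fix y f assume y: "y \<in> Arr V" "f \<in> Arr V" "Dom V y = Dom V f" "Cod V y = ?X" "Cod V f = IOb T2"
    show "F1 \<cdot> pair V y (iid T2 \<cdot> f) = iid B \<cdot> (F0 \<cdot> pair V y f)"
    proof (rule obj_local_eq[OF small_vcat_two, of f])
      fix b e assume "e \<in> Arr V" "Cod V e = Dom V f" "f \<cdot> e = inc0 V two b \<cdot> bang V (Dom V e)"
      then show "(F1 \<cdot> pair V y (iid T2 \<cdot> f)) \<cdot> e = (iid B \<cdot> (F0 \<cdot> pair V y f)) \<cdot> e"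
        using y F1i[of "y \<cdot> e" b] F0y[of "y \<cdot> e" b] by simp
    qed (use y in simp_all)
  next
    fix y f g assume y: "y \<in> Arr V" "f \<in> Arr V" "g \<in> Arr V" "Dom V y = Dom V f" "Dom V f = Dom V g" "Cod V y = ?X" "Cod V f = IAr T2" "Cod V g = IAr T2"
      and fg: "itgt T2 \<cdot> f = isrc T2 \<cdot> g"
    note y' = y[simplified]
    have c: "itgt B \<cdot> (F1 \<cdot> pair V y f) = isrc B \<cdot> (F1 \<cdot> pair V y g)" using st[of y f] st[of y g] y fg by simp
    show "F1 \<cdot> pair V y (igcmp V T2 f g) = igcmp V B (F1 \<cdot> pair V y f) (F1 \<cdot> pair V y g)"
    proof (rule pair_local_eq[OF small_vcat_two y'(2,7,3,8) fg])
      fix a b d e f' g' assume e: "e \<in> Arr V" "Cod V e = Dom V f" and f': "f' \<in> Hom V (Dom V e) (VHom two a b)" "f \<cdot> e = inc1 V two a b \<cdot> f'"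
        and g': "g' \<in> Hom V (Dom V e) (VHom two b d)" "g \<cdot> e = inc1 V two b d \<cdot> g'"
      have gc: "vcmp V two a b d g' f' \<in> Hom V (Dom V e) (two_hom V a d)" using f'(1) g'(1) by simp
      have lhs: "(F1 \<cdot> pair V y (igcmp V T2 f g)) \<cdot> e = F1 \<cdot> pair V (y \<cdot> e) (inc1 V two a d \<cdot> vcmp V two a b d g' f')"
        using y e f' g' fg by simp
      have rhs: "igcmp V B (F1 \<cdot> pair V y f) (F1 \<cdot> pair V y g) \<cdot> e = igcmp V B (F1 \<cdot> pair V (y \<cdot> e) (inc1 V two a b \<cdot> f')) (F1 \<cdot> pair V (y \<cdot> e) (inc1 V two b d \<cdot> g'))"
        using y e f' g' c by simp
      have s1: "isrc B \<cdot> (F1 \<cdot> pair V (y \<cdot> e) (inc1 V two b d \<cdot> g')) = v0 b \<cdot> (y \<cdot> e)"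
        using st(1)[of "y \<cdot> e" "inc1 V two b d \<cdot> g'"] F0y[of "y \<cdot> e" b] y e g' by simp
      have t1: "itgt B \<cdot> (F1 \<cdot> pair V (y \<cdot> e) (inc1 V two a b \<cdot> f')) = v0 b \<cdot> (y \<cdot> e)"
        using st(2)[of "y \<cdot> e" "inc1 V two a b \<cdot> f'"] F0y[of "y \<cdot> e" b] y e f' by simp
      consider "a = b" | "b = d" | "a \<and> \<not> b \<or> b \<and> \<not> d" by blast
      then show "(F1 \<cdot> pair V y (igcmp V T2 f g)) \<cdot> e = igcmp V B (F1 \<cdot> pair V y f) (F1 \<cdot> pair V y g) \<cdot> e"
      proof cases
        case 1
        have "vcmp V two a b d g' f' = g'" using gc g' 1 by (intro to_two_hom[of _ _ b d]) simp_all
        moreover have "F1 \<cdot> pair V (y \<cdot> e) (inc1 V two a b \<cdot> f') = iid B \<cdot> (v0 b \<cdot> (y \<cdot> e))"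
          using F1y(1)[of "y \<cdot> e" f' a b] y e f' 1 by simp
        ultimately show ?thesis unfolding lhs rhs using 1 s1 y e g' by simp
      next
        case 2
        have "vcmp V two a b d g' f' = f'" using gc f' 2 by (intro to_two_hom[of _ _ a b]) simp_all
        moreover have "F1 \<cdot> pair V (y \<cdot> e) (inc1 V two b d \<cdot> g') = iid B \<cdot> (v0 b \<cdot> (y \<cdot> e))"
          using F1y(1)[of "y \<cdot> e" g' b d] y e g' 2 by simp
        ultimately show ?thesis unfolding lhs rhs using 2 t1 y e f' by simp
      next
        case 3
        then have "is_initial V (Dom V e)" using two_arr(3)[of f' a b] two_arr(3)[of g' b d] f' g' by auto
        then show ?thesis by (rule initial_comp_eq) (use y e fg c in simp_all)
      qed
    qed (use y fg c in simp_all)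
  qed simp_all
  then obtain N where N: "N \<in> Hom V ?X (IOb E)" "evo T2 E ev N = F0" "eva T2 E ev N = F1" using P(5) by blast
  have "F1 \<cdot> pair V (Ident V ?X) (a01 \<cdot> bang V ?X) = x"
    using F1y(2)[of "Ident V ?X" "bang V ?X" False True] by (simp add: two_hom_def)
  moreover have "eva T2 E ev N \<cdot> pair V (Ident V ?X) (a01 \<cdot> bang V ?X) = ar N"
    using N(1) by (simp add: S ar_def)
  ultimately have "ar N = x" using N(3) by simp
  then show ?thesis using N(1) by blast
qed

text \<open>Both composites are the value of the evaluation at the arrow \<open>(M, 0 \<rightarrow> 1)\<close>, factored in two ways.\<close>

lemma ar_square:
  assumes M: "M \<in> Arr V" "Cod V M = IAr E"
  shows "igcmp V B (end1 False M) (ar (itgt E \<cdot> M)) = igcmp V B (ar (isrc E \<cdot> M)) (end1 True M)"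
proof -
  let ?b = "bang V (Dom V M)"
  have "igcmp V (prd W E T2) (ip1 E T2 M (iid T2 \<cdot> (inc0 V two False \<cdot> ?b))) (ip1 E T2 (iid E \<cdot> (itgt E \<cdot> M)) (a01 \<cdot> ?b)) = ip1 E T2 M (a01 \<cdot> ?b)"
    using M by simp
  moreover have "igcmp V (prd W E T2) (ip1 E T2 (iid E \<cdot> (isrc E \<cdot> M)) (a01 \<cdot> ?b)) (ip1 E T2 M (iid T2 \<cdot> (inc0 V two True \<cdot> ?b))) = ip1 E T2 M (a01 \<cdot> ?b)"
    using M by simp
  ultimately have "IF1 ev \<cdot> igcmp V (prd W E T2) (ip1 E T2 M (iid T2 \<cdot> (inc0 V two False \<cdot> ?b))) (ip1 E T2 (iid E \<cdot> (itgt E \<cdot> M)) (a01 \<cdot> ?b)) =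
    IF1 ev \<cdot> igcmp V (prd W E T2) (ip1 E T2 (iid E \<cdot> (isrc E \<cdot> M)) (a01 \<cdot> ?b)) (ip1 E T2 M (iid T2 \<cdot> (inc0 V two True \<cdot> ?b)))"
    by (simp only:)
  then show ?thesis using M by (simp add: ar_def end1_def del: igcmp_ip1)
qed

lemma square_eq:
  assumes M: "M \<in> Arr V" "M' \<in> Arr V" "Dom V M = Dom V M'" "Cod V M = IAr E" "Cod V M' = IAr E"
    and eq: "isrc E \<cdot> M = isrc E \<cdot> M'" "itgt E \<cdot> M = itgt E \<cdot> M'" "\<And>b. end1 b M = end1 b M'"
  shows "M = M'"
proof -
  have e: "evt T2 E ev M \<cdot> pair V y (inc0 V two b \<cdot> bang V (Dom V y)) = end1 b M \<cdot> y"
    if "y \<in> Arr V" "Cod V y = Dom V M" "M \<in> Arr V" "Cod V M = IAr E" for b y M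
    using that by (simp add: S) (simp add: end1_def)
  show ?thesis
    by (rule P(8)[OF M eq(1,2)], rule prd_Int_ob_ext[of two "Dom V M"])
      (use M eq(3) e in \<open>simp_all add: T del: end1_simps(6)\<close>)
qed

text \<open>Naturality of a transformation between functors out of \<open>2\<close> has to be checked at \<open>0 \<rightarrow> 1\<close> only.\<close>

lemma square_ex:
  assumes N: "N \<in> Arr V" "N' \<in> Arr V" "Dom V N = Dom V N'" "Cod V N = IOb E" "Cod V N' = IOb E"
    and f: "\<And>b. f b \<in> Hom V (Dom V N) (IAr B)" "\<And>b. isrc B \<cdot> f b = end0 b N" "\<And>b. itgt B \<cdot> f b = end0 b N'"
    and sq: "igcmp V B (f False) (ar N') = igcmp V B (ar N) (f True)"
  shows "\<exists>M. M \<in> Hom V (Dom V N) (IAr E) \<and> isrc E \<cdot> M = N \<and> itgt E \<cdot> M = N' \<and> (\<forall>b. end1 b M = f b)"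
proof -
  let ?X = "Dom V N"
  note [simp] = N f(2,3) f(1)[simplified]
  have fy: "isrc B \<cdot> (f b \<cdot> y) = end0 b (N \<cdot> y)" "itgt B \<cdot> (f b \<cdot> y) = end0 b (N' \<cdot> y)" if "y \<in> Arr V" "Cod V y = ?X" for b y
    using reassoc[OF f(2), of b y] reassoc[OF f(3), of b y] that by simp_all
  obtain \<alpha> where \<alpha> [simp]: "\<alpha> \<in> Arr V" "Dom V \<alpha> = prd V ?X (Int_ob V two)" "Cod V \<alpha> = IAr B"
    and \<alpha>y: "\<And>b y. y \<in> Arr V \<Longrightarrow> Cod V y = ?X \<Longrightarrow> \<alpha> \<cdot> pair V y (inc0 V two b \<cdot> bang V (Dom V y)) = f b \<cdot> y"
    using prd_Int_ob_ex[of two ?X "IAr B" f] by auto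
  have ff: "ffam T2 B ?X (evo T2 E ev N) (eva T2 E ev N)" "ffam T2 B ?X (evo T2 E ev N') (eva T2 E ev N')"
    using ffam_ev[OF Intl_Obj[OF small_vcat_two] B P(1-4), of N] ffam_ev[OF Intl_Obj[OF small_vcat_two] B P(1-4), of N'] by simp_all
  have s\<alpha>: "isrc B \<cdot> \<alpha> = evo T2 E ev N" "itgt B \<cdot> \<alpha> = evo T2 E ev N'"
    by (rule prd_Int_ob_ext[of two ?X]; simp add: S T \<alpha>y fy ev_two(1))+
  have \<alpha>st: "isrc B \<cdot> (\<alpha> \<cdot> z) = evo T2 E ev N \<cdot> z" "itgt B \<cdot> (\<alpha> \<cdot> z) = evo T2 E ev N' \<cdot> z" if "z \<in> Arr V" "Cod V z = prd V ?X (Int_ob V two)" for z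
    using reassoc[OF s\<alpha>(1), of z] reassoc[OF s\<alpha>(2), of z] that by simp_all
  have "nfam T2 B ?X (evo T2 E ev N) (eva T2 E ev N) (evo T2 E ev N') (eva T2 E ev N') \<alpha>"
  proof (rule nfamI)
    fix y h assume y: "y \<in> Arr V" "h \<in> Arr V" "Dom V y = Dom V h" "Cod V y = ?X" "Cod V h = IAr T2"
    note y' = y[simplified]
    note fe = ffam_elem[OF Intl_Obj[OF small_vcat_two] B ff(1)] ffam_elem[OF Intl_Obj[OF small_vcat_two] B ff(2)]
    let ?l = "igcmp V B (eva T2 E ev N \<cdot> pair V y h) (\<alpha> \<cdot> pair V y (itgt T2 \<cdot> h))"
    let ?r = "igcmp V B (\<alpha> \<cdot> pair V y (isrc T2 \<cdot> h)) (eva T2 E ev N' \<cdot> pair V y h)"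
    have lr: "?l \<in> Arr V" "Dom V ?l = Dom V h" "Cod V ?l = IAr B" "?r \<in> Arr V" "Dom V ?r = Dom V h" "Cod V ?r = IAr B"
      "\<And>e. e \<in> Arr V \<Longrightarrow> Cod V e = Dom V h \<Longrightarrow> ?l \<cdot> e = igcmp V B (eva T2 E ev N \<cdot> pair V (y \<cdot> e) (h \<cdot> e)) (\<alpha> \<cdot> pair V (y \<cdot> e) (itgt T2 \<cdot> (h \<cdot> e)))"
      "\<And>e. e \<in> Arr V \<Longrightarrow> Cod V e = Dom V h \<Longrightarrow> ?r \<cdot> e = igcmp V B (\<alpha> \<cdot> pair V (y \<cdot> e) (isrc T2 \<cdot> (h \<cdot> e))) (eva T2 E ev N' \<cdot> pair V (y \<cdot> e) (h \<cdot> e))"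
      using y by (simp_all add: T fe \<alpha>st del: ev_simps)
    show "?l = ?r"
    proof (rule arr_local_eq[OF small_vcat_two, of h])
      fix a b e g assume e: "e \<in> Arr V" "Cod V e = Dom V h" and g: "g \<in> Hom V (Dom V e) (VHom two a b)" "h \<cdot> e = inc1 V two a b \<cdot> g"
      define z where "z = y \<cdot> e"
      have z: "z \<in> Arr V" "Cod V z = ?X" and dz: "Dom V z = Dom V e" using y e by (simp_all add: z_def)
      have st: "itgt T2 \<cdot> (h \<cdot> e) = inc0 V two b \<cdot> bang V (Dom V z)" "isrc T2 \<cdot> (h \<cdot> e) = inc0 V two a \<cdot> bang V (Dom V z)"
        unfolding g(2) dz using g(1) by simp_all
      have l: "?l \<cdot> e = igcmp V B (eva T2 E ev N \<cdot> pair V z (h \<cdot> e)) (f b \<cdot> z)"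
        unfolding lr(7)[OF e] z_def[symmetric] st using \<alpha>y[OF z, of b] by simp
      have r: "?r \<cdot> e = igcmp V B (f a \<cdot> z) (eva T2 E ev N' \<cdot> pair V z (h \<cdot> e))"
        unfolding lr(8)[OF e] z_def[symmetric] st using \<alpha>y[OF z, of a] by simp
      consider "a = b" | "\<not> a" b | a "\<not> b" by blast
      then show "?l \<cdot> e = ?r \<cdot> e"
      proof cases
        case 1
        then have h: "h \<cdot> e = iid T2 \<cdot> (inc0 V two a \<cdot> bang V (Dom V z))" using two_arr(1)[of g a b] g dz by simp
        have "eva T2 E ev N \<cdot> pair V z (h \<cdot> e) = iid B \<cdot> (end0 a N \<cdot> z)"
          "eva T2 E ev N' \<cdot> pair V z (h \<cdot> e) = iid B \<cdot> (end0 a N' \<cdot> z)"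
          unfolding h using z by (simp_all add: S ev_two(3) del: ar_simps(10) IF1_ip1_id)
        then show ?thesis unfolding l r using 1 z fy[OF z] by simp
      next
        case 2
        then have h: "h \<cdot> e = a01 \<cdot> bang V (Dom V z)" using two_arr(2)[of g a b] g dz by simp
        have "eva T2 E ev N \<cdot> pair V z (h \<cdot> e) = ar N \<cdot> z" "eva T2 E ev N' \<cdot> pair V z (h \<cdot> e) = ar N' \<cdot> z"
          unfolding h using z by (simp_all add: S ev_two(2) del: ar_simps(9))
        moreover have "igcmp V B (ar N \<cdot> z) (f True \<cdot> z) = igcmp V B (f False \<cdot> z) (ar N' \<cdot> z)"
          using arg_cong[OF sq, of "\<lambda>h. h \<cdot> z"] z by simp
        ultimately show ?thesis unfolding l r using 2 by simp
      next
        case 3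
        then have "is_initial V (Dom V e)" using two_arr(3)[of g a b] g by simp
        then show ?thesis by (rule initial_comp_eq) (use lr(1-6) e in simp_all)
      qed
    qed (use y lr(1-6) in simp_all)
  qed (use ff s\<alpha> in simp_all)
  with P(7)[OF N] obtain M where M: "M \<in> Hom V ?X (IAr E)" "isrc E \<cdot> M = N" "itgt E \<cdot> M = N'" "evt T2 E ev M = \<alpha>" by auto
  have "end1 b M = f b" for b
  proof -
    have "\<alpha> \<cdot> pair V (Ident V ?X) (inc0 V two b \<cdot> bang V ?X) = f b" using \<alpha>y[of "Ident V ?X" b] by simp
    moreover have "evt T2 E ev M \<cdot> pair V (Ident V ?X) (inc0 V two b \<cdot> bang V ?X) = end1 b M"
      using M(1) by (simp add: S) (simp add: end1_def)
    ultimately show ?thesis using M(4) by simp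
  qed
  then show ?thesis using M(1-3) by blast
qed

end

end

section \<open>Comma internal categories and internal terminal objects\<close>

context ccc
begin

lemma ev_at_simps [simp]:
  assumes "x \<in> Arr V" "Dom V x = \<one>" "Y \<in> Obj V"
  shows "ev_at V x Y \<in> Arr V" "Dom V (ev_at V x Y) = expo V (Cod V x) Y" "Cod V (ev_at V x Y) = Y"
  using assms by (simp_all add: ev_at_def Let_def const_at_def)

lemma pre_comp_simps [simp]:
  assumes "F \<in> Arr V" "Y \<in> Obj V"
  shows "pre_comp V F Y \<in> Arr V" "Dom V (pre_comp V F Y) = expo V (Cod V F) Y" "Cod V (pre_comp V F Y) = expo V (Dom V F) Y"
  using assms by (simp_all add: pre_comp_def Let_def prod_map_def)

lemma ev_at_pre_comp:
  assumes "F \<in> Arr V" "Y \<in> Obj V" "x \<in> Arr V" "Dom V x = \<one>" "Cod V x = Dom V F"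
  shows "ev_at V x Y \<cdot> pre_comp V F Y = ev_at V (F \<cdot> x) Y"
  using assms by (simp add: ev_at_def pre_comp_def Let_def prod_map_def const_at_def)

end

lemma Ex1_bij:
  assumes "\<And>r. P r \<Longrightarrow> Q (g r)" "\<And>f. Q f \<Longrightarrow> \<exists>r. P r \<and> g r = f" "\<And>r r'. \<lbrakk>P r; P r'; g r = g r'\<rbrakk> \<Longrightarrow> r = r'"
  shows "(\<exists>!r. P r) \<longleftrightarrow> (\<exists>!f. Q f)"
  using assms by metis

context cat
begin

text \<open>The preimage of the identity is the inverse.\<close>

lemma iso_if_points:
  assumes f: "f \<in> Arr V" and ex: "\<And>a. a \<in> Arr V \<Longrightarrow> Cod V a = Cod V f \<Longrightarrow> \<exists>!q. q \<in> Hom V (Dom V a) (Dom V f) \<and> f \<cdot> q = a"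
  shows "iso V f"
proof -
  have "\<exists>q. q \<in> Hom V (Cod V f) (Dom V f) \<and> f \<cdot> q = Ident V (Cod V f)"
    using ex1_implies_ex[OF ex[of "Ident V (Cod V f)"]] f by simp
  then obtain g where g: "g \<in> Arr V" "Dom V g = Cod V f" "Cod V g = Dom V f" "f \<cdot> g = Ident V (Cod V f)" by auto
  have "g \<cdot> f = Ident V (Dom V f)"
    by (rule Ex1_unique[OF ex[of f]]) (use f g in \<open>simp_all add: reassoc[OF g(4)]\<close>)
  then show ?thesis using f g by (intro isoI[of f g]) simp_all
qed

lemma iso_points:
  assumes "iso V f" "a \<in> Arr V" "Cod V a = Cod V f"
  shows "\<exists>!q. q \<in> Hom V (Dom V a) (Dom V f) \<and> f \<cdot> q = a"
proof -
  obtain g where g: "f \<in> Arr V" "g \<in> Arr V" "Dom V g = Cod V f" "Cod V g = Dom V f" "g \<cdot> f = Ident V (Dom V f)" "f \<cdot> g = Ident V (Cod V f)"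
    using assms(1) by (auto elim: isoE)
  show ?thesis
  proof (rule ex1I)
    show "g \<cdot> a \<in> Hom V (Dom V a) (Dom V f) \<and> f \<cdot> (g \<cdot> a) = a"
      using g assms(2,3) by (simp add: reassoc[OF g(6)])
    fix q assume q: "q \<in> Hom V (Dom V a) (Dom V f) \<and> f \<cdot> q = a"
    have "g \<cdot> (f \<cdot> q) = q" using conjunct1[OF q] g by (simp add: reassoc[OF g(5)])
    then show "q = g \<cdot> a" using q by metis
  qed
qed

end

context extensive_ccc
begin

text \<open>The inverses on objects and on arrows form an internal functor.\<close>

lemma iso_W:
  assumes F: "F \<in> Arr W" and iso: "iso V (IF0 F)" "iso V (IF1 F)"
  shows "iso W F"
proof -
  define A B where "A = Dom W F" and "B = Cod W F"
  have [simp]: "F \<in> Arr W" "Dom W F = A" "Cod W F = B" using F by (simp_all add: A_def B_def)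
  have [simp]: "A \<in> Obj W" "B \<in> Obj W" unfolding A_def B_def by (rule W.Dom_Obj[OF F] W.Cod_Obj[OF F])+
  have "\<exists>g. g \<in> Arr V \<and> Dom V g = IOb B \<and> Cod V g = IOb A \<and> g \<cdot> IF0 F = Ident V (IOb A) \<and> IF0 F \<cdot> g = Ident V (IOb B)"
    by (rule isoE[OF iso(1)]) auto
  then obtain g where g [simp]: "g \<in> Arr V" "Dom V g = IOb B" "Cod V g = IOb A" and gF: "g \<cdot> IF0 F = Ident V (IOb A)" "IF0 F \<cdot> g = Ident V (IOb B)" by blast
  have "\<exists>h. h \<in> Arr V \<and> Dom V h = IAr B \<and> Cod V h = IAr A \<and> h \<cdot> IF1 F = Ident V (IAr A) \<and> IF1 F \<cdot> h = Ident V (IAr B)"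
    by (rule isoE[OF iso(2)]) auto
  then obtain h where h [simp]: "h \<in> Arr V" "Dom V h = IAr B" "Cod V h = IAr A" and hF: "h \<cdot> IF1 F = Ident V (IAr A)" "IF1 F \<cdot> h = Ident V (IAr B)" by blast
  have [simp]: "g \<cdot> (IF0 F \<cdot> x) = x" if "x \<in> Arr V" "Cod V x = IOb A" for x using reassoc[OF gF(1), of x] that by simp
  have [simp]: "h \<cdot> (IF1 F \<cdot> x) = x" if "x \<in> Arr V" "Cod V x = IAr A" for x using reassoc[OF hF(1), of x] that by simp
  have [simp]: "IF0 F \<cdot> (g \<cdot> x) = x" if "x \<in> Arr V" "Cod V x = IOb B" for x using reassoc[OF gF(2), of x] that by simp
  have [simp]: "IF1 F \<cdot> (h \<cdot> x) = x" if "x \<in> Arr V" "Cod V x = IAr B" for x using reassoc[OF hF(2), of x] that by simp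
  have st: "isrc A \<cdot> h = g \<cdot> isrc B" "itgt A \<cdot> h = g \<cdot> itgt B"
  proof -
    have "IF0 F \<cdot> (isrc A \<cdot> h) = isrc B" "IF0 F \<cdot> (itgt A \<cdot> h) = itgt B"
      using ifun_comp_simps(1)[of F h B] ifun_comp_simps(2)[of F h B] by (simp_all del: ifun_comp_simps add: hF(2))
    then have "g \<cdot> (IF0 F \<cdot> (isrc A \<cdot> h)) = g \<cdot> isrc B" "g \<cdot> (IF0 F \<cdot> (itgt A \<cdot> h)) = g \<cdot> itgt B"
      by (simp_all only:)
    then show "isrc A \<cdot> h = g \<cdot> isrc B" "itgt A \<cdot> h = g \<cdot> itgt B" by simp_all
  qed
  have stx [simp]: "isrc A \<cdot> (h \<cdot> x) = g \<cdot> (isrc B \<cdot> x)" "itgt A \<cdot> (h \<cdot> x) = g \<cdot> (itgt B \<cdot> x)" if "x \<in> Arr V" "Cod V x = IAr B" for x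
    using reassoc[OF st(1), of x] reassoc[OF st(2), of x] that by simp_all
  define K where "K = \<lparr>IDom = B, ICod = A, IF0 = g, IF1 = h\<rparr>"
  have K: "K \<in> Hom W B A"
    unfolding K_def
  proof (rule ifunI)
    have "h \<cdot> (IF1 F \<cdot> (iid A \<cdot> g)) = h \<cdot> iid B" using gF(2) by simp
    then show "h \<cdot> iid B = iid A \<cdot> g" by (simp del: ifun_comp_simps)
    fix f k assume fk: "f \<in> Arr V" "k \<in> Arr V" "Cod V f = IAr B" "Cod V k = IAr B" "Dom V f = Dom V k" "itgt B \<cdot> f = isrc B \<cdot> k"
    then have "h \<cdot> (IF1 F \<cdot> igcmp V A (h \<cdot> f) (h \<cdot> k)) = h \<cdot> igcmp V B f k" by simp
    moreover have "h \<cdot> (IF1 F \<cdot> igcmp V A (h \<cdot> f) (h \<cdot> k)) = igcmp V A (h \<cdot> f) (h \<cdot> k)"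
      using fk by (simp del: ifun_igcmp)
    ultimately show "h \<cdot> igcmp V B f k = igcmp V A (h \<cdot> f) (h \<cdot> k)" by simp
  qed (simp_all add: st)
  have [simp]: "IF0 K = g" "IF1 K = h" by (simp_all add: K_def)
  have "K \<cdot>\<^sub>W F = Ident W A" "F \<cdot>\<^sub>W K = Ident W B"
    using K by (auto intro!: ifun_eqI simp: gF hF)
  then show ?thesis using K by (intro W.isoI[of F K]) simp_all
qed

text \<open>The discrete internal category on \<open>\<one> \<squnion> \<one>\<close> is a coproduct, hence so is the chosen object.\<close>

lemma W_coproduct_bool: "is_coproduct W (UNIV :: bool set) (\<lambda>_. \<one>\<^sub>W) (coprod W (UNIV :: bool set) (\<lambda>_. \<one>\<^sub>W), incl W (UNIV :: bool set) (\<lambda>_. \<one>\<^sub>W))"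
proof (rule W.coproduct_choice)
  let ?X = "coprod V (UNIV :: bool set) (\<lambda>_. \<one>)" and ?k = "incl V (UNIV :: bool set) (\<lambda>_. \<one>)"
  have c: "is_coproduct V (UNIV :: bool set) (\<lambda>_. \<one>) (?X, ?k)" by (rule small_coproduct[OF small_bool]) simp
  note D [simp] = is_coproductD[OF c, simplified]
  have el: "el (disc ?X) (?k b) \<in> Hom W \<one>\<^sub>W (disc ?X)" "pt (el (disc ?X) (?k b)) = ?k b" for b
    using el[of "disc ?X" "?k b"] by simp_all
  note [simp] = el[simplified]
  have "is_coproduct W (UNIV :: bool set) (\<lambda>_. \<one>\<^sub>W) (disc ?X, \<lambda>b. el (disc ?X) (?k b))"
  proof (rule W.coproductI)
    fix Y f assume Y: "Y \<in> Obj W" and f: "\<And>b. b \<in> (UNIV :: bool set) \<Longrightarrow> f b \<in> Hom W \<one>\<^sub>W Y"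
    have f' [simp]: "f b \<in> Arr W" "Dom W (f b) = \<one>\<^sub>W" "Cod W (f b) = Y" for b using f[of b] by simp_all
    obtain h where h: "h \<in> Arr V" "Dom V h = ?X" "Cod V h = IOb Y" "\<And>b. b \<in> UNIV \<Longrightarrow> h \<cdot> ?k b = pt (f b)"
      by (rule coproduct_ex[OF c, of "IOb Y" "\<lambda>b. pt (f b)"]) (use Y in auto)
    let ?h = "\<lparr>IDom = disc ?X, ICod = Y, IF0 = h, IF1 = iid Y \<cdot> h\<rparr>"
    have H: "?h \<in> Hom W (disc ?X) Y" by (rule disc_functor) (use Y h in simp_all)
    have "?h \<cdot>\<^sub>W el (disc ?X) (?k b) = f b" for b
      by (rule elem_eqI[of _ Y]) (use H h(4)[of b] in simp_all)
    then show "\<exists>h. h \<in> Hom W (disc ?X) Y \<and> (\<forall>b\<in>UNIV. h \<cdot>\<^sub>W el (disc ?X) (?k b) = f b)" using H by blast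
  next
    fix h h' assume hh: "h \<in> Arr W" "h' \<in> Arr W" "Dom W h = disc ?X" "Dom W h' = disc ?X" "Cod W h = Cod W h'"
      and eq: "\<And>b. b \<in> (UNIV :: bool set) \<Longrightarrow> h \<cdot>\<^sub>W el (disc ?X) (?k b) = h' \<cdot>\<^sub>W el (disc ?X) (?k b)"
    have "IF0 h \<cdot> ?k b = IF0 h' \<cdot> ?k b" for b
      using arg_cong[OF eq[of b], of pt] hh by simp
    then have e0: "IF0 h = IF0 h'" using hh by - (rule coproduct_ext[OF c], simp_all)
    moreover have "IF1 h = IF1 h'" using e0 disc_functor_IF1[of ?X h] disc_functor_IF1[of ?X h'] hh by simp
    ultimately show "h = h'" using hh by (intro ifun_eqI) simp_all
  qed simp_all
  then show "\<exists>C. is_coproduct W (UNIV :: bool set) (\<lambda>_. \<one>\<^sub>W) C" ..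
qed

lemma ends_eq:
  assumes "B \<in> Obj W"
  shows "ends V B = pair W (ev_at W (Int_elem V two False) B) (ev_at W (Int_elem V two True) B)"
proof -
  let ?i = "incl W (UNIV :: bool set) (\<lambda>_. \<one>\<^sub>W)"
  note I = W.is_coproductD[OF W_coproduct_bool, simplified]
  note el = Int_elem[OF small_vcat_two, simplified]
  note c = W.cotuple[OF W_coproduct_bool, of T2 "Int_elem V two"]
  have e: "ends_incl V \<in> Arr W" "Dom W (ends_incl V) = coprod W (UNIV :: bool set) (\<lambda>_. \<one>\<^sub>W)" "Cod W (ends_incl V) = T2"
    "ends_incl V \<cdot>\<^sub>W ?i b = Int_elem V two b" for b
    using c el by (simp_all add: ends_incl_def Two_def)
  show ?thesis
    using assms e I by (simp add: ends_def Let_def W.ev_at_pre_comp)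
qed

lemma IF_const_at:
  assumes "b \<in> Arr W" "Dom W b = \<one>\<^sub>W" "A \<in> Obj W" "y \<in> Arr V"
  shows "Cod V y = IOb A \<Longrightarrow> IF0 (const_at W A b) \<cdot> y = pt b \<cdot> bang V (Dom V y)"
    "Cod V y = IAr A \<Longrightarrow> IF1 (const_at W A b) \<cdot> y = iid (Cod W b) \<cdot> (pt b \<cdot> bang V (Dom V y))"
  using assms elem_eq(1)[of b "IF0 (bang W A) \<cdot> y"] elem_eq(2)[of b "IF1 (bang W A) \<cdot> y"]
  by (simp_all add: const_at_def)

lemma ip0_inject:
  assumes "A \<in> Obj W" "B \<in> Obj W" "f \<in> Hom V X (IOb A)" "g \<in> Hom V X (IOb B)" "f' \<in> Hom V X (IOb A)" "g' \<in> Hom V X (IOb B)"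
  shows "ip0 A B f g = ip0 A B f' g' \<longleftrightarrow> f = f' \<and> g = g'"
proof
  assume e: "ip0 A B f g = ip0 A B f' g'"
  show "f = f' \<and> g = g'" using arg_cong[OF e, of "\<lambda>h. IF0 (pr1 W A B) \<cdot> h"] arg_cong[OF e, of "\<lambda>h. IF0 (pr2 W A B) \<cdot> h"] assms by simp
qed simp

lemma ip1_inject:
  assumes "A \<in> Obj W" "B \<in> Obj W" "f \<in> Hom V X (IAr A)" "g \<in> Hom V X (IAr B)" "f' \<in> Hom V X (IAr A)" "g' \<in> Hom V X (IAr B)"
  shows "ip1 A B f g = ip1 A B f' g' \<longleftrightarrow> f = f' \<and> g = g'"
proof
  assume e: "ip1 A B f g = ip1 A B f' g'"
  show "f = f' \<and> g = g'" using arg_cong[OF e, of "\<lambda>h. IF1 (pr1 W A B) \<cdot> h"] arg_cong[OF e, of "\<lambda>h. IF1 (pr2 W A B) \<cdot> h"] assms by simp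
qed simp

context
  fixes A B H b
  assumes H: "H \<in> Arr W" "Dom W H = A" "Cod W H = B" and b: "b \<in> Arr W" "Dom W b = \<one>\<^sub>W" "Cod W b = B"
begin

private lemma AB: "A \<in> Obj W" "B \<in> Obj W"
  using H by auto

private abbreviation "E2 \<equiv> expo W T2 B"
private abbreviation "QQ \<equiv> comma V H b"
private abbreviation "PP \<equiv> comma_proj V H b"
private abbreviation "RR \<equiv> comma_arrow V H b"

lemma ends_simps:
  shows "ends V B \<in> Hom W E2 (prd W B B)"
    "N \<in> Arr V \<Longrightarrow> Cod V N = IOb E2 \<Longrightarrow> IF0 (ends V B) \<cdot> N = ip0 B B (end0 B False N) (end0 B True N)" (is "PROP ?ga")
    "N \<in> Arr V \<Longrightarrow> Cod V N = IAr E2 \<Longrightarrow> IF1 (ends V B) \<cdot> N = ip1 B B (end1 B False N) (end1 B True N)" (is "PROP ?gb")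
proof -
  note [simp] = AB
  note el [simp] = Int_elem(2,3)[OF small_vcat_two, simplified]
  have [simp]: "E2 \<in> Obj W" by simp
  have e0: "IF0 (ev_at W (Int_elem V two c) B) \<cdot> N = end0 B c N" if "N \<in> Arr V" "Cod V N = IOb E2" for N c
    using that IF_const_at(1)[of "Int_elem V two c" E2 N] by (simp add: ev_at_def Let_def end0_def const_at_def)
  have e1: "IF1 (ev_at W (Int_elem V two c) B) \<cdot> N = end1 B c N" if "N \<in> Arr V" "Cod V N = IAr E2" for N c
    using that IF_const_at(2)[of "Int_elem V two c" E2 N] by (simp add: ev_at_def Let_def end1_def const_at_def)
  show "ends V B \<in> Hom W E2 (prd W B B)" by (simp add: ends_eq)
  show "PROP ?ga"
    "PROP ?gb"
    by (simp_all add: ends_eq e0 e1)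
qed

lemma comma_base_simps:
  shows "comma_base V H b \<in> Hom W A (prd W B B)"
    "a \<in> Arr V \<Longrightarrow> Cod V a = IOb A \<Longrightarrow> IF0 (comma_base V H b) \<cdot> a = ip0 B B (IF0 H \<cdot> a) (pt b \<cdot> bang V (Dom V a))" (is "PROP ?ga")
    "a \<in> Arr V \<Longrightarrow> Cod V a = IAr A \<Longrightarrow> IF1 (comma_base V H b) \<cdot> a = ip1 B B (IF1 H \<cdot> a) (iid B \<cdot> (pt b \<cdot> bang V (Dom V a)))" (is "PROP ?gb")
proof -
  note [simp] = AB H b
  have D: "IDom H = A" using H(2) by (simp add: Cat_def)
  have c: "const_at W A b \<in> Hom W A B" by (simp add: const_at_def)
  show "comma_base V H b \<in> Hom W A (prd W B B)"
    "PROP ?ga"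
    "PROP ?gb"
    using c by (simp_all add: comma_base_def D IF_const_at)
qed

lemma comma_pullback: "is_pullback W (comma_base V H b) (ends V B) (QQ, PP, RR)"
proof -
  have D: "ICod H = B" using H(3) by (simp add: Cat_def)
  show ?thesis unfolding comma_def comma_proj_def comma_arrow_def D
    by (rule W.pullback) (use comma_base_simps(1) ends_simps(1) in simp_all)
qed

lemma comma_Hom: "QQ \<in> Obj W" "PP \<in> Hom W QQ A" "RR \<in> Hom W QQ E2"
  using W.is_pullbackD[OF comma_pullback] comma_base_simps(1) ends_simps(1) by simp_all

text \<open>
  A generalized object of the comma category is a generalized object \<open>a\<close> of \<open>A\<close> together with an arrow \<open>H a \<rightarrow> b\<close>,
  which is the value of \<open>kap\<close>; a generalized arrow is an arrow of \<open>A\<close> that makes the triangle over \<open>b\<close> commute.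
\<close>

definition kap :: "'m \<Rightarrow> 'm" where
  "kap q = ar B (IF0 RR \<cdot> q)"

private lemma pbs: "is_pullback V (IF0 (comma_base V H b)) (IF0 (ends V B)) (IOb QQ, IF0 PP, IF0 RR)"
  "is_pullback V (IF1 (comma_base V H b)) (IF1 (ends V B)) (IAr QQ, IF1 PP, IF1 RR)"
  using pullback_pointwise[OF comma_pullback] comma_base_simps(1) ends_simps(1) by simp_all

lemma kap_simps:
  assumes "q \<in> Arr V" "Cod V q = IOb QQ"
  shows "kap q \<in> Arr V" "Dom V (kap q) = Dom V q" "Cod V (kap q) = IAr B"
    "isrc B \<cdot> kap q = IF0 H \<cdot> (IF0 PP \<cdot> q)" (is ?ga) "itgt B \<cdot> kap q = pt b \<cdot> bang V (Dom V q)" (is ?gb)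
    "x \<in> Arr V \<Longrightarrow> Cod V x = Dom V q \<Longrightarrow> kap q \<cdot> x = kap (q \<cdot> x)" (is "PROP ?gc")
proof -
  note [simp] = AB H b comma_Hom[simplified] assms
  note bs = comma_base_simps[simplified] and es = ends_simps[simplified]
  have "IF0 (comma_base V H b) \<cdot> (IF0 PP \<cdot> q) = IF0 (ends V B) \<cdot> (IF0 RR \<cdot> q)"
    using reassoc[OF is_pullbackD(8)[OF pbs(1)], of q] bs(1) es(1) by simp
  then have "IF0 H \<cdot> (IF0 PP \<cdot> q) = end0 B False (IF0 RR \<cdot> q)" "pt b \<cdot> bang V (Dom V q) = end0 B True (IF0 RR \<cdot> q)"
    using bs es ip0_inject[OF AB(2) AB(2), of "IF0 H \<cdot> (IF0 PP \<cdot> q)" "Dom V q"] by simp_all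
  then show "kap q \<in> Arr V" "Dom V (kap q) = Dom V q" "Cod V (kap q) = IAr B"
    ?ga ?gb
    "PROP ?gc"
    by (simp_all add: kap_def)
qed

lemma comma_obj_ex:
  assumes "a \<in> Arr V" "x \<in> Arr V" "Cod V a = IOb A" "Cod V x = IAr B" "Dom V a = Dom V x"
    "isrc B \<cdot> x = IF0 H \<cdot> a" "itgt B \<cdot> x = pt b \<cdot> bang V (Dom V x)"
  shows "\<exists>q. q \<in> Hom V (Dom V x) (IOb QQ) \<and> IF0 PP \<cdot> q = a \<and> kap q = x"
proof -
  note [simp] = AB H b comma_Hom[simplified] assms
  note bs = comma_base_simps[simplified] and es = ends_simps[simplified]
  obtain N where N: "N \<in> Arr V" "Dom V N = Dom V x" "Cod V N = IOb E2" and arN: "ar B N = x" using ar_surj[of B x] by auto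
  have "IF0 (comma_base V H b) \<cdot> a = IF0 (ends V B) \<cdot> N"
    using N arN ar_simps(4,5)[of B N] by (simp add: bs es)
  from pullback_lift[OF pbs(1), of a N] this N bs(1) es(1)
  obtain q where "q \<in> Hom V (Dom V x) (IOb QQ)" "IF0 PP \<cdot> q = a" "IF0 RR \<cdot> q = N" by auto
  then show ?thesis using arN by (intro exI[of _ q]) (simp add: kap_def)
qed

lemma comma_obj_eq:
  assumes "q \<in> Arr V" "q' \<in> Arr V" "Dom V q = Dom V q'" "Cod V q = IOb QQ" "Cod V q' = IOb QQ" "IF0 PP \<cdot> q = IF0 PP \<cdot> q'" "kap q = kap q'"
  shows "q = q'"
proof (rule pullback_ext[OF pbs(1)])
  note [simp] = AB H b comma_Hom[simplified]
  show "IF0 RR \<cdot> q = IF0 RR \<cdot> q'" by (rule ar_inj[OF AB(2)]) (use assms in \<open>simp_all add: kap_def\<close>)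
qed (use assms comma_base_simps(1) ends_simps(1) in simp_all)

lemma comma_arr_square:
  assumes "r \<in> Arr V" "Cod V r = IAr QQ"
  shows "igcmp V B (IF1 H \<cdot> (IF1 PP \<cdot> r)) (kap (itgt QQ \<cdot> r)) = kap (isrc QQ \<cdot> r)"
proof -
  note [simp] = AB H b comma_Hom[simplified] assms
  note bs = comma_base_simps[simplified] and es = ends_simps[simplified]
  let ?M = "IF1 RR \<cdot> r"
  have "IF1 (comma_base V H b) \<cdot> (IF1 PP \<cdot> r) = IF1 (ends V B) \<cdot> ?M"
    using reassoc[OF is_pullbackD(8)[OF pbs(2)], of r] bs(1) es(1) by simp
  then have e: "IF1 H \<cdot> (IF1 PP \<cdot> r) = end1 B False ?M" "iid B \<cdot> (pt b \<cdot> bang V (Dom V r)) = end1 B True ?M"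
    using bs es ip1_inject[OF AB(2) AB(2), of "IF1 H \<cdot> (IF1 PP \<cdot> r)" "Dom V r"] by simp_all
  have "igcmp V B (end1 B False ?M) (ar B (itgt E2 \<cdot> ?M)) = igcmp V B (ar B (isrc E2 \<cdot> ?M)) (end1 B True ?M)"
    by (rule ar_square) simp_all
  moreover have "igcmp V B (kap (isrc QQ \<cdot> r)) (iid B \<cdot> (pt b \<cdot> bang V (Dom V r))) = kap (isrc QQ \<cdot> r)"
    using kap_simps[of "isrc QQ \<cdot> r"] kap_simps[of "itgt QQ \<cdot> r"] by simp
  ultimately show ?thesis using e by (simp add: kap_def)
qed

lemma comma_arr_ex:
  assumes "q \<in> Arr V" "q' \<in> Arr V" "Dom V q = Dom V q'" "Cod V q = IOb QQ" "Cod V q' = IOb QQ"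
    and f: "f \<in> Hom V (Dom V q) (IAr A)" "isrc A \<cdot> f = IF0 PP \<cdot> q" "itgt A \<cdot> f = IF0 PP \<cdot> q'"
    and sq: "igcmp V B (IF1 H \<cdot> f) (kap q') = kap q"
  shows "\<exists>r. r \<in> Hom V (Dom V q) (IAr QQ) \<and> isrc QQ \<cdot> r = q \<and> itgt QQ \<cdot> r = q' \<and> IF1 PP \<cdot> r = f"
proof -
  note [simp] = AB H b comma_Hom[simplified] assms(1-5) f[simplified]
  note bs = comma_base_simps[simplified] and es = ends_simps[simplified]
  note k = kap_simps[of q] kap_simps[of q']
  define g where "g c = (if c then iid B \<cdot> (pt b \<cdot> bang V (Dom V q)) else IF1 H \<cdot> f)" for c
  have sN: "end0 B False (IF0 RR \<cdot> q) = IF0 H \<cdot> (IF0 PP \<cdot> q)" "end0 B True (IF0 RR \<cdot> q) = pt b \<cdot> bang V (Dom V q)"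
    "end0 B False (IF0 RR \<cdot> q') = IF0 H \<cdot> (IF0 PP \<cdot> q')" "end0 B True (IF0 RR \<cdot> q') = pt b \<cdot> bang V (Dom V q')"
    using k(4,5,10,11) ar_simps(4,5)[of B "IF0 RR \<cdot> q"] ar_simps(4,5)[of B "IF0 RR \<cdot> q'"] by (simp_all add: kap_def)
  have "\<exists>M. M \<in> Hom V (Dom V (IF0 RR \<cdot> q)) (IAr E2) \<and> isrc E2 \<cdot> M = IF0 RR \<cdot> q \<and> itgt E2 \<cdot> M = IF0 RR \<cdot> q' \<and> (\<forall>c. end1 B c M = g c)"
  proof (rule square_ex[OF AB(2)])
    show "g c \<in> Hom V (Dom V (IF0 RR \<cdot> q)) (IAr B)" "isrc B \<cdot> g c = end0 B c (IF0 RR \<cdot> q)" "itgt B \<cdot> g c = end0 B c (IF0 RR \<cdot> q')" for c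
      by (cases c; simp add: g_def sN)+
    show "igcmp V B (g False) (ar B (IF0 RR \<cdot> q')) = igcmp V B (ar B (IF0 RR \<cdot> q)) (g True)"
      using sq k(1-5) by (simp add: g_def kap_def)
  qed simp_all
  then obtain M where M: "M \<in> Arr V" "Dom V M = Dom V q" "Cod V M = IAr E2" "isrc E2 \<cdot> M = IF0 RR \<cdot> q" "itgt E2 \<cdot> M = IF0 RR \<cdot> q'"
    "end1 B False M = IF1 H \<cdot> f" "end1 B True M = iid B \<cdot> (pt b \<cdot> bang V (Dom V q))"
    by (auto simp: g_def)
  have "IF1 (comma_base V H b) \<cdot> f = IF1 (ends V B) \<cdot> M" using M by (simp add: bs es)
  from pullback_lift[OF pbs(2), of f M] this M bs(1) es(1)
  obtain r where r: "r \<in> Arr V" "Dom V r = Dom V q" "Cod V r = IAr QQ" "IF1 PP \<cdot> r = f" "IF1 RR \<cdot> r = M" by auto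
  have "isrc QQ \<cdot> r = q" "itgt QQ \<cdot> r = q'"
    using r M ifun_comp_simps(1)[of PP r A] ifun_comp_simps(1)[of RR r E2] ifun_comp_simps(2)[of PP r A] ifun_comp_simps(2)[of RR r E2]
      bs(1) es(1) by - (rule pullback_ext[OF pbs(1)]; simp del: ifun_comp_simps)+
  then show ?thesis using r by auto
qed

lemma comma_arr_eq:
  assumes "r \<in> Arr V" "r' \<in> Arr V" "Dom V r = Dom V r'" "Cod V r = IAr QQ" "Cod V r' = IAr QQ"
    "isrc QQ \<cdot> r = isrc QQ \<cdot> r'" "itgt QQ \<cdot> r = itgt QQ \<cdot> r'" "IF1 PP \<cdot> r = IF1 PP \<cdot> r'"
  shows "r = r'"
proof (rule pullback_ext[OF pbs(2)])
  note [simp] = AB H b comma_Hom[simplified]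
  note bs = comma_base_simps[simplified] and es = ends_simps[simplified]
  have t: "end1 B False (IF1 RR \<cdot> r) = IF1 H \<cdot> (IF1 PP \<cdot> r) \<and> end1 B True (IF1 RR \<cdot> r) = iid B \<cdot> (pt b \<cdot> bang V (Dom V r))"
    if [simp]: "r \<in> Arr V" "Cod V r = IAr QQ" for r
  proof -
    have "IF1 (comma_base V H b) \<cdot> (IF1 PP \<cdot> r) = IF1 (ends V B) \<cdot> (IF1 RR \<cdot> r)"
      using reassoc[OF is_pullbackD(8)[OF pbs(2)], of r] bs(1) es(1) by simp
    then show ?thesis
      using bs es ip1_inject[OF AB(2) AB(2), of "IF1 H \<cdot> (IF1 PP \<cdot> r)" "Dom V r"] by simp
  qed
  show "IF1 RR \<cdot> r = IF1 RR \<cdot> r'"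
  proof (rule square_eq[OF AB(2)])
    show "end1 B c (IF1 RR \<cdot> r) = end1 B c (IF1 RR \<cdot> r')" for c using t[of r] t[of r'] assms by (cases c) simp_all
  qed (use assms in simp_all)
qed (use assms comma_base_simps(1) ends_simps(1) in simp_all)

end

text \<open>
  The generalized objects of the slice are the arrows into \<open>T\<close>, so the right-hand side says that its projection is bijective
  on objects. It is then bijective on arrows too, as the triangle over an arrow commutes by uniqueness.
\<close>

lemma internal_terminal_iff:
  assumes A: "A \<in> Obj W" and T: "T \<in> Hom W \<one>\<^sub>W A"
  shows "internal_terminal V A T \<longleftrightarrow>
    (\<forall>a. a \<in> Arr V \<longrightarrow> Cod V a = IOb A \<longrightarrow> (\<exists>!f. f \<in> Hom V (Dom V a) (IAr A) \<and> isrc A \<cdot> f = a \<and> itgt A \<cdot> f = pt T \<cdot> bang V (Dom V a)))"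
    (is "_ \<longleftrightarrow> ?R")
proof -
  let ?I = "Ident W A"
  have H: "?I \<in> Arr W" "Dom W ?I = A" "Cod W ?I = A" using A by simp_all
  have T': "T \<in> Arr W" "Dom W T = \<one>\<^sub>W" "Cod W T = A" using T by simp_all
  let ?Q = "comma V ?I T" and ?P = "comma_proj V ?I T" and ?k = "kap A ?I T"
  note [simp] = A T' comma_Hom[OF H T', simplified]
  note ks = kap_simps[OF H T'] and oe = comma_obj_ex[OF H T'] and oq = comma_obj_eq[OF H T']
    and ae = comma_arr_ex[OF H T'] and aq = comma_arr_eq[OF H T'] and asq = comma_arr_square[OF H T']
  have slice: "(\<exists>!q. q \<in> Hom V (Dom V a) (IOb ?Q) \<and> IF0 ?P \<cdot> q = a) \<longleftrightarrow>
      (\<exists>!f. f \<in> Hom V (Dom V a) (IAr A) \<and> isrc A \<cdot> f = a \<and> itgt A \<cdot> f = pt T \<cdot> bang V (Dom V a))"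
    if a: "a \<in> Arr V" "Cod V a = IOb A" for a
  proof (rule Ex1_bij[where g = ?k])
    fix q assume q: "q \<in> Hom V (Dom V a) (IOb ?Q) \<and> IF0 ?P \<cdot> q = a"
    then show "?k q \<in> Hom V (Dom V a) (IAr A) \<and> isrc A \<cdot> ?k q = a \<and> itgt A \<cdot> ?k q = pt T \<cdot> bang V (Dom V a)"
      using ks[of q] a by simp
  next
    fix f assume f: "f \<in> Hom V (Dom V a) (IAr A) \<and> isrc A \<cdot> f = a \<and> itgt A \<cdot> f = pt T \<cdot> bang V (Dom V a)"
    then show "\<exists>q. (q \<in> Hom V (Dom V a) (IOb ?Q) \<and> IF0 ?P \<cdot> q = a) \<and> ?k q = f"
      using oe[of a f] a by auto
  next
    fix q q' assume q: "q \<in> Hom V (Dom V a) (IOb ?Q) \<and> IF0 ?P \<cdot> q = a" "q' \<in> Hom V (Dom V a) (IOb ?Q) \<and> IF0 ?P \<cdot> q' = a" "?k q = ?k q'"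
    show "q = q'" by (rule oq) (use q in simp_all)
  qed
  have "iso W ?P \<longleftrightarrow> ?R"
  proof
    assume "iso W ?P"
    then show ?R using iso_points[OF iso_IF(1)[of ?P]] slice by simp
  next
    assume R: ?R
    show "iso W ?P"
    proof (rule iso_W)
      show i0: "iso V (IF0 ?P)"
        by (rule iso_if_points) (use R slice in simp_all)
      show "iso V (IF1 ?P)"
      proof (rule iso_if_points)
        fix f assume f: "f \<in> Arr V" "Cod V f = Cod V (IF1 ?P)"
        then have f' [simp]: "f \<in> Arr V" "Cod V f = IAr A" by simp_all
        have "\<exists>q. q \<in> Hom V (Dom V f) (IOb ?Q) \<and> IF0 ?P \<cdot> q = isrc A \<cdot> f" "\<exists>q. q \<in> Hom V (Dom V f) (IOb ?Q) \<and> IF0 ?P \<cdot> q = itgt A \<cdot> f"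
          using ex1_implies_ex[OF iso_points[OF i0, of "isrc A \<cdot> f"]] ex1_implies_ex[OF iso_points[OF i0, of "itgt A \<cdot> f"]] by simp_all
        then obtain q q' where q: "q \<in> Hom V (Dom V f) (IOb ?Q)" "IF0 ?P \<cdot> q = isrc A \<cdot> f" "q' \<in> Hom V (Dom V f) (IOb ?Q)" "IF0 ?P \<cdot> q' = itgt A \<cdot> f"
          by blast
        have "igcmp V A f (?k q') = ?k q"
        proof (rule Ex1_unique)
          show "\<exists>!g. g \<in> Hom V (Dom V f) (IAr A) \<and> isrc A \<cdot> g = isrc A \<cdot> f \<and> itgt A \<cdot> g = pt T \<cdot> bang V (Dom V f)"
            using R[rule_format, of "isrc A \<cdot> f"] by simp
          show "igcmp V A f (?k q') \<in> Hom V (Dom V f) (IAr A) \<and> isrc A \<cdot> igcmp V A f (?k q') = isrc A \<cdot> f \<and> itgt A \<cdot> igcmp V A f (?k q') = pt T \<cdot> bang V (Dom V f)"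
            using q(3,4) ks[of q'] by simp
          show "?k q \<in> Hom V (Dom V f) (IAr A) \<and> isrc A \<cdot> ?k q = isrc A \<cdot> f \<and> itgt A \<cdot> ?k q = pt T \<cdot> bang V (Dom V f)"
            using q(1,2) ks[of q] by simp
        qed
        then have sq: "igcmp V A (IF1 ?I \<cdot> f) (?k q') = ?k q" by simp
        have "\<exists>r. r \<in> Hom V (Dom V q) (IAr ?Q) \<and> isrc ?Q \<cdot> r = q \<and> itgt ?Q \<cdot> r = q' \<and> IF1 ?P \<cdot> r = f"
          by (rule ae[OF _ _ _ _ _ _ _ _ sq]) (use q in simp_all)
        then obtain r where r: "r \<in> Hom V (Dom V f) (IAr ?Q)" "IF1 ?P \<cdot> r = f" using q(1) by auto
        show "\<exists>!r. r \<in> Hom V (Dom V f) (Dom V (IF1 ?P)) \<and> IF1 ?P \<cdot> r = f"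
        proof (rule ex1I)
          show "r \<in> Hom V (Dom V f) (Dom V (IF1 ?P)) \<and> IF1 ?P \<cdot> r = f" using r by simp
          fix r' assume r': "r' \<in> Hom V (Dom V f) (Dom V (IF1 ?P)) \<and> IF1 ?P \<cdot> r' = f"
          have "IF0 ?P \<cdot> (isrc ?Q \<cdot> r') = isrc A \<cdot> f" "IF0 ?P \<cdot> (isrc ?Q \<cdot> r) = isrc A \<cdot> f"
            "IF0 ?P \<cdot> (itgt ?Q \<cdot> r') = itgt A \<cdot> f" "IF0 ?P \<cdot> (itgt ?Q \<cdot> r) = itgt A \<cdot> f"
            using ifun_comp_simps(1,2)[of ?P r' A] ifun_comp_simps(1,2)[of ?P r A] r r' by (simp_all del: ifun_comp_simps)
          then have "isrc ?Q \<cdot> r' = isrc ?Q \<cdot> r" "itgt ?Q \<cdot> r' = itgt ?Q \<cdot> r"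
            using Ex1_unique[OF iso_points[OF i0, of "isrc A \<cdot> f"], of "isrc ?Q \<cdot> r'" "isrc ?Q \<cdot> r"]
              Ex1_unique[OF iso_points[OF i0, of "itgt A \<cdot> f"], of "itgt ?Q \<cdot> r'" "itgt ?Q \<cdot> r"] r r' by simp_all
          then show "r' = r" using r r' by - (rule aq; simp)
        qed
      qed simp
    qed simp
  qed
  then show ?thesis using T by (simp add: internal_terminal_def)
qed

end

section \<open>Internal categories of cones\<close>

context extensive_ccc
begin

context
  fixes II CC K
  assumes K: "K \<in> Arr W" "Dom W K = II" "Cod W K = CC"
begin

private abbreviation "EE \<equiv> expo W II CC"
private abbreviation "evv \<equiv> evl W II CC"
private abbreviation "DD \<equiv> cone_diag V K"
private abbreviation "kk \<equiv> name_of W K"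
private abbreviation "CQ \<equiv> cones V K"
private abbreviation "CP \<equiv> comma_proj V DD kk"
private abbreviation "CR \<equiv> comma_arrow V DD kk"

private lemma OB: "II \<in> Obj W" "CC \<in> Obj W" "EE \<in> Obj W"
  using K by auto

private lemma DD_def: "DD = transp W CC II CC (pr1 W CC II)"
  using K by (simp add: cone_diag_def diag_def Cat_def)

private lemma DD: "DD \<in> Arr W" "Dom W DD = CC" "Cod W DD = EE"
  using OB by (simp_all add: DD_def)

private lemma kk: "kk \<in> Arr W" "Dom W kk = \<one>\<^sub>W" "Cod W kk = EE"
  using K by simp_all

private lemmas pex = pexpD[OF OB(1,2) pexp_expo[OF OB(1,2)]]
private lemmas evs = ev_simps[OF OB(1,2) pex(1-4)] ev_typing[OF OB(1,2) pex(1-4)]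
private lemmas ce = comma_obj_ex[OF DD kk, folded cones_def] and ceq = comma_obj_eq[OF DD kk, folded cones_def]
  and ks = kap_simps[OF DD kk, folded cones_def] and cH = comma_Hom[OF DD kk, folded cones_def]
private lemmas ed = evo_def[OF OB(1,2)] eva_def[OF OB(1,2)] evt_def[OF OB(1,2)]
private abbreviation "kp \<equiv> kap EE DD kk"

lemma evl_cone_diag:
  assumes "x \<in> Arr V" "y \<in> Arr V" "Dom V x = Dom V y"
  shows "Cod V x = IOb CC \<Longrightarrow> Cod V y = IOb II \<Longrightarrow> IF0 evv \<cdot> ip0 EE II (IF0 DD \<cdot> x) y = x" (is "PROP ?ga")
    "Cod V x = IAr CC \<Longrightarrow> Cod V y = IAr II \<Longrightarrow> IF1 evv \<cdot> ip1 EE II (IF1 DD \<cdot> x) y = x" (is "PROP ?gb")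
proof -
  note [simp] = OB DD assms
  have e: "evv \<cdot>\<^sub>W pair W (DD \<cdot>\<^sub>W pr1 W CC II) (pr2 W CC II) = pr1 W CC II"
    by (simp add: DD_def)
  show "PROP ?ga"
    using arg_cong[OF e, of "\<lambda>F. IF0 F \<cdot> ip0 CC II x y"] by simp
  show "PROP ?gb"
    using arg_cong[OF e, of "\<lambda>F. IF1 F \<cdot> ip1 CC II x y"] by simp
qed

lemma evl_cone_name:
  assumes "y \<in> Arr V"
  shows "Cod V y = IOb II \<Longrightarrow> IF0 evv \<cdot> ip0 EE II (pt kk \<cdot> bang V (Dom V y)) y = IF0 K \<cdot> y" (is "PROP ?ga")
    "Cod V y = IAr II \<Longrightarrow> IF1 evv \<cdot> ip1 EE II (iid EE \<cdot> (pt kk \<cdot> bang V (Dom V y))) y = IF1 K \<cdot> y" (is "PROP ?gb")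
proof -
  note [simp] = OB K assms
  have e: "evv \<cdot>\<^sub>W pair W (kk \<cdot>\<^sub>W bang W II) (Ident W II) = K"
    by simp
  show "PROP ?ga"
    using arg_cong[OF e, of "\<lambda>F. IF0 F \<cdot> y"] elem_eq(1)[OF kk(1,2), of "IF0 (bang W II) \<cdot> y"] by (simp del: W.evl_name_of)
  show "PROP ?gb"
    using arg_cong[OF e, of "\<lambda>F. IF1 F \<cdot> y"] elem_eq(2)[OF kk(1,2), of "IF1 (bang W II) \<cdot> y"] by (simp del: W.evl_name_of)
qed

private lemma pt_kk: "pt kk \<in> Arr V" "Dom V (pt kk) = \<one>" "Cod V (pt kk) = IOb EE"
  using pt[of kk] kk by simp_all

lemma cone_ev:
  assumes "x \<in> Arr V"
  shows "Cod V x = IOb CC \<Longrightarrow> evo II EE evv (IF0 DD \<cdot> x) = x \<cdot> pr1 V (Dom V x) (IOb II)" (is "PROP ?ga")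
    "Cod V x = IOb CC \<Longrightarrow> eva II EE evv (IF0 DD \<cdot> x) = iid CC \<cdot> (x \<cdot> pr1 V (Dom V x) (IAr II))" (is "PROP ?gb")
    "Cod V x = IAr CC \<Longrightarrow> evt II EE evv (IF1 DD \<cdot> x) = x \<cdot> pr1 V (Dom V x) (IOb II)" (is "PROP ?gc")
    "Cod V x = \<one> \<Longrightarrow> evo II EE evv (pt kk \<cdot> x) = IF0 K \<cdot> pr2 V (Dom V x) (IOb II)" (is "PROP ?gd")
    "Cod V x = \<one> \<Longrightarrow> eva II EE evv (pt kk \<cdot> x) = IF1 K \<cdot> pr2 V (Dom V x) (IAr II)" (is "PROP ?ge")
proof -
  note [simp] = OB DD K assms pt_kk
  show "PROP ?ga"
    "PROP ?gc"
    by (simp_all add: ed evl_cone_diag)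
  have e: "iid EE \<cdot> (IF0 DD \<cdot> (x \<cdot> pr1 V (Dom V x) (IAr II))) = IF1 DD \<cdot> (iid CC \<cdot> (x \<cdot> pr1 V (Dom V x) (IAr II)))" if "Cod V x = IOb CC"
    using that by simp
  show "PROP ?gb"
    by (simp add: ed e evl_cone_diag del: ifun_comp_simps(3))
  have b: "x \<cdot> pr1 V (Dom V x) (IOb II) = bang V (prd V (Dom V x) (IOb II))" "x \<cdot> pr1 V (Dom V x) (IAr II) = bang V (prd V (Dom V x) (IAr II))" if "Cod V x = \<one>"
    using that by (simp_all add: eq_bang)
  show "PROP ?gd"
    "PROP ?ge"
    using evl_cone_name(1)[of "pr2 V (Dom V x) (IOb II)"] evl_cone_name(2)[of "pr2 V (Dom V x) (IAr II)"]
    by (simp_all add: ed b)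
qed

lemma evt_comp:
  assumes "M \<in> Arr V" "Cod V M = IAr EE" "h \<in> Arr V" "Cod V h = Dom V M"
  shows "evt II EE evv (M \<cdot> h) = evt II EE evv M \<cdot> pair V (h \<cdot> pr1 V (Dom V h) (IOb II)) (pr2 V (Dom V h) (IOb II))"
  using assms OB by (simp add: evs) (simp add: ed)

text \<open>An internal cone over \<open>K\<close> with vertex the generalized object \<open>a\<close>.\<close>

definition cone_fam :: "'o \<Rightarrow> 'm \<Rightarrow> 'm \<Rightarrow> bool" where
  "cone_fam X a \<gamma> \<longleftrightarrow> a \<in> Hom V X (IOb CC) \<and>
     nfam II CC X (a \<cdot> pr1 V X (IOb II)) (iid CC \<cdot> (a \<cdot> pr1 V X (IAr II))) (IF0 K \<cdot> pr2 V X (IOb II)) (IF1 K \<cdot> pr2 V X (IAr II)) \<gamma>"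

lemma cone_fam_kap:
  assumes "q \<in> Arr V" "Cod V q = IOb CQ"
  shows "cone_fam (Dom V q) (IF0 CP \<cdot> q) (evt II EE evv (kp q))"
proof -
  note [simp] = OB DD K assms pt_kk cH[simplified] ks(1-5)[OF assms]
  show ?thesis
    using nfam_ev[OF OB(1,2) pex(1-4), of "kp q"] cone_ev(1,2)[of "IF0 CP \<cdot> q"] cone_ev(4,5)[of "bang V (Dom V q)"]
    by (simp add: cone_fam_def)
qed

lemma cone_fam_ex:
  assumes "cone_fam X a \<gamma>"
  shows "\<exists>q. q \<in> Hom V X (IOb CQ) \<and> IF0 CP \<cdot> q = a \<and> evt II EE evv (kp q) = \<gamma>"
proof -
  have a [simp]: "a \<in> Arr V" "Dom V a = X" "Cod V a = IOb CC" "X \<in> Obj V" using assms by (auto simp: cone_fam_def)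
  note [simp] = OB DD K pt_kk
  have "\<exists>M. M \<in> Hom V (Dom V (IF0 DD \<cdot> a)) (IAr EE) \<and> isrc EE \<cdot> M = IF0 DD \<cdot> a \<and> itgt EE \<cdot> M = pt kk \<cdot> bang V X \<and> evt II EE evv M = \<gamma>"
    by (rule pex(7)) (use assms cone_ev(1,2)[of a] cone_ev(4,5)[of "bang V X"] in \<open>simp_all add: cone_fam_def\<close>)
  then obtain M where M: "M \<in> Arr V" "Dom V M = X" "Cod V M = IAr EE" "isrc EE \<cdot> M = IF0 DD \<cdot> a" "itgt EE \<cdot> M = pt kk \<cdot> bang V X" "evt II EE evv M = \<gamma>"
    by auto
  have "\<exists>q. q \<in> Hom V (Dom V M) (IOb CQ) \<and> IF0 CP \<cdot> q = a \<and> kp q = M"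
    by (rule ce) (use M in simp_all)
  then show ?thesis using M by auto
qed

lemma cone_fam_restrict:
  assumes c: "cone_fam X a \<gamma>" and h: "h \<in> Hom V Y X"
  shows "cone_fam Y (a \<cdot> h) (\<gamma> \<cdot> pair V (h \<cdot> pr1 V Y (IOb II)) (pr2 V Y (IOb II)))"
proof -
  obtain q where q: "q \<in> Hom V X (IOb CQ)" "IF0 CP \<cdot> q = a" "evt II EE evv (kp q) = \<gamma>"
    using cone_fam_ex[OF c] by blast
  note [simp] = OB DD cH[simplified] h[simplified] q(1)[simplified] ks(1-3)[of q]
  have "kp (q \<cdot> h) = kp q \<cdot> h" using ks(6)[of q h] by simp
  moreover have "IF0 CP \<cdot> (q \<cdot> h) = a \<cdot> h" using reassoc[OF q(2), of h] by simp
  ultimately show ?thesis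
    using cone_fam_kap[of "q \<cdot> h"] evt_comp[of "kp q" h] q(3) by simp
qed

lemma evt_kap_inject:
  assumes "q \<in> Arr V" "q' \<in> Arr V" "Dom V q = Dom V q'" "Cod V q = IOb CQ" "Cod V q' = IOb CQ" "IF0 CP \<cdot> q = IF0 CP \<cdot> q'"
    and M: "evt II EE evv (kp q) = evt II EE evv (kp q')"
  shows "q = q'"
proof (rule ceq)
  show "kp q = kp q'"
    by (rule pex(8)) (use assms ks(1-5)[of q] ks(1-5)[of q'] in simp_all)
qed (use assms in simp_all)

text \<open>The underlying map consists of the components of the transformation that corresponds to the arrow of \<open>[I, A]\<close> named by \<open>N\<close>.\<close>

lemma nat_underlying_eq:
  assumes N: "N \<in> Arr W" "Dom W N = \<one>\<^sub>W" "Cod W N = expo W T2 EE"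
  shows "nat_underlying V II CC N = evt II EE evv (ar EE (pt N)) \<cdot> pair V (bang V (IOb II)) (Ident V (IOb II))"
proof -
  note [simp] = OB N pt[OF N(1,2)]
  note T2 [simp] = Intl_Obj[OF small_vcat_two] 
  note a01 [simp] = inc_simps[OF small_vcat_two, simplified]
  let ?a = "inc1 V two False True \<cdot> bang V (IOb II)"
  have m: "(THE m. m \<in> Hom V (IOb II) (IAr (prd W T2 II)) \<and> IF1 (pr1 W T2 II) \<cdot> m = ?a \<and> IF1 (pr2 W T2 II) \<cdot> m = iid II) = ip1 T2 II ?a (iid II)"
  proof (rule the_equality)
    fix m assume "m \<in> Hom V (IOb II) (IAr (prd W T2 II)) \<and> IF1 (pr1 W T2 II) \<cdot> m = ?a \<and> IF1 (pr2 W T2 II) \<cdot> m = iid II"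
    then show "m = ip1 T2 II ?a (iid II)" by - (rule ip1_ext[where A = T2 and B = II], simp_all)
  qed simp
  have c: "IF1 (const_at W T2 N) \<cdot> ?a = iid (expo W T2 EE) \<cdot> (pt N \<cdot> bang V (IOb II))"
    using IF_const_at(2)[of N T2 ?a] by simp
  have [simp]: "const_at W T2 N \<in> Arr W" "Dom W (const_at W T2 N) = T2" "Cod W (const_at W T2 N) = expo W T2 EE" by (simp_all add: const_at_def)
  show ?thesis
    unfolding nat_underlying_def nat_uncurry_def Let_def Two_def const_at_def[of V] m
    by (simp add: prod_map_def c evs ar_def[OF OB(3)])
qed

text \<open>This makes the definite description \<open>cone_elem\<close> meaningful and computes the internal cone that it gives.\<close>

lemma cone_elem_unique:
  assumes L: "L \<in> Hom V \<one> (IOb CC)" and l: "l \<in> Hom V (IOb II) (IAr CC)" and fam: "cone_fam \<one> L (l \<cdot> pr2 V \<one> (IOb II))"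
  shows "\<exists>!e. e \<in> Hom W \<one>\<^sub>W CQ \<and> CP \<cdot>\<^sub>W e = el CC L \<and> nat_underlying V II CC (CR \<cdot>\<^sub>W e) = l" (is ?ga)
    and "\<lbrakk>e \<in> Hom W \<one>\<^sub>W CQ; CP \<cdot>\<^sub>W e = el CC L; nat_underlying V II CC (CR \<cdot>\<^sub>W e) = l\<rbrakk> \<Longrightarrow>
      IF0 CP \<cdot> pt e = L \<and> evt II EE evv (kp (pt e)) = l \<cdot> pr2 V \<one> (IOb II)" (is "PROP ?gb")
proof -
  note [simp] = OB K DD L[simplified] l[simplified] cH[simplified] pt
  note elL = el[OF OB(2) L]
  have data: "(CP \<cdot>\<^sub>W e = el CC L \<and> nat_underlying V II CC (CR \<cdot>\<^sub>W e) = l) \<longleftrightarrow>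
      IF0 CP \<cdot> pt e = L \<and> evt II EE evv (kp (pt e)) = l \<cdot> pr2 V \<one> (IOb II)"
    if e: "e \<in> Hom W \<one>\<^sub>W CQ" for e
  proof -
    note [simp] = e[simplified] ks(1-5)[of "pt e"]
    have p: "CP \<cdot>\<^sub>W e = el CC L \<longleftrightarrow> IF0 CP \<cdot> pt e = L"
    proof
      assume "CP \<cdot>\<^sub>W e = el CC L"
      from arg_cong[OF this, of pt] show "IF0 CP \<cdot> pt e = L" using elL by simp
    next
      assume "IF0 CP \<cdot> pt e = L"
      then show "CP \<cdot>\<^sub>W e = el CC L" by - (rule elem_eqI[of _ CC], use elL in simp_all)
    qed
    have u: "nat_underlying V II CC (CR \<cdot>\<^sub>W e) = evt II EE evv (kp (pt e)) \<cdot> pair V (bang V (IOb II)) (Ident V (IOb II))"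
      using nat_underlying_eq[of "CR \<cdot>\<^sub>W e"] by (simp add: kap_def[OF DD kk, folded cones_def])
    have h: "h \<cdot> pair V (bang V (IOb II)) (Ident V (IOb II)) = l \<longleftrightarrow> h = l \<cdot> pr2 V \<one> (IOb II)"
      if h: "h \<in> Hom V (prd V \<one> (IOb II)) (IAr CC)" for h
    proof
      assume "h \<cdot> pair V (bang V (IOb II)) (Ident V (IOb II)) = l"
      from arg_cong[OF this, of "\<lambda>l. l \<cdot> pr2 V \<one> (IOb II)"]
      have "h \<cdot> pair V (bang V (prd V \<one> (IOb II))) (pr2 V \<one> (IOb II)) = l \<cdot> pr2 V \<one> (IOb II)"
        using h by simp
      moreover have "bang V (prd V \<one> (IOb II)) = pr1 V \<one> (IOb II)" by (rule eq_bang[symmetric]) simp_all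
      ultimately show "h = l \<cdot> pr2 V \<one> (IOb II)" using h by simp
    qed (use h in simp)
    have "evt II EE evv (kp (pt e)) \<in> Hom V (prd V \<one> (IOb II)) (IAr CC)" by (simp add: evs)
    from h[OF this] show ?thesis unfolding p u by blast
  qed
  show "PROP ?gb"
    using data by blast
  obtain q where q: "q \<in> Hom V \<one> (IOb CQ)" "IF0 CP \<cdot> q = L" "evt II EE evv (kp q) = l \<cdot> pr2 V \<one> (IOb II)"
    using cone_fam_ex[OF fam] by blast
  note elq = el[OF cH(1) q(1)]
  show ?ga
  proof (rule ex1I)
    show "el CQ q \<in> Hom W \<one>\<^sub>W CQ \<and> CP \<cdot>\<^sub>W el CQ q = el CC L \<and> nat_underlying V II CC (CR \<cdot>\<^sub>W el CQ q) = l"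
      using data[OF elq(1)] elq q by auto
    fix e assume e: "e \<in> Hom W \<one>\<^sub>W CQ \<and> CP \<cdot>\<^sub>W e = el CC L \<and> nat_underlying V II CC (CR \<cdot>\<^sub>W e) = l"
    have "pt e = q"
      by (rule evt_kap_inject) (use e data[OF conjunct1[OF e]] q in simp_all)
    then show "e = el CQ q" using e elq by - (rule elem_eqI[of _ CQ], simp_all)
  qed
qed

text \<open>
  The generalized objects of \<open>\<Delta> \<down> K\<close> are the internal cones. An arrow \<open>f\<close> between vertices is a morphism of cones if the
  triangle in the exponential commutes, which is tested by evaluation.
\<close>

lemma cones_terminal_iff:
  assumes L: "L \<in> Hom V \<one> (IOb CC)" and l: "l \<in> Hom V (IOb II) (IAr CC)"
    and e: "e \<in> Hom W \<one>\<^sub>W CQ" "IF0 CP \<cdot> pt e = L" "evt II EE evv (kp (pt e)) = l \<cdot> pr2 V \<one> (IOb II)"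
  shows "internal_terminal V CQ e \<longleftrightarrow> (\<forall>X a \<gamma>. cone_fam X a \<gamma> \<longrightarrow>
    (\<exists>!f. f \<in> Hom V X (IAr CC) \<and> isrc CC \<cdot> f = a \<and> itgt CC \<cdot> f = L \<cdot> bang V X \<and>
      igcmp V CC (f \<cdot> pr1 V X (IOb II)) (l \<cdot> pr2 V X (IOb II)) = \<gamma>))"
proof -
  note [simp] = OB K DD L[simplified] l[simplified] cH[simplified] pt e(1)[simplified]
  let ?Q = "\<lambda>X a \<gamma> f. f \<in> Hom V X (IAr CC) \<and> isrc CC \<cdot> f = a \<and> itgt CC \<cdot> f = L \<cdot> bang V X \<and>
      igcmp V CC (f \<cdot> pr1 V X (IOb II)) (l \<cdot> pr2 V X (IOb II)) = \<gamma>"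
  have eL: "IF0 CP \<cdot> (pt e \<cdot> x) = L \<cdot> x" if "x \<in> Arr V" "Cod V x = \<one>" for x
    using reassoc[OF e(2), of x] that by simp
  have step: "(\<exists>!r. r \<in> Hom V (Dom V q) (IAr CQ) \<and> isrc CQ \<cdot> r = q \<and> itgt CQ \<cdot> r = pt e \<cdot> bang V (Dom V q)) \<longleftrightarrow>
      (\<exists>!f. ?Q (Dom V q) (IF0 CP \<cdot> q) (evt II EE evv (kp q)) f)"
    if q [simp]: "q \<in> Arr V" "Cod V q = IOb CQ" for q
  proof -
    let ?X = "Dom V q" and ?q' = "pt e \<cdot> bang V (Dom V q)"
    note k = ks(1-5)[OF q] and k' = ks(1-5)[of ?q']
    have kq': "kp ?q' = kp (pt e) \<cdot> bang V ?X" using ks(6)[of "pt e" "bang V ?X"] by simp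
    have ev': "evt II EE evv (kp ?q') = l \<cdot> pr2 V ?X (IOb II)"
      unfolding kq' by (subst evt_comp) (simp_all add: e(3) ks(1-5)[of "pt e"])
    have sq: "igcmp V EE (IF1 DD \<cdot> f) (kp ?q') = kp q \<longleftrightarrow>
        igcmp V CC (f \<cdot> pr1 V ?X (IOb II)) (l \<cdot> pr2 V ?X (IOb II)) = evt II EE evv (kp q)"
      if f: "f \<in> Hom V ?X (IAr CC)" "isrc CC \<cdot> f = IF0 CP \<cdot> q" "itgt CC \<cdot> f = IF0 CP \<cdot> ?q'" for f
    proof -
      note [simp] = f[simplified] k k'
      have E: "evt II EE evv (igcmp V EE (IF1 DD \<cdot> f) (kp ?q')) = igcmp V CC (f \<cdot> pr1 V ?X (IOb II)) (l \<cdot> pr2 V ?X (IOb II))"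
        using evt_igcmp[OF OB(1,2) pex(1-4), of "IF1 DD \<cdot> f" "kp ?q'"] cone_ev(3)[of f] ev' by simp
      have "igcmp V EE (IF1 DD \<cdot> f) (kp ?q') = kp q" if "evt II EE evv (igcmp V EE (IF1 DD \<cdot> f) (kp ?q')) = evt II EE evv (kp q)"
        by (rule pex(8)[OF _ _ _ _ _ _ _ that]) simp_all
      then show ?thesis using E by metis
    qed
    show ?thesis
    proof (rule Ex1_bij[where g = "\<lambda>r. IF1 CP \<cdot> r"])
      fix r assume r: "r \<in> Hom V ?X (IAr CQ) \<and> isrc CQ \<cdot> r = q \<and> itgt CQ \<cdot> r = ?q'"
      then have f: "IF1 CP \<cdot> r \<in> Hom V ?X (IAr CC)" "isrc CC \<cdot> (IF1 CP \<cdot> r) = IF0 CP \<cdot> q" "itgt CC \<cdot> (IF1 CP \<cdot> r) = IF0 CP \<cdot> ?q'"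
        by simp_all
      have "igcmp V EE (IF1 DD \<cdot> (IF1 CP \<cdot> r)) (kp ?q') = kp q"
        using comma_arr_square[OF DD kk, folded cones_def, of r] r by simp
      then show "?Q ?X (IF0 CP \<cdot> q) (evt II EE evv (kp q)) (IF1 CP \<cdot> r)"
        using f sq[OF f] by (simp add: eL)
    next
      fix f assume f: "?Q ?X (IF0 CP \<cdot> q) (evt II EE evv (kp q)) f"
      then have f': "f \<in> Hom V ?X (IAr CC)" "isrc CC \<cdot> f = IF0 CP \<cdot> q" "itgt CC \<cdot> f = IF0 CP \<cdot> ?q'"
        by (simp_all add: eL)
      have "igcmp V EE (IF1 DD \<cdot> f) (kp ?q') = kp q" using sq[OF f'] f by blast
      from comma_arr_ex[OF DD kk, folded cones_def, OF _ _ _ _ _ f' this]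
      show "\<exists>r. (r \<in> Hom V ?X (IAr CQ) \<and> isrc CQ \<cdot> r = q \<and> itgt CQ \<cdot> r = ?q') \<and> IF1 CP \<cdot> r = f"
        by auto
    next
      fix r r' assume "r \<in> Hom V ?X (IAr CQ) \<and> isrc CQ \<cdot> r = q \<and> itgt CQ \<cdot> r = ?q'" "r' \<in> Hom V ?X (IAr CQ) \<and> isrc CQ \<cdot> r' = q \<and> itgt CQ \<cdot> r' = ?q'"
        "IF1 CP \<cdot> r = IF1 CP \<cdot> r'"
      then show "r = r'" by - (rule comma_arr_eq[OF DD kk, folded cones_def], simp_all)
    qed
  qed
  have "internal_terminal V CQ e \<longleftrightarrow> (\<forall>q. q \<in> Arr V \<longrightarrow> Cod V q = IOb CQ \<longrightarrow> (\<exists>!f. ?Q (Dom V q) (IF0 CP \<cdot> q) (evt II EE evv (kp q)) f))"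
    unfolding internal_terminal_iff[OF cH(1) e(1)] by (intro all_cong1 imp_cong refl) (rule step)
  also have "\<dots> \<longleftrightarrow> (\<forall>X a \<gamma>. cone_fam X a \<gamma> \<longrightarrow> (\<exists>!f. ?Q X a \<gamma> f))"
  proof (intro iffI allI impI)
    fix X a \<gamma> assume all: "\<forall>q. q \<in> Arr V \<longrightarrow> Cod V q = IOb CQ \<longrightarrow> (\<exists>!f. ?Q (Dom V q) (IF0 CP \<cdot> q) (evt II EE evv (kp q)) f)" and "cone_fam X a \<gamma>"
    from cone_fam_ex[OF this(2)] obtain q where q: "q \<in> Hom V X (IOb CQ)" "IF0 CP \<cdot> q = a" "evt II EE evv (kp q) = \<gamma>" by blast
    then have "q \<in> Arr V" "Cod V q = IOb CQ" "Dom V q = X" by simp_all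
    then show "\<exists>!f. ?Q X a \<gamma> f" using all[rule_format, of q] q(2,3) by simp
  next
    fix q assume all: "\<forall>X a \<gamma>. cone_fam X a \<gamma> \<longrightarrow> (\<exists>!f. ?Q X a \<gamma> f)" and q: "q \<in> Arr V" "Cod V q = IOb CQ"
    show "\<exists>!f. ?Q (Dom V q) (IF0 CP \<cdot> q) (evt II EE evv (kp q)) f"
      by (rule all[rule_format, OF cone_fam_kap[OF q]])
  qed
  finally show ?thesis .
qed

end

end

section \<open>Wedges and ends\<close>

context extensive_ccc
begin

lemma vfunctorD:
  assumes "vfunctor V I C F" "i \<in> VObj I"
  shows "VFOb F i \<in> VObj C"
    "j \<in> VObj I \<Longrightarrow> VFHom F i j \<in> Arr V" (is "PROP ?ga") "j \<in> VObj I \<Longrightarrow> Dom V (VFHom F i j) = VHom I i j" (is "PROP ?gb")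
    "j \<in> VObj I \<Longrightarrow> Cod V (VFHom F i j) = VHom C (VFOb F i) (VFOb F j)" (is "PROP ?gc")
proof -
  show "VFOb F i \<in> VObj C" using assms unfolding vfunctor_def by blast
  have "VFHom F i j \<in> Hom V (VHom I i j) (VHom C (VFOb F i) (VFOb F j))" if "j \<in> VObj I"
    using assms that unfolding vfunctor_def by blast
  then show "PROP ?ga" "PROP ?gb"
    "PROP ?gc" by simp_all
qed

lemma ffam_const:
  assumes "K \<in> Arr W" "Dom W K = A" "Cod W K = B" "X \<in> Obj V"
  shows "ffam A B X (IF0 K \<cdot> pr2 V X (IOb A)) (IF1 K \<cdot> pr2 V X (IAr A))"
proof -
  note [simp] = assms
  have "A \<in> Obj W" "B \<in> Obj W" using W.Dom_Obj[OF assms(1)] W.Cod_Obj[OF assms(1)] by simp_all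
  then show ?thesis by - (rule ffamI, simp_all)
qed

context
  fixes I :: "('x, 'o, 'm) vcat" and C :: "('y, 'o, 'm) vcat"
  assumes I: "small_vcat I" and C: "small_vcat C"
begin

private lemmas wedge_simps = VHom_Obj[OF I] VHom_Obj[OF C] VId_simps[OF C] inc_simps[OF I] inc_simps[OF C] Intl_sel[OF I] Intl_sel[OF C]
    Intl_st[OF I] Intl_st[OF C] Intl_st_comp[OF I] Intl_st_comp[OF C] Intl_id(1-3)[OF I] Intl_id(1-3)[OF C] Intl_igcmp[OF C]
    vcmp_simps[OF C] vcmp_unit[OF C] Intl_Obj[OF I] Intl_Obj[OF C] VComp_simps[OF C]

private abbreviation "II \<equiv> Intl V I"
private abbreviation "CC \<equiv> Intl V C"
private abbreviation "KF \<equiv> Int_fun V I C"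

text \<open>
  The families \<open>\<alpha>\<close> of internal natural transformations between the internalizations of \<open>F\<close> and \<open>F'\<close>, and
  the relation between such a family and its components.
\<close>

abbreviation int_nat :: "('x, 'y, 'm) vfun \<Rightarrow> ('x, 'y, 'm) vfun \<Rightarrow> 'o \<Rightarrow> 'm \<Rightarrow> bool" where
  "int_nat F F' X \<alpha> \<equiv> nfam II CC X (IF0 (KF F) \<cdot> pr2 V X (Int_ob V I)) (IF1 (KF F) \<cdot> pr2 V X (Int_ar V I))
     (IF0 (KF F') \<cdot> pr2 V X (Int_ob V I)) (IF1 (KF F') \<cdot> pr2 V X (Int_ar V I)) \<alpha>"

definition components :: "('x, 'y, 'm) vfun \<Rightarrow> ('x, 'y, 'm) vfun \<Rightarrow> 'o \<Rightarrow> 'm \<Rightarrow> ('x \<Rightarrow> 'm) \<Rightarrow> bool" where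
  "components F F' X \<alpha> w \<longleftrightarrow> \<alpha> \<in> Hom V (prd V X (Int_ob V I)) (Int_ar V C) \<and>
     (\<forall>i\<in>VObj I. w i \<in> Hom V X (VHom C (VFOb F i) (VFOb F' i)) \<and>
       (\<forall>x. x \<in> Arr V \<longrightarrow> Cod V x = X \<longrightarrow>
         \<alpha> \<cdot> pair V x (inc0 V I i \<cdot> bang V (Dom V x)) = inc1 V C (VFOb F i) (VFOb F' i) \<cdot> (w i \<cdot> x)))"

lemma componentsD:
  assumes "components F F' X \<alpha> w"
  shows "\<alpha> \<in> Arr V" "Dom V \<alpha> = prd V X (Int_ob V I)" "Cod V \<alpha> = Int_ar V C"
    "i \<in> VObj I \<Longrightarrow> w i \<in> Arr V" "i \<in> VObj I \<Longrightarrow> Dom V (w i) = X" "i \<in> VObj I \<Longrightarrow> Cod V (w i) = VHom C (VFOb F i) (VFOb F' i)"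
    "\<lbrakk>i \<in> VObj I; x \<in> Arr V; Cod V x = X; Dom V x = Y\<rbrakk> \<Longrightarrow>
       \<alpha> \<cdot> pair V x (inc0 V I i \<cdot> bang V Y) = inc1 V C (VFOb F i) (VFOb F' i) \<cdot> (w i \<cdot> x)"
  using assms unfolding components_def by auto

lemma Int_fun_comp:
  assumes "vfunctor V I C F" "i \<in> VObj I" "x \<in> Arr V"
  shows "Cod V x = \<one> \<Longrightarrow> IF0 (KF F) \<cdot> (inc0 V I i \<cdot> x) = inc0 V C (VFOb F i) \<cdot> x" (is "PROP ?ga")
    "j \<in> VObj I \<Longrightarrow> Cod V x = VHom I i j \<Longrightarrow> IF1 (KF F) \<cdot> (inc1 V I i j \<cdot> x) = inc1 V C (VFOb F i) (VFOb F j) \<cdot> (VFHom F i j \<cdot> x)" (is "PROP ?gb")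
proof -
  note [simp] = wedge_simps assms vfunctorD[OF assms(1)]
  note K = Int_fun[OF I C assms(1)]
  note [simp] = K(1)[simplified]
  show "PROP ?ga"
    using reassoc[OF K(2)[OF assms(2)], of x] by simp
  show "PROP ?gb"
    using reassoc[OF K(3)[OF assms(2)], of j x] by simp
qed

context
  fixes F F' assumes F: "vfunctor V I C F" and F': "vfunctor V I C F'"
begin

private lemmas FF = wedge_simps vfunctorD[OF F] vfunctorD[OF F'] Int_fun(1)[OF I C F, simplified] Int_fun(1)[OF I C F', simplified] Int_fun_comp[OF F] Int_fun_comp[OF F']

lemma is_wedge_iff:
  "is_wedge V I C F F' X w \<longleftrightarrow> X \<in> Obj V \<and> (\<forall>i\<in>VObj I. w i \<in> Hom V X (VHom C (VFOb F i) (VFOb F' i))) \<and>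
     (\<forall>i\<in>VObj I. \<forall>j\<in>VObj I. \<forall>x u. x \<in> Arr V \<longrightarrow> u \<in> Arr V \<longrightarrow> Dom V x = Dom V u \<longrightarrow> Cod V x = X \<longrightarrow> Cod V u = VHom I i j \<longrightarrow>
        vcmp V C (VFOb F i) (VFOb F' i) (VFOb F' j) (VFHom F' i j \<cdot> u) (w i \<cdot> x) =
        vcmp V C (VFOb F i) (VFOb F j) (VFOb F' j) (w j \<cdot> x) (VFHom F i j \<cdot> u))" (is "_ \<longleftrightarrow> _ \<and> ?T \<and> ?N")
proof -
  note [simp] = FF
  let ?e = "\<lambda>i j. vcmp V C (VFOb F i) (VFOb F' i) (VFOb F' j) (VFHom F' i j \<cdot> pr2 V X (VHom I i j)) (w i \<cdot> pr1 V X (VHom I i j)) =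
    vcmp V C (VFOb F i) (VFOb F j) (VFOb F' j) (w j \<cdot> pr1 V X (VHom I i j)) (VFHom F i j \<cdot> pr2 V X (VHom I i j))"
  have "?N \<longleftrightarrow> (\<forall>i\<in>VObj I. \<forall>j\<in>VObj I. ?e i j)" if X [simp]: "X \<in> Obj V" and T: ?T
  proof (intro iffI ballI allI impI)
    fix i j assume "?N" "i \<in> VObj I" "j \<in> VObj I"
    then show "?e i j" by simp
  next
    fix i j x u assume e: "\<forall>i\<in>VObj I. \<forall>j\<in>VObj I. ?e i j" and ij: "i \<in> VObj I" "j \<in> VObj I"
      and xu: "x \<in> Arr V" "u \<in> Arr V" "Dom V x = Dom V u" "Cod V x = X" "Cod V u = VHom I i j"
    have "?e i j" using e ij by blast
    from arg_cong[OF this, of "\<lambda>h. h \<cdot> pair V x u"]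
    show "vcmp V C (VFOb F i) (VFOb F' i) (VFOb F' j) (VFHom F' i j \<cdot> u) (w i \<cdot> x) =
        vcmp V C (VFOb F i) (VFOb F j) (VFOb F' j) (w j \<cdot> x) (VFHom F i j \<cdot> u)"
      using ij xu T by simp
  qed
  then show ?thesis unfolding is_wedge_def Let_def by blast
qed

text \<open>
  Naturality is an equation between morphisms out of \<open>X \<times> (Int I)\<^sub>1\<close>; on the summand \<open>X \<times> I(i, j)\<close> it is the wedge
  condition, as inclusions of hom-objects are monic.
\<close>

lemma wedge_iff_int_nat:
  assumes c: "components F F' X \<alpha> w" and X: "X \<in> Obj V"
  shows "is_wedge V I C F F' X w \<longleftrightarrow> int_nat F F' X \<alpha>"
proof -
  note [simp] = FF X componentsD[OF c]
  have fF: "ffam II CC X (IF0 (KF F) \<cdot> pr2 V X (Int_ob V I)) (IF1 (KF F) \<cdot> pr2 V X (Int_ar V I))"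
    and fF': "ffam II CC X (IF0 (KF F') \<cdot> pr2 V X (Int_ob V I)) (IF1 (KF F') \<cdot> pr2 V X (Int_ar V I))"
    using ffam_const[of "KF F" II CC X] ffam_const[of "KF F'" II CC X] by simp_all
  show ?thesis
  proof
    assume w: "is_wedge V I C F F' X w"
    have s: "isrc CC \<cdot> \<alpha> = IF0 (KF F) \<cdot> pr2 V X (Int_ob V I)" "itgt CC \<cdot> \<alpha> = IF0 (KF F') \<cdot> pr2 V X (Int_ob V I)"
      by (rule prd_Int_ob_ext[OF I X]; simp)+
    have sp: "isrc CC \<cdot> (\<alpha> \<cdot> x) = IF0 (KF F) \<cdot> (pr2 V X (Int_ob V I) \<cdot> x)" "itgt CC \<cdot> (\<alpha> \<cdot> x) = IF0 (KF F') \<cdot> (pr2 V X (Int_ob V I) \<cdot> x)"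
      if "x \<in> Arr V" "Cod V x = prd V X (Int_ob V I)" for x
      using reassoc[OF s(1), of x] reassoc[OF s(2), of x] that by simp_all
    have "igcmp V CC (IF1 (KF F) \<cdot> pr2 V X (IAr II)) (\<alpha> \<cdot> pair V (pr1 V X (IAr II)) (itgt II \<cdot> pr2 V X (IAr II))) =
        igcmp V CC (\<alpha> \<cdot> pair V (pr1 V X (IAr II)) (isrc II \<cdot> pr2 V X (IAr II))) (IF1 (KF F') \<cdot> pr2 V X (IAr II))"
    proof (rule prd_Int_ar_ext[OF I X])
      fix i j y u assume "i \<in> VObj I" "j \<in> VObj I" "y \<in> Arr V" "Cod V y = X" "u \<in> Arr V" "Dom V u = Dom V y" "Cod V u = VHom I i j"
      then show "igcmp V CC (IF1 (KF F) \<cdot> pr2 V X (IAr II)) (\<alpha> \<cdot> pair V (pr1 V X (IAr II)) (itgt II \<cdot> pr2 V X (IAr II))) \<cdot> pair V y (inc1 V I i j \<cdot> u) =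
        igcmp V CC (\<alpha> \<cdot> pair V (pr1 V X (IAr II)) (isrc II \<cdot> pr2 V X (IAr II))) (IF1 (KF F') \<cdot> pr2 V X (IAr II)) \<cdot> pair V y (inc1 V I i j \<cdot> u)"
        using w unfolding is_wedge_iff by (simp add: sp)
    qed (simp_all add: sp)
    then show "int_nat F F' X \<alpha>" by (simp add: nfam_def s)
  next
    assume n: "int_nat F F' X \<alpha>"
    have "vcmp V C (VFOb F i) (VFOb F' i) (VFOb F' j) (VFHom F' i j \<cdot> u) (w i \<cdot> x) =
        vcmp V C (VFOb F i) (VFOb F j) (VFOb F' j) (w j \<cdot> x) (VFHom F i j \<cdot> u)"
      if a: "i \<in> VObj I" "j \<in> VObj I" "x \<in> Arr V" "u \<in> Arr V" "Dom V x = Dom V u" "Cod V x = X" "Cod V u = VHom I i j" for i j x u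
      by (rule inc1_mono[OF C, of "VFOb F i" "VFOb F' j", symmetric])
        (use a nfam_elem(3)[OF Intl_Obj[OF I] Intl_Obj[OF C] fF fF' n, of x "inc1 V I i j \<cdot> u"] in simp_all)
    then show "is_wedge V I C F F' X w" unfolding is_wedge_iff by auto
  qed
qed

lemma components_ex:
  assumes [simp]: "X \<in> Obj V" and w: "\<And>i. i \<in> VObj I \<Longrightarrow> w i \<in> Hom V X (VHom C (VFOb F i) (VFOb F' i))"
  shows "\<exists>\<alpha>. components F F' X \<alpha> w"
proof -
  note [simp] = FF
  have [simp]: "w i \<in> Arr V" "Dom V (w i) = X" "Cod V (w i) = VHom C (VFOb F i) (VFOb F' i)" if "i \<in> VObj I" for i
    using w[OF that] by simp_all
  obtain \<alpha> where "\<alpha> \<in> Hom V (prd V X (Int_ob V I)) (Int_ar V C)"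
    "\<forall>i\<in>VObj I. \<forall>x. x \<in> Arr V \<longrightarrow> Cod V x = X \<longrightarrow>
      \<alpha> \<cdot> pair V x (inc0 V I i \<cdot> bang V (Dom V x)) = (inc1 V C (VFOb F i) (VFOb F' i) \<cdot> w i) \<cdot> x"
    using prd_Int_ob_ex[OF I assms(1), of "Int_ar V C" "\<lambda>i. inc1 V C (VFOb F i) (VFOb F' i) \<cdot> w i"] by auto
  then show ?thesis unfolding components_def by auto
qed

text \<open>The restriction of \<open>\<alpha>\<close> to an object \<open>i\<close> has constant ends, so it factors through one hom-object.\<close>

lemma int_nat_components:
  assumes n: "int_nat F F' X \<alpha>" and [simp]: "X \<in> Obj V"
  shows "\<exists>w. components F F' X \<alpha> w"
proof -
  note [simp] = FF nfamD(1-3)[OF Intl_Obj[OF I] Intl_Obj[OF C] n, simplified]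
  have fF: "ffam II CC X (IF0 (KF F) \<cdot> pr2 V X (Int_ob V I)) (IF1 (KF F) \<cdot> pr2 V X (Int_ar V I))"
    and fF': "ffam II CC X (IF0 (KF F') \<cdot> pr2 V X (Int_ob V I)) (IF1 (KF F') \<cdot> pr2 V X (Int_ar V I))"
    using ffam_const[of "KF F" II CC X] ffam_const[of "KF F'" II CC X] by simp_all
  have "\<exists>w. w \<in> Hom V X (VHom C (VFOb F i) (VFOb F' i)) \<and>
      \<alpha> \<cdot> pair V (Ident V X) (inc0 V I i \<cdot> bang V X) = inc1 V C (VFOb F i) (VFOb F' i) \<cdot> w" if i [simp]: "i \<in> VObj I" for i
  proof -
    define f where "f = \<alpha> \<cdot> pair V (Ident V X) (inc0 V I i \<cdot> bang V X)"
    have f: "f \<in> Arr V" "Cod V f = Int_ar V C" "isrc CC \<cdot> f = inc0 V C (VFOb F i) \<cdot> bang V (Dom V f)" "itgt CC \<cdot> f = inc0 V C (VFOb F' i) \<cdot> bang V (Dom V f)" "Dom V f = X"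
      using nfam_elem(1,2)[OF Intl_Obj[OF I] Intl_Obj[OF C] fF fF' n, of "Ident V X" "inc0 V I i \<cdot> bang V X"] by (simp_all add: f_def)
    obtain w where "w \<in> Arr V" "Dom V w = Dom V f" "Cod V w = VHom C (VFOb F i) (VFOb F' i)" "f = inc1 V C (VFOb F i) (VFOb F' i) \<cdot> w"
      by (rule hom_factor[OF C f(1,2) vfunctorD(1)[OF F i] vfunctorD(1)[OF F' i] f(3,4)]) blast
    then show ?thesis using f(5) unfolding f_def[symmetric] by auto
  qed
  then obtain w where w: "\<And>i. i \<in> VObj I \<Longrightarrow> w i \<in> Hom V X (VHom C (VFOb F i) (VFOb F' i))"
    "\<And>i. i \<in> VObj I \<Longrightarrow> \<alpha> \<cdot> pair V (Ident V X) (inc0 V I i \<cdot> bang V X) = inc1 V C (VFOb F i) (VFOb F' i) \<cdot> w i"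
    by metis
  have "\<alpha> \<cdot> pair V x (inc0 V I i \<cdot> bang V (Dom V x)) = inc1 V C (VFOb F i) (VFOb F' i) \<cdot> (w i \<cdot> x)"
    if "i \<in> VObj I" "x \<in> Arr V" "Cod V x = X" for i x
    using arg_cong[OF w(2)[OF that(1)], of "\<lambda>h. h \<cdot> x"] w(1)[OF that(1)] that by simp
  then show ?thesis unfolding components_def using w(1) by (intro exI[of _ w]) auto
qed

lemma components_inject:
  assumes "components F F' X \<alpha> w" "components F F' X \<beta> v" "\<And>i. i \<in> VObj I \<Longrightarrow> w i = v i" "X \<in> Obj V"
  shows "\<alpha> = \<beta>"
  by (rule prd_Int_ob_ext[OF I assms(4)]) (use assms(3) componentsD[OF assms(1)] componentsD[OF assms(2)] in auto)

lemma components_comp: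
  assumes c: "components F F' X \<alpha> w" and h: "h \<in> Hom V Y X" "X \<in> Obj V"
  shows "components F F' Y (\<alpha> \<cdot> pair V (h \<cdot> pr1 V Y (Int_ob V I)) (pr2 V Y (Int_ob V I))) (\<lambda>i. w i \<cdot> h)"
proof -
  note [simp] = FF h[simplified] componentsD[OF c]
  have [simp]: "Y \<in> Obj V" using Dom_Obj[of h] by simp
  show ?thesis unfolding components_def by simp
qed

lemma wedge_comp:
  assumes w: "is_wedge V I C F F' X w" and h: "h \<in> Hom V Y X"
  shows "is_wedge V I C F F' Y (\<lambda>i. w i \<cdot> h)"
proof -
  note [simp] = FF h[simplified]
  have [simp]: "Y \<in> Obj V" using Dom_Obj[of h] by simp
  have [simp]: "w i \<in> Arr V" "Dom V (w i) = X" "Cod V (w i) = VHom C (VFOb F i) (VFOb F' i)" if "i \<in> VObj I" for i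
    using w that unfolding is_wedge_iff by simp_all
  show ?thesis using w unfolding is_wedge_iff by simp
qed

text \<open>
  The end is the fibre of the object of arrows of \<open>\<lbrakk>I, C\<rbrakk>\<close> over the elements named by the two functors.
\<close>

lemma end_ex: "\<exists>E. is_end V I C F F' E"
proof -
  note [simp] = FF
  let ?E = "expo W II CC" and ?ev = "evl W II CC" and ?k = "pt (name_of W (KF F))" and ?k' = "pt (name_of W (KF F'))"
  note II = Intl_Obj[OF I] and CC = Intl_Obj[OF C]
  note P = pexpD[OF II CC pexp_expo[OF II CC]]
  note [simp] = ev_simps[OF II CC P(1-4)] ev_typing[OF II CC P(1-4)] pt[of "name_of W (KF F)"] pt[of "name_of W (KF F')"]
  have k: "evo II ?E ?ev (?k \<cdot> x) = IF0 (KF F) \<cdot> pr2 V (Dom V x) (Int_ob V I)" "eva II ?E ?ev (?k \<cdot> x) = IF1 (KF F) \<cdot> pr2 V (Dom V x) (Int_ar V I)"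
    "evo II ?E ?ev (?k' \<cdot> x) = IF0 (KF F') \<cdot> pr2 V (Dom V x) (Int_ob V I)" "eva II ?E ?ev (?k' \<cdot> x) = IF1 (KF F') \<cdot> pr2 V (Dom V x) (Int_ar V I)"
    if "x \<in> Arr V" "Cod V x = \<one>" for x
    using that cone_ev(4,5)[of "KF F" II CC x] cone_ev(4,5)[of "KF F'" II CC x] by simp_all
  \<comment> \<open>The pullback of \<open>f\<close> along \<open>g\<close> is the fibre.\<close>
  define f g where "f = pair V (isrc ?E) (itgt ?E)" and "g = pair V ?k ?k'"
  have fg [simp]: "f \<in> Arr V" "g \<in> Arr V" "Dom V f = IAr ?E" "Dom V g = \<one>" "Cod V f = prd V (IOb ?E) (IOb ?E)" "Cod V g = prd V (IOb ?E) (IOb ?E)"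
    by (simp_all add: f_def g_def)
  have sq: "f \<cdot> M = g \<cdot> x \<longleftrightarrow> isrc ?E \<cdot> M = ?k \<cdot> x \<and> itgt ?E \<cdot> M = ?k' \<cdot> x"
    if "M \<in> Arr V" "x \<in> Arr V" "Cod V M = IAr ?E" "Cod V x = \<one>" "Dom V M = Dom V x" for M x
  proof
    assume e: "f \<cdot> M = g \<cdot> x"
    show "isrc ?E \<cdot> M = ?k \<cdot> x \<and> itgt ?E \<cdot> M = ?k' \<cdot> x"
      using arg_cong[OF e, of "\<lambda>h. pr1 V (IOb ?E) (IOb ?E) \<cdot> h"] arg_cong[OF e, of "\<lambda>h. pr2 V (IOb ?E) (IOb ?E) \<cdot> h"] that
      by (simp add: f_def g_def)
  qed (use that in \<open>simp add: f_def g_def\<close>)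
  define E m where "E = pb V f g" and "m = pb1 V f g"
  have pb: "is_pullback V f g (E, m, pb2 V f g)" unfolding E_def m_def by (rule pullback) simp_all
  note pbD = is_pullbackD[OF pb, simplified]
  have pb2: "pb2 V f g \<cdot> h = bang V (Dom V h)" if "h \<in> Arr V" "Cod V h = E" for h
    using that pbD by (intro eq_bang) simp_all
  note [simp] = pbD(1-7)
  have m [simp]: "m \<in> Arr V" "Dom V m = E" "Cod V m = IAr ?E" using pbD by simp_all
  have bE: "pb2 V f g = bang V E" by (rule eq_bang) simp_all
  have st: "isrc ?E \<cdot> m = ?k \<cdot> bang V E" "itgt ?E \<cdot> m = ?k' \<cdot> bang V E"
    using sq[of m "bang V E"] pbD(8) by (simp_all add: bE)
  have n: "int_nat F F' E (evt II ?E ?ev m)"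
    using nfam_ev[OF II CC P(1-4), of m] by (simp add: st k)
  then obtain \<pi> where \<pi>: "components F F' E (evt II ?E ?ev m) \<pi>" using int_nat_components[OF n pbD(1)] by blast
  have comp: "components F F' X (evt II ?E ?ev (m \<cdot> h)) (\<lambda>i. \<pi> i \<cdot> h)" if "h \<in> Hom V X E" for h X
    using components_comp[OF \<pi> that] that evt_comp[of "KF F" II CC m h] by simp
  have univ: "\<exists>!h. h \<in> Hom V X E \<and> (\<forall>i\<in>VObj I. \<pi> i \<cdot> h = w i)" if w: "is_wedge V I C F F' X w" for X w
  proof -
    have X [simp]: "X \<in> Obj V" using w unfolding is_wedge_iff by blast
    obtain \<alpha> where \<alpha>: "components F F' X \<alpha> w"
      using components_ex[OF X, of w] w unfolding is_wedge_iff by blast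
    then have n: "int_nat F F' X \<alpha>" using w wedge_iff_int_nat[OF _ X] by blast
    have "\<exists>M. M \<in> Hom V (Dom V (?k \<cdot> bang V X)) (IAr ?E) \<and> isrc ?E \<cdot> M = ?k \<cdot> bang V X \<and> itgt ?E \<cdot> M = ?k' \<cdot> bang V X \<and> evt II ?E ?ev M = \<alpha>"
      by (rule P(7)) (use n in \<open>simp_all add: k\<close>)
    then obtain M where M: "M \<in> Arr V" "Dom V M = X" "Cod V M = IAr ?E" "isrc ?E \<cdot> M = ?k \<cdot> bang V X" "itgt ?E \<cdot> M = ?k' \<cdot> bang V X" "evt II ?E ?ev M = \<alpha>"
      by auto
    have "f \<cdot> M = g \<cdot> bang V X" using sq[of M "bang V X"] M by simp
    from pullback_lift[OF pb, of M "bang V X"] this M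
    obtain h where h: "h \<in> Arr V" "Dom V h = X" "Cod V h = E" "m \<cdot> h = M" by auto
    show ?thesis
    proof (rule ex1I)
      have "\<pi> i \<cdot> h = w i" if i: "i \<in> VObj I" for i
        by (rule inc1_mono[OF C, of "VFOb F i" "VFOb F' i"])
          (use i h M componentsD[OF \<pi>] componentsD[OF \<alpha>] componentsD(7)[OF comp[of h X] i, of "Ident V X"] componentsD(7)[OF \<alpha> i, of "Ident V X"] in simp_all)
      then show "h \<in> Hom V X E \<and> (\<forall>i\<in>VObj I. \<pi> i \<cdot> h = w i)" using h by simp
      fix h' assume h': "h' \<in> Hom V X E \<and> (\<forall>i\<in>VObj I. \<pi> i \<cdot> h' = w i)"
      have e: "evt II ?E ?ev (m \<cdot> h') = \<alpha>"
        by (rule components_inject[OF comp[OF conjunct1[OF h']] \<alpha>]) (use h' in simp_all)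
      have sh: "isrc ?E \<cdot> (m \<cdot> h') = ?k \<cdot> bang V X" "itgt ?E \<cdot> (m \<cdot> h') = ?k' \<cdot> bang V X"
        using h' reassoc[OF st(1), of h'] reassoc[OF st(2), of h'] by simp_all
      have "m \<cdot> h' = M" by (rule P(8)) (use M e h' sh in simp_all)
      then show "h' = h" using h h' by - (rule pullback_ext[OF pb], simp_all add: pb2)
    qed
  qed
  have "is_wedge V I C F F' E \<pi>" using wedge_iff_int_nat[OF \<pi>] n by simp
  then have "is_end V I C F F' (E, \<pi>)" unfolding is_end_def using univ by auto
  then show ?thesis ..
qed

lemma end_choice: "is_end V I C F F' (end_ob V I C F F', end_pr V I C F F')"
  using someI_ex[OF end_ex] by (simp add: end_ob_def end_pr_def end_choice_def)

lemma end_simps: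
  "end_ob V I C F F' \<in> Obj V" "i \<in> VObj I \<Longrightarrow> end_pr V I C F F' i \<in> Arr V" "i \<in> VObj I \<Longrightarrow> Dom V (end_pr V I C F F' i) = end_ob V I C F F'"
  "i \<in> VObj I \<Longrightarrow> Cod V (end_pr V I C F F' i) = VHom C (VFOb F i) (VFOb F' i)"
  using end_choice unfolding is_end_def is_wedge_iff by auto

lemma end_wedge: "is_wedge V I C F F' (end_ob V I C F F') (end_pr V I C F F')"
  using end_choice unfolding is_end_def by auto

lemma end_tuple:
  assumes "is_wedge V I C F F' X w"
  shows "end_tuple V I C F F' X w \<in> Arr V" "Dom V (end_tuple V I C F F' X w) = X" "Cod V (end_tuple V I C F F' X w) = end_ob V I C F F'" (is ?ga)
    "i \<in> VObj I \<Longrightarrow> end_pr V I C F F' i \<cdot> end_tuple V I C F F' X w = w i" (is "PROP ?gb")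
proof -
  have "\<exists>!h. h \<in> Hom V X (end_ob V I C F F') \<and> (\<forall>i\<in>VObj I. end_pr V I C F F' i \<cdot> h = w i)"
    using end_choice assms unfolding is_end_def by auto
  from theI'[OF this] show "end_tuple V I C F F' X w \<in> Arr V" "Dom V (end_tuple V I C F F' X w) = X" ?ga
    "PROP ?gb"
    by (simp_all add: end_tuple_def)
qed

lemma end_ext:
  assumes h: "h \<in> Arr V" "k \<in> Arr V" "Dom V h = Dom V k" "Cod V h = end_ob V I C F F'" "Cod V k = end_ob V I C F F'"
    and e: "\<And>i. i \<in> VObj I \<Longrightarrow> end_pr V I C F F' i \<cdot> h = end_pr V I C F F' i \<cdot> k"
  shows "h = k"
proof (rule Ex1_unique)
  have "is_wedge V I C F F' (Dom V h) (\<lambda>i. end_pr V I C F F' i \<cdot> h)" by (rule wedge_comp[OF end_wedge]) (use h in simp)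
  then show "\<exists>!h'. h' \<in> Hom V (Dom V h) (end_ob V I C F F') \<and> (\<forall>i\<in>VObj I. end_pr V I C F F' i \<cdot> h' = end_pr V I C F F' i \<cdot> h)"
    using end_choice unfolding is_end_def by auto
qed (use h e in simp_all)

end

end

end

section \<open>Enriched limits\<close>

context ccc
begin

lemma self_vcat_sel: "VObj (self_vcat V) = Obj V" "VHom (self_vcat V) = expo V" "VId (self_vcat V) = (\<lambda>X. name_of V (Ident V X))"
  by (simp_all add: self_vcat_def)

lemma vcmp_self:
  assumes "X \<in> Obj V" "Y \<in> Obj V" "Z \<in> Obj V" "g \<in> Arr V" "f \<in> Arr V" "Dom V g = Dom V f" "Cod V g = expo V Y Z" "Cod V f = expo V X Y"
  shows "vcmp V (self_vcat V) X Y Z g f \<in> Arr V" "Dom V (vcmp V (self_vcat V) X Y Z g f) = Dom V f" "Cod V (vcmp V (self_vcat V) X Y Z g f) = expo V X Z"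
    "\<lbrakk>h \<in> Arr V; x \<in> Arr V; Cod V h = Dom V f; Dom V x = Dom V h; Cod V x = X\<rbrakk> \<Longrightarrow>
      evl V X Z \<cdot> pair V (vcmp V (self_vcat V) X Y Z g f \<cdot> h) x = evl V Y Z \<cdot> pair V (g \<cdot> h) (evl V X Y \<cdot> pair V (f \<cdot> h) x)"
  using assms by (simp_all add: vcmp_def self_vcat_def Let_def)

lemma vnat_self:
  assumes D: "\<And>A B. A \<in> VObj D \<Longrightarrow> B \<in> VObj D \<Longrightarrow> VHom D A B \<in> Obj V"
    and F: "\<And>A. A \<in> VObj D \<Longrightarrow> VFOb F A \<in> Obj V" "\<And>A B. A \<in> VObj D \<Longrightarrow> B \<in> VObj D \<Longrightarrow> VFHom F A B \<in> Hom V (VHom D A B) (expo V (VFOb F A) (VFOb F B))"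
    and F': "\<And>A. A \<in> VObj D \<Longrightarrow> VFOb F' A \<in> Obj V" "\<And>A B. A \<in> VObj D \<Longrightarrow> B \<in> VObj D \<Longrightarrow> VFHom F' A B \<in> Hom V (VHom D A B) (expo V (VFOb F' A) (VFOb F' B))"
    and e: "\<And>A. A \<in> VObj D \<Longrightarrow> e A \<in> Hom V (VFOb F A) (VFOb F' A)"
    and nat: "\<And>A B u f. \<lbrakk>A \<in> VObj D; B \<in> VObj D; u \<in> Arr V; f \<in> Arr V; Dom V u = Dom V f; Cod V u = VHom D A B; Cod V f = VFOb F A\<rbrakk> \<Longrightarrow>
      e B \<cdot> (evl V (VFOb F A) (VFOb F B) \<cdot> pair V (VFHom F A B \<cdot> u) f) = evl V (VFOb F' A) (VFOb F' B) \<cdot> pair V (VFHom F' A B \<cdot> u) (e A \<cdot> f)"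
  shows "vnat V D (self_vcat V) F F' (\<lambda>A. name_of V (e A))"
  unfolding vnat_def Let_def self_vcat_sel
proof (intro conjI ballI)
  note [simp] = D F(1) F'(1) F(2)[simplified] F'(2)[simplified] e[simplified]
  show "name_of V (e A) \<in> Hom V \<one> (expo V (VFOb F A) (VFOb F' A))" if "A \<in> VObj D" for A using that by simp
  fix A B assume [simp]: "A \<in> VObj D" "B \<in> VObj D"
  note [simp] = vcmp_self
  show "vcmp V (self_vcat V) (VFOb F A) (VFOb F B) (VFOb F' B) (const_at V (VHom D A B) (name_of V (e B))) (VFHom F A B) =
      vcmp V (self_vcat V) (VFOb F A) (VFOb F' A) (VFOb F' B) (VFHom F' A B) (const_at V (VHom D A B) (name_of V (e A)))"
    by (rule expo_ext[where X = "VFOb F A" and Y = "VFOb F' B" and Z = "VHom D A B"]) (simp_all add: const_at_def nat)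
qed

text \<open>
  Evaluating an inverse transformation gives inverses of the components; conversely the inverses of the components of a
  natural family are natural.
\<close>

lemma vnat_iso_self:
  assumes D: "\<And>A B. A \<in> VObj D \<Longrightarrow> B \<in> VObj D \<Longrightarrow> VHom D A B \<in> Obj V"
    and F: "\<And>A. A \<in> VObj D \<Longrightarrow> VFOb F A \<in> Obj V" "\<And>A B. A \<in> VObj D \<Longrightarrow> B \<in> VObj D \<Longrightarrow> VFHom F A B \<in> Hom V (VHom D A B) (expo V (VFOb F A) (VFOb F B))"
    and F': "\<And>A. A \<in> VObj D \<Longrightarrow> VFOb F' A \<in> Obj V" "\<And>A B. A \<in> VObj D \<Longrightarrow> B \<in> VObj D \<Longrightarrow> VFHom F' A B \<in> Hom V (VHom D A B) (expo V (VFOb F' A) (VFOb F' B))"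
    and e: "\<And>A. A \<in> VObj D \<Longrightarrow> e A \<in> Hom V (VFOb F A) (VFOb F' A)"
    and nat: "\<And>A B u f. \<lbrakk>A \<in> VObj D; B \<in> VObj D; u \<in> Arr V; f \<in> Arr V; Dom V u = Dom V f; Cod V u = VHom D A B; Cod V f = VFOb F A\<rbrakk> \<Longrightarrow>
      e B \<cdot> (evl V (VFOb F A) (VFOb F B) \<cdot> pair V (VFHom F A B \<cdot> u) f) = evl V (VFOb F' A) (VFOb F' B) \<cdot> pair V (VFHom F' A B \<cdot> u) (e A \<cdot> f)"
  shows "vnat_iso V D (self_vcat V) F F' (\<lambda>A. name_of V (e A)) \<longleftrightarrow> (\<forall>A\<in>VObj D. iso V (e A))"
proof
  note [simp] = D F(1) F'(1) F(2)[simplified] F'(2)[simplified] e[simplified]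
  note [simp] = vcmp_self
  {
    assume "vnat_iso V D (self_vcat V) F F' (\<lambda>A. name_of V (e A))"
    then obtain \<beta> where \<beta>: "vnat V D (self_vcat V) F' F \<beta>" and
      inv: "\<And>A. A \<in> VObj D \<Longrightarrow> vcmp V (self_vcat V) (VFOb F A) (VFOb F' A) (VFOb F A) (\<beta> A) (name_of V (e A)) = VId (self_vcat V) (VFOb F A)"
      "\<And>A. A \<in> VObj D \<Longrightarrow> vcmp V (self_vcat V) (VFOb F' A) (VFOb F A) (VFOb F' A) (name_of V (e A)) (\<beta> A) = VId (self_vcat V) (VFOb F' A)"
      unfolding vnat_iso_def by blast
    show "\<forall>A\<in>VObj D. iso V (e A)"
    proof
      fix A assume A [simp]: "A \<in> VObj D"
      have "\<beta> A \<in> Hom V \<one> (expo V (VFOb F' A) (VFOb F A))" using \<beta> A unfolding vnat_def self_vcat_sel by blast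
      then have [simp]: "\<beta> A \<in> Arr V" "Dom V (\<beta> A) = \<one>" "Cod V (\<beta> A) = expo V (VFOb F' A) (VFOb F A)" by simp_all
      let ?X = "VFOb F A" and ?Y = "VFOb F' A"
      let ?k = "evl V ?Y ?X \<cdot> pair V (\<beta> A \<cdot> bang V ?Y) (Ident V ?Y)"
      have "?k \<cdot> e A = Ident V ?X"
        using arg_cong[OF inv(1)[OF A], of "\<lambda>h. evl V ?X ?X \<cdot> pair V (h \<cdot> bang V ?X) (Ident V ?X)"] by (simp add: self_vcat_sel)
      moreover have "e A \<cdot> ?k = Ident V ?Y"
        using arg_cong[OF inv(2)[OF A], of "\<lambda>h. evl V ?Y ?Y \<cdot> pair V (h \<cdot> bang V ?Y) (Ident V ?Y)"] by (simp add: self_vcat_sel)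
      ultimately show "iso V (e A)" by (intro isoI[of "e A" ?k]) simp_all
    qed
  }
  assume "\<forall>A\<in>VObj D. iso V (e A)"
  then have "\<forall>A\<in>VObj D. \<exists>k. k \<in> Hom V (VFOb F' A) (VFOb F A) \<and> k \<cdot> e A = Ident V (VFOb F A) \<and> e A \<cdot> k = Ident V (VFOb F' A)"
    unfolding iso_def by (simp add: Bex_def)
  then obtain k where k: "\<And>A. A \<in> VObj D \<Longrightarrow> k A \<in> Hom V (VFOb F' A) (VFOb F A)"
    and ke: "\<And>A. A \<in> VObj D \<Longrightarrow> k A \<cdot> e A = Ident V (VFOb F A)" and ek: "\<And>A. A \<in> VObj D \<Longrightarrow> e A \<cdot> k A = Ident V (VFOb F' A)"
    by metis
  note [simp] = k[simplified]
  have kx [simp]: "k A \<cdot> (e A \<cdot> x) = x" if "A \<in> VObj D" "x \<in> Arr V" "Cod V x = VFOb F A" for A x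
    using reassoc[OF ke[OF that(1)], of x] that by simp
  have ex [simp]: "e A \<cdot> (k A \<cdot> x) = x" if "A \<in> VObj D" "x \<in> Arr V" "Cod V x = VFOb F' A" for A x
    using reassoc[OF ek[OF that(1)], of x] that by simp
  have "vnat V D (self_vcat V) F F' (\<lambda>A. name_of V (e A))"
    by (rule vnat_self) (fact D F F' e nat)+
  moreover have "vnat V D (self_vcat V) F' F (\<lambda>A. name_of V (k A))"
  proof (rule vnat_self)
    fix A B u f assume AB [simp]: "A \<in> VObj D" "B \<in> VObj D" and uf: "u \<in> Arr V" "f \<in> Arr V" "Dom V u = Dom V f" "Cod V u = VHom D A B" "Cod V f = VFOb F' A"
    show "k B \<cdot> (evl V (VFOb F' A) (VFOb F' B) \<cdot> pair V (VFHom F' A B \<cdot> u) f) = evl V (VFOb F A) (VFOb F B) \<cdot> pair V (VFHom F A B \<cdot> u) (k A \<cdot> f)"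
      using nat[OF AB, of u "k A \<cdot> f", symmetric] uf by simp
  qed (fact D F F' k)+
  moreover have "vcmp V (self_vcat V) (VFOb F A) (VFOb F' A) (VFOb F A) (name_of V (k A)) (name_of V (e A)) = VId (self_vcat V) (VFOb F A)"
    "vcmp V (self_vcat V) (VFOb F' A) (VFOb F A) (VFOb F' A) (name_of V (e A)) (name_of V (k A)) = VId (self_vcat V) (VFOb F' A)"
    if A [simp]: "A \<in> VObj D" for A
    unfolding self_vcat_sel
    by (rule expo_ext[where X = "VFOb F A" and Y = "VFOb F A" and Z = \<one>], simp_all)
      (rule expo_ext[where X = "VFOb F' A" and Y = "VFOb F' A" and Z = \<one>], simp_all)
  ultimately show "vnat_iso V D (self_vcat V) F F' (\<lambda>A. name_of V (e A))"
    unfolding vnat_iso_def by (intro conjI exI[of _ "\<lambda>A. name_of V (k A)"] ballI)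
qed

end

context extensive_ccc
begin

lemma op_vcat_sel: "VObj (op_vcat V C) = VObj C" "VHom (op_vcat V C) A B = VHom C B A"
  by (simp_all add: op_vcat_def)

lemma fun_vcat_sel: "VObj (fun_vcat V I C) = {F. vfunctor V I C F}" "VHom (fun_vcat V I C) = end_ob V I C"
  by (simp_all add: fun_vcat_def)

context
  fixes I :: "('x, 'o, 'm) vcat" and C :: "('y, 'o, 'm) vcat"
  assumes I: "small_vcat I" and C: "small_vcat C"
begin

private lemmas enriched_simps = VHom_Obj[OF I] VHom_Obj[OF C] VId_simps[OF C] VId_simps[OF I] vcmp_simps[OF C] vcmp_unit[OF C] VComp_simps[OF C] VComp_simps[OF I]

private abbreviation "cst \<equiv> const_vfun V I C"

lemma const_vfun:
  assumes A [simp]: "A \<in> VObj C"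
  shows "vfunctor V I C (cst A)" "i \<in> VObj I \<Longrightarrow> VFOb (cst A) i = A"
    "i \<in> VObj I \<Longrightarrow> j \<in> VObj I \<Longrightarrow> VFHom (cst A) i j = VId C A \<cdot> bang V (VHom I i j)" (is "PROP ?ga")
proof -
  note [simp] = enriched_simps
  have [simp]: "VFOb (cst A) i = A" "j \<in> VObj I \<Longrightarrow> VFHom (cst A) i j = VId C A \<cdot> bang V (VHom I i j)" if "i \<in> VObj I" for i j
    using that by (simp_all add: const_vfun_def mk_vfun_def const_at_def)
  then show "i \<in> VObj I \<Longrightarrow> VFOb (cst A) i = A" "PROP ?ga"
    by simp_all
  have "cst A = mk_vfun I (VFOb (cst A)) (VFHom (cst A))"
    by (simp add: const_vfun_def mk_vfun_def fun_eq_iff)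
  then show "vfunctor V I C (cst A)" unfolding vfunctor_def Let_def by simp
qed

lemma wedge_vcmp:
  assumes F: "vfunctor V I C F" and F': "vfunctor V I C F'" and F'': "vfunctor V I C F''"
    and w: "is_wedge V I C F' F'' X w" and v: "is_wedge V I C F F' X v"
  shows "is_wedge V I C F F'' X (\<lambda>i. vcmp V C (VFOb F i) (VFOb F' i) (VFOb F'' i) (w i) (v i))"
proof -
  note [simp] = enriched_simps vfunctorD[OF F] vfunctorD[OF F'] vfunctorD[OF F'']
  note W = is_wedge_iff[OF I C F' F''] is_wedge_iff[OF I C F F'] is_wedge_iff[OF I C F F'']
  have [simp]: "X \<in> Obj V" "i \<in> VObj I \<Longrightarrow> w i \<in> Arr V" "i \<in> VObj I \<Longrightarrow> Dom V (w i) = X" "i \<in> VObj I \<Longrightarrow> Cod V (w i) = VHom C (VFOb F' i) (VFOb F'' i)"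
    "i \<in> VObj I \<Longrightarrow> v i \<in> Arr V" "i \<in> VObj I \<Longrightarrow> Dom V (v i) = X" "i \<in> VObj I \<Longrightarrow> Cod V (v i) = VHom C (VFOb F i) (VFOb F' i)" for i
    using w v unfolding W by simp_all
  have "vcmp V C (VFOb F i) (VFOb F'' i) (VFOb F'' j) (VFHom F'' i j \<cdot> u) (vcmp V C (VFOb F i) (VFOb F' i) (VFOb F'' i) (w i \<cdot> x) (v i \<cdot> x)) =
      vcmp V C (VFOb F i) (VFOb F j) (VFOb F'' j) (vcmp V C (VFOb F j) (VFOb F' j) (VFOb F'' j) (w j \<cdot> x) (v j \<cdot> x)) (VFHom F i j \<cdot> u)"
    if a: "i \<in> VObj I" "j \<in> VObj I" "x \<in> Arr V" "u \<in> Arr V" "Dom V x = Dom V u" "Cod V x = X" "Cod V u = VHom I i j" for i j x u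
  proof -
    note [simp] = a
    have e: "vcmp V C (VFOb F' i) (VFOb F'' i) (VFOb F'' j) (VFHom F'' i j \<cdot> u) (w i \<cdot> x) = vcmp V C (VFOb F' i) (VFOb F' j) (VFOb F'' j) (w j \<cdot> x) (VFHom F' i j \<cdot> u)"
      "vcmp V C (VFOb F i) (VFOb F' i) (VFOb F' j) (VFHom F' i j \<cdot> u) (v i \<cdot> x) = vcmp V C (VFOb F i) (VFOb F j) (VFOb F' j) (v j \<cdot> x) (VFHom F i j \<cdot> u)"
      using w v a unfolding W by blast+
    show ?thesis
      using vcmp_assoc[OF C, of "VFOb F i" "VFOb F' i" "VFOb F'' i" "VFOb F'' j" "v i \<cdot> x" "w i \<cdot> x" "VFHom F'' i j \<cdot> u"]
        vcmp_assoc[OF C, of "VFOb F i" "VFOb F' i" "VFOb F' j" "VFOb F'' j" "v i \<cdot> x" "VFHom F' i j \<cdot> u" "w j \<cdot> x"]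
        vcmp_assoc[OF C, of "VFOb F i" "VFOb F j" "VFOb F' j" "VFOb F'' j" "VFHom F i j \<cdot> u" "v j \<cdot> x" "w j \<cdot> x"] e by simp
  qed
  then show ?thesis unfolding W by simp
qed

context
  fixes G assumes G: "vfunctor V I C G"
begin

private abbreviation "KG \<equiv> cone_vfun V I C G"
private abbreviation "EG A \<equiv> end_ob V I C (cst A) G"
private abbreviation "pG A \<equiv> end_pr V I C (cst A) G"

lemma cone_vfun_Ob: "A \<in> VObj C \<Longrightarrow> VFOb KG A = EG A"
  using const_vfun(1) by (simp add: cone_vfun_def vfun_comp_def mk_vfun_def hom_vfun_def op_vfun_def diag_vfun_def op_vcat_sel fun_vcat_sel)

text \<open>The functor of cones acts by precomposition.\<close>

lemma cone_vfun_act: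
  assumes A [simp]: "A \<in> VObj C" and B [simp]: "B \<in> VObj C"
  shows "VFHom KG A B \<in> Hom V (VHom C B A) (expo V (EG A) (EG B))" (is ?ga)
    "\<lbrakk>u \<in> Arr V; y \<in> Arr V; Dom V u = Dom V y; Cod V u = VHom C B A; Cod V y = EG A; i \<in> VObj I\<rbrakk> \<Longrightarrow>
      pG B i \<cdot> (evl V (EG A) (EG B) \<cdot> pair V (VFHom KG A B \<cdot> u) y) = vcmp V C B A (VFOb G i) (pG A i \<cdot> y) u"
proof -
  note cA = const_vfun[OF A] and cB = const_vfun[OF B]
  note [simp] = enriched_simps cA cB vfunctorD[OF G] end_simps[OF I C cA(1) G] end_simps[OF I C cB(1) G] end_simps[OF I C cB(1) cA(1)]
  let ?X = "end_ob V I C (cst B) (cst A)" and ?P = "prd V (EG A) (end_ob V I C (cst B) (cst A))"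
  let ?d = "end_tuple V I C (cst B) (cst A) (VHom C B A) (\<lambda>i. Ident V (VHom C B A))"
  let ?w = "\<lambda>i. vcmp V C (VFOb (cst B) i) (VFOb (cst A) i) (VFOb G i) (pG A i \<cdot> pr1 V (EG A) ?X) (end_pr V I C (cst B) (cst A) i \<cdot> pr2 V (EG A) ?X)"
  have "is_wedge V I C (cst B) (cst A) (VHom C B A) (\<lambda>i. Ident V (VHom C B A))"
    unfolding is_wedge_iff[OF I C cB(1) cA(1)] by simp
  note d [simp] = end_tuple[OF I C cB(1) cA(1) this]
  have "is_wedge V I C (cst B) G ?P ?w"
    by (rule wedge_vcmp[OF cB(1) cA(1) G wedge_comp[OF I C cA(1) G end_wedge[OF I C cA(1) G]] wedge_comp[OF I C cB(1) cA(1) end_wedge[OF I C cB(1) cA(1)]]]) simp_all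
  note m = end_tuple[OF I C cB(1) G this]
  define m where "m = end_tuple V I C (cst B) G ?P ?w"
  note m [simp] = m[folded m_def]
  have K: "VFHom KG A B = transp V ?X (EG A) (EG B) (m \<cdot> pair V (pr2 V ?X (EG A)) (pr1 V ?X (EG A))) \<cdot> ?d"
    by (simp add: cone_vfun_def vfun_comp_def mk_vfun_def hom_vfun_def op_vfun_def diag_vfun_def op_vcat_sel fun_vcat_sel Let_def vcmp_def)
      (simp add: fun_vcat_def m_def vcmp_def Let_def)
  show ?ga by (simp add: K)
  assume a [simp]: "u \<in> Arr V" "y \<in> Arr V" "Dom V u = Dom V y" "Cod V u = VHom C B A" "Cod V y = EG A" "i \<in> VObj I"
  have "pG B i \<cdot> (m \<cdot> pair V y (?d \<cdot> u)) = ?w i \<cdot> pair V y (?d \<cdot> u)"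
    using reassoc[OF m(4)[OF a(6)], of "pair V y (?d \<cdot> u)"] by simp
  moreover have "end_pr V I C (cst B) (cst A) i \<cdot> (?d \<cdot> u) = u"
    using reassoc[OF d(4)[OF a(6)], of u] by simp
  ultimately show "pG B i \<cdot> (evl V (EG A) (EG B) \<cdot> pair V (VFHom KG A B \<cdot> u) y) = vcmp V C B A (VFOb G i) (pG A i \<cdot> y) u"
    by (simp add: K)
qed

lemma hom_vfun_act:
  assumes "L \<in> VObj C" "A \<in> VObj C"
  shows "VFOb (hom_vfun V C L) A = VHom C A L"
    "B \<in> VObj C \<Longrightarrow> VFHom (hom_vfun V C L) A B \<in> Hom V (VHom C B A) (expo V (VHom C A L) (VHom C B L))"
    "\<lbrakk>B \<in> VObj C; u \<in> Arr V; f \<in> Arr V; Dom V u = Dom V f; Cod V u = VHom C B A; Cod V f = VHom C A L\<rbrakk> \<Longrightarrow>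
      evl V (VHom C A L) (VHom C B L) \<cdot> pair V (VFHom (hom_vfun V C L) A B \<cdot> u) f = vcmp V C B A L f u"
  using assms enriched_simps by (simp_all add: hom_vfun_def mk_vfun_def op_vcat_sel Let_def)

lemma vnat_wedge:
  assumes L [simp]: "L \<in> VObj C" and l: "vnat V I C (cst L) G l"
  shows "is_wedge V I C (cst L) G \<one> l"
proof -
  note cL = const_vfun[OF L]
  note [simp] = enriched_simps vfunctorD[OF G] cL
  have lT: "l i \<in> Hom V \<one> (VHom C L (VFOb G i))" if "i \<in> VObj I" for i
    using l that unfolding vnat_def by simp
  note [simp] = lT[simplified]
  show ?thesis
    unfolding is_wedge_iff[OF I C cL(1) G]
  proof (intro conjI ballI allI impI)
    fix i j x u assume a [simp]: "i \<in> VObj I" "j \<in> VObj I" "x \<in> Arr V" "u \<in> Arr V" "Dom V x = Dom V u" "Cod V x = \<one>" "Cod V u = VHom I i j"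
    have "x = bang V (Dom V u)" by (rule eq_bang) simp_all
    moreover have "vcmp V C L L (VFOb G j) (l j \<cdot> bang V (VHom I i j)) (VId C L \<cdot> bang V (VHom I i j)) =
        vcmp V C L (VFOb G i) (VFOb G j) (VFHom G i j) (l i \<cdot> bang V (VHom I i j))"
      using l a(1,2) unfolding vnat_def Let_def const_at_def by simp
    from arg_cong[OF this, of "\<lambda>h. h \<cdot> u"]
    have "l j \<cdot> bang V (Dom V u) = vcmp V C L (VFOb G i) (VFOb G j) (VFHom G i j \<cdot> u) (l i \<cdot> bang V (Dom V u))" by simp
    ultimately show "vcmp V C (VFOb (cst L) i) (VFOb G i) (VFOb G j) (VFHom G i j \<cdot> u) (l i \<cdot> x) =
        vcmp V C (VFOb (cst L) i) (VFOb (cst L) j) (VFOb G j) (l j \<cdot> x) (VFHom (cst L) i j \<cdot> u)" by simp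
  qed simp_all
qed

text \<open>
  The component \<open>e A\<close> of the transformation given by \<open>l\<close> sends \<open>h\<close> to the wedge of the composites of the \<open>l i\<close> with \<open>h\<close>, so its
  invertibility is unique factorization of wedges.
\<close>

lemma is_vlimit_iff:
  assumes L [simp]: "L \<in> VObj C" and l: "vnat V I C (cst L) G l"
  shows "is_vlimit V I C G L l \<longleftrightarrow> (\<forall>A\<in>VObj C. \<forall>X w. is_wedge V I C (cst A) G X w \<longrightarrow>
    (\<exists>!h. h \<in> Hom V X (VHom C A L) \<and> (\<forall>i\<in>VObj I. vcmp V C A L (VFOb G i) (l i \<cdot> bang V X) h = w i)))"
proof -
  note cL = const_vfun[OF L]
  note [simp] = enriched_simps vfunctorD[OF G] cone_vfun_Ob cL const_vfun end_simps[OF I C const_vfun(1) G]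
  have lT: "l i \<in> Hom V \<one> (VHom C L (VFOb G i))" if "i \<in> VObj I" for i
    using l that unfolding vnat_def by simp
  note [simp] = lT[simplified]
  note tl = end_tuple[OF I C cL(1) G vnat_wedge[OF L l]]
  define x where "x = end_tuple V I C (cst L) G \<one> l"
  note [simp] = tl[folded x_def]
  define e where "e A = evl V (VFOb KG L) (VFOb KG A) \<cdot> pair V (VFHom KG L A) (const_at V (VHom C A L) x)" for A
  have K [simp]: "VFHom KG A B \<in> Arr V" "Dom V (VFHom KG A B) = VHom C B A" "Cod V (VFHom KG A B) = expo V (EG A) (EG B)" if "A \<in> VObj C" "B \<in> VObj C" for A B
    using cone_vfun_act(1)[OF that] by simp_all
  have e [simp]: "e A \<in> Arr V" "Dom V (e A) = VHom C A L" "Cod V (e A) = EG A" if "A \<in> VObj C" for A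
    using that by (simp_all add: e_def const_at_def)
  have xi: "pG L i \<cdot> (x \<cdot> y) = l i \<cdot> y" if "i \<in> VObj I" "y \<in> Arr V" "Cod V y = \<one>" for i y
    using reassoc[OF tl(4)[folded x_def, OF that(1)], of y] that by simp
  have pe: "pG A i \<cdot> (e A \<cdot> h) = vcmp V C A L (VFOb G i) (l i \<cdot> bang V (Dom V h)) h"
    if "A \<in> VObj C" "i \<in> VObj I" "h \<in> Arr V" "Cod V h = VHom C A L" for A i h
    using cone_vfun_act(2)[OF L that(1), of h "x \<cdot> bang V (Dom V h)" i] that by (simp add: e_def const_at_def xi)
  have "is_vlimit V I C G L l \<longleftrightarrow> (\<forall>A\<in>VObj (op_vcat V C). iso V (e A))"
    unfolding is_vlimit_def represents_def yoneda_vnat_def x_def[symmetric] e_def[symmetric]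
  proof (rule vnat_iso_self, unfold op_vcat_sel)
      fix A B u f assume a [simp]: "A \<in> VObj C" "B \<in> VObj C" "u \<in> Arr V" "f \<in> Arr V" "Dom V u = Dom V f" "Cod V u = VHom C B A" "Cod V f = VFOb (hom_vfun V C L) A"
      note [simp] = hom_vfun_act[OF L] hom_vfun_act(2)[OF L, simplified]
      show "e B \<cdot> (evl V (VFOb (hom_vfun V C L) A) (VFOb (hom_vfun V C L) B) \<cdot> pair V (VFHom (hom_vfun V C L) A B \<cdot> u) f) =
          evl V (VFOb KG A) (VFOb KG B) \<cdot> pair V (VFHom KG A B \<cdot> u) (e A \<cdot> f)"
      proof (rule end_ext[OF I C const_vfun(1)[OF a(2)] G])
        fix i assume i [simp]: "i \<in> VObj I"
        show "pG B i \<cdot> (e B \<cdot> (evl V (VFOb (hom_vfun V C L) A) (VFOb (hom_vfun V C L) B) \<cdot> pair V (VFHom (hom_vfun V C L) A B \<cdot> u) f)) =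
          pG B i \<cdot> (evl V (VFOb KG A) (VFOb KG B) \<cdot> pair V (VFHom KG A B \<cdot> u) (e A \<cdot> f))"
          using vcmp_assoc[OF C, of B A L "VFOb G i" u f "l i \<cdot> bang V (Dom V f)"] by (simp add: pe cone_vfun_act(2))
      qed simp_all
    qed (use hom_vfun_act[OF L] in simp_all)
  also have "\<dots> \<longleftrightarrow> (\<forall>A\<in>VObj C. iso V (e A))" by (simp add: op_vcat_sel)
  also have "\<dots> \<longleftrightarrow> (\<forall>A\<in>VObj C. \<forall>X w. is_wedge V I C (cst A) G X w \<longrightarrow>
    (\<exists>!h. h \<in> Hom V X (VHom C A L) \<and> (\<forall>i\<in>VObj I. vcmp V C A L (VFOb G i) (l i \<cdot> bang V X) h = w i)))"
  proof (intro ball_cong refl iffI allI impI)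
    fix A X w assume A [simp]: "A \<in> VObj C" and iso: "iso V (e A)" and w: "is_wedge V I C (cst A) G X w"
    note t [simp] = end_tuple[OF I C const_vfun(1)[OF A] G w]
    let ?t = "end_tuple V I C (cst A) G X w"
    have [simp]: "X \<in> Obj V" using Dom_Obj[OF t(1)] by simp
    have "e A \<cdot> h = ?t \<longleftrightarrow> (\<forall>i\<in>VObj I. vcmp V C A L (VFOb G i) (l i \<cdot> bang V X) h = w i)" if h: "h \<in> Hom V X (VHom C A L)" for h
    proof
      assume eq: "e A \<cdot> h = ?t"
      show "\<forall>i\<in>VObj I. vcmp V C A L (VFOb G i) (l i \<cdot> bang V X) h = w i"
        using pe[OF A, of _ h] h by (auto simp: eq)
    next
      assume r: "\<forall>i\<in>VObj I. vcmp V C A L (VFOb G i) (l i \<cdot> bang V X) h = w i"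
      show "e A \<cdot> h = ?t" by (rule end_ext[OF I C const_vfun(1)[OF A] G]) (use r h in \<open>simp_all add: pe\<close>)
    qed
    then have "h \<in> Hom V X (VHom C A L) \<and> (\<forall>i\<in>VObj I. vcmp V C A L (VFOb G i) (l i \<cdot> bang V X) h = w i) \<longleftrightarrow> h \<in> Hom V (Dom V ?t) (Dom V (e A)) \<and> e A \<cdot> h = ?t" for h
      by auto
    then show "\<exists>!h. h \<in> Hom V X (VHom C A L) \<and> (\<forall>i\<in>VObj I. vcmp V C A L (VFOb G i) (l i \<cdot> bang V X) h = w i)"
      using iso_points[OF iso, of ?t] by simp
  next
    fix A assume A [simp]: "A \<in> VObj C" and all: "\<forall>X w. is_wedge V I C (cst A) G X w \<longrightarrow>
      (\<exists>!h. h \<in> Hom V X (VHom C A L) \<and> (\<forall>i\<in>VObj I. vcmp V C A L (VFOb G i) (l i \<cdot> bang V X) h = w i))"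
    show "iso V (e A)"
    proof (rule iso_if_points)
      fix a assume a: "a \<in> Arr V" "Cod V a = Cod V (e A)"
      then have w: "is_wedge V I C (cst A) G (Dom V a) (\<lambda>i. pG A i \<cdot> a)"
        using wedge_comp[OF I C const_vfun(1)[OF A] G end_wedge[OF I C const_vfun(1)[OF A] G], of a "Dom V a"] by simp
      have "e A \<cdot> h = a \<longleftrightarrow> (\<forall>i\<in>VObj I. vcmp V C A L (VFOb G i) (l i \<cdot> bang V (Dom V a)) h = pG A i \<cdot> a)" if h: "h \<in> Hom V (Dom V a) (VHom C A L)" for h
      proof
        assume eq: "e A \<cdot> h = a"
        show "\<forall>i\<in>VObj I. vcmp V C A L (VFOb G i) (l i \<cdot> bang V (Dom V a)) h = pG A i \<cdot> a"
          using pe[OF A, of _ h] h by (auto simp: eq)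
      next
        assume r: "\<forall>i\<in>VObj I. vcmp V C A L (VFOb G i) (l i \<cdot> bang V (Dom V a)) h = pG A i \<cdot> a"
        show "e A \<cdot> h = a" by (rule end_ext[OF I C const_vfun(1)[OF A] G]) (use r h a in \<open>simp_all add: pe\<close>)
      qed
      then have "h \<in> Hom V (Dom V a) (VHom C A L) \<and> (\<forall>i\<in>VObj I. vcmp V C A L (VFOb G i) (l i \<cdot> bang V (Dom V a)) h = pG A i \<cdot> a) \<longleftrightarrow> h \<in> Hom V (Dom V a) (Dom V (e A)) \<and> e A \<cdot> h = a" for h
        by auto
      then show "\<exists>!q. q \<in> Hom V (Dom V a) (Dom V (e A)) \<and> e A \<cdot> q = a"
        using all[rule_format, OF w] by simp
    qed simp
  qed
  finally show ?thesis .
qed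

end

end

end

section \<open>Enriched and internal limits\<close>

lemma (in ccc) coproduct_prd_ext:
  assumes c: "is_coproduct V J Y (X, e)" and K [simp]: "K \<in> Obj V"
    and u: "u \<in> Hom V (prd V X K) Z" "v \<in> Hom V (prd V X K) Z"
    and eq: "\<And>j. j \<in> J \<Longrightarrow> u \<cdot> pair V (e j \<cdot> pr1 V (Y j) K) (pr2 V (Y j) K) = v \<cdot> pair V (e j \<cdot> pr1 V (Y j) K) (pr2 V (Y j) K)"
  shows "u = v"
proof -
  have [simp]: "X \<in> Obj V" "Z \<in> Obj V" using is_coproductD(1)[OF c] Cod_Obj[of u] u by auto
  note [simp] = u[simplified] is_coproductD(2-4)[OF c]
  have [simp]: "Y j \<in> Obj V" if "j \<in> J" for j using Dom_Obj[of "e j"] that by simp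
  have t: "transp V X K Z u = transp V X K Z v"
  proof (rule coproduct_ext[OF c])
    fix j assume j [simp]: "j \<in> J"
    show "transp V X K Z u \<cdot> e j = transp V X K Z v \<cdot> e j"
      by (rule expo_ext[where X = K and Y = Z and Z = "Y j"]) (simp_all add: eq)
  qed simp_all
  show ?thesis
    using arg_cong[OF t, of "\<lambda>h. evl V K Z \<cdot> pair V (h \<cdot> pr1 V X K) (pr2 V X K)"] by simp
qed

context extensive_ccc
begin

context
  fixes I :: "('x, 'o, 'm) vcat" and C :: "('y, 'o, 'm) vcat" and G L l
  assumes I: "small_vcat I" and C: "small_vcat C" and G: "vfunctor V I C G" and L: "L \<in> VObj C" and l: "vnat V I C (const_vfun V I C L) G l"
begin

private lemmas comparison_simps = VHom_Obj[OF I] VHom_Obj[OF C] VId_simps[OF C] inc_simps[OF I] inc_simps[OF C] Intl_sel[OF I] Intl_sel[OF C]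
    Intl_st[OF I] Intl_st[OF C] Intl_st_comp[OF I] Intl_st_comp[OF C] Intl_id(1-3)[OF I] Intl_id(1-3)[OF C] Intl_igcmp[OF C]
    vcmp_simps[OF C] vcmp_unit[OF C] Intl_Obj[OF I] Intl_Obj[OF C] VComp_simps[OF C] vfunctorD[OF G] Int_fun(1)[OF I C G, simplified] Int_fun_comp[OF I C G]
    L

private abbreviation "IN \<equiv> Intl V I"
private abbreviation "CN \<equiv> Intl V C"
private abbreviation "KN \<equiv> Int_fun V I C G"
private abbreviation "cs \<equiv> const_vfun V I C"
private abbreviation "lh \<equiv> Int_ob_cotuple V I (Int_ar V C) (\<lambda>i. inc1 V C L (VFOb G i) \<cdot> l i)"

private lemma KN: "KN \<in> Arr W" "Dom W KN = IN" "Cod W KN = CN"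
  using Int_fun(1)[OF I C G] by simp_all

private lemma l_simps: "i \<in> VObj I \<Longrightarrow> l i \<in> Arr V" "i \<in> VObj I \<Longrightarrow> Dom V (l i) = \<one>" "i \<in> VObj I \<Longrightarrow> Cod V (l i) = VHom C L (VFOb G i)" (is "PROP ?ga")
proof -
  have "l i \<in> Hom V \<one> (VHom C L (VFOb G i))" if "i \<in> VObj I"
    using l that const_vfun(2)[OF I C L] unfolding vnat_def by simp
  then show "i \<in> VObj I \<Longrightarrow> l i \<in> Arr V" "i \<in> VObj I \<Longrightarrow> Dom V (l i) = \<one>" "PROP ?ga" by simp_all
qed

private lemma lh: "lh \<in> Arr V" "Dom V lh = Int_ob V I" "Cod V lh = Int_ar V C"
  "\<lbrakk>i \<in> VObj I; x \<in> Arr V; Cod V x = \<one>\<rbrakk> \<Longrightarrow> lh \<cdot> (inc0 V I i \<cdot> x) = inc1 V C L (VFOb G i) \<cdot> (l i \<cdot> x)" (is "PROP ?ga")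
proof -
  note [simp] = comparison_simps l_simps
  note c = Int_ob_cotuple[OF I, of "Int_ar V C" "\<lambda>i. inc1 V C L (VFOb G i) \<cdot> l i"]
  show lh [simp]: "lh \<in> Arr V" "Dom V lh = Int_ob V I" "Cod V lh = Int_ar V C" using c(1-3) by simp_all
  show "PROP ?ga"
    using reassoc[OF c(4), of i x] by simp
qed

lemma const_fam:
  assumes [simp]: "A \<in> VObj C" "X \<in> Obj V"
  shows "IF0 (Int_fun V I C (cs A)) \<cdot> pr2 V X (Int_ob V I) = inc0 V C A \<cdot> bang V (prd V X (Int_ob V I))" (is ?ga)
    "IF1 (Int_fun V I C (cs A)) \<cdot> pr2 V X (Int_ar V I) = iid CN \<cdot> (inc0 V C A \<cdot> bang V (prd V X (Int_ar V I)))" (is ?gb)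
proof -
  note c = const_vfun[OF I C assms(1)]
  note [simp] = comparison_simps c Int_fun(1)[OF I C c(1), simplified] Int_fun_comp[OF I C c(1)] Intl_id(5)[OF C]
  show ?ga
    by (rule prd_Int_ob_ext[OF I assms(2)]) simp_all
  show ?gb
    by (rule prd_Int_ar_ext[OF I assms(2)]) simp_all
qed

lemma cone_fam_const:
  assumes "A \<in> VObj C" "X \<in> Obj V"
  shows "cone_fam IN CN KN X (inc0 V C A \<cdot> bang V X) \<gamma> \<longleftrightarrow> int_nat I C (cs A) G X \<gamma>"
  unfolding cone_fam_def[OF KN] const_fam[OF assms] using assms by (simp add: comparison_simps)

text \<open>The arrow \<open>f\<close> is a morphism of internal cones from \<open>\<gamma>\<close> with vertex \<open>a\<close> to \<open>l\<close> with vertex \<open>L\<close>.\<close>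

definition factors :: "'o \<Rightarrow> 'm \<Rightarrow> 'm \<Rightarrow> 'm \<Rightarrow> bool" where
  "factors X a \<gamma> f \<longleftrightarrow> f \<in> Hom V X (Int_ar V C) \<and> isrc CN \<cdot> f = a \<and> itgt CN \<cdot> f = inc0 V C L \<cdot> bang V X \<and>
     igcmp V CN (f \<cdot> pr1 V X (Int_ob V I)) (lh \<cdot> pr2 V X (Int_ob V I)) = \<gamma>"

lemma lh_source: "isrc CN \<cdot> (lh \<cdot> x) = inc0 V C L \<cdot> bang V (Dom V x)" if "x \<in> Arr V" "Cod V x = Int_ob V I" for x
proof -
  note [simp] = comparison_simps l_simps lh
  have e: "isrc CN \<cdot> lh = inc0 V C L \<cdot> bang V (Int_ob V I)"
    by (rule coproduct_ext[OF Int_ob_coproduct[OF I]]) (use lh(4)[of _ "Ident V \<one>"] in simp_all)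
  show ?thesis using reassoc[OF e, of x] that by simp
qed

lemma factors_restrict:
  assumes f: "factors X a \<gamma> f" and h: "h \<in> Hom V Y X" "X \<in> Obj V"
  shows "factors Y (a \<cdot> h) (\<gamma> \<cdot> pair V (h \<cdot> pr1 V Y (Int_ob V I)) (pr2 V Y (Int_ob V I))) (f \<cdot> h)"
proof -
  note [simp] = comparison_simps lh h[simplified] lh_source
  have [simp]: "Y \<in> Obj V" using Dom_Obj[of h] by simp
  have [simp]: "f \<in> Arr V" "Dom V f = X" "Cod V f = Int_ar V C" and st: "isrc CN \<cdot> f = a" "itgt CN \<cdot> f = inc0 V C L \<cdot> bang V X"
    and g: "\<gamma> = igcmp V CN (f \<cdot> pr1 V X (Int_ob V I)) (lh \<cdot> pr2 V X (Int_ob V I))"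
    using f unfolding factors_def by auto
  have [simp]: "isrc CN \<cdot> (f \<cdot> x) = a \<cdot> x" "itgt CN \<cdot> (f \<cdot> x) = inc0 V C L \<cdot> bang V (Dom V x)" if "x \<in> Arr V" "Cod V x = X" for x
    using reassoc[OF st(1), of x] reassoc[OF st(2), of x] that by simp_all
  show ?thesis unfolding factors_def g by simp
qed

text \<open>An arrow with constant ends \<open>A\<close> and \<open>L\<close> factors uniquely through \<open>C(A, L)\<close>.\<close>

lemma factors_const_iff:
  assumes A [simp]: "A \<in> VObj C" and X [simp]: "X \<in> Obj V" and c: "components I C (cs A) G X \<gamma> w"
  shows "(\<exists>!f. factors X (inc0 V C A \<cdot> bang V X) \<gamma> f) \<longleftrightarrow>
    (\<exists>!h. h \<in> Hom V X (VHom C A L) \<and> (\<forall>i\<in>VObj I. vcmp V C A L (VFOb G i) (l i \<cdot> bang V X) h = w i))"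
proof (rule Ex1_bij[where g = "\<lambda>h. inc1 V C A L \<cdot> h", symmetric])
  note cA = const_vfun[OF I C A]
  note [simp] = comparison_simps lh l_simps lh_source componentsD[OF I C c] cA
  fix h assume h: "h \<in> Hom V X (VHom C A L) \<and> (\<forall>i\<in>VObj I. vcmp V C A L (VFOb G i) (l i \<cdot> bang V X) h = w i)"
  have e: "w i \<cdot> x = vcmp V C A L (VFOb G i) (l i \<cdot> bang V (Dom V x)) (h \<cdot> x)" if "i \<in> VObj I" "x \<in> Arr V" "Cod V x = X" for i x
  proof -
    have "w i = vcmp V C A L (VFOb G i) (l i \<cdot> bang V X) h" using h that by simp
    show ?thesis by (subst \<open>w i = _\<close>) (use conjunct1[OF h] that in simp)
  qed
  note [simp] = conjunct1[OF h, simplified]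
  have "igcmp V CN ((inc1 V C A L \<cdot> h) \<cdot> pr1 V X (Int_ob V I)) (lh \<cdot> pr2 V X (Int_ob V I)) = \<gamma>"
    by (rule prd_Int_ob_ext[OF I X]) (simp_all add: e)
  then show "factors X (inc0 V C A \<cdot> bang V X) \<gamma> (inc1 V C A L \<cdot> h)" unfolding factors_def by simp
next
  note cA = const_vfun[OF I C A]
  note [simp] = comparison_simps lh l_simps lh_source componentsD[OF I C c] cA
  fix f assume f: "factors X (inc0 V C A \<cdot> bang V X) \<gamma> f"
  then have f': "f \<in> Arr V" "Cod V f = Int_ar V C" "isrc CN \<cdot> f = inc0 V C A \<cdot> bang V (Dom V f)" "itgt CN \<cdot> f = inc0 V C L \<cdot> bang V (Dom V f)" "Dom V f = X"
    unfolding factors_def by auto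
  obtain h where h: "h \<in> Arr V" "Dom V h = X" "Cod V h = VHom C A L" "f = inc1 V C A L \<cdot> h"
    by (rule hom_factor[OF C f'(1,2) A L f'(3,4)]) (use f'(5) in blast)
  note [simp] = h(1-3)
  have g: "igcmp V CN ((inc1 V C A L \<cdot> h) \<cdot> pr1 V X (Int_ob V I)) (lh \<cdot> pr2 V X (Int_ob V I)) = \<gamma>"
    using f unfolding factors_def h(4) by blast
  have "vcmp V C A L (VFOb G i) (l i \<cdot> bang V X) h = w i" if [simp]: "i \<in> VObj I" for i
    by (rule inc1_mono[OF C, of A "VFOb G i"])
      (use arg_cong[OF g, of "\<lambda>k. k \<cdot> pair V (Ident V X) (inc0 V I i \<cdot> bang V X)"] in simp_all)
  then show "\<exists>h. (h \<in> Hom V X (VHom C A L) \<and> (\<forall>i\<in>VObj I. vcmp V C A L (VFOb G i) (l i \<cdot> bang V X) h = w i)) \<and> inc1 V C A L \<cdot> h = f"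
    using h by (intro exI[of _ h]) simp
next
  fix h h' assume "h \<in> Hom V X (VHom C A L) \<and> (\<forall>i\<in>VObj I. vcmp V C A L (VFOb G i) (l i \<cdot> bang V X) h = w i)"
    "h' \<in> Hom V X (VHom C A L) \<and> (\<forall>i\<in>VObj I. vcmp V C A L (VFOb G i) (l i \<cdot> bang V X) h' = w i)"
    "inc1 V C A L \<cdot> h = inc1 V C A L \<cdot> h'"
  then show "h = h'" by - (rule inc1_mono[OF C A L], simp_all)
qed

text \<open>
  Wedges are the internal cones with constant vertex. A general vertex \<open>a\<close> is decomposed into constant pieces, and the
  arrows found on the pieces are glued; that the result is the unique morphism of cones is checked on the pieces.
\<close>

lemma all_factors_iff:
  "(\<forall>X a \<gamma>. cone_fam IN CN KN X a \<gamma> \<longrightarrow> (\<exists>!f. factors X a \<gamma> f)) \<longleftrightarrow> is_vlimit V I C G L l"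
  unfolding is_vlimit_iff[OF I C G L l]
proof (intro iffI allI ballI impI)
  fix A X w assume all: "\<forall>X a \<gamma>. cone_fam IN CN KN X a \<gamma> \<longrightarrow> (\<exists>!f. factors X a \<gamma> f)" and A [simp]: "A \<in> VObj C" and w: "is_wedge V I C (cs A) G X w"
  note cA = const_vfun[OF I C A]
  have X: "X \<in> Obj V" and wT: "\<And>i. i \<in> VObj I \<Longrightarrow> w i \<in> Hom V X (VHom C (VFOb (cs A) i) (VFOb G i))"
    using w unfolding is_wedge_iff[OF I C cA(1) G] by simp_all
  obtain \<gamma> where c: "components I C (cs A) G X \<gamma> w" using components_ex[OF I C cA(1) G X wT] by blast
  have "cone_fam IN CN KN X (inc0 V C A \<cdot> bang V X) \<gamma>"
    unfolding cone_fam_const[OF A X] using w wedge_iff_int_nat[OF I C cA(1) G c X] by simp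
  then show "\<exists>!h. h \<in> Hom V X (VHom C A L) \<and> (\<forall>i\<in>VObj I. vcmp V C A L (VFOb G i) (l i \<cdot> bang V X) h = w i)"
    unfolding factors_const_iff[OF A X c, symmetric] using all by blast
next
  fix X a \<gamma> assume all: "\<forall>A\<in>VObj C. \<forall>X w. is_wedge V I C (cs A) G X w \<longrightarrow>
      (\<exists>!h. h \<in> Hom V X (VHom C A L) \<and> (\<forall>i\<in>VObj I. vcmp V C A L (VFOb G i) (l i \<cdot> bang V X) h = w i))"
    and cf: "cone_fam IN CN KN X a \<gamma>"
  note [simp] = comparison_simps lh lh_source
  have aT: "a \<in> Hom V X (Int_ob V C)" and g: "\<gamma> \<in> Hom V (prd V X (Int_ob V I)) (Int_ar V C)"
    using cf unfolding cone_fam_def[OF KN] nfam_def by simp_all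
  note [simp] = aT[simplified] g[simplified]
  have X [simp]: "X \<in> Obj V" using Dom_Obj[of a] by simp
  \<comment> \<open>The vertex is constant at \<open>A\<close> on the piece \<open>Y A\<close>.\<close>
  obtain Y e where Y: "is_coproduct V (VObj C) Y (X, e)" and ae: "\<And>A. A \<in> VObj C \<Longrightarrow> a \<cdot> e A = inc0 V C A \<cdot> bang V (Y A)"
    using obj_decompose[OF C, of a] by auto
  note [simp] = is_coproductD(2-4)[OF Y]
  have YO: "Y A \<in> Obj V" if "A \<in> VObj C" for A using Dom_Obj[of "e A"] that by simp
  let ?g = "\<lambda>A. \<gamma> \<cdot> pair V (e A \<cdot> pr1 V (Y A) (Int_ob V I)) (pr2 V (Y A) (Int_ob V I))"
  have loc: "\<exists>!f. factors (Y A) (inc0 V C A \<cdot> bang V (Y A)) (?g A) f" if A: "A \<in> VObj C" for A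
  proof -
    note cA = const_vfun[OF I C A]
    have "cone_fam IN CN KN (Y A) (inc0 V C A \<cdot> bang V (Y A)) (?g A)"
      using cone_fam_restrict[OF KN cf, of "e A" "Y A"] A ae[OF A] by simp
    then have n: "int_nat I C (cs A) G (Y A) (?g A)" unfolding cone_fam_const[OF A YO[OF A]] .
    then obtain w where c: "components I C (cs A) G (Y A) (?g A) w"
      using int_nat_components[OF I C cA(1) G n YO[OF A]] by blast
    then have "is_wedge V I C (cs A) G (Y A) w" using wedge_iff_int_nat[OF I C cA(1) G c YO[OF A]] n by blast
    then show ?thesis unfolding factors_const_iff[OF A YO[OF A] c] using all A by blast
  qed
  have ex: "\<exists>fA. \<forall>A\<in>VObj C. factors (Y A) (inc0 V C A \<cdot> bang V (Y A)) (?g A) (fA A)"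
    by (rule bchoice) (use loc in blast)
  then obtain fA where fA: "\<And>A. A \<in> VObj C \<Longrightarrow> factors (Y A) (inc0 V C A \<cdot> bang V (Y A)) (?g A) (fA A)" by blast
  then have fT: "\<And>A. A \<in> VObj C \<Longrightarrow> fA A \<in> Hom V (Y A) (Int_ar V C)" unfolding factors_def by blast
  obtain f where f [simp]: "f \<in> Arr V" "Dom V f = X" "Cod V f = Int_ar V C" and fe: "\<And>A. A \<in> VObj C \<Longrightarrow> f \<cdot> e A = fA A"
    by (rule coproduct_ex[OF Y, of "Int_ar V C" fA]) (use fT in auto)
  have st: "isrc CN \<cdot> f = a" "itgt CN \<cdot> f = inc0 V C L \<cdot> bang V X"
    by (rule coproduct_ext[OF Y]; use fe ae fA in \<open>simp add: factors_def\<close>)+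
  have stx [simp]: "isrc CN \<cdot> (f \<cdot> x) = a \<cdot> x" "itgt CN \<cdot> (f \<cdot> x) = inc0 V C L \<cdot> bang V (Dom V x)" if "x \<in> Arr V" "Cod V x = X" for x
    using reassoc[OF st(1), of x] reassoc[OF st(2), of x] that by simp_all
  have "igcmp V CN (f \<cdot> pr1 V X (Int_ob V I)) (lh \<cdot> pr2 V X (Int_ob V I)) = \<gamma>"
  proof (rule coproduct_prd_ext[OF Y])
    fix A assume A [simp]: "A \<in> VObj C"
    note [simp] = YO[OF A]
    have "igcmp V CN (fA A \<cdot> pr1 V (Y A) (Int_ob V I)) (lh \<cdot> pr2 V (Y A) (Int_ob V I)) = ?g A"
      using fA[OF A] unfolding factors_def by blast
    then show "igcmp V CN (f \<cdot> pr1 V X (Int_ob V I)) (lh \<cdot> pr2 V X (Int_ob V I)) \<cdot> pair V (e A \<cdot> pr1 V (Y A) (Int_ob V I)) (pr2 V (Y A) (Int_ob V I)) = ?g A"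
      unfolding fe[OF A, symmetric] by simp
  qed simp_all
  then have "factors X a \<gamma> f" unfolding factors_def using st by simp
  moreover have "f' = f" if f': "factors X a \<gamma> f'" for f'
  proof (rule coproduct_ext[OF Y])
    fix A assume A: "A \<in> VObj C"
    have "factors (Y A) (a \<cdot> e A) (?g A) (f' \<cdot> e A)" by (rule factors_restrict[OF f']) (use A in simp_all)
    then show "f' \<cdot> e A = f \<cdot> e A" using loc[OF A] fA[OF A] unfolding ae[OF A] fe[OF A] by blast
  qed (use f' in \<open>simp_all add: factors_def\<close>)
  ultimately show "\<exists>!f. factors X a \<gamma> f" by blast
qed

theorem is_vlimit_iff_is_internal_limit:
  "is_vlimit V I C G L l \<longleftrightarrow> is_internal_limit V KN (cone_elem V I C G L l)"
proof -
  note [simp] = comparison_simps lh l_simps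
  note cL = const_vfun[OF I C L]
  have L0: "inc0 V C L \<in> Hom V \<one> (IOb CN)" and lT: "lh \<in> Hom V (IOb IN) (IAr CN)" by simp_all
  have c: "components I C (cs L) G \<one> (lh \<cdot> pr2 V \<one> (Int_ob V I)) l"
    unfolding components_def[OF I C] using eq_bang[of _ \<one>] by (auto simp: cL) (metis eq_bang)
  have "is_wedge V I C (cs L) G \<one> l" using vnat_wedge[OF I C G L l] .
  then have fam: "cone_fam IN CN KN \<one> (inc0 V C L) (lh \<cdot> pr2 V \<one> (IOb IN))"
    using cone_fam_const[OF L terminal_Obj] wedge_iff_int_nat[OF I C cL(1) G c terminal_Obj] by (simp add: eq_bang[symmetric])
  note cu = cone_elem_unique[OF KN L0 lT fam]
  have "cone_elem V I C G L l = (THE e. e \<in> Hom W \<one>\<^sub>W (cones V KN) \<and> comma_proj V (cone_diag V KN) (name_of W KN) \<cdot>\<^sub>W e = el CN (inc0 V C L) \<and>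
       nat_underlying V IN CN (comma_arrow V (cone_diag V KN) (name_of W KN) \<cdot>\<^sub>W e) = lh)"
    unfolding cone_elem_def Let_def Int_elem(1)[OF C L] ..
  with theI'[OF cu(1)] have e: "cone_elem V I C G L l \<in> Hom W \<one>\<^sub>W (cones V KN)"
    "comma_proj V (cone_diag V KN) (name_of W KN) \<cdot>\<^sub>W cone_elem V I C G L l = el CN (inc0 V C L)"
    "nat_underlying V IN CN (comma_arrow V (cone_diag V KN) (name_of W KN) \<cdot>\<^sub>W cone_elem V I C G L l) = lh"
    by simp_all
  note e' = cu(2)[OF e]
  show ?thesis
    unfolding all_factors_iff[symmetric] is_internal_limit_def cones_terminal_iff[OF KN L0 lT e(1) conjunct1[OF e'] conjunct2[OF e']] factors_def
    by (simp only: comparison_simps)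
qed

end

end

theorem corollary8p28:
  fixes V :: "('o, 'm) cat"
    and I :: "('x, 'o, 'm) vcat"
    and C :: "('y, 'o, 'm) vcat"
    and G :: "('x, 'y, 'm) vfun"
    and L :: 'y
    and l :: "'x \<Rightarrow> 'm"
  assumes "infinite (UNIV :: 'u set)"
    and "category V"
    and "extensive V TYPE('u)"
    and "cartesian_closed V"
    and "has_pullbacks V"
    and "vcategory V I" and "small TYPE('u) (VObj I)"
    and "vcategory V C" and "small TYPE('u) (VObj C)"
    and "vfunctor V I C G"
    and "L \<in> VObj C"
    and "vnat V I C (const_vfun V I C L) G l"
  shows "is_vlimit V I C G L l \<longleftrightarrow> is_internal_limit V (Int_fun V I C G) (cone_elem V I C G L l)"
proof -
  interpret extensive_ccc V "TYPE('u)"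
    by (intro extensive_ccc.intro ccc_pb.intro extensive_ccc_axioms.intro ccc_if_cartesian_closed
        pullback_cat_if_has_pullbacks assms)
  show ?thesis
    by (rule is_vlimit_iff_is_internal_limit) (use assms in \<open>simp_all add: small_vcat_def\<close>)
qed

end
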